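(* Let $\Gamma$ be a co-compact Fuchsian group acting on the Poincaré disk $\mathbb{D}$, let $\Delta$ be the hyperbolic Laplace operator, let $\lambda=s(1-s)$ with $s=\frac12+it$, $t\in\mathbb{R}$, and let $f$ be a (nonzero) eigenfunction of $-\Delta$ automorphic with respect to $\Gamma$, that is, $\Delta f=-\lambda f$ and $f\circ\gamma=f$ for every $\gamma\in\Gamma$. Let $(\hat\Sigma,\hat T,\{I_k^L\},\{I_l^R\},J)$ be a piecewise $\Gamma$-Möbius baker transformation, with left Bowen-Series transformation $T_L:\mathbb{S}^1\to\mathbb{S}^1$ and associated intervals $Q_k^R$, and let $$(\mathcal{L}_s^L\psi)(\xi')=\sum_{T_L(\xi)=\xi'}\frac{\psi(\xi)}{|T_L'(\xi)|^s}$$ be the complex Ruelle transfer operator associated to $T_L$ and the potential $A_L=-s\ln|T_L'|$. Then there exists a nonzero piecewise real analytic function $\psi_{f,s}:\mathbb{S}^1\to\mathbb{C}$ (real analytic on each $I_k^L$) that is a solution of the functional equation $$\mathcal{L}_s^L(\psi_{f,s})=\psi_{f,s}.$$ Moreover, $\psi_{f,s}$ admits an integral representation via the Helgason distribution $\mathcal{D}_{f,s}$ of $f$ and the positive kernel $k(\xi,\eta)=|\xi-\eta|^{-2}$ defined on the finite union of disjoint rectangles $\bigcup_k I_k^L\times Q_k^R\subset\mathbb{S}^1\times\mathbb{S}^1$, namely, for every $k$ and every $\xi\in I_k^L$, $$\psi_{f,s}(\xi)=\int_{Q_k^R}k^s(\xi,\eta)\,\mathcal{D}_{f,s}(\eta)=\int_{Q_k^R}\frac{1}{|\xi-\eta|^{2s}}\,\mathcal{D}_{f,s}(\eta),$$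 where $I_k^L$ and $Q_k^R$ are intervals of $\mathbb{S}^1$ with disjoint closures and $\{I_k^L\}_k$ is a partition of $\mathbb{S}^1$ on each element of which $T_L$ is injective and equal to an element of $\Gamma$, and with respect to which $T_L$ is Markov.
   Context: **Setting.** $\mathbb{D}=\{|z|<1\}$ carries the metric $4(dx^2+dy^2)/(1-|z|^2)^2$, with $\Delta=\frac14(1-|z|^2)^2(\partial_x^2+\partial_y^2)$, hyperbolic distance $d$, origin $\mathcal{O}=0$, and $\mathbb{S}^1=\partial\mathbb{D}$. A co-compact Fuchsian group is a discrete group of Möbius transformations preserving $\mathbb{D}$ with compact fundamental domain. For $\gamma\in\Gamma$, $|\gamma'|$ is the modulus of the derivative on $\mathbb{S}^1$; $|T'|$ is the derivative with respect to Lebesgue measure (arc length) on $\mathbb{S}^1$, i.e. $|T'(\xi)|=|\gamma'(\xi)|$ when $T$ is given by $\gamma$ on the partition interval containing $\xi$. **Helgason distribution.** Let $f$ be a bounded $C^2$ function with $\Delta f=-s(1-s)f$, $s=\frac12+it$. By a known theorem of Otal, for $\psi\in C^1(\mathbb{S}^1)$ the limit $$\int\psi\,\mathcal{D}_{f,s}:=\lim_{r\to\infty}\frac1{c(s)}\int_{\{d(\mathcal{O},z)=r\}}\psi(z)e^{-sr}\Big(\frac{\partial f}{\partial n}+sf\Big)|dz|_{\mathbb{D}}$$ exists, where $\psi(z)$ is any $C^1$ extension of $\psi$ to a neighborhood of $\mathbb{S}^1$, $\partial/\partial n$ is the exterior normal derivative, $|dz|_{\mathbb{D}}=\sinh(r)\,d\theta$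 is hyperbolic arc length, and $c(s)\ne0$ is the constant (depending only on $s$) such that $\int 1\,\mathcal{D}_{f,s}=f(0)$. It is the unique distribution with $f(z)=\int\big(\frac{1-|z|^2}{|z-\xi|^2}\big)^s\mathcal{D}_{f,s}(\xi)$ for all $z\in\mathbb{D}$. Moreover $$\tilde{\mathcal{D}}_{f,s}(\alpha)=\lim_{r\to\infty}\frac1{c(s)}\int_0^\alpha e^{-sr}\Big(\frac{\partial f}{\partial n}+sf\Big)\big(\tanh(\tfrac r2)e^{i\theta}\big)\sinh(r)\,d\theta$$ exists uniformly in $\alpha\in[0,2\pi]$ and extends to a $\frac12$-Hölder function on $\mathbb{R}$ with $\tilde{\mathcal{D}}_{f,s}(\theta+2\pi)=\tilde{\mathcal{D}}_{f,s}(\theta)+f(0)$. For an interval $I\subset\mathbb{S}^1$ with endpoints $e^{i\alpha},e^{i\beta}$ ($\alpha<\beta\le\alpha+2\pi$) and $\psi$ of class $C^1$ on the closure of $I$, with $\tilde\psi(\theta)=\psi(e^{i\theta})$, one sets $$\int_I\psi\,\mathcal{D}_{f,s}=\tilde\psi(\beta)\tilde{\mathcal{D}}_{f,s}(\beta)-\tilde\psi(\alpha)\tilde{\mathcal{D}}_{f,s}(\alpha)-\int_\alpha^\beta\tilde\psi'(\theta)\tilde{\mathcal{D}}_{f,s}(\theta)\,d\theta.$$ Automorphic eigenfunctions for co-compact $\Gamma$ are smooth and bounded, so this applies. **Piecewise $\Gamma$-Möbius Markov transformation** $(\mathbb{S}^1,T,\{I_k\})$: $T:\mathbb{S}^1\to\mathbb{S}^1$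 is surjective and $\{I_k\}$ is a finite partition of $\mathbb{S}^1$ into intervals such that (1) each $T(I_k)$ is a union of adjacent intervals $I_l$; (2) $T|_{I_k}$ coincides with an element $\gamma_k\in\Gamma$; (3) some finite iterate of $T$ is uniformly expanding. **Piecewise $\Gamma$-Möbius baker transformation** $(\hat\Sigma,\hat T,\{I_k^L\},\{I_l^R\},J)$: 1. $\{I_k^L\}$, $\{I_l^R\}$ are finite partitions of $\mathbb{S}^1$ into disjoint intervals, $J(k,l)\in\{0,1\}$, and $\hat\Sigma=\coprod_{J(k,l)=1}I_k^L\times I_l^R\subset\mathbb{S}^1\times\mathbb{S}^1$. 2. For each $k$, $Q_k^R=\coprod\{I_l^R: J(k,l)=1\}$ is an interval whose closure is disjoint from $\overline{I_k^L}$; for each $l$, $Q_l^L=\coprod\{I_k^L: J(k,l)=1\}$ is an interval whose closure is disjoint from $\overline{I_l^R}$. 3. $\hat T:\hat\Sigma\to\hat\Sigma$ is bijective with $\hat T(\xi,\eta)=(T_L(\xi),S_R(\xi,\eta))$ and $\hat T^{-1}(\xi',\eta')=(S_L(\xi',\eta'),T_R(\eta'))$ for certain maps $T_L,T_R:\mathbb{S}^1\to\mathbb{S}^1$, $S_L,S_R:\hat\Sigma\to\mathbb{S}^1$. 4. $(\mathbb{S}^1,T_L,\{I_k^L\})$ and $(\mathbb{S}^1,T_R,\{I_l^R\})$ are piecewise $\Gamma$-Möbius Markov transformations, and there are functions $\gamma_L,\gamma_R:\mathbb{S}^1\to\Gamma$, constant on each $I_k^L$, respectively each $I_l^R$, with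 $\hat T(\xi,\eta)=(\gamma_L[\xi](\xi),\gamma_L[\xi](\eta))$ and $\hat T^{-1}(\xi',\eta')=(\gamma_R[\eta'](\xi'),\gamma_R[\eta'](\eta'))$. $T_L$ and $T_R$ are called the left and right Bowen-Series transformations. It is known (Adler–Flatto, Series) that such a baker transformation exists for every co-compact Fuchsian group. *)

theory Defs
  imports "HOL-Analysis.Analysis" "HOL-Algebra.Bij"
begin

section \<open>Co-compact Fuchsian groups\<close>

definition moebius :: "complex \<Rightarrow> complex \<Rightarrow> complex \<Rightarrow> complex \<Rightarrow> complex \<Rightarrow> complex" where
  "moebius a b c d z = (a * z + b) / (c * z + d)"

text \<open>
  Group elements are extensional bijections of the closed disk, so that they act on the disk and
  on the unit circle, and composition is the multiplication of \<^const>\<open>BijGroup\<close>.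
  Discreteness is that of the preimage of the group in $SL(2,C)$, as a subset of $C^4$.
  A fundamental domain is the closure of its interior, its translates cover the disk, and distinct
  translates have disjoint interiors.
\<close>

definition cocompact_fuchsian :: "(complex \<Rightarrow> complex) set \<Rightarrow> bool" where
  "cocompact_fuchsian \<Gamma> \<longleftrightarrow>
     subgroup \<Gamma> (BijGroup (cball 0 1)) \<and>
     (\<forall>\<gamma>\<in>\<Gamma>. \<gamma> ` ball 0 1 = ball 0 1 \<and>
        (\<exists>a b c d. a * d - b * c = 1 \<and> \<gamma> = restrict (moebius a b c d) (cball 0 1))) \<and>
     discrete {(a, b, c, d). a * d - b * c = 1 \<and> restrict (moebius a b c d) (cball 0 1) \<in> \<Gamma>} \<and>
     (\<exists>F. compact F \<and> F \<subseteq> ball 0 1 \<and> F = closure (interior F) \<and>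
        (\<Union>\<gamma>\<in>\<Gamma>. \<gamma> ` F) = ball 0 1 \<and>
        (\<forall>\<gamma>\<in>\<Gamma>. \<gamma> \<noteq> \<one>\<^bsub>BijGroup (cball 0 1)\<^esub> \<longrightarrow> \<gamma> ` interior F \<inter> interior F = {}))"


section \<open>Eigenfunctions of the hyperbolic Laplacian\<close>

definition partial_x :: "(complex \<Rightarrow> complex) \<Rightarrow> complex \<Rightarrow> complex" where
  "partial_x f z = frechet_derivative f (at z) 1"

definition partial_y :: "(complex \<Rightarrow> complex) \<Rightarrow> complex \<Rightarrow> complex" where
  "partial_y f z = frechet_derivative f (at z) \<i>"

text \<open>Real differentiability classes; only used on open sets.\<close>

definition C1_on :: "complex set \<Rightarrow> (complex \<Rightarrow> complex) \<Rightarrow> bool" where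
  "C1_on S f \<longleftrightarrow> (\<forall>z\<in>S. f differentiable (at z)) \<and>
     continuous_on S (partial_x f) \<and> continuous_on S (partial_y f)"

definition C2_on :: "complex set \<Rightarrow> (complex \<Rightarrow> complex) \<Rightarrow> bool" where
  "C2_on S f \<longleftrightarrow> C1_on S f \<and> C1_on S (partial_x f) \<and> C1_on S (partial_y f)"

definition hyp_laplacian :: "(complex \<Rightarrow> complex) \<Rightarrow> complex \<Rightarrow> complex" where
  "hyp_laplacian f z = of_real ((1 - (norm z)\<^sup>2)\<^sup>2 / 4) *
     (partial_x (partial_x f) z + partial_y (partial_y f) z)"

definition hyp_eigenfunction :: "complex \<Rightarrow> (complex \<Rightarrow> complex) \<Rightarrow> bool" where
  "hyp_eigenfunction \<mu> f \<longleftrightarrow>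
     C2_on (ball 0 1) f \<and> (\<forall>z\<in>ball 0 1. hyp_laplacian f z = - \<mu> * f z)"

definition automorphic :: "(complex \<Rightarrow> complex) set \<Rightarrow> (complex \<Rightarrow> complex) \<Rightarrow> bool" where
  "automorphic \<Gamma> f \<longleftrightarrow> (\<forall>\<gamma>\<in>\<Gamma>. \<forall>z\<in>ball 0 1. f (\<gamma> z) = f z)"


section \<open>The Helgason distribution\<close>

text \<open>
  The point at hyperbolic distance $r$ from the origin in direction $\theta$; for fixed
  $\theta$ this is a unit speed geodesic, so the exterior normal derivative on the circle of
  hyperbolic radius $r$ is the derivative in $r$.
\<close>

definition polar_point :: "real \<Rightarrow> real \<Rightarrow> complex" where
  "polar_point r \<theta> = of_real (tanh (r / 2)) * cis \<theta>"

definition normal_deriv :: "(complex \<Rightarrow> complex) \<Rightarrow> real \<Rightarrow> real \<Rightarrow> complex" where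
  "normal_deriv f r \<theta> = vector_derivative (\<lambda>\<rho>. f (polar_point \<rho> \<theta>)) (at r)"

definition helgason_density :: "(complex \<Rightarrow> complex) \<Rightarrow> complex \<Rightarrow> real \<Rightarrow> real \<Rightarrow> complex" where
  "helgason_density f s r \<theta> =
     exp (- s * of_real r) * (normal_deriv f r \<theta> + s * f (polar_point r \<theta>)) * of_real (sinh r)"

text \<open>
  The constant $c(s)$ is the nonzero one for which the total mass of the distribution of every
  bounded eigenfunction is the value of the eigenfunction at the origin.
\<close>

definition helgason_const :: "complex \<Rightarrow> complex" where
  "helgason_const s = (THE c. c \<noteq> 0 \<and>
     (\<forall>h. hyp_eigenfunction (s * (1 - s)) h \<and> bounded (h ` ball 0 1) \<longrightarrow>
        ((\<lambda>r. (1 / c) * integral {0..2 * pi} (helgason_density h s r)) \<longlongrightarrow> h 0) at_top))"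

definition helgason_primitive0 :: "(complex \<Rightarrow> complex) \<Rightarrow> complex \<Rightarrow> real \<Rightarrow> complex" where
  "helgason_primitive0 f s \<alpha> =
     Lim at_top (\<lambda>r. (1 / helgason_const s) * integral {0..\<alpha>} (helgason_density f s r))"

text \<open>
  The extension from $[0, 2\pi)$ to the real line with increment $f(0)$ over each period.
\<close>

definition helgason_primitive :: "(complex \<Rightarrow> complex) \<Rightarrow> complex \<Rightarrow> real \<Rightarrow> complex" where
  "helgason_primitive f s \<theta> =
     (let m = \<lfloor>\<theta> / (2 * pi)\<rfloor>
      in helgason_primitive0 f s (\<theta> - 2 * pi * of_int m) + of_int m * f 0)"

text \<open>
  The integral of $\psi$ against the distribution over an arc with endpoints
  $e^{i\alpha}$ and $e^{i\beta}$, for $\psi$ of class $C^1$ on the closed arc. It does not depend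
  on which endpoints belong to the arc, nor on the lift of the endpoints to the real line.
\<close>

definition helgason_integral ::
  "(complex \<Rightarrow> complex) \<Rightarrow> complex \<Rightarrow> real \<Rightarrow> real \<Rightarrow> (complex \<Rightarrow> complex) \<Rightarrow> complex" where
  "helgason_integral f s \<alpha> \<beta> \<psi> =
     \<psi> (cis \<beta>) * helgason_primitive f s \<beta> - \<psi> (cis \<alpha>) * helgason_primitive f s \<alpha>
     - integral {\<alpha>..\<beta>} (\<lambda>\<theta>. vector_derivative (\<lambda>u. \<psi> (cis u)) (at \<theta> within {\<alpha>..\<beta>})
                              * helgason_primitive f s \<theta>)"


section \<open>Markov and baker transformations\<close>

text \<open>Nondegenerate arcs of the unit circle, with or without either endpoint.\<close>

definition arc_between :: "complex set \<Rightarrow> real \<Rightarrow> real \<Rightarrow> bool" where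
  "arc_between I \<alpha> \<beta> \<longleftrightarrow> \<alpha> < \<beta> \<and> \<beta> \<le> \<alpha> + 2 * pi \<and>
     (\<exists>A. {\<alpha><..<\<beta>} \<subseteq> A \<and> A \<subseteq> {\<alpha>..\<beta>} \<and> I = cis ` A)"

definition circle_interval :: "complex set \<Rightarrow> bool" where
  "circle_interval I \<longleftrightarrow> (\<exists>\<alpha> \<beta>. arc_between I \<alpha> \<beta>)"

definition circle_partition :: "nat \<Rightarrow> (nat \<Rightarrow> complex set) \<Rightarrow> bool" where
  "circle_partition n I \<longleftrightarrow> (\<forall>k<n. circle_interval (I k)) \<and>
     disjoint_family_on I {..<n} \<and> (\<Union>k<n. I k) = sphere 0 1"

text \<open>
  The modulus of the derivative of $T$ with respect to arc length at $\xi$, taken within the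
  partition interval containing $\xi$ (one-sided at an endpoint); it equals $|\gamma'(\xi)|$ if
  $T$ is given by $\gamma$ on that interval.
\<close>

definition arc_deriv :: "nat \<Rightarrow> (nat \<Rightarrow> complex set) \<Rightarrow> (complex \<Rightarrow> complex) \<Rightarrow> complex \<Rightarrow> real" where
  "arc_deriv n I T \<xi> = norm (vector_derivative (\<lambda>\<theta>. T (cis \<theta>))
     (at (Arg \<xi>) within {\<theta>. \<exists>k<n. \<xi> \<in> I k \<and> cis \<theta> \<in> I k}))"

text \<open>
  A union of intervals of the partition is one of adjacent intervals iff it is an interval.
  By the chain rule the product below is the modulus of the derivative of the $m$-th iterate.
\<close>

definition moebius_markov ::
  "(complex \<Rightarrow> complex) set \<Rightarrow> nat \<Rightarrow> (nat \<Rightarrow> complex set) \<Rightarrow> (complex \<Rightarrow> complex) \<Rightarrow> bool" where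
  "moebius_markov \<Gamma> n I T \<longleftrightarrow>
     T ` sphere 0 1 = sphere 0 1 \<and>
     circle_partition n I \<and>
     (\<forall>k<n. circle_interval (T ` I k) \<and> (\<exists>A\<subseteq>{..<n}. T ` I k = (\<Union>l\<in>A. I l))) \<and>
     (\<forall>k<n. \<exists>\<gamma>\<in>\<Gamma>. \<forall>\<xi>\<in>I k. T \<xi> = \<gamma> \<xi>) \<and>
     (\<exists>m\<ge>1. \<exists>\<kappa>>1. \<forall>\<xi>\<in>sphere 0 1. (\<Prod>j<m. arc_deriv n I T ((T ^^ j) \<xi>)) \<ge> \<kappa>)"

definition baker_domain ::
  "nat \<Rightarrow> (nat \<Rightarrow> complex set) \<Rightarrow> nat \<Rightarrow> (nat \<Rightarrow> complex set) \<Rightarrow> (nat \<Rightarrow> nat \<Rightarrow> nat)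
     \<Rightarrow> (complex \<times> complex) set" where
  "baker_domain p IL q IR J = (\<Union>(k, l)\<in>{(k, l). k < p \<and> l < q \<and> J k l = 1}. IL k \<times> IR l)"

definition QR :: "nat \<Rightarrow> (nat \<Rightarrow> complex set) \<Rightarrow> (nat \<Rightarrow> nat \<Rightarrow> nat) \<Rightarrow> nat \<Rightarrow> complex set" where
  "QR q IR J k = (\<Union>l\<in>{l. l < q \<and> J k l = 1}. IR l)"

definition QL :: "nat \<Rightarrow> (nat \<Rightarrow> complex set) \<Rightarrow> (nat \<Rightarrow> nat \<Rightarrow> nat) \<Rightarrow> nat \<Rightarrow> complex set" where
  "QL p IL J l = (\<Union>k\<in>{k. k < p \<and> J k l = 1}. IL k)"

definition moebius_baker ::
  "(complex \<Rightarrow> complex) set \<Rightarrow> nat \<Rightarrow> (nat \<Rightarrow> complex set) \<Rightarrow> nat \<Rightarrow> (nat \<Rightarrow> complex set)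
     \<Rightarrow> (nat \<Rightarrow> nat \<Rightarrow> nat) \<Rightarrow> (complex \<times> complex \<Rightarrow> complex \<times> complex)
     \<Rightarrow> (complex \<Rightarrow> complex) \<Rightarrow> (complex \<Rightarrow> complex) \<Rightarrow> bool" where
  "moebius_baker \<Gamma> p IL q IR J T TL TR \<longleftrightarrow>
     (let \<Sigma> = baker_domain p IL q IR J in
        circle_partition p IL \<and> circle_partition q IR \<and>
        (\<forall>k<p. \<forall>l<q. J k l \<in> {0, 1}) \<and>
        (\<forall>k<p. circle_interval (QR q IR J k) \<and> closure (QR q IR J k) \<inter> closure (IL k) = {}) \<and>
        (\<forall>l<q. circle_interval (QL p IL J l) \<and> closure (QL p IL J l) \<inter> closure (IR l) = {}) \<and>
        bij_betw T \<Sigma> \<Sigma> \<and>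
        (\<exists>SL SR. SL \<in> \<Sigma> \<rightarrow> sphere 0 1 \<and> SR \<in> \<Sigma> \<rightarrow> sphere 0 1 \<and>
           (\<forall>(\<xi>, \<eta>)\<in>\<Sigma>. T (\<xi>, \<eta>) = (TL \<xi>, SR (\<xi>, \<eta>)) \<and>
                     inv_into \<Sigma> T (\<xi>, \<eta>) = (SL (\<xi>, \<eta>), TR \<eta>))) \<and>
        moebius_markov \<Gamma> p IL TL \<and> moebius_markov \<Gamma> q IR TR \<and>
        (\<exists>\<gamma>L \<gamma>R. \<gamma>L \<in> sphere 0 1 \<rightarrow> \<Gamma> \<and> \<gamma>R \<in> sphere 0 1 \<rightarrow> \<Gamma> \<and>
           (\<forall>k<p. \<gamma>L constant_on IL k) \<and> (\<forall>l<q. \<gamma>R constant_on IR l) \<and>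
           (\<forall>(\<xi>, \<eta>)\<in>\<Sigma>. T (\<xi>, \<eta>) = (\<gamma>L \<xi> \<xi>, \<gamma>L \<xi> \<eta>) \<and>
                     inv_into \<Sigma> T (\<xi>, \<eta>) = (\<gamma>R \<eta> \<xi>, \<gamma>R \<eta> \<eta>))))"


section \<open>The transfer operator and its eigenfunction\<close>

definition transfer_operator ::
  "complex \<Rightarrow> nat \<Rightarrow> (nat \<Rightarrow> complex set) \<Rightarrow> (complex \<Rightarrow> complex)
     \<Rightarrow> (complex \<Rightarrow> complex) \<Rightarrow> complex \<Rightarrow> complex" where
  "transfer_operator s n I T \<psi> \<xi>' =
     (\<Sum>\<xi>\<in>{\<xi>\<in>sphere 0 1. T \<xi> = \<xi>'}. \<psi> \<xi> / (of_real (arc_deriv n I T \<xi>) powr s))"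

text \<open>
  Real analyticity in the angle on a subset of the circle; at an endpoint belonging to an
  arc the expansion is one-sided.
\<close>

definition circle_real_analytic_on :: "complex set \<Rightarrow> (complex \<Rightarrow> complex) \<Rightarrow> bool" where
  "circle_real_analytic_on I \<psi> \<longleftrightarrow>
     (\<forall>\<theta>\<^sub>0. cis \<theta>\<^sub>0 \<in> I \<longrightarrow>
        (\<exists>a :: nat \<Rightarrow> complex. \<exists>\<epsilon>>0. \<forall>\<theta>. \<bar>\<theta> - \<theta>\<^sub>0\<bar> < \<epsilon> \<and> cis \<theta> \<in> I \<longrightarrow>
           (\<lambda>n. a n * of_real (\<theta> - \<theta>\<^sub>0) ^ n) sums \<psi> (cis \<theta>)))"

definition boundary_kernel :: "complex \<Rightarrow> complex \<Rightarrow> real" where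
  "boundary_kernel \<xi> \<eta> = inverse ((norm (\<xi> - \<eta>))\<^sup>2)"

end

theory Submission
  imports Defs "HOL-Real_Asymp.Real_Asymp" "HOL-Complex_Analysis.Complex_Analysis"
begin

text \<open>
  Along a circle of hyperbolic radius \<open>r\<close> the eigenvalue equation turns the \<open>r\<close>-derivative of the
  integral of the Helgason density over an arc into boundary terms of size \<open>O(e\<^sup>-\<^sup>r\<^sup>/\<^sup>2)\<close>, so Otal's limit
  exists; let \<open>G\<close> be the primitive of the distribution. The Fourier coefficients of \<open>f\<close> solve a
  singular radial equation whose regular solutions form a line, and comparing them with those of the
  Poisson kernel shows that \<open>f\<close> is the Poisson transform of \<open>dG\<close> and that \<open>dG\<close> is determined by
  \<open>f\<close>. Hence invariance of \<open>f\<close> under \<open>\<gamma>\<close> gives \<open>dG = |\<gamma>'|\<^sup>-\<^sup>s d(G \<circ> \<gamma>)\<close>.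

  Since \<open>|\<gamma>\<xi> - \<gamma>\<eta>|\<^sup>2 = |\<gamma>'\<xi>| |\<gamma>'\<eta>| |\<xi> - \<eta>|\<^sup>2\<close>, each term \<open>\<psi>(\<xi>) / |T'(\<xi>)|\<^sup>s\<close> of the transfer operator at \<open>\<xi>'\<close> is the
  integral of \<open>|\<xi>' - \<eta>|\<^sup>-\<^sup>2\<^sup>s\<close> over the image under \<open>\<gamma>\<close> of the arc belonging to \<open>\<xi>\<close>. Because the baker map is
  bijective, these images partition the arc belonging to \<open>\<xi>'\<close>, and the terms add up to \<open>\<psi>(\<xi>')\<close>.

  If \<open>\<psi>\<close> vanished, repeated differentiation in \<open>\<xi>\<close> would annihilate all moments of \<open>G\<close> against powers of a
  monotone function on each arc, so that \<open>G\<close> would be constant on each of finitely many arcs covering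
  the circle. Then its range is countable, hence a point, and \<open>f = 0\<close>.
\<close>

subsection \<open>The radial equation\<close>

text \<open>Regularity at the singular point r = 0 is encoded by asking for a C^2 solution on the
  whole line: \<open>polar_point\<close> makes sense for negative r, so the Fourier coefficients of
  an eigenfunction extend through 0. This takes the place of series expansions at 0. That a regular
  solution is determined by its limiting density is proved with monotone quantities, and separately
  for t = 0, where the density no longer bounds the solution pointwise.

  The constant c(s) is described by its effect on bounded eigenfunctions. The Poisson kernel, from
  which it is computed, is unbounded, and f may vanish at the origin, where the description says
  nothing; so f is first moved by an automorphism of the disk.

  Covariance is not read off Otal's limit, since an automorphism moves the centre of the circles;
  the Poisson transform reduces it to uniqueness. Integrals against dG are written by parts, because
  only continuity of G is established, and arcs are lifted to the line, where endpoints are fixed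
  only up to multiples of 2 pi.\<close>

definition radial_solution ::
  "real \<Rightarrow> real \<Rightarrow> (real \<Rightarrow> complex) \<Rightarrow> (real \<Rightarrow> complex) \<Rightarrow> (real \<Rightarrow> complex) \<Rightarrow> bool" where
  "radial_solution \<mu> n K K' K'' \<longleftrightarrow>
     (\<forall>r. (K has_vector_derivative K' r) (at r)) \<and>
     (\<forall>r. (K' has_vector_derivative K'' r) (at r)) \<and>
     continuous_on UNIV K'' \<and>
     (\<forall>r. of_real ((sinh r)\<^sup>2) * K'' r + of_real (sinh r * cosh r) * K' r +
          of_real (\<mu> * (sinh r)\<^sup>2 - n\<^sup>2) * K r = 0)"

text \<open>The density of Otal's limit for one Fourier coefficient instead of the whole function.
  For the parameter \<open>s\<close> with s(1 - s) = \<mu> its derivative loses all terms that do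
  not decay.\<close>

definition radial_density :: "complex \<Rightarrow> (real \<Rightarrow> complex) \<Rightarrow> (real \<Rightarrow> complex) \<Rightarrow> real \<Rightarrow> complex" where
  "radial_density s K K' r = exp (- s * of_real r) * (K' r + s * K r) * of_real (sinh r)"

lemma has_real_derivative_inner:
  fixes f g :: "real \<Rightarrow> complex"
  assumes "(f has_vector_derivative f') (at x)" "(g has_vector_derivative g') (at x)"
  shows "((\<lambda>x. f x \<bullet> g x) has_real_derivative (f x \<bullet> g' + f' \<bullet> g x)) (at x)"
  using bounded_bilinear.has_vector_derivative[OF bounded_bilinear_inner assms]
  by (simp add: has_real_derivative_iff_has_vector_derivative)

lemma inner_self_le_0: "x \<bullet> x \<le> 0 \<longleftrightarrow> x = 0" for x :: complex
  by (meson inner_gt_zero_iff inner_eq_zero_iff not_less order_refl)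

lemma inner_of_real_mult: "(of_real a * x) \<bullet> (of_real b * y) = a * b * (x \<bullet> y)" for x y :: complex
  by (simp add: inner_complex_def algebra_simps)

text \<open>Isolates the contribution of the imaginary part of s. Once \<open>Im (cnj b * a)\<close>
  vanishes, |a + s b| bounds |t| |b|; with a = K' and b = K this is how the density controls the
  solution when t is nonzero.\<close>

lemma norm_half_plus_imaginary:
  "(norm (a + (1/2 + \<i> * of_real t) * b))\<^sup>2 =
     (norm (a + b / 2))\<^sup>2 + t\<^sup>2 * (norm b)\<^sup>2 + 2 * t * Im (cnj b * a)"
proof -
  have "(x + (u / 2 - t * v))\<^sup>2 + (y + (t * u + v / 2))\<^sup>2 =
    (x + u / 2)\<^sup>2 + (y + v / 2)\<^sup>2 + t\<^sup>2 * (u\<^sup>2 + v\<^sup>2) + 2 * t * (u * y - v * x)"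
    for x y u v :: real
    by (simp add: power2_eq_square algebra_simps)
  from this[of "Re a" "Re b" "Im b" "Im a"] show ?thesis
    unfolding cmod_power2 by (simp add: add_ac)
qed

lemma has_vector_derivative_exp_real:
  "((\<lambda>r. exp (a * of_real r)) has_vector_derivative a * exp (a * of_real r)) (at r within S)"
  for a :: complex
proof -
  have "((\<lambda>z. exp (a * z)) has_field_derivative a * exp (a * of_real r)) (at (of_real r))"
    by (auto intro!: derivative_eq_intros)
  from has_vector_derivative_real_field[OF this] show ?thesis
    by (simp add: o_def has_vector_derivative_at_within)
qed

lemma radial_solutionD:
  assumes "radial_solution \<mu> n K K' K''"
  shows "(K has_vector_derivative K' r) (at r)" "(K' has_vector_derivative K'' r) (at r)"
    and "sinh r \<noteq> 0 \<Longrightarrow> of_real (sinh r) * K'' r =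
      - of_real (cosh r) * K' r - of_real (\<mu> * sinh r - n\<^sup>2 / sinh r) * K r"
proof -
  show "(K has_vector_derivative K' r) (at r)" "(K' has_vector_derivative K'' r) (at r)"
    using assms by (auto simp: radial_solution_def)
  assume nz: "sinh r \<noteq> 0"
  have "of_real ((sinh r)\<^sup>2) * K'' r + of_real (sinh r * cosh r) * K' r +
          of_real (\<mu> * (sinh r)\<^sup>2 - n\<^sup>2) * K r = 0"
    using assms unfolding radial_solution_def by blast
  then have "of_real (sinh r) * (of_real (sinh r) * K'' r + of_real (cosh r) * K' r +
      of_real (\<mu> * sinh r - n\<^sup>2 / sinh r) * K r) = 0"
    using nz by (simp add: field_simps power2_eq_square)
  then have "of_real (sinh r) * K'' r + of_real (cosh r) * K' r +
      of_real (\<mu> * sinh r - n\<^sup>2 / sinh r) * K r = 0"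
    using nz by simp
  then show "of_real (sinh r) * K'' r =
      - of_real (cosh r) * K' r - of_real (\<mu> * sinh r - n\<^sup>2 / sinh r) * K r"
    by (simp add: algebra_simps eq_neg_iff_add_eq_0)
qed

text \<open>The factor sinh r absorbs the friction term of the equation, s(1 - s) = \<mu> cancels
  the rest, and cosh r - sinh r = e^(-r) leaves only a decaying multiple of K. The inhomogeneity
  \<open>g\<close> stands for whatever the angular derivative contributes: n^2 K / sinh r for a
  Fourier coefficient, boundary terms for an arc.\<close>

lemma radial_density_has_derivative:
  assumes K: "(K has_vector_derivative K' r) (at r)" "(K' has_vector_derivative K'') (at r)"
    and \<mu>: "of_real \<mu> = s * (1 - s)"
    and eq: "of_real (sinh r) * K'' = - of_real (cosh r) * K' r - of_real (\<mu> * sinh r) * K r + g"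
  shows "(radial_density s K K' has_vector_derivative
     exp (- s * of_real r) * (s * of_real (exp (- r)) * K r + g)) (at r)"
proof -
  have sh: "(((\<lambda>x. of_real (sinh x)) :: real \<Rightarrow> complex) has_vector_derivative of_real (cosh r)) (at r)"
    by (rule has_vector_derivative_of_real) (auto intro!: derivative_eq_intros)
  have ch: "of_real (exp (- r)) = (of_real (cosh r) - of_real (sinh r) :: complex)"
  proof -
    have "exp (- r) = cosh r - sinh r" by (simp add: sinh_def cosh_def field_simps)
    then show ?thesis by simp
  qed
  have "(radial_density s K K' has_vector_derivative
     exp (- s * of_real r) * (K' r + s * K r) * of_real (cosh r) +
     (exp (- s * of_real r) * (K'' + s * K' r) + (- s) * exp (- s * of_real r) * (K' r + s * K r)) *
        of_real (sinh r)) (at r)"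
    unfolding radial_density_def
    by (rule has_vector_derivative_mult has_vector_derivative_exp_real sh
        has_vector_derivative_add K has_vector_derivative_mult_right)+
  also have "exp (- s * of_real r) * (K' r + s * K r) * of_real (cosh r) +
     (exp (- s * of_real r) * (K'' + s * K' r) + (- s) * exp (- s * of_real r) * (K' r + s * K r)) *
        of_real (sinh r) =
     exp (- s * of_real r) * ((K' r + s * K r) * of_real (cosh r) + of_real (sinh r) * K'' -
        s * s * K r * of_real (sinh r))"
    by (simp add: algebra_simps)
  also have "(K' r + s * K r) * of_real (cosh r) + of_real (sinh r) * K'' -
        s * s * K r * of_real (sinh r) = s * of_real (exp (- r)) * K r + g"
    unfolding ch eq by (simp add: algebra_simps \<mu>)
  finally show ?thesis .
qed

lemma radial_density_derivative:
  assumes K: "radial_solution \<mu> n K K' K''" and \<mu>: "of_real \<mu> = s * (1 - s)" and r: "0 < r"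
  shows "(radial_density s K K' has_vector_derivative
     exp (- s * of_real r) * (s * of_real (exp (- r)) + of_real (n\<^sup>2 / sinh r)) * K r) (at r)"
proof -
  have "of_real (sinh r) * K'' r =
      - of_real (cosh r) * K' r - of_real (\<mu> * sinh r) * K r + of_real (n\<^sup>2 / sinh r) * K r"
    using radial_solutionD(3)[OF K, of r] r by (simp add: algebra_simps)
  from radial_density_has_derivative[where K' = K', OF radial_solutionD(1,2)[OF K] \<mu> this]
  show ?thesis by (simp add: algebra_simps)
qed

text \<open>The Wronskian of a solution and its conjugate vanishes at the singular point \<open>r = 0\<close>.\<close>

lemma radial_solution_Im:
  assumes K: "radial_solution \<mu> n K K' K''" and r: "0 < r"
  shows "Im (cnj (K r) * K' r) = 0"
proof -
  define W where "W = (\<lambda>r. sinh r * Im (cnj (K r) * K' r))"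
  have D: "(W has_real_derivative
      cosh x * Im (cnj (K x) * K' x) + sinh x * Im (cnj (K x) * K'' x)) (at x)" for x
  proof -
    have a: "((\<lambda>x. cnj (K x) * K' x) has_vector_derivative (cnj (K x) * K'' x + cnj (K' x) * K' x)) (at x)"
      by (intro has_vector_derivative_mult has_vector_derivative_cnj radial_solutionD(1,2)[OF K])
    have "((\<lambda>x. Im (cnj (K x) * K' x)) has_real_derivative Im (cnj (K x) * K'' x + cnj (K' x) * K' x)) (at x)"
      using bounded_linear.has_vector_derivative[OF bounded_linear_Im a]
      by (simp add: has_real_derivative_iff_has_vector_derivative)
    then have "((\<lambda>x. Im (cnj (K x) * K' x)) has_real_derivative Im (cnj (K x) * K'' x)) (at x)"
      by (simp add: mult.commute)
    moreover have "(sinh has_real_derivative cosh x) (at x)"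
      by (auto intro!: derivative_eq_intros)
    ultimately have "(W has_real_derivative
      cosh x * Im (cnj (K x) * K' x) + Im (cnj (K x) * K'' x) * sinh x) (at x)"
      unfolding W_def by (intro DERIV_mult)
    then show ?thesis by (simp only: mult.commute)
  qed
  have "W r = W 0"
  proof (rule DERIV_isconst_end[OF r])
    show "continuous_on {0..r} W"
      by (rule DERIV_continuous_on) (use D in \<open>auto intro: has_field_derivative_at_within\<close>)
    show "(W has_real_derivative 0) (at x)" if "0 < x" "x < r" for x
    proof -
      have "sinh x * Im (cnj (K x) * K'' x) = Im (cnj (K x) * (of_real (sinh x) * K'' x))"
        by (simp add: algebra_simps)
      also have "\<dots> = - cosh x * Im (cnj (K x) * K' x)"
        using that by (subst radial_solutionD(3)[OF K]) (auto simp: algebra_simps)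
      finally show ?thesis using D[of x] by simp
    qed
  qed
  then show ?thesis using r by (simp add: W_def)
qed

lemma nondecreasing_tendsto_0:
  fixes E :: "real \<Rightarrow> real"
  assumes lim: "(E \<longlongrightarrow> 0) at_top"
    and D: "\<And>x. a \<le> x \<Longrightarrow> \<exists>y. (E has_real_derivative y) (at x) \<and> 0 \<le> y"
  shows "E a \<le> 0"
proof (rule tendsto_lowerbound[OF lim])
  show "\<forall>\<^sub>F x in at_top. E a \<le> E x"
    using eventually_ge_at_top[of a]
    by eventually_elim (rule DERIV_nonneg_imp_nondecreasing, use D in auto)
qed simp

text \<open>With u the density, E = |u|^2 tends to 0 at infinity; if E, or E times a factor tending
  to 1, is nondecreasing, then E must vanish. For t nonzero the vanishing Wronskian bounds K by u,
  and a Gronwall factor makes E monotone. For t = 0 a second monotone quantity, starting from 0 at r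
  = 0, shows that u and u' never form an obtuse angle.\<close>

lemma radial_solution_zero:
  assumes K: "radial_solution \<mu> n K K' K''" and s: "s = 1/2 + \<i> * of_real t"
    and \<mu>: "of_real \<mu> = s * (1 - s)" and lim: "(radial_density s K K' \<longlongrightarrow> 0) at_top" and a: "0 < a"
  shows "K a = 0"
proof -
  define u where "u = radial_density s K K'"
  define u' where "u' = (\<lambda>r. exp (- s * of_real r) * (s * of_real (exp (- r)) + of_real (n\<^sup>2 / sinh r)) * K r)"
  have u': "(u has_vector_derivative u' r) (at r)" if "0 < r" for r
    unfolding u_def u'_def by (rule radial_density_derivative[OF K \<mu> that])
  define E where "E = (\<lambda>r. u r \<bullet> u r)"
  have E': "(E has_real_derivative 2 * (u r \<bullet> u' r)) (at r)" if "0 < r" for r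
    using has_real_derivative_inner[OF u'[OF that] u'[OF that]]
    by (simp add: E_def inner_commute)
  have limE: "(E \<longlongrightarrow> 0) at_top"
    using tendsto_inner[OF lim lim] by (simp add: E_def u_def)
  have nexp: "norm (exp (- s * of_real r)) = exp (- r / 2)" for r
    by (simp add: s norm_exp_eq_Re)
  show ?thesis
  proof (cases "t = 0")
    case False
    \<comment> \<open>The Wronskian term drops out of |K' + s K|^2, so |t| |K| is at most |K' + s
      K|.\<close>
    have low: "\<bar>t\<bar> * (exp (- r / 2) * sinh r * norm (K r)) \<le> norm (u r)" if "0 < r" for r
    proof -
      have im: "Im (cnj (K r) * K' r) = 0" using radial_solution_Im[OF K that] .
      have "(norm (K' r + s * K r))\<^sup>2 = (norm (K' r + K r / 2))\<^sup>2 + t\<^sup>2 * (norm (K r))\<^sup>2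
            + 2 * t * Im (cnj (K r) * K' r)"
        unfolding s by (rule norm_half_plus_imaginary)
      then have "(\<bar>t\<bar> * norm (K r))\<^sup>2 \<le> (norm (K' r + s * K r))\<^sup>2"
        using im by (simp add: power_mult_distrib)
      then have "\<bar>t\<bar> * norm (K r) \<le> norm (K' r + s * K r)"
        by (rule power2_le_imp_le) simp
      then have "exp (- r / 2) * sinh r * (\<bar>t\<bar> * norm (K r)) \<le> exp (- r / 2) * sinh r * norm (K' r + s * K r)"
        using that by (intro mult_left_mono) auto
      moreover have "norm (u r) = exp (- r / 2) * sinh r * norm (K' r + s * K r)"
        using that by (simp only: u_def radial_density_def norm_mult nexp) simp
      ultimately show ?thesis by (simp add: algebra_simps)
    qed
    \<comment> \<open>The constant for which |u'| is at most M e^(-r) |u| beyond a. The factor e^a /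
      sinh a comes from the comparison of sinh r e^(-r) with its value at a.\<close>
    define M where "M = (norm s + n\<^sup>2 / sinh a) * exp a / (\<bar>t\<bar> * sinh a)"
    have M0: "0 \<le> M" using a by (simp add: M_def)
    have upp: "norm (u' r) \<le> M * exp (- r) * norm (u r)" if r: "a \<le> r" for r
    proof -
      have sr: "0 < sinh a" "sinh a \<le> sinh r" using a r by auto
      \<comment> \<open>Since sinh x e^(-x) = (1 - e^(-2x)) / 2 increases, the factor sinh r e^(-r)
        e^a / sinh a is at least 1 and may be inserted into the bound of u'. It brings the sinh r
        needed to compare with u and the e^(-r) that makes the bound integrable.\<close>
      have "sinh a * exp (- a) \<le> sinh r * exp (- r)"
      proof -
        have le: "exp (-2 * r) \<le> exp (-2 * a)" using r by simp
        have eq: "sinh x * exp (- x) = (1 - exp (-2 * x)) / 2" for x :: real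
        proof -
          have "sinh x * exp (- x) = (exp x * exp (- x) - exp (- x) * exp (- x)) / 2"
            by (simp add: sinh_def left_diff_distrib)
          also have "exp x * exp (- x) = 1" by (simp flip: exp_add)
          also have "exp (- x) * exp (- x) = exp (-2 * x)" by (simp flip: exp_add)
          finally show ?thesis .
        qed
        show ?thesis unfolding eq by (intro divide_right_mono diff_left_mono le) simp
      qed
      then have e: "exp (- r) \<ge> 0" "1 \<le> sinh r * (exp (-r) * exp a / sinh a)"
        using sr by (auto simp: divide_simps exp_minus mult.commute)
      have "norm (u' r) \<le> exp (- r / 2) * (norm s * exp (-r) + n\<^sup>2 / sinh r) * norm (K r)"
        unfolding u'_def norm_mult nexp using a r
        by (intro mult_right_mono mult_left_mono norm_triangle_le) (auto simp: norm_mult simp del: of_real_divide)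
      also have "\<dots> \<le> exp (- r / 2) * (norm s + n\<^sup>2 / sinh a) * norm (K r)"
        using a r sr by (intro mult_right_mono mult_left_mono add_mono mult_right_le_one_le divide_left_mono) auto
      also have "\<dots> \<le> (exp (- r / 2) * (norm s + n\<^sup>2 / sinh a) * norm (K r)) * (sinh r * (exp (-r) * exp a / sinh a))"
        using mult_left_mono[OF e(2), of "exp (- r / 2) * (norm s + n\<^sup>2 / sinh a) * norm (K r)"] sr by simp
      also have "\<dots> = M * exp (- r) * (\<bar>t\<bar> * (exp (- r / 2) * sinh r * norm (K r)))"
        using False sr by (simp add: M_def field_simps)
      also have "\<dots> \<le> M * exp (- r) * norm (u r)"
        using low[of r] a r M0 by (intro mult_left_mono) auto
      finally show ?thesis .
    qed
    \<comment> \<open>Integrating factor: X'/X = 2 M e^(-r) outweighs the possible decrease 2 |u|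
      |u'| of E, and X tends to 1, so E X still tends to 0.\<close>
    define X where "X = (\<lambda>r. exp (- (2 * M) * exp (- r)) :: real)"
    have "E a * X a \<le> 0"
    proof (rule nondecreasing_tendsto_0[where E = "\<lambda>r. E r * X r"])
      have "((\<lambda>r. exp (- r)) \<longlongrightarrow> (0::real)) at_top"
        using exp_at_bot filterlim_uminus_at_bot_at_top by (rule filterlim_compose)
      then have "(X \<longlongrightarrow> exp (- (2 * M) * 0)) at_top"
        unfolding X_def by (intro tendsto_intros)
      from tendsto_mult[OF limE this] show "((\<lambda>r. E r * X r) \<longlongrightarrow> 0) at_top" by simp
      fix x assume x: "a \<le> x"
      have DX: "(X has_real_derivative X x * (2 * M * exp (- x))) (at x)"
        unfolding X_def by (auto intro!: derivative_eq_intros)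
      have "((\<lambda>r. E r * X r) has_real_derivative
          E x * (X x * (2 * M * exp (- x))) + 2 * (u x \<bullet> u' x) * X x) (at x)"
        using DERIV_mult[OF E'[of x] DX] a x by (simp add: algebra_simps)
      moreover have "0 \<le> E x * (X x * (2 * M * exp (- x))) + 2 * (u x \<bullet> u' x) * X x"
      proof -
        have "\<bar>u x \<bullet> u' x\<bar> \<le> norm (u x) * norm (u' x)"
          by (rule Cauchy_Schwarz_ineq2)
        also have "\<dots> \<le> norm (u x) * (M * exp (- x) * norm (u x))"
          using upp[OF x] by (intro mult_left_mono) auto
        also have "\<dots> = M * exp (- x) * E x"
          by (simp add: E_def dot_square_norm power2_eq_square)
        finally have "0 \<le> 2 * X x * (M * exp (- x) * E x + u x \<bullet> u' x)"
          by (intro mult_nonneg_nonneg) (auto simp: X_def)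
        then show ?thesis by (simp add: algebra_simps)
      qed
      ultimately show "\<exists>y. ((\<lambda>r. E r * X r) has_real_derivative y) (at x) \<and> 0 \<le> y" by blast
    qed
    then have "E a \<le> 0" by (simp add: X_def mult_le_0_iff)
    then have "u a = 0" by (simp add: E_def inner_self_le_0)
    then show ?thesis using low[OF a] a False
      by (simp add: mult_le_0_iff not_less)
  next
    case True
    then have s': "s = of_real (1/2)" by (simp add: s)
    \<comment> \<open>The real inner product of u with e^(r/2) K. Both terms of its derivative are
      nonnegative and sinh makes it 0 at r = 0, so R is nonnegative; and u . u' is a positive
      multiple of R.\<close>
    define R where "R = (\<lambda>r. sinh r * ((K' r + K r / 2) \<bullet> K r))"
    have u_eq: "u r = of_real (exp (- r / 2) * sinh r) * (K' r + K r / 2)" for r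
    proof -
      have "exp (- s * of_real r) = of_real (exp (- r / 2))"
        by (simp add: s' exp_of_real[symmetric])
      then show ?thesis by (simp add: u_def radial_density_def s')
    qed
    have e: "exp (- r / 2) * exp (r / 2) = 1" for r :: real by (simp flip: exp_add)
    have uw: "u r \<bullet> (of_real (exp (r / 2)) * K r) = R r" for r
    proof -
      have "u r \<bullet> (of_real (exp (r / 2)) * K r) =
        (exp (- r / 2) * exp (r/2)) * (sinh r * ((K' r + K r / 2) \<bullet> K r))"
        unfolding u_eq inner_of_real_mult by (simp only: mult_ac)
      then show ?thesis unfolding e R_def by simp
    qed
    define q where "q = (\<lambda>r. exp (- r) / 2 + n\<^sup>2 / sinh r)"
    have q: "0 < q r" if "0 < r" for r using that by (simp add: q_def add_pos_nonneg)
    have u'2: "u' r = of_real (exp (- r / 2) * q r) * K r" for r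
    proof -
      have "exp (- s * of_real r) = of_real (exp (- r / 2))"
        by (simp add: s' exp_of_real[symmetric])
      then show ?thesis by (simp add: u'_def s' q_def)
    qed
    have R': "(R has_real_derivative
        q r * (K r \<bullet> K r) + sinh r * ((K' r + K r / 2) \<bullet> (K' r + K r / 2))) (at r)"
      if r: "0 < r" for r
    proof -
      have w: "((\<lambda>r. of_real (exp (r / 2)) * K r) has_vector_derivative
          of_real (exp (r / 2)) * K' r + of_real (exp (r/2) / 2) * K r) (at r)"
        by (intro has_vector_derivative_mult has_vector_derivative_of_real radial_solutionD(1)[OF K])
          (auto intro!: derivative_eq_intros)
      have a1: "u' r \<bullet> (of_real (exp (r / 2)) * K r) = q r * (K r \<bullet> K r)"
      proof -
        have "u' r \<bullet> (of_real (exp (r / 2)) * K r) = (exp (- r / 2) * exp (r/2)) * (q r * (K r \<bullet> K r))"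
          unfolding u'2 inner_of_real_mult by (simp only: mult_ac)
        then show ?thesis unfolding e by simp
      qed
      have a2: "u r \<bullet> (of_real (exp (r / 2)) * K' r + of_real (exp (r/2) / 2) * K r) =
         sinh r * ((K' r + K r / 2) \<bullet> (K' r + K r / 2))"
      proof -
        have "of_real (exp (r / 2)) * K' r + of_real (exp (r/2) / 2) * K r =
          of_real (exp (r / 2)) * (K' r + K r / 2)" by (simp add: algebra_simps)
        then have "u r \<bullet> (of_real (exp (r / 2)) * K' r + of_real (exp (r/2) / 2) * K r) =
         (exp (- r / 2) * exp (r/2)) * (sinh r * ((K' r + K r / 2) \<bullet> (K' r + K r / 2)))"
          unfolding u_eq by (simp only: inner_of_real_mult) (simp only: mult_ac)
        then show ?thesis unfolding e by simp
      qed
      show ?thesis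
        using has_real_derivative_inner[OF u'[OF r] w] unfolding uw a1 a2 by (simp add: add.commute)
    qed
    have R_nonneg: "0 \<le> R r" if r: "0 < r" for r
    proof -
      have "R 0 \<le> R r"
      proof (rule DERIV_nonneg_imp_increasing_open[where f = R and a = 0 and b = r])
        show "0 \<le> r" using r by simp
        show "\<exists>y. (R has_real_derivative y) (at x) \<and> 0 \<le> y" if "0 < x" "x < r" for x
        proof -
          have "0 \<le> q x * (K x \<bullet> K x) + sinh x * ((K' x + K x / 2) \<bullet> (K' x + K x / 2))"
            using q[OF that(1)] that by (intro add_nonneg_nonneg mult_nonneg_nonneg inner_ge_zero) auto
          then show ?thesis using R'[OF that(1)] by blast
        qed
        show "continuous_on {0..r} R"
          unfolding R_def
          by (intro continuous_intros)
            (auto intro: continuous_on_vector_derivative[OF has_vector_derivative_at_within]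
               radial_solutionD(1,2)[OF K])
      qed
      then show ?thesis by (simp add: R_def)
    qed
    have "u r = 0" if r: "0 < r" for r
    proof -
      have "E r \<le> 0"
      proof (rule nondecreasing_tendsto_0[OF limE])
        fix x assume "r \<le> x"
        then have x: "0 < x" using r by simp
        have "u x \<bullet> u' x = exp (- x) * q x * R x"
        proof -
          have "u x \<bullet> u' x = (exp (- x / 2) * exp (- x / 2)) * q x * R x"
            unfolding u_eq u'2 inner_of_real_mult R_def by (simp only: mult_ac)
          also have "exp (- x / 2) * exp (- x / 2) = exp (- x)" by (simp flip: exp_add)
          finally show ?thesis .
        qed
        then have "0 \<le> 2 * (u x \<bullet> u' x)" using q[OF x] R_nonneg[OF x] by simp
        then show "\<exists>y. (E has_real_derivative y) (at x) \<and> 0 \<le> y" using E'[OF x] by blast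
      qed
      then show ?thesis by (simp add: E_def inner_self_le_0)
    qed
    \<comment> \<open>The density vanishes on a neighbourhood of a, so its derivative does, and for
      t = 0 that derivative is a positive multiple of K.\<close>
    then have "(u has_vector_derivative 0) (at a)"
      by (intro has_vector_derivative_transform_within_open[OF has_vector_derivative_const, of "{0<..}"]) (use a in auto)
    then have "u' a = 0" using u'[OF a] vector_derivative_unique_at by blast
    then show ?thesis using q[OF a] by (simp add: u'2)
  qed
qed

text \<open>The energy |K'|^2 + \<mu> |K|^2 cannot increase, because the first-order term of the
  equation acts as friction for r > 0. It is 0 at the start, as regularity for n = 0 forces K'(0) =
  0.\<close>

lemma radial_solution_unique:
  assumes K: "radial_solution \<mu> 0 K K' K''" and \<mu>: "0 < \<mu>" and K0: "K 0 = 0" and r: "0 \<le> r"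
  shows "K r = 0"
proof -
  have contK: "continuous_on UNIV K" "continuous_on UNIV K'" "continuous_on UNIV K''"
    using K by (auto simp: radial_solution_def
        intro: continuous_on_vector_derivative[OF has_vector_derivative_at_within])
  \<comment> \<open>The equation divided by sinh r. It holds for r > 0 and extends to r = 0 by
    continuity, where it reads K'(0) = 0.\<close>
  define L where "L = (\<lambda>r. of_real (sinh r) * K'' r + of_real (cosh r) * K' r + of_real (\<mu> * sinh r) * K r)"
  have "L 0 = 0"
  proof -
    have "(L \<longlongrightarrow> L 0) (at_right 0)"
    proof -
      have "continuous_on UNIV L" unfolding L_def
        by (intro continuous_intros contK)
      then show ?thesis
        by (meson UNIV_I continuous_on_def tendsto_within_subset subset_UNIV)
    qed
    moreover have "\<forall>\<^sub>F x in at_right 0. L x = 0"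
      using eventually_at_right_less[of 0]
      by eventually_elim (simp add: L_def radial_solutionD(3)[OF K])
    ultimately have "((\<lambda>_. 0) \<longlongrightarrow> L 0) (at_right (0::real))"
      using tendsto_cong by fastforce
    then show ?thesis using tendsto_unique[OF _ _ tendsto_const] trivial_limit_at_right_real by blast
  qed
  then have K'0: "K' 0 = 0" by (simp add: L_def)
  define E where "E = (\<lambda>r. K' r \<bullet> K' r + \<mu> * (K r \<bullet> K r))"
  have "E r \<le> E 0"
  proof (rule DERIV_nonpos_imp_decreasing_open[OF r])
    show "continuous_on {0..r} E" unfolding E_def
      by (intro continuous_intros continuous_on_subset[OF contK(1)] continuous_on_subset[OF contK(2)]) auto
    fix x assume x: "0 < x" "x < r"
    have D: "(E has_real_derivative 2 * (K' x \<bullet> (K'' x + of_real \<mu> * K x))) (at x)"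
    proof -
      have "(E has_real_derivative (K' x \<bullet> K'' x + K'' x \<bullet> K' x) + \<mu> * (K x \<bullet> K' x + K' x \<bullet> K x)) (at x)"
        unfolding E_def
        by (intro DERIV_add DERIV_cmult has_real_derivative_inner radial_solutionD(1,2)[OF K])
      then show ?thesis by (simp add: inner_complex_def algebra_simps)
    qed
    have "of_real (sinh x) * (K'' x + of_real \<mu> * K x) = - of_real (cosh x) * K' x"
      using x radial_solutionD(3)[OF K, of x] by (simp add: algebra_simps)
    then have "sinh x * (K' x \<bullet> (K'' x + of_real \<mu> * K x)) = - cosh x * (K' x \<bullet> K' x)"
    proof -
      have "sinh x * (K' x \<bullet> (K'' x + of_real \<mu> * K x)) = K' x \<bullet> (of_real (sinh x) * (K'' x + of_real \<mu> * K x))"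
        by (simp add: inner_complex_def algebra_simps)
      also assume "of_real (sinh x) * (K'' x + of_real \<mu> * K x) = - of_real (cosh x) * K' x"
      also have "K' x \<bullet> (- of_real (cosh x) * K' x) = - cosh x * (K' x \<bullet> K' x)"
        by (simp add: inner_complex_def algebra_simps)
      finally show ?thesis .
    qed
    then have "sinh x * (K' x \<bullet> (K'' x + of_real \<mu> * K x)) \<le> 0" by simp
    then have "2 * (K' x \<bullet> (K'' x + of_real \<mu> * K x)) \<le> 0"
      using x by (simp add: mult_le_0_iff)
    with D show "\<exists>y. (E has_real_derivative y) (at x) \<and> y \<le> 0" by blast
  qed
  then have "K' r \<bullet> K' r + \<mu> * (K r \<bullet> K r) \<le> 0" by (simp add: E_def K0 K'0)
  then have "\<mu> * (K r \<bullet> K r) \<le> 0" using inner_ge_zero[of "K' r"] by linarith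
  then show ?thesis using \<mu> by (simp add: mult_le_0_iff inner_self_le_0)
qed

subsection \<open>Existence of the limit\<close>

text \<open>The derivative is integrable at infinity. The rate is recorded because it depends on g
  only through C: applied to arcs, it makes the convergence uniform in the endpoint.\<close>

lemma exponential_decay_limit:
  fixes g :: "real \<Rightarrow> complex"
  assumes D: "\<And>r. 0 < r \<Longrightarrow> (g has_vector_derivative g' r) (at r)"
    and B: "\<And>r. 0 < r \<Longrightarrow> norm (g' r) \<le> C * exp (- r / 2)"
  obtains L where "(g \<longlongrightarrow> L) at_top" "\<And>r. 0 < r \<Longrightarrow> norm (g r - L) \<le> 2 * C * exp (- r / 2)"
proof -
  have C: "0 \<le> C" using order_trans[OF norm_ge_zero B[of 1]] by (simp add: zero_le_mult_iff)
  have diff: "norm (g y - g x) \<le> 2 * C * exp (- x / 2)" if "0 < x" "x \<le> y" for x y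
  proof (cases "x = y")
    case False
    have "norm (g y - g x) \<le> (- 2 * C * exp (- y / 2)) - (- 2 * C * exp (- x / 2))"
    proof (rule differentiable_bound_general[where f' = "\<lambda>r. g' r" and \<phi>' = "\<lambda>r. C * exp (- r / 2)"])
      show "x < y" using False that by simp
      show "continuous_on {x..y} g"
        by (rule continuous_on_vector_derivative[OF has_vector_derivative_at_within], rule D) (use that in auto)
      show "continuous_on {x..y} (\<lambda>r. - 2 * C * exp (- r / 2))" by (intro continuous_intros) auto
      show "(g has_vector_derivative g' r) (at r)" if "x < r" "r < y" for r
        by (rule D) (use that \<open>0 < x\<close> in auto)
      show "((\<lambda>r. - 2 * C * exp (- r / 2)) has_vector_derivative C * exp (- r / 2)) (at r)" for r
        unfolding has_real_derivative_iff_has_vector_derivative[symmetric]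
        by (auto intro!: derivative_eq_intros)
      show "norm (g' r) \<le> C * exp (- r / 2)" if "x < r" "r < y" for r
        by (rule B) (use that \<open>0 < x\<close> in auto)
    qed
    moreover have "0 \<le> 2 * C * exp (- y / 2)" using C by simp
    ultimately show ?thesis by linarith
  qed (use C in auto)
  have lim0: "((\<lambda>x. 2 * C * exp (- x / 2)) \<longlongrightarrow> 0) at_top"
    by real_asymp
  have "Cauchy (\<lambda>n. g (real (Suc n)))"
  proof (rule metric_CauchyI)
    fix e :: real assume "0 < e"
    then have "eventually (\<lambda>x. 2 * C * exp (- x / 2) < e / 2) at_top"
      using order_tendstoD(2)[OF lim0, of "e/2"] by simp
    then obtain M where M: "\<And>x. M \<le> x \<Longrightarrow> 2 * C * exp (- x / 2) < e / 2"
      by (auto simp: eventually_at_top_linorder)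
    define N where "N = nat \<lceil>M\<rceil>"
    have N: "M \<le> real (Suc N)" unfolding N_def by linarith
    have "dist (g (real (Suc N))) (g (real (Suc n))) < e / 2" if "N \<le> n" for n
      using diff[of "real (Suc N)" "real (Suc n)"] M[OF N] that
      by (simp add: dist_norm norm_minus_commute del: of_nat_Suc)
    then have "dist (g (real (Suc m))) (g (real (Suc n))) < e" if "N \<le> m" "N \<le> n" for m n
      using that dist_triangle_half_r by blast
    then show "\<exists>M. \<forall>m\<ge>M. \<forall>n\<ge>M. dist (g (real (Suc m))) (g (real (Suc n))) < e" by blast
  qed
  then obtain L where L: "(\<lambda>n. g (real (Suc n))) \<longlonglongrightarrow> L"
    using Cauchy_convergent convergent_def by blast
  have est: "norm (g r - L) \<le> 2 * C * exp (- r / 2)" if r: "0 < r" for r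
  proof -
    have "(\<lambda>n. norm (g r - g (real (Suc n)))) \<longlonglongrightarrow> norm (g r - L)"
      by (intro tendsto_intros L)
    moreover have "\<forall>\<^sub>F n in sequentially. norm (g r - g (real (Suc n))) \<le> 2 * C * exp (- r / 2)"
      using eventually_ge_at_top[of "nat \<lceil>r\<rceil>"]
    proof eventually_elim
      case (elim n)
      then have "r \<le> real (Suc n)" by linarith
      then show ?case using diff[OF r, of "real (Suc n)"] by (simp add: norm_minus_commute del: of_nat_Suc)
    qed
    ultimately show ?thesis by (rule tendsto_upperbound) simp
  qed
  have "((\<lambda>r. g r - L) \<longlongrightarrow> 0) at_top"
    by (rule Lim_null_comparison[OF _ lim0])
      (use eventually_gt_at_top[of 0] in eventually_elim, rule est)
  then have "(g \<longlongrightarrow> L) at_top" by (simp add: LIM_zero_iff)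
  then show ?thesis using est that by blast
qed

section \<open>Periodic solutions of the polar eigenvalue equation and Otal's limit\<close>

definition fourier :: "(real \<Rightarrow> real \<Rightarrow> complex) \<Rightarrow> int \<Rightarrow> real \<Rightarrow> complex" where
  "fourier F n r = integral {0..2 * pi} (\<lambda>\<theta>. cis (- of_int n * \<theta>) * F r \<theta>)"

definition polar_density ::
  "complex \<Rightarrow> (real \<Rightarrow> real \<Rightarrow> complex) \<Rightarrow> (real \<Rightarrow> real \<Rightarrow> complex) \<Rightarrow> real \<Rightarrow> real \<Rightarrow> complex" where
  "polar_density s F Fr r \<theta> = exp (- s * of_real r) * (Fr r \<theta> + s * F r \<theta>) * of_real (sinh r)"

lemma continuous_on_slice:
  fixes F :: "'a::topological_space \<Rightarrow> 'b::topological_space \<Rightarrow> 'c::topological_space"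
  assumes "continuous_on UNIV (\<lambda>(r, \<theta>). F r \<theta>)"
  shows "continuous_on S (\<lambda>\<theta>. F r \<theta>)" "continuous_on T (\<lambda>r. F r \<theta>)"
proof -
  have "continuous_on S (\<lambda>\<theta>. (\<lambda>(r, \<theta>). F r \<theta>) (r, \<theta>))"
    by (rule continuous_on_compose2[OF assms]) (auto intro: continuous_on_Pair continuous_on_const continuous_on_id)
  then show "continuous_on S (\<lambda>\<theta>. F r \<theta>)" by simp
  have "continuous_on T (\<lambda>r. (\<lambda>(r, \<theta>). F r \<theta>) (r, \<theta>))"
    by (rule continuous_on_compose2[OF assms]) (auto intro: continuous_on_Pair continuous_on_const continuous_on_id)
  then show "continuous_on T (\<lambda>r. F r \<theta>)" by simp
qed

lemma has_vector_derivative_cis: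
  "((\<lambda>\<theta>. cis (a * \<theta>)) has_vector_derivative \<i> * of_real a * cis (a * \<theta>)) (at \<theta> within S)"
proof -
  have "(\<lambda>\<theta>. cis (a * \<theta>)) = (\<lambda>\<theta>. exp ((\<i> * of_real a) * of_real \<theta>))"
    by (simp add: cis_conv_exp mult.assoc)
  then show ?thesis using has_vector_derivative_exp_real[of "\<i> * of_real a" \<theta> S]
    by (simp add: cis_conv_exp mult.assoc)
qed

text \<open>Shared by two instances, an eigenfunction of the disk in polar coordinates and the
  Poisson kernel with fixed boundary point, which are compared coefficient by coefficient. The
  radius runs over all reals, so that smoothness across r = 0 is part of the data.\<close>

locale polar_eigenfunction =
  fixes \<mu> :: real and F Fr Frr Ft Ftt :: "real \<Rightarrow> real \<Rightarrow> complex"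
  assumes F_r: "((\<lambda>r. F r \<theta>) has_vector_derivative Fr r \<theta>) (at r)"
    and F_rr: "((\<lambda>r. Fr r \<theta>) has_vector_derivative Frr r \<theta>) (at r)"
    and F_t: "((\<lambda>\<theta>. F r \<theta>) has_vector_derivative Ft r \<theta>) (at \<theta>)"
    and F_tt: "((\<lambda>\<theta>. Ft r \<theta>) has_vector_derivative Ftt r \<theta>) (at \<theta>)"
    and contF: "continuous_on UNIV (\<lambda>(r, \<theta>). F r \<theta>)"
    and contFr: "continuous_on UNIV (\<lambda>(r, \<theta>). Fr r \<theta>)"
    and contFrr: "continuous_on UNIV (\<lambda>(r, \<theta>). Frr r \<theta>)"
    and contFt: "continuous_on UNIV (\<lambda>(r, \<theta>). Ft r \<theta>)"
    and contFtt: "continuous_on UNIV (\<lambda>(r, \<theta>). Ftt r \<theta>)"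
    and periodic: "F r (\<theta> + 2 * pi) = F r \<theta>"
    and eigen: "of_real ((sinh r)\<^sup>2) * Frr r \<theta> + of_real (sinh r * cosh r) * Fr r \<theta> +
      of_real (\<mu> * (sinh r)\<^sup>2) * F r \<theta> + Ftt r \<theta> = 0"
begin

lemma Ft_periodic: "Ft r (\<theta> + 2 * pi) = Ft r \<theta>"
proof -
  have "((\<lambda>\<theta>. F r (\<theta> + 2 * pi)) has_vector_derivative Ft r (\<theta> + 2 * pi)) (at \<theta>)"
  proof -
    have "((\<lambda>\<theta>. \<theta> + 2 * pi) has_vector_derivative 1) (at \<theta>)"
      unfolding has_real_derivative_iff_has_vector_derivative[symmetric]
      by (auto intro!: derivative_eq_intros)
    from vector_diff_chain_at[OF this F_t] show ?thesis by (simp add: o_def)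
  qed
  then show ?thesis unfolding periodic using F_t vector_derivative_unique_at by blast
qed

text \<open>One weight c serves both uses: c = 1 for the mass of an arc, c = cis(-n \<theta>) for a
  Fourier coefficient.\<close>

lemma integral_derivatives:
  assumes c: "continuous_on UNIV c"
  shows "((\<lambda>r. integral {a..b} (\<lambda>\<theta>. c \<theta> * F r \<theta>)) has_vector_derivative
            integral {a..b} (\<lambda>\<theta>. c \<theta> * Fr r \<theta>)) (at r)"
    and "((\<lambda>r. integral {a..b} (\<lambda>\<theta>. c \<theta> * Fr r \<theta>)) has_vector_derivative
            integral {a..b} (\<lambda>\<theta>. c \<theta> * Frr r \<theta>)) (at r)"
    and "continuous_on UNIV (\<lambda>r. integral {a..b} (\<lambda>\<theta>. c \<theta> * Frr r \<theta>))"
proof -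
  have cont: "continuous_on (UNIV \<times> cbox a b) (\<lambda>(r, \<theta>). c \<theta> * G r \<theta>)"
    if "continuous_on UNIV (\<lambda>(r, \<theta>). G r \<theta>)" for G
    using that continuous_on_compose2[OF c, of "UNIV \<times> cbox a b" snd]
    by (auto simp: case_prod_unfold continuous_on_snd intro!: continuous_on_mult intro: continuous_on_subset)
  have int: "(\<lambda>\<theta>. c \<theta> * G r \<theta>) integrable_on cbox a b"
    if "continuous_on UNIV (\<lambda>(r, \<theta>). G r \<theta>)" for G r
    by (intro integrable_continuous continuous_intros continuous_on_slice[OF that]
        continuous_on_subset[OF c]) auto
  show "((\<lambda>r. integral {a..b} (\<lambda>\<theta>. c \<theta> * F r \<theta>)) has_vector_derivative
            integral {a..b} (\<lambda>\<theta>. c \<theta> * Fr r \<theta>)) (at r)"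
    using leibniz_rule_vector_derivative[where U = UNIV and f = "\<lambda>r \<theta>. c \<theta> * F r \<theta>",
        OF has_vector_derivative_mult_right[OF F_r] int[OF contF] cont[OF contFr]] by simp
  show "((\<lambda>r. integral {a..b} (\<lambda>\<theta>. c \<theta> * Fr r \<theta>)) has_vector_derivative
            integral {a..b} (\<lambda>\<theta>. c \<theta> * Frr r \<theta>)) (at r)"
    using leibniz_rule_vector_derivative[where U = UNIV and f = "\<lambda>r \<theta>. c \<theta> * Fr r \<theta>",
        OF has_vector_derivative_mult_right[OF F_rr] int[OF contFr] cont[OF contFrr]] by simp
  show "continuous_on UNIV (\<lambda>r. integral {a..b} (\<lambda>\<theta>. c \<theta> * Frr r \<theta>))"
    using integral_continuous_on_param[OF cont[OF contFrr]] by simp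
qed

lemma integral_eigen:
  assumes c: "continuous_on UNIV c"
  shows "of_real ((sinh r)\<^sup>2) * integral {a..b} (\<lambda>\<theta>. c \<theta> * Frr r \<theta>) +
    of_real (sinh r * cosh r) * integral {a..b} (\<lambda>\<theta>. c \<theta> * Fr r \<theta>) +
    of_real (\<mu> * (sinh r)\<^sup>2) * integral {a..b} (\<lambda>\<theta>. c \<theta> * F r \<theta>) +
    integral {a..b} (\<lambda>\<theta>. c \<theta> * Ftt r \<theta>) = 0"
proof -
  have int: "((\<lambda>\<theta>. c \<theta> * G r \<theta>) has_integral integral {a..b} (\<lambda>\<theta>. c \<theta> * G r \<theta>)) {a..b}"
    if "continuous_on UNIV (\<lambda>(r, \<theta>). G r \<theta>)" for G
    by (intro integrable_integral integrable_continuous_real continuous_on_mult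
        continuous_on_slice[OF that] continuous_on_subset[OF c subset_UNIV])
  have "((\<lambda>\<theta>. of_real ((sinh r)\<^sup>2) * (c \<theta> * Frr r \<theta>) +
    of_real (sinh r * cosh r) * (c \<theta> * Fr r \<theta>) +
    of_real (\<mu> * (sinh r)\<^sup>2) * (c \<theta> * F r \<theta>) + c \<theta> * Ftt r \<theta>) has_integral
    (of_real ((sinh r)\<^sup>2) * integral {a..b} (\<lambda>\<theta>. c \<theta> * Frr r \<theta>) +
    of_real (sinh r * cosh r) * integral {a..b} (\<lambda>\<theta>. c \<theta> * Fr r \<theta>) +
    of_real (\<mu> * (sinh r)\<^sup>2) * integral {a..b} (\<lambda>\<theta>. c \<theta> * F r \<theta>) +
    integral {a..b} (\<lambda>\<theta>. c \<theta> * Ftt r \<theta>))) {a..b}" (is "(?g has_integral _) _")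
    by (intro has_integral_add has_integral_mult_right int contF contFr contFrr contFtt)
  moreover have "(\<lambda>\<theta>. of_real ((sinh r)\<^sup>2) * (c \<theta> * Frr r \<theta>) +
    of_real (sinh r * cosh r) * (c \<theta> * Fr r \<theta>) +
    of_real (\<mu> * (sinh r)\<^sup>2) * (c \<theta> * F r \<theta>) + c \<theta> * Ftt r \<theta>) = (\<lambda>\<theta>. 0)"
  proof
    fix \<theta>
    have "?g \<theta> = c \<theta> * (of_real ((sinh r)\<^sup>2) * Frr r \<theta> + of_real (sinh r * cosh r) * Fr r \<theta> +
      of_real (\<mu> * (sinh r)\<^sup>2) * F r \<theta> + Ftt r \<theta>)" by (simp only: distrib_left mult_ac)
    then show "?g \<theta> = 0" unfolding eigen by simp
  qed
  ultimately show ?thesis by (simp only: has_integral_0_eq)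
qed

lemma fourier_radial_solution:
  "radial_solution \<mu> (of_int n) (fourier F n) (fourier Fr n) (fourier Frr n)"
proof -
  let ?c = "\<lambda>\<theta>. cis (- of_int n * \<theta>)"
  have c: "continuous_on UNIV ?c" by (intro continuous_intros)
  have fd: "fourier G n = (\<lambda>r. integral {0..2 * pi} (\<lambda>\<theta>. ?c \<theta> * G r \<theta>))" for G
    by (rule ext) (rule fourier_def)
  have tt: "integral {0..2 * pi} (\<lambda>\<theta>. ?c \<theta> * Ftt r \<theta>) = - of_real ((of_int n)\<^sup>2) * fourier F n r" for r
  proof -
    \<comment> \<open>Two integrations by parts at once: the primitive is c F_t + i n c F, and its
      values at 0 and 2 pi agree by periodicity.\<close>
    have "((\<lambda>\<theta>. ?c \<theta> * Ftt r \<theta> + of_real ((of_int n)\<^sup>2) * (?c \<theta> * F r \<theta>)) has_integral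
       (?c (2 * pi) * Ft r (2 * pi) + \<i> * of_int n * (?c (2 * pi) * F r (2 * pi))) -
       (?c 0 * Ft r 0 + \<i> * of_int n * (?c 0 * F r 0))) {0..2 * pi}"
    proof (rule fundamental_theorem_of_calculus)
      fix \<theta> :: real
      have "((\<lambda>\<theta>. ?c \<theta> * Ft r \<theta> + \<i> * of_int n * (?c \<theta> * F r \<theta>)) has_vector_derivative
         (?c \<theta> * Ftt r \<theta> + (\<i> * of_real (- of_int n) * ?c \<theta>) * Ft r \<theta>) +
         \<i> * of_int n * (?c \<theta> * Ft r \<theta> + (\<i> * of_real (- of_int n) * ?c \<theta>) * F r \<theta>)) (at \<theta>)"
        by (intro has_vector_derivative_add has_vector_derivative_mult has_vector_derivative_cis
            F_t F_tt has_vector_derivative_mult_right)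
      also have "(?c \<theta> * Ftt r \<theta> + (\<i> * of_real (- of_int n) * ?c \<theta>) * Ft r \<theta>) +
         \<i> * of_int n * (?c \<theta> * Ft r \<theta> + (\<i> * of_real (- of_int n) * ?c \<theta>) * F r \<theta>) =
         ?c \<theta> * Ftt r \<theta> + of_real ((of_int n)\<^sup>2) * (?c \<theta> * F r \<theta>)"
        by (simp add: algebra_simps power2_eq_square)
      finally show "((\<lambda>\<theta>. ?c \<theta> * Ft r \<theta> + \<i> * of_int n * (?c \<theta> * F r \<theta>)) has_vector_derivative
        ?c \<theta> * Ftt r \<theta> + of_real ((of_int n)\<^sup>2) * (?c \<theta> * F r \<theta>)) (at \<theta> within {0..2 * pi})"
        by (rule has_vector_derivative_at_within)
    qed simp
    moreover have "?c (2 * pi) = ?c 0" 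
      using cis_multiple_2pi[of "- of_int n"] by (simp add: mult.commute)
    moreover have "Ft r (2 * pi) = Ft r 0" "F r (2 * pi) = F r 0"
      using Ft_periodic[of r 0] periodic[of r 0] by auto
    ultimately have "integral {0..2 * pi} (\<lambda>\<theta>. ?c \<theta> * Ftt r \<theta> + of_real ((of_int n)\<^sup>2) * (?c \<theta> * F r \<theta>)) = 0"
      by (simp add: integral_unique)
    also have "integral {0..2 * pi} (\<lambda>\<theta>. ?c \<theta> * Ftt r \<theta> + of_real ((of_int n)\<^sup>2) * (?c \<theta> * F r \<theta>)) =
      integral {0..2 * pi} (\<lambda>\<theta>. ?c \<theta> * Ftt r \<theta>) + of_real ((of_int n)\<^sup>2) * fourier F n r"
      unfolding fourier_def integral_mult_right[symmetric]
      by (intro integral_add integrable_continuous_real continuous_intros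
          continuous_on_slice[OF contF] continuous_on_slice[OF contFtt])
    finally show ?thesis by (simp add: eq_neg_iff_add_eq_0)
  qed
  show ?thesis
    unfolding radial_solution_def
  proof (intro conjI allI)
    show "(fourier F n has_vector_derivative fourier Fr n r) (at r)"
      "(fourier Fr n has_vector_derivative fourier Frr n r) (at r)"
      "continuous_on UNIV (fourier Frr n)" for r
      unfolding fd by (rule integral_derivatives[OF c])+
    show "of_real ((sinh r)\<^sup>2) * fourier Frr n r + of_real (sinh r * cosh r) * fourier Fr n r +
          of_real (\<mu> * (sinh r)\<^sup>2 - (of_int n)\<^sup>2) * fourier F n r = 0" for r
      using integral_eigen[OF c, of r 0 "2 * pi"] unfolding tt unfolding fd of_real_diff left_diff_distrib
      by (simp add: add_diff_eq)
  qed
qed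

lemma integral_polar_density:
  assumes c: "continuous_on UNIV c"
  shows "integral {a..b} (\<lambda>\<theta>. c \<theta> * polar_density s F Fr r \<theta>) =
    radial_density s (\<lambda>r. integral {a..b} (\<lambda>\<theta>. c \<theta> * F r \<theta>))
      (\<lambda>r. integral {a..b} (\<lambda>\<theta>. c \<theta> * Fr r \<theta>)) r"
proof -
  have int: "((\<lambda>\<theta>. c \<theta> * G r \<theta>) has_integral integral {a..b} (\<lambda>\<theta>. c \<theta> * G r \<theta>)) {a..b}"
    if "continuous_on UNIV (\<lambda>(r, \<theta>). G r \<theta>)" for G
    by (intro integrable_integral integrable_continuous_real continuous_on_mult
        continuous_on_slice[OF that] continuous_on_subset[OF c subset_UNIV])
  have "((\<lambda>\<theta>. (exp (- s * of_real r) * of_real (sinh r)) * (c \<theta> * Fr r \<theta> + s * (c \<theta> * F r \<theta>)))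
     has_integral (exp (- s * of_real r) * of_real (sinh r)) *
     (integral {a..b} (\<lambda>\<theta>. c \<theta> * Fr r \<theta>) + s * integral {a..b} (\<lambda>\<theta>. c \<theta> * F r \<theta>))) {a..b}"
    by (intro has_integral_add has_integral_mult_right int contF contFr)
  also have "(\<lambda>\<theta>. (exp (- s * of_real r) * of_real (sinh r)) * (c \<theta> * Fr r \<theta> + s * (c \<theta> * F r \<theta>))) =
     (\<lambda>\<theta>. c \<theta> * polar_density s F Fr r \<theta>)"
    by (simp add: polar_density_def distrib_left mult_ac)
  finally show ?thesis by (simp add: radial_density_def mult_ac integral_unique)
qed

lemma fourier_polar_density:
  "fourier (polar_density s F Fr) n = radial_density s (fourier F n) (fourier Fr n)"
proof
  fix r
  have c: "continuous_on UNIV (\<lambda>\<theta>. cis (- of_int n * \<theta>))" by (intro continuous_intros)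
  show "fourier (polar_density s F Fr) n r = radial_density s (fourier F n) (fourier Fr n) r"
    using integral_polar_density[OF c, of 0 "2 * pi" s r] unfolding fourier_def radial_density_def .
qed

text \<open>The angular second derivative in the derivative of the density integrates to boundary terms.\<close>

lemma integral_density_derivative:
  assumes \<mu>: "of_real \<mu> = s * (1 - s)" and ab: "a \<le> b" and r: "0 < r"
  shows "((\<lambda>r. integral {a..b} (polar_density s F Fr r)) has_vector_derivative
     exp (- s * of_real r) * (s * of_real (exp (- r)) * integral {a..b} (F r) -
        (Ft r b - Ft r a) / of_real (sinh r))) (at r)"
proof -
  have c: "continuous_on UNIV (\<lambda>_::real. 1::complex)" by simp
  have Ftt: "integral {a..b} (\<lambda>\<theta>. Ftt r \<theta>) = Ft r b - Ft r a"
    by (rule integral_unique, rule fundamental_theorem_of_calculus[OF ab],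
        rule has_vector_derivative_at_within, rule F_tt)
  have "of_real (sinh r) * (of_real (sinh r) * integral {a..b} (Frr r) +
      of_real (cosh r) * integral {a..b} (Fr r) + of_real (\<mu> * sinh r) * integral {a..b} (F r)) +
      (Ft r b - Ft r a) = 0"
    using integral_eigen[OF c, of r a b] unfolding mult_1 Ftt
    by (simp only: distrib_left of_real_mult of_real_power power2_eq_square mult_ac)
  moreover have "of_real (sinh r) * ((Ft r b - Ft r a) / of_real (sinh r)) = Ft r b - Ft r a"
    using r by simp
  ultimately have "of_real (sinh r) * (of_real (sinh r) * integral {a..b} (Frr r) +
      of_real (cosh r) * integral {a..b} (Fr r) + of_real (\<mu> * sinh r) * integral {a..b} (F r)
      + (Ft r b - Ft r a) / of_real (sinh r)) = 0"
    by (simp only: distrib_left[of _ _ "(Ft r b - Ft r a) / of_real (sinh r)"])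
  then have eq0: "of_real (sinh r) * integral {a..b} (Frr r) +
      of_real (cosh r) * integral {a..b} (Fr r) + of_real (\<mu> * sinh r) * integral {a..b} (F r)
      + (Ft r b - Ft r a) / of_real (sinh r) = 0"
    using r by (simp only: mult_eq_0_iff of_real_eq_0_iff sinh_real_zero_iff) auto
  have lin: "x + y + z + w = 0 \<Longrightarrow> x = - y - z + - w" for x y z w :: complex
    by (simp add: eq_neg_iff_add_eq_0 algebra_simps)
  have eq: "of_real (sinh r) * integral {a..b} (Frr r) =
      - of_real (cosh r) * integral {a..b} (Fr r) - of_real (\<mu> * sinh r) * integral {a..b} (F r)
      + - ((Ft r b - Ft r a) / of_real (sinh r))"
    unfolding mult_minus_left by (rule lin[OF eq0])
  show ?thesis
    using radial_density_has_derivative[OF integral_derivatives(1)[OF c, of a b r, unfolded mult_1]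
        integral_derivatives(2)[OF c, of a b r, unfolded mult_1] \<mu> eq]
    unfolding integral_polar_density[OF c, unfolded mult_1] diff_conv_add_uminus .
qed

text \<open>The bound on \<open>Ft\<close> says that the angular derivative per unit of hyperbolic
  length, which is sinh r times the angle, stays bounded. The boundary terms divided by sinh r are
  then bounded, and e^(-sr) supplies the decay.\<close>

lemma Otal_limit:
  assumes \<mu>: "of_real \<mu> = s * (1 - s)" and s: "Re s = 1/2" and ab: "a \<le> b"
    and B: "\<And>r \<theta>. 0 < r \<Longrightarrow> norm (F r \<theta>) \<le> B" "\<And>r \<theta>. 0 < r \<Longrightarrow> norm (Ft r \<theta>) \<le> B * sinh r"
  obtains L where "((\<lambda>r. integral {a..b} (polar_density s F Fr r)) \<longlongrightarrow> L) at_top"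
    "\<And>r. 0 < r \<Longrightarrow> norm (integral {a..b} (polar_density s F Fr r) - L)
       \<le> 2 * (norm s * B * (b - a) + 2 * B) * exp (- r / 2)"
proof (rule exponential_decay_limit)
  show "((\<lambda>r. integral {a..b} (polar_density s F Fr r)) has_vector_derivative
     exp (- s * of_real r) * (s * of_real (exp (- r)) * integral {a..b} (F r) -
        (Ft r b - Ft r a) / of_real (sinh r))) (at r)" if "0 < r" for r
    by (rule integral_density_derivative[OF \<mu> ab that])
  fix r :: real assume r: "0 < r"
  have 1: "norm (integral {a..b} (F r)) \<le> B * (b - a)"
    by (rule integral_bound[OF ab continuous_on_slice(1)[OF contF] B(1)[OF r]])
  have 2: "norm ((Ft r b - Ft r a) / of_real (sinh r)) \<le> 2 * B"
  proof -
    have "norm (Ft r b - Ft r a) \<le> 2 * (B * sinh r)"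
      using norm_triangle_ineq4[of "Ft r b" "Ft r a"] B(2)[OF r, of b] B(2)[OF r, of a] by linarith
    then show ?thesis using r by (simp add: norm_divide divide_simps mult_ac)
  qed
  have "norm (s * of_real (exp (- r)) * integral {a..b} (F r)) \<le> norm s * 1 * (B * (b - a))"
    unfolding norm_mult using 1 r by (intro mult_mono) auto
  then have "norm (s * of_real (exp (- r)) * integral {a..b} (F r) - (Ft r b - Ft r a) / of_real (sinh r))
    \<le> norm s * B * (b - a) + 2 * B"
    using order_trans[OF norm_triangle_ineq4 add_mono[OF _ 2]] by (simp add: mult.assoc)
  moreover have "norm (exp (- s * of_real r)) = exp (- r / 2)" by (simp add: s)
  ultimately show "norm (exp (- s * of_real r) * (s * of_real (exp (- r)) * integral {a..b} (F r) -
        (Ft r b - Ft r a) / of_real (sinh r))) \<le> (norm s * B * (b - a) + 2 * B) * exp (- r / 2)"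
    unfolding norm_mult by (metis exp_ge_zero mult.commute mult_right_mono)
qed (use that in blast)

end

subsection \<open>The Poisson kernel\<close>

text \<open>The reciprocal of the classical Poisson kernel (1 - |z|^2) / |z - \<xi>|^2 at hyperbolic
  radius r, where \<theta> is the angle between z and \<xi>; see
  \<open>poisson_kernel_polar\<close>.\<close>

definition poisson_denom :: "real \<Rightarrow> real \<Rightarrow> real" where
  "poisson_denom r \<theta> = cosh r - sinh r * cos \<theta>"

definition poisson_kernel :: "complex \<Rightarrow> real \<Rightarrow> real \<Rightarrow> complex" where
  "poisson_kernel s r \<theta> = exp (- s * of_real (ln (poisson_denom r \<theta>)))"

text \<open>All derivatives are expressed through the kernels with parameters s + 1 and s + 2. After
  \<open>poisson_kernel (s + 2)\<close> is factored out, the eigenvalue equation becomes a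
  polynomial identity in hyperbolic and circular functions.\<close>

definition poisson_kernel_r :: "complex \<Rightarrow> real \<Rightarrow> real \<Rightarrow> complex" where
  "poisson_kernel_r s r \<theta> = - s * of_real (sinh r - cosh r * cos \<theta>) * poisson_kernel (s + 1) r \<theta>"

definition poisson_kernel_t :: "complex \<Rightarrow> real \<Rightarrow> real \<Rightarrow> complex" where
  "poisson_kernel_t s r \<theta> = - s * of_real (sinh r * sin \<theta>) * poisson_kernel (s + 1) r \<theta>"

definition poisson_kernel_rr :: "complex \<Rightarrow> real \<Rightarrow> real \<Rightarrow> complex" where
  "poisson_kernel_rr s r \<theta> = - s * of_real (poisson_denom r \<theta>) * poisson_kernel (s + 1) r \<theta> +
     s * (s + 1) * of_real ((sinh r - cosh r * cos \<theta>)\<^sup>2) * poisson_kernel (s + 2) r \<theta>"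

definition poisson_kernel_tt :: "complex \<Rightarrow> real \<Rightarrow> real \<Rightarrow> complex" where
  "poisson_kernel_tt s r \<theta> = - s * of_real (sinh r * cos \<theta>) * poisson_kernel (s + 1) r \<theta> +
     s * (s + 1) * of_real ((sinh r * sin \<theta>)\<^sup>2) * poisson_kernel (s + 2) r \<theta>"

lemma poisson_denom_pos: "0 < poisson_denom r \<theta>"
proof -
  have "\<bar>sinh r * cos \<theta>\<bar> \<le> \<bar>sinh r\<bar> * 1"
    unfolding abs_mult by (intro mult_left_mono) auto
  also have "\<dots> < cosh r"
    using sinh_less_cosh_real[of r] sinh_less_cosh_real[of "-r"] by (simp add: abs_if)
  finally show ?thesis by (simp add: poisson_denom_def abs_if split: if_splits)
qed

lemma poisson_kernel_plus: "poisson_kernel (s + s') r \<theta> = poisson_kernel s r \<theta> * poisson_kernel s' r \<theta>"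
  by (simp add: poisson_kernel_def distrib_right exp_diff exp_minus field_simps)

lemma poisson_kernel_1: "poisson_kernel 1 r \<theta> = of_real (inverse (poisson_denom r \<theta>))"
proof -
  have "poisson_kernel 1 r \<theta> = of_real (exp (- ln (poisson_denom r \<theta>)))"
    by (simp only: poisson_kernel_def exp_of_real[symmetric]) simp
  also have "exp (- ln (poisson_denom r \<theta>)) = inverse (poisson_denom r \<theta>)"
    using poisson_denom_pos[of r \<theta>] by (simp add: exp_minus)
  finally show ?thesis .
qed

lemma poisson_kernel_step: "of_real (poisson_denom r \<theta>) * poisson_kernel (s + 1) r \<theta> = poisson_kernel s r \<theta>"
  using poisson_denom_pos[of r \<theta>] by (simp add: poisson_kernel_plus poisson_kernel_1)

lemma poisson_kernel_at_0: "poisson_kernel s 0 \<theta> = 1" by (simp add: poisson_kernel_def poisson_denom_def)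

lemma norm_poisson_kernel: "norm (poisson_kernel s r \<theta>) = exp (- Re s * ln (poisson_denom r \<theta>))"
  by (simp add: poisson_kernel_def)

lemma poisson_kernel_derivative:
  assumes "(g has_real_derivative g') (at x)" "g x = poisson_denom r \<theta>"
    and pos: "\<And>x. 0 < g x"
  shows "((\<lambda>x. exp (- s * of_real (ln (g x)))) has_vector_derivative
    - s * of_real g' * poisson_kernel (s + 1) r \<theta>) (at x)"
proof -
  have l: "((\<lambda>x. ln (g x)) has_real_derivative g' / g x) (at x)"
    using assms(1) pos[of x] by (auto intro!: derivative_eq_intros)
  have "((\<lambda>x. exp (- s * of_real (ln (g x)))) has_vector_derivative
     (g' / g x) *\<^sub>R (- s * exp (- s * of_real (ln (g x))))) (at x)"
    using vector_diff_chain_at[OF l[unfolded has_real_derivative_iff_has_vector_derivative]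
       has_vector_derivative_exp_real[of "-s"]] by (simp add: o_def)
  also have "(g' / g x) *\<^sub>R (- s * exp (- s * of_real (ln (g x)))) = - s * of_real g' * poisson_kernel (s + 1) r \<theta>"
    unfolding poisson_kernel_plus poisson_kernel_1 assms(2) unfolding poisson_kernel_def by (simp add: scaleR_conv_of_real divide_inverse)
  finally show ?thesis .
qed

lemma poisson_kernel_derivatives:
  "((\<lambda>r. poisson_kernel s r \<theta>) has_vector_derivative poisson_kernel_r s r \<theta>) (at r)"
  "((\<lambda>\<theta>. poisson_kernel s r \<theta>) has_vector_derivative poisson_kernel_t s r \<theta>) (at \<theta>)"
proof -
  have "((\<lambda>r. poisson_denom r \<theta>) has_real_derivative sinh r - cosh r * cos \<theta>) (at r)"
    unfolding poisson_denom_def by (auto intro!: derivative_eq_intros)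
  from poisson_kernel_derivative[OF this refl poisson_denom_pos] show "((\<lambda>r. poisson_kernel s r \<theta>) has_vector_derivative poisson_kernel_r s r \<theta>) (at r)"
    unfolding poisson_kernel_r_def poisson_kernel_def[abs_def] .
  have "((\<lambda>\<theta>. poisson_denom r \<theta>) has_real_derivative sinh r * sin \<theta>) (at \<theta>)"
    unfolding poisson_denom_def by (auto intro!: derivative_eq_intros)
  from poisson_kernel_derivative[OF this refl poisson_denom_pos] show "((\<lambda>\<theta>. poisson_kernel s r \<theta>) has_vector_derivative poisson_kernel_t s r \<theta>) (at \<theta>)"
    unfolding poisson_kernel_t_def poisson_kernel_def[abs_def] .
qed

lemma poisson_kernel_second_derivatives:
  "((\<lambda>r. poisson_kernel_r s r \<theta>) has_vector_derivative poisson_kernel_rr s r \<theta>) (at r)"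
  "((\<lambda>\<theta>. poisson_kernel_t s r \<theta>) has_vector_derivative poisson_kernel_tt s r \<theta>) (at \<theta>)"
proof -
  have two: "s + 1 + 1 = s + 2" by simp
  have 1: "((\<lambda>r. - s * of_real (sinh r - cosh r * cos \<theta>)) has_vector_derivative - s * of_real (poisson_denom r \<theta>)) (at r)"
    by (intro has_vector_derivative_mult_right has_vector_derivative_of_real)
      (auto intro!: derivative_eq_intros simp: poisson_denom_def)
  show "((\<lambda>r. poisson_kernel_r s r \<theta>) has_vector_derivative poisson_kernel_rr s r \<theta>) (at r)"
    using has_vector_derivative_mult[OF 1 poisson_kernel_derivatives(1)[of "s + 1" \<theta> r]]
    unfolding poisson_kernel_r_def poisson_kernel_rr_def two by (simp add: algebra_simps power2_eq_square)
  have 2: "((\<lambda>\<theta>. - s * of_real (sinh r * sin \<theta>)) has_vector_derivative - s * of_real (sinh r * cos \<theta>)) (at \<theta>)"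
    by (intro has_vector_derivative_mult_right has_vector_derivative_of_real)
      (auto intro!: derivative_eq_intros)
  show "((\<lambda>\<theta>. poisson_kernel_t s r \<theta>) has_vector_derivative poisson_kernel_tt s r \<theta>) (at \<theta>)"
    using has_vector_derivative_mult[OF 2 poisson_kernel_derivatives(2)[of "s + 1" r \<theta>]]
    unfolding poisson_kernel_t_def poisson_kernel_tt_def two by (simp add: algebra_simps power2_eq_square)
qed

lemma continuous_on_poisson_kernel: "continuous_on S (\<lambda>(r, \<theta>). poisson_kernel s r \<theta>)"
  unfolding poisson_kernel_def poisson_denom_def case_prod_unfold
  by (intro continuous_intros) (use poisson_denom_pos in \<open>auto simp: poisson_denom_def less_le\<close>)

lemma continuous_on_poisson_kernel_derivatives:
  "continuous_on S (\<lambda>(r, \<theta>). poisson_kernel_r s r \<theta>)" "continuous_on S (\<lambda>(r, \<theta>). poisson_kernel_t s r \<theta>)"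
  "continuous_on S (\<lambda>(r, \<theta>). poisson_kernel_rr s r \<theta>)" "continuous_on S (\<lambda>(r, \<theta>). poisson_kernel_tt s r \<theta>)"
  unfolding poisson_kernel_r_def poisson_kernel_t_def poisson_kernel_rr_def poisson_kernel_tt_def poisson_denom_def case_prod_unfold
  by (intro continuous_intros continuous_on_poisson_kernel[unfolded case_prod_unfold])+

lemma poisson_kernel_eigen:
  assumes \<mu>: "of_real \<mu> = s * (1 - s)"
  shows "of_real ((sinh r)\<^sup>2) * poisson_kernel_rr s r \<theta> + of_real (sinh r * cosh r) * poisson_kernel_r s r \<theta> +
      of_real (\<mu> * (sinh r)\<^sup>2) * poisson_kernel s r \<theta> + poisson_kernel_tt s r \<theta> = 0"
proof -
  define D where "D = complex_of_real (poisson_denom r \<theta>)"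
  define S C c q where "S = complex_of_real (sinh r)" and "C = complex_of_real (cosh r)"
    and "c = complex_of_real (cos \<theta>)" and "q = complex_of_real (sin \<theta>)"
  define E where "E = poisson_kernel (s + 2) r \<theta>"
  have D: "D = C - S * c" by (simp add: D_def poisson_denom_def C_def S_def c_def)
  have CS: "C * C = 1 + S * S"
  proof -
    have "cosh r * cosh r = 1 + sinh r * sinh r"
      using cosh_square_eq[of r] by (simp add: power2_eq_square)
    then have "complex_of_real (cosh r * cosh r) = of_real (1 + sinh r * sinh r)" by (rule arg_cong)
    then show ?thesis by (simp add: C_def S_def)
  qed
  have cq: "q * q = 1 - c * c"
  proof -
    have "sin \<theta> * sin \<theta> = 1 - cos \<theta> * cos \<theta>"
      using sin_cos_squared_add[of \<theta>] by (simp add: power2_eq_square)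
    then have "complex_of_real (sin \<theta> * sin \<theta>) = of_real (1 - cos \<theta> * cos \<theta>)" by (rule arg_cong)
    then show ?thesis by (simp add: q_def c_def)
  qed
  have p1: "poisson_kernel (s + 1) r \<theta> = D * E"
    using poisson_kernel_step[of r \<theta> "s + 1"] by (simp add: D_def E_def add.assoc)
  have p0: "poisson_kernel s r \<theta> = D * (D * E)"
    using poisson_kernel_step[of r \<theta> s] p1 by (simp add: D_def)
  \<comment> \<open>The coefficient of s(s + 1): the squared hyperbolic gradient of the denominator
    D is D^2, that is, (S - C c)^2 + q^2 = D^2.\<close>
  have key: "S * S * (s * (s + 1) * ((S - C * c) * (S - C * c))) + s * (s + 1) * (S * S * (q * q))
      = s * (s + 1) * (S * S) * (D * D)"
  proof -
    have "(S - C * c) * (S - C * c) + q * q = S * S - 2 * S * C * c + (C * C) * (c * c) + q * q"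
      by (simp add: algebra_simps)
    also have "\<dots> = C * C - 2 * S * C * c + S * S * (c * c)"
      unfolding CS cq by (simp add: algebra_simps)
    also have "\<dots> = D * D" unfolding D by (simp add: algebra_simps)
    finally have "s * (s + 1) * (S * S) * ((S - C * c) * (S - C * c) + q * q) = s * (s + 1) * (S * S) * (D * D)"
      by simp
    then show ?thesis by (simp add: algebra_simps)
  qed
  have key2: "C * (S - C * c) + c = S * D"
  proof -
    have "C * (S - C * c) + c = C * S - (C * C) * c + c" by (simp add: algebra_simps)
    also have "\<dots> = S * D" unfolding CS D by (simp add: algebra_simps)
    finally show ?thesis .
  qed
  have "of_real ((sinh r)\<^sup>2) * poisson_kernel_rr s r \<theta> + of_real (sinh r * cosh r) * poisson_kernel_r s r \<theta> +
      of_real (\<mu> * (sinh r)\<^sup>2) * poisson_kernel s r \<theta> + poisson_kernel_tt s r \<theta> =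
     S * S * (- s * D * (D * E) + s * (s + 1) * ((S - C * c) * (S - C * c)) * E)
     + S * C * (- s * (S - C * c) * (D * E)) + s * (1 - s) * (S * S) * (D * (D * E))
     + (- s * (S * c) * (D * E) + s * (s + 1) * (S * S * (q * q)) * E)"
    unfolding poisson_kernel_rr_def poisson_kernel_tt_def poisson_kernel_r_def p1 p0 E_def[symmetric]
    unfolding of_real_mult \<mu> of_real_power of_real_diff power2_eq_square
      D_def[symmetric] S_def[symmetric] C_def[symmetric] c_def[symmetric] q_def[symmetric]
    by (simp only: mult_ac)
  also have "\<dots> = E * (- s * (S * S) * (D * D) +
      (S * S * (s * (s + 1) * ((S - C * c) * (S - C * c))) + s * (s + 1) * (S * S * (q * q)))
     - s * S * D * (C * (S - C * c) + c) + s * (1 - s) * (S * S) * (D * D))"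
    by (simp add: algebra_simps)
  also have "\<dots> = 0" unfolding key key2 by (simp add: algebra_simps)
  finally show ?thesis .
qed

lemma poisson_kernel_polar_eigenfunction:
  assumes "of_real \<mu> = s * (1 - s)"
  shows "polar_eigenfunction \<mu> (poisson_kernel s) (poisson_kernel_r s) (poisson_kernel_rr s) (poisson_kernel_t s) (poisson_kernel_tt s)"
proof (rule polar_eigenfunction.intro)
  show "poisson_kernel s r (\<theta> + 2 * pi) = poisson_kernel s r \<theta>" for r \<theta> by (simp add: poisson_kernel_def poisson_denom_def)
qed (rule poisson_kernel_derivatives poisson_kernel_second_derivatives continuous_on_poisson_kernel continuous_on_poisson_kernel_derivatives poisson_kernel_eigen assms)+

text \<open>The combination of the radial derivative with s times the kernel gains a factor e^(-r)
  (1 + cos \<theta>) and raises the exponent to s + 1. At exponent s alone the density would not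
  concentrate at \<theta> = 0; at s + 1 it does.\<close>

lemma polar_density_poisson_kernel:
  "polar_density s (poisson_kernel s) (poisson_kernel_r s) r \<theta> =
     s * exp (- s * of_real r) * of_real (sinh r * exp (- r) * (1 + cos \<theta>)) * poisson_kernel (s + 1) r \<theta>"
proof -
  have "cosh r - sinh r = exp (- r)" by (simp add: sinh_def cosh_def field_simps)
  moreover have "poisson_denom r \<theta> - (sinh r - cosh r * cos \<theta>) = (cosh r - sinh r) * (1 + cos \<theta>)"
    by (simp add: poisson_denom_def algebra_simps)
  ultimately have "poisson_denom r \<theta> - (sinh r - cosh r * cos \<theta>) = exp (- r) * (1 + cos \<theta>)"
    by (simp only:)
  moreover have "poisson_kernel_r s r \<theta> + s * poisson_kernel s r \<theta> =
    s * of_real (poisson_denom r \<theta> - (sinh r - cosh r * cos \<theta>)) * poisson_kernel (s + 1) r \<theta>"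
    unfolding poisson_kernel_r_def poisson_kernel_step[of r \<theta> s, symmetric] by (simp add: algebra_simps)
  ultimately show ?thesis unfolding polar_density_def by (simp add: mult_ac)
qed

text \<open>The classical Poisson kernel is the case \<open>s = 1\<close>, where the radial equation says that
  the mean does not depend on the radius.\<close>

lemma integral_poisson_kernel_1:
  assumes r: "0 \<le> r"
  shows "integral {0..2 * pi} (poisson_kernel 1 r) = of_real (2 * pi)"
proof -
  interpret polar_eigenfunction 0 "poisson_kernel 1" "poisson_kernel_r 1" "poisson_kernel_rr 1" "poisson_kernel_t 1" "poisson_kernel_tt 1"
    by (rule poisson_kernel_polar_eigenfunction) simp
  define K where "K = fourier (poisson_kernel 1) 0"
  define K' where "K' = fourier (poisson_kernel_r 1) 0"
  define K'' where "K'' = fourier (poisson_kernel_rr 1) 0"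
  have K: "radial_solution 0 0 K K' K''"
    using fourier_radial_solution[of 0] by (simp add: K_def K'_def K''_def)
  \<comment> \<open>For eigenvalue 0 and n = 0 the equation says that sinh r K' is constant, and it
    vanishes at r = 0.\<close>
  have c0: "((\<lambda>r. of_real (sinh r) * K' r) has_vector_derivative 0) (at x)" if "0 < x" for x
  proof -
    have "((\<lambda>r. of_real (sinh r) * K' r) has_vector_derivative
        of_real (sinh x) * K'' x + of_real (cosh x) * K' x) (at x)"
      by (intro has_vector_derivative_mult has_vector_derivative_of_real radial_solutionD(2)[OF K])
        (auto intro!: derivative_eq_intros)
    then show ?thesis using radial_solutionD(3)[OF K, of x] that by simp
  qed
  have contK: "continuous_on S K" "continuous_on S K'" for S
    by (rule continuous_on_vector_derivative[OF has_vector_derivative_at_within],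
        rule radial_solutionD[OF K])+
  have K'0: "K' x = 0" if x: "0 < x" for x
  proof -
    have "of_real (sinh x) * K' x = of_real (sinh 0) * K' 0"
    proof (rule has_derivative_zero_unique_strong_interval[of "{0}" 0 x])
      show "continuous_on {0..x} (\<lambda>r. of_real (sinh r) * K' r)"
        by (intro continuous_intros contK)
      show "((\<lambda>r. of_real (sinh r) * K' r) has_derivative (\<lambda>h. 0)) (at y within {0..x})"
        if "y \<in> {0..x} - {0}" for y
        using c0[of y] that has_vector_derivative_at_within[of _ 0 y "{0..x}"]
        unfolding has_vector_derivative_def by auto
    qed (use x in auto)
    then show ?thesis using x by simp
  qed
  have "K r = K 0"
  proof (rule has_derivative_zero_unique_strong_interval[of "{0}" 0 r])
    show "continuous_on {0..r} K" by (rule contK)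
    show "(K has_derivative (\<lambda>h. 0)) (at y within {0..r})" if "y \<in> {0..r} - {0}" for y
      using radial_solutionD(1)[OF K, of y] K'0[of y] that has_vector_derivative_at_within[of K 0 y "{0..r}"]
      unfolding has_vector_derivative_def by auto
  qed (use r in auto)
  then show ?thesis by (simp add: K_def fourier_def poisson_kernel_at_0 scaleR_conv_of_real)
qed

lemma integral_inverse_poisson_denom:
  assumes "0 \<le> r"
  shows "((\<lambda>\<theta>. inverse (poisson_denom r \<theta>)) has_integral 2 * pi) {0..2 * pi}"
proof -
  have "(\<lambda>\<theta>. inverse (poisson_denom r \<theta>)) integrable_on {0..2 * pi}"
    unfolding poisson_denom_def
    by (intro integrable_continuous_real continuous_intros) (use poisson_denom_pos in \<open>auto simp: poisson_denom_def less_le\<close>)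
  then have i: "((\<lambda>\<theta>. inverse (poisson_denom r \<theta>)) has_integral integral {0..2 * pi} (\<lambda>\<theta>. inverse (poisson_denom r \<theta>))) {0..2 * pi}"
    by blast
  have "((\<lambda>\<theta>. complex_of_real (inverse (poisson_denom r \<theta>))) has_integral
     of_real (integral {0..2 * pi} (\<lambda>\<theta>. inverse (poisson_denom r \<theta>)))) {0..2 * pi}"
    using has_integral_linear[OF i bounded_linear_of_real[where ?'a = complex]] by (simp only: o_def)
  then have "integral {0..2 * pi} (poisson_kernel 1 r) = of_real (integral {0..2 * pi} (\<lambda>\<theta>. inverse (poisson_denom r \<theta>)))"
    using integral_unique poisson_kernel_1 by (metis (no_types, lifting) ext)
  then have "integral {0..2 * pi} (\<lambda>\<theta>. inverse (poisson_denom r \<theta>)) = 2 * pi"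
    unfolding integral_poisson_kernel_1[OF assms] of_real_eq_iff by simp
  then show ?thesis using i by simp
qed

lemma norm_cis_minus_1: "norm (cis (of_int n * \<theta>) - 1) \<le> of_int \<bar>n\<bar> * norm (cis \<theta> - 1)"
proof -
  have nat: "norm (cis (of_nat m * \<theta>) - 1) \<le> of_nat m * norm (cis \<theta> - 1)" for m
    using norm_power_diff[of "cis \<theta>" 1 m] by (simp add: Complex.DeMoivre)
  show ?thesis
  proof (cases "0 \<le> n")
    case True then show ?thesis using nat[of "nat n"] by simp
  next
    case False
    have "norm (cis (of_int n * \<theta>) - 1) = norm (cnj (cis (of_int n * \<theta>) - 1))" by (simp only: complex_mod_cnj)
    also have "cnj (cis (of_int n * \<theta>) - 1) = cis (of_nat (nat (- n)) * \<theta>) - 1"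
      using False by (simp add: cis_cnj)
    finally show ?thesis using nat[of "nat (-n)"] False by simp
  qed
qed

lemma norm_cis_minus_1_sq: "(norm (cis \<theta> - 1))\<^sup>2 = 2 * (1 - cos \<theta>)"
proof -
  have "(norm (cis \<theta> - 1))\<^sup>2 = (cos \<theta>)\<^sup>2 + (sin \<theta>)\<^sup>2 + 1 - 2 * cos \<theta>"
    unfolding cmod_power2 by (simp add: power2_eq_square algebra_simps)
  then show ?thesis by simp
qed

lemma exp_half_ln_squared:
  assumes "0 < x" shows "(exp (- (1/2) * ln x))\<^sup>2 = inverse (x::real)"
proof -
  have "(exp (- (1/2) * ln x))\<^sup>2 = exp (- (1/2) * ln x + - (1/2) * ln x)"
    unfolding power2_eq_square by (rule exp_add[symmetric])
  also have "- (1/2) * ln x + - (1/2) * ln x = - ln x" by simp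
  finally show ?thesis using assms by (simp add: exp_minus)
qed

text \<open>The first factor is at most |n| |cis \<theta> - 1|, and this zero at \<theta> = 0
  cancels a half power of the denominator, which is at least sinh r (1 - cos \<theta>). What is left
  is e^(-r) times the classical Poisson kernel, whose mass does not depend on r.\<close>

lemma poisson_kernel_approximate_identity_bound:
  assumes s: "Re s = 1/2" and r: "0 < r"
  shows "norm ((cis (- of_int n * \<theta>) - 1) * polar_density s (poisson_kernel s) (poisson_kernel_r s) r \<theta>)
    \<le> 4 * of_int \<bar>n\<bar> * norm s * exp (- r) * inverse (poisson_denom r \<theta>)"
proof -
  define A where "A = norm (cis \<theta> - 1)"
  define e where "e = exp (- (1/2) * ln (poisson_denom r \<theta>))"
  have p: "0 < poisson_denom r \<theta>" by (rule poisson_denom_pos)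
  have e2: "e\<^sup>2 = inverse (poisson_denom r \<theta>)"
    unfolding e_def by (rule exp_half_ln_squared[OF p])
  have A2: "A\<^sup>2 = 2 * (1 - cos \<theta>)" unfolding A_def by (rule norm_cis_minus_1_sq)
  \<comment> \<open>The denominator exceeds the left side by cosh r - sinh r, which is
    positive.\<close>
  have "sinh r * (1 - cos \<theta>) \<le> poisson_denom r \<theta>"
    using sinh_le_cosh_real[of r] by (simp add: poisson_denom_def algebra_simps)
  have "(A * sinh r * e)\<^sup>2 = 2 * sinh r * (sinh r * (1 - cos \<theta>) * inverse (poisson_denom r \<theta>))"
    unfolding power_mult_distrib e2 A2 by (simp add: power2_eq_square)
  also have "\<dots> \<le> 2 * sinh r * 1"
    using r p \<open>sinh r * (1 - cos \<theta>) \<le> poisson_denom r \<theta>\<close> by (intro mult_left_mono) (auto simp: divide_simps)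
  also have "\<dots> \<le> (2 * exp (r / 2))\<^sup>2"
  proof -
    have "(2 * exp (r / 2))\<^sup>2 = 4 * exp r" by (simp add: power2_eq_square flip: exp_add)
    moreover have "2 * sinh r \<le> exp r" by (simp add: sinh_def)
    ultimately show ?thesis using exp_ge_zero[of r] by linarith
  qed
  finally have Ae: "A * sinh r * e \<le> 2 * exp (r / 2)"
    by (rule power2_le_imp_le) simp
  have n1: "norm (cis (- of_int n * \<theta>) - 1) \<le> of_int \<bar>n\<bar> * A"
    using norm_cis_minus_1[of "-n" \<theta>] by (simp add: A_def)
  have npk: "norm (poisson_kernel (s + 1) r \<theta>) = e * inverse (poisson_denom r \<theta>)"
    unfolding poisson_kernel_plus poisson_kernel_1 norm_mult norm_poisson_kernel s e_def
    by (simp only: norm_of_real abs_of_pos[OF positive_imp_inverse_positive[OF p]])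
  have cos1: "0 \<le> 1 + cos \<theta>" using cos_ge_minus_one[of \<theta>] by linarith
  have nd: "norm (polar_density s (poisson_kernel s) (poisson_kernel_r s) r \<theta>) =
    norm s * exp (- r / 2) * (sinh r * exp (- r) * (1 + cos \<theta>)) * (e * inverse (poisson_denom r \<theta>))"
  proof -
    have "0 \<le> sinh r * exp (- r) * (1 + cos \<theta>)" using r cos1 by (intro mult_nonneg_nonneg) auto
    moreover have "norm (exp (- s * of_real r)) = exp (- r / 2)" by (simp add: s)
    ultimately show ?thesis unfolding polar_density_poisson_kernel norm_mult npk by (simp only: norm_of_real abs_of_nonneg)
  qed
  have "norm ((cis (- of_int n * \<theta>) - 1) * polar_density s (poisson_kernel s) (poisson_kernel_r s) r \<theta>) \<le>
    (of_int \<bar>n\<bar> * A) * (norm s * exp (- r / 2) * (sinh r * exp (- r) * 2) * (e * inverse (poisson_denom r \<theta>)))"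
    unfolding norm_mult nd
    by (intro mult_mono n1 mult_nonneg_nonneg) (use r p cos1 cos_le_one[of \<theta>] in
        \<open>auto simp: e_def A_def intro!: mult_nonneg_nonneg\<close>)
  also have "\<dots> = (2 * of_int \<bar>n\<bar> * norm s * exp (- r) * inverse (poisson_denom r \<theta>)) * (exp (- r / 2) * (A * sinh r * e))"
    by (simp only: mult_ac)
  also have "\<dots> \<le> (2 * of_int \<bar>n\<bar> * norm s * exp (- r) * inverse (poisson_denom r \<theta>)) * (exp (- r / 2) * (2 * exp (r / 2)))"
    using Ae p by (intro mult_left_mono mult_nonneg_nonneg) auto
  also have "exp (- r / 2) * (2 * exp (r / 2)) = 2" by (simp flip: exp_add)
  finally show ?thesis by (simp add: mult_ac)
qed

text \<open>The constant c(s), read off from one explicit eigenfunction: the Poisson kernel has the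
  value 1 at the origin, so its limiting mass is c(s). That the limit exists is
  \<open>otal_const_limit_0\<close>; agreement with the abstract description is
  \<open>helgason_const_otal\<close>.\<close>

definition otal_const :: "complex \<Rightarrow> complex" where
  "otal_const s = Lim at_top (\<lambda>r. integral {0..2 * pi} (polar_density s (poisson_kernel s) (poisson_kernel_r s) r))"

context
  fixes s :: complex and t \<mu> :: real
  assumes s: "s = 1/2 + \<i> * of_real t" and \<mu>: "\<mu> = 1/4 + t\<^sup>2"
begin

lemma spectral_parameter: "of_real \<mu> = s * (1 - s)" "Re s = 1/2" "0 < \<mu>"
  by (auto simp: s \<mu> algebra_simps power2_eq_square complex_eq_iff intro: add_nonneg_pos)

interpretation poisson_kernel: polar_eigenfunction \<mu> "poisson_kernel s" "poisson_kernel_r s" "poisson_kernel_rr s" "poisson_kernel_t s" "poisson_kernel_tt s"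
  by (rule poisson_kernel_polar_eigenfunction[OF spectral_parameter(1)])

text \<open>For Re s = 1/2 the kernel has the modulus of the square root of the classical Poisson
  kernel P, which is at most (1 + P) / 2, and both 1 and P have integral 2 pi.\<close>

lemma fourier_poisson_kernel_0_bound:
  assumes "0 < r" shows "norm (fourier (poisson_kernel s) 0 r) \<le> 2 * pi"
proof -
  have "norm (fourier (poisson_kernel s) 0 r) \<le> integral {0..2 * pi} (\<lambda>\<theta>. (1 + inverse (poisson_denom r \<theta>)) / 2)"
    unfolding fourier_def
  proof (rule integral_norm_bound_integral)
    show "(\<lambda>\<theta>. cis (- of_int 0 * \<theta>) * poisson_kernel s r \<theta>) integrable_on {0..2 * pi}"
      by (intro integrable_continuous_real continuous_intros continuous_on_slice[OF continuous_on_poisson_kernel])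
    show "(\<lambda>\<theta>. (1 + inverse (poisson_denom r \<theta>)) / 2) integrable_on {0..2 * pi}"
      using integral_inverse_poisson_denom[of r] assms
      by (intro integrable_on_divide integrable_add integrable_const_ivl) (auto simp: has_integral_iff)
    show "norm (cis (- of_int 0 * \<theta>) * poisson_kernel s r \<theta>) \<le> (1 + inverse (poisson_denom r \<theta>)) / 2" for \<theta>
    proof -
      define e where "e = exp (- (1/2) * ln (poisson_denom r \<theta>))"
      have "e\<^sup>2 = inverse (poisson_denom r \<theta>)"
        unfolding e_def by (rule exp_half_ln_squared[OF poisson_denom_pos])
      moreover have "0 \<le> (e - 1)\<^sup>2" by simp
      ultimately have "e \<le> (1 + inverse (poisson_denom r \<theta>)) / 2" by (simp add: power2_diff)
      then show ?thesis by (simp add: norm_poisson_kernel spectral_parameter(2) e_def)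
    qed
  qed
  also have "integral {0..2 * pi} (\<lambda>\<theta>. (1 + inverse (poisson_denom r \<theta>)) / 2) = (2 * pi + 2 * pi) / 2"
  proof (rule integral_unique)
    have "((\<lambda>\<theta>. 1) has_integral 2 * pi) {0..2 * pi :: real}"
      using has_integral_const_real[of "1::real" 0 "2 * pi"] by simp
    from has_integral_add[OF this integral_inverse_poisson_denom[of r]]
    show "((\<lambda>\<theta>. (1 + inverse (poisson_denom r \<theta>)) / 2) has_integral (2 * pi + 2 * pi) / 2) {0..2 * pi}"
      using assms by (intro has_integral_divide) auto
  qed
  finally show ?thesis by simp
qed

lemma fourier_0: "fourier F 0 r = integral {0..2 * pi} (F r)"
  by (simp add: fourier_def)

lemma otal_const_limit_0:
  "(fourier (polar_density s (poisson_kernel s) (poisson_kernel_r s)) 0 \<longlongrightarrow> otal_const s) at_top"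
proof -
  have K: "radial_solution \<mu> 0 (fourier (poisson_kernel s) 0) (fourier (poisson_kernel_r s) 0) (fourier (poisson_kernel_rr s) 0)"
    using poisson_kernel.fourier_radial_solution[of 0] by simp
  have D: "(radial_density s (fourier (poisson_kernel s) 0) (fourier (poisson_kernel_r s) 0) has_vector_derivative
     exp (- s * of_real r) * (s * of_real (exp (- r)) + of_real (0\<^sup>2 / sinh r)) * fourier (poisson_kernel s) 0 r) (at r)"
    if "0 < r" for r
    by (rule radial_density_derivative[OF K spectral_parameter(1) that])
  have B: "norm (exp (- s * of_real r) * (s * of_real (exp (- r)) + of_real (0\<^sup>2 / sinh r)) * fourier (poisson_kernel s) 0 r)
    \<le> norm s * (2 * pi) * exp (- r / 2)" if r: "0 < r" for r
  proof -
    have "norm (exp (- s * of_real r)) = exp (- r / 2)" by (simp add: spectral_parameter(2))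
    then have "norm (exp (- s * of_real r) * (s * of_real (exp (- r)) + of_real (0\<^sup>2 / sinh r)) * fourier (poisson_kernel s) 0 r)
      = exp (- r / 2) * (norm s * exp (- r)) * norm (fourier (poisson_kernel s) 0 r)"
      by (simp add: norm_mult)
    also have "\<dots> \<le> exp (- r / 2) * (norm s * 1) * (2 * pi)"
      using r fourier_poisson_kernel_0_bound[OF r] by (intro mult_mono mult_left_mono mult_nonneg_nonneg) auto
    finally show ?thesis by (simp add: mult_ac)
  qed
  obtain L where L: "(radial_density s (fourier (poisson_kernel s) 0) (fourier (poisson_kernel_r s) 0) \<longlongrightarrow> L) at_top"
    using exponential_decay_limit[OF D B] by blast
  have "otal_const s = L"
    unfolding otal_const_def fourier_0[symmetric] poisson_kernel.fourier_polar_density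
    by (rule tendsto_Lim[OF _ L]) simp
  with L show ?thesis unfolding poisson_kernel.fourier_polar_density by (simp only:)
qed

text \<open>The densities of the Poisson kernel form an approximate identity up to the factor
  \<open>otal_const s\<close>.\<close>

lemma otal_const_limit:
  "(fourier (polar_density s (poisson_kernel s) (poisson_kernel_r s)) n \<longlongrightarrow> otal_const s) at_top"
proof -
  let ?w = "polar_density s (poisson_kernel s) (poisson_kernel_r s)"
  have cw: "continuous_on S (?w r)" for S r
    unfolding polar_density_def
    by (intro continuous_intros continuous_on_slice[OF continuous_on_poisson_kernel]
        continuous_on_slice[OF continuous_on_poisson_kernel_derivatives(1)])
  have "((\<lambda>r. fourier ?w n r - fourier ?w 0 r) \<longlongrightarrow> 0) at_top"
  proof (rule Lim_null_comparison)
    show "((\<lambda>r. 4 * of_int \<bar>n\<bar> * norm s * exp (- r) * (2 * pi)) \<longlongrightarrow> 0) at_top"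
      by real_asymp
    show "\<forall>\<^sub>F r in at_top. norm (fourier ?w n r - fourier ?w 0 r) \<le> 4 * of_int \<bar>n\<bar> * norm s * exp (- r) * (2 * pi)"
      using eventually_gt_at_top[of 0]
    proof eventually_elim
      case (elim r)
      have "fourier ?w n r - fourier ?w 0 r =
          integral {0..2 * pi} (\<lambda>\<theta>. cis (- of_int n * \<theta>) * ?w r \<theta> - ?w r \<theta>)"
        unfolding fourier_0 unfolding fourier_def
        by (intro integral_diff[symmetric] integrable_continuous_real continuous_intros cw)
      also have "(\<lambda>\<theta>. cis (- of_int n * \<theta>) * ?w r \<theta> - ?w r \<theta>) = (\<lambda>\<theta>. (cis (- of_int n * \<theta>) - 1) * ?w r \<theta>)"
        by (simp only: left_diff_distrib mult_1)
      finally have eq: "fourier ?w n r - fourier ?w 0 r =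
        integral {0..2 * pi} (\<lambda>\<theta>. (cis (- of_int n * \<theta>) - 1) * ?w r \<theta>)" .
      have "norm (fourier ?w n r - fourier ?w 0 r) \<le>
        integral {0..2 * pi} (\<lambda>\<theta>. 4 * of_int \<bar>n\<bar> * norm s * exp (- r) * inverse (poisson_denom r \<theta>))"
        unfolding eq
      proof (rule integral_norm_bound_integral)
        show "(\<lambda>\<theta>. (cis (- of_int n * \<theta>) - 1) * ?w r \<theta>) integrable_on {0..2 * pi}"
          by (intro integrable_continuous_real continuous_intros cw)
        show "(\<lambda>\<theta>. 4 * of_int \<bar>n\<bar> * norm s * exp (- r) * inverse (poisson_denom r \<theta>)) integrable_on {0..2 * pi}"
          by (rule has_integral_integrable, rule has_integral_mult_right, rule integral_inverse_poisson_denom)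
            (use elim in simp)
      qed (rule poisson_kernel_approximate_identity_bound[OF spectral_parameter(2) elim])
      also have "\<dots> = 4 * of_int \<bar>n\<bar> * norm s * exp (- r) * (2 * pi)"
        using integral_inverse_poisson_denom[of r] elim by (intro integral_unique has_integral_mult_right) auto
      finally show ?case .
    qed
  qed
  from tendsto_add[OF this otal_const_limit_0] show ?thesis by simp
qed

text \<open>If the limiting mass were 0, \<open>radial_solution_zero\<close> would annihilate the
  mean of the Poisson kernel for all r > 0; but this mean is continuous and equals 2 pi at r =
  0.\<close>

lemma otal_const_nonzero: "otal_const s \<noteq> 0"
proof
  assume "otal_const s = 0"
  moreover have K: "radial_solution \<mu> 0 (fourier (poisson_kernel s) 0) (fourier (poisson_kernel_r s) 0) (fourier (poisson_kernel_rr s) 0)"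
    using poisson_kernel.fourier_radial_solution[of 0] by simp
  ultimately have z: "fourier (poisson_kernel s) 0 a = 0" if "0 < a" for a
    using radial_solution_zero[OF K s spectral_parameter(1) _ that] otal_const_limit_0
    unfolding poisson_kernel.fourier_polar_density by simp
  have "isCont (fourier (poisson_kernel s) 0) 0"
    using radial_solutionD(1)[OF K, of 0] has_vector_derivative_continuous by blast
  then have "(fourier (poisson_kernel s) 0 \<longlongrightarrow> fourier (poisson_kernel s) 0 0) (at_right 0)"
    by (simp add: isCont_def filterlim_at_split)
  moreover have "\<forall>\<^sub>F x in at_right (0::real). fourier (poisson_kernel s) 0 x = 0"
    using eventually_at_right_less[of 0] by eventually_elim (rule z)
  ultimately have "((\<lambda>_. 0) \<longlongrightarrow> fourier (poisson_kernel s) 0 0) (at_right (0::real))"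
    using tendsto_cong by fastforce
  then have "fourier (poisson_kernel s) 0 0 = 0" using tendsto_unique[OF _ _ tendsto_const] trivial_limit_at_right_real by blast
  then show False by (simp add: fourier_def poisson_kernel_at_0 scaleR_conv_of_real)
qed

end

subsection \<open>Stieltjes integrals by parts\<close>

text \<open>The integral of \<psi> against dG for G that is merely continuous. The derivative of
  \<psi> is two-sided even at the endpoints, unlike that of \<open>helgason_integral\<close>;
  \<open>helgason_integral_stieltjes\<close> identifies the two for functions differentiable at the
  endpoints.\<close>

definition stieltjes :: "real \<Rightarrow> real \<Rightarrow> (real \<Rightarrow> complex) \<Rightarrow> (real \<Rightarrow> complex) \<Rightarrow> complex" where
  "stieltjes a b \<psi> G = \<psi> b * G b - \<psi> a * G a - integral {a..b} (\<lambda>\<theta>. vector_derivative \<psi> (at \<theta>) * G \<theta>)"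

lemma C1_D:
  assumes "\<psi> C1_differentiable_on S"
  shows "x \<in> S \<Longrightarrow> (\<psi> has_vector_derivative vector_derivative \<psi> (at x)) (at x)"
    and "continuous_on S (\<lambda>x. vector_derivative \<psi> (at x))" and "continuous_on S \<psi>"
proof -
  show "x \<in> S \<Longrightarrow> (\<psi> has_vector_derivative vector_derivative \<psi> (at x)) (at x)"
    using assms unfolding C1_differentiable_on_eq by (simp flip: vector_derivative_works)
  show "continuous_on S (\<lambda>x. vector_derivative \<psi> (at x))"
    using assms unfolding C1_differentiable_on_eq by blast
  show "continuous_on S \<psi>" using assms by (rule C1_differentiable_imp_continuous_on)
qed

lemma C1_I:
  assumes "\<And>x. x \<in> S \<Longrightarrow> (\<psi> has_vector_derivative \<psi>' x) (at x)" "continuous_on S \<psi>'"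
  shows "\<psi> C1_differentiable_on S"
  using assms by (auto simp: C1_differentiable_on_def)

lemma C1_subset: "\<psi> C1_differentiable_on S \<Longrightarrow> T \<subseteq> S \<Longrightarrow> \<psi> C1_differentiable_on T"
  by (auto simp: C1_differentiable_on_def intro: continuous_on_subset)

lemma stieltjes_integrand:
  fixes \<psi> G :: "real \<Rightarrow> complex"
  assumes "\<psi> C1_differentiable_on {a..b}" "continuous_on {a..b} G"
  shows "continuous_on {a..b} (\<lambda>\<theta>. vector_derivative \<psi> (at \<theta>) * G \<theta>)"
    and "(\<lambda>\<theta>. vector_derivative \<psi> (at \<theta>) * G \<theta>) integrable_on {a..b}"
proof -
  show "continuous_on {a..b} (\<lambda>\<theta>. vector_derivative \<psi> (at \<theta>) * G \<theta>)"
    by (rule continuous_on_mult[OF C1_D(2)[OF assms(1)] assms(2)])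
  then show "(\<lambda>\<theta>. vector_derivative \<psi> (at \<theta>) * G \<theta>) integrable_on {a..b}"
    by (rule integrable_continuous_real)
qed

lemma stieltjes_eq:
  assumes "\<And>\<theta>. \<theta> \<in> {a..b} \<Longrightarrow> (\<psi> has_vector_derivative \<psi>' \<theta>) (at \<theta>)"
  shows "stieltjes a b \<psi> G = \<psi> b * G b - \<psi> a * G a - integral {a..b} (\<lambda>\<theta>. \<psi>' \<theta> * G \<theta>)"
proof -
  have "integral {a..b} (\<lambda>\<theta>. vector_derivative \<psi> (at \<theta>) * G \<theta>) = integral {a..b} (\<lambda>\<theta>. \<psi>' \<theta> * G \<theta>)"
    by (rule integral_cong) (use vector_derivative_at[OF assms] in auto)
  then show ?thesis by (simp add: stieltjes_def)
qed

lemma stieltjes_refl: "stieltjes a a \<psi> G = 0"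
  by (simp add: stieltjes_def)

lemma stieltjes_combine:
  assumes "\<psi> C1_differentiable_on {a..b}" "continuous_on {a..b} G" "a \<le> c" "c \<le> b"
  shows "stieltjes a b \<psi> G = stieltjes a c \<psi> G + stieltjes c b \<psi> G"
  using Henstock_Kurzweil_Integration.integral_combine[OF assms(3,4) stieltjes_integrand(2)[OF assms(1,2)]]
  by (simp add: stieltjes_def algebra_simps)

lemma stieltjes_const:
  assumes "\<psi> C1_differentiable_on {a..b}" "a \<le> b"
  shows "stieltjes a b \<psi> (\<lambda>_. k) = 0"
proof -
  have "((\<lambda>\<theta>. vector_derivative \<psi> (at \<theta>) * k) has_integral \<psi> b * k - \<psi> a * k) {a..b}"
    by (rule fundamental_theorem_of_calculus[OF assms(2)], rule has_vector_derivative_at_within,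
        rule has_vector_derivative_mult_left, rule C1_D(1)[OF assms(1)])
  from integral_unique[OF this] show ?thesis unfolding stieltjes_def by (simp only: diff_self)
qed

lemma stieltjes_add:
  assumes "\<psi> C1_differentiable_on {a..b}" "continuous_on {a..b} G" "continuous_on {a..b} H"
  shows "stieltjes a b \<psi> (\<lambda>x. G x + H x) = stieltjes a b \<psi> G + stieltjes a b \<psi> H"
  using integral_add[OF stieltjes_integrand(2)[OF assms(1,2)] stieltjes_integrand(2)[OF assms(1,3)]]
  by (simp add: stieltjes_def algebra_simps)

lemma stieltjes_diff:
  assumes "\<psi> C1_differentiable_on {a..b}" "continuous_on {a..b} G" "continuous_on {a..b} H"
  shows "stieltjes a b \<psi> (\<lambda>x. G x - H x) = stieltjes a b \<psi> G - stieltjes a b \<psi> H"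
  using integral_diff[OF stieltjes_integrand(2)[OF assms(1,2)] stieltjes_integrand(2)[OF assms(1,3)]]
  by (simp add: stieltjes_def algebra_simps)

lemma stieltjes_add_const:
  assumes "\<psi> C1_differentiable_on {a..b}" "continuous_on {a..b} G" "a \<le> b"
  shows "stieltjes a b \<psi> (\<lambda>x. G x + k) = stieltjes a b \<psi> G"
  using stieltjes_add[OF assms(1,2) continuous_on_const] stieltjes_const[OF assms(1,3)] by simp

lemma stieltjes_cmult_left:
  assumes "\<psi> C1_differentiable_on {a..b}"
  shows "stieltjes a b (\<lambda>x. k * \<psi> x) G = k * stieltjes a b \<psi> G"
proof -
  have "stieltjes a b (\<lambda>x. k * \<psi> x) G = k * \<psi> b * G b - k * \<psi> a * G a -
     integral {a..b} (\<lambda>\<theta>. k * vector_derivative \<psi> (at \<theta>) * G \<theta>)"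
    by (rule stieltjes_eq) (intro has_vector_derivative_mult_right C1_D(1)[OF assms])
  also have "(\<lambda>\<theta>. k * vector_derivative \<psi> (at \<theta>) * G \<theta>) = (\<lambda>\<theta>. k * (vector_derivative \<psi> (at \<theta>) * G \<theta>))"
    by (simp add: mult_ac)
  finally show ?thesis by (simp add: stieltjes_def algebra_simps)
qed

text \<open>Outside the interval the two functions may differ, so their two-sided derivatives at the
  endpoints agree only because each equals the derivative within the interval.\<close>

lemma stieltjes_cong:
  assumes ab: "a < b" and \<psi>: "\<psi> C1_differentiable_on {a..b}" and \<phi>: "\<phi> C1_differentiable_on {a..b}"
    and eq: "\<And>x. x \<in> {a..b} \<Longrightarrow> \<psi> x = \<phi> x" and GH: "\<And>x. x \<in> {a..b} \<Longrightarrow> G x = H x"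
  shows "stieltjes a b \<psi> G = stieltjes a b \<phi> H"
proof -
  have "vector_derivative \<psi> (at x) = vector_derivative \<phi> (at x)" if x: "x \<in> {a..b}" for x
  proof (rule vector_derivative_unique_within_closed_interval[OF ab])
    show "(\<psi> has_vector_derivative vector_derivative \<psi> (at x)) (at x within cbox a b)"
      using C1_D(1)[OF \<psi> x] by (rule has_vector_derivative_at_within)
    have "(\<phi> has_vector_derivative vector_derivative \<phi> (at x)) (at x within cbox a b)"
      using C1_D(1)[OF \<phi> x] by (rule has_vector_derivative_at_within)
    then show "(\<psi> has_vector_derivative vector_derivative \<phi> (at x)) (at x within cbox a b)"
      by (rule has_vector_derivative_transform[rotated 2]) (use x eq in auto)
  qed (use x in auto)
  then have "integral {a..b} (\<lambda>\<theta>. vector_derivative \<psi> (at \<theta>) * G \<theta>) =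
      integral {a..b} (\<lambda>\<theta>. vector_derivative \<phi> (at \<theta>) * H \<theta>)"
    by (intro integral_cong) (use GH in auto)
  then show ?thesis using eq[of a] eq[of b] GH[of a] GH[of b] ab by (simp add: stieltjes_def)
qed

text \<open>The rule \<open>\<psi>\<^sub>1 d(\<integral> \<psi>\<^sub>2 dG) = \<psi>\<^sub>1 \<psi>\<^sub>2 dG\<close>.\<close>

lemma stieltjes_density:
  assumes \<psi>1: "\<psi>\<^sub>1 C1_differentiable_on {a..b}" and \<psi>2: "\<psi>\<^sub>2 C1_differentiable_on {a..b}"
    and G: "continuous_on {a..b} G" and ab: "a \<le> b"
    and H: "\<And>x. x \<in> {a..b} \<Longrightarrow> H x = stieltjes a x \<psi>\<^sub>2 G + k"
  shows "stieltjes a b \<psi>\<^sub>1 H = stieltjes a b (\<lambda>x. \<psi>\<^sub>1 x * \<psi>\<^sub>2 x) G"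
proof -
  define d1 where "d1 = (\<lambda>x. vector_derivative \<psi>\<^sub>1 (at x))"
  define d2 where "d2 = (\<lambda>x. vector_derivative \<psi>\<^sub>2 (at x))"
  define I where "I = (\<lambda>x. integral {a..x} (\<lambda>\<theta>. d2 \<theta> * G \<theta>))"
  \<comment> \<open>Collects the constants, so that H = \<psi>2 G - (I + m) with I the indefinite
    integral of \<psi>2' G. The claim is then one integration by parts of \<psi>1 (I + m).\<close>
  define m where "m = \<psi>\<^sub>2 a * G a - k"
  note c = C1_D(2)[OF \<psi>1, folded d1_def] C1_D(2)[OF \<psi>2, folded d2_def] C1_D(3)[OF \<psi>1] C1_D(3)[OF \<psi>2]
  have c2: "continuous_on {a..b} (\<lambda>\<theta>. d2 \<theta> * G \<theta>)" by (intro continuous_on_mult c G)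
  have I': "(I has_vector_derivative d2 x * G x) (at x within {a..b})" if "x \<in> {a..b}" for x
    unfolding I_def by (rule integral_has_vector_derivative[OF c2 that])
  have cI: "continuous_on {a..b} I" by (rule continuous_on_vector_derivative[OF I'])
  have Heq: "H x = \<psi>\<^sub>2 x * G x - (I x + m)" if "x \<in> {a..b}" for x
    using H[OF that] by (simp add: stieltjes_def I_def d2_def m_def)
  have i1: "(\<lambda>x. d1 x * (I x + m)) integrable_on {a..b}" "(\<lambda>x. \<psi>\<^sub>1 x * (d2 x * G x)) integrable_on {a..b}"
    "(\<lambda>x. d1 x * (\<psi>\<^sub>2 x * G x)) integrable_on {a..b}"
    by (rule integrable_continuous_real, intro continuous_on_mult continuous_on_add continuous_on_const c cI G)+
  have "((\<lambda>x. \<psi>\<^sub>1 x * (d2 x * G x) + d1 x * (I x + m)) has_integral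
      (\<psi>\<^sub>1 b * (I b + m) - \<psi>\<^sub>1 a * (I a + m))) {a..b}"
  proof (rule fundamental_theorem_of_calculus[OF ab])
    fix x assume x: "x \<in> {a..b}"
    have "((\<lambda>x. I x + m) has_vector_derivative d2 x * G x + 0) (at x within {a..b})"
      by (rule has_vector_derivative_add[OF I'[OF x] has_vector_derivative_const])
    moreover have "(\<psi>\<^sub>1 has_vector_derivative d1 x) (at x within {a..b})"
      unfolding d1_def using C1_D(1)[OF \<psi>1 x] by (rule has_vector_derivative_at_within)
    ultimately show "((\<lambda>x. \<psi>\<^sub>1 x * (I x + m)) has_vector_derivative
       \<psi>\<^sub>1 x * (d2 x * G x) + d1 x * (I x + m)) (at x within {a..b})"
      using has_vector_derivative_mult by fastforce
  qed
  then have parts: "integral {a..b} (\<lambda>x. \<psi>\<^sub>1 x * (d2 x * G x)) + integral {a..b} (\<lambda>x. d1 x * (I x + m)) =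
     \<psi>\<^sub>1 b * (I b + m) - \<psi>\<^sub>1 a * (I a + m)"
    using integral_add[OF i1(2,1)] by (simp add: integral_unique)
  have "integral {a..b} (\<lambda>x. d1 x * H x) = integral {a..b} (\<lambda>x. d1 x * (\<psi>\<^sub>2 x * G x) - d1 x * (I x + m))"
    by (rule integral_cong) (simp add: Heq algebra_simps)
  also have "\<dots> = integral {a..b} (\<lambda>x. d1 x * (\<psi>\<^sub>2 x * G x)) - integral {a..b} (\<lambda>x. d1 x * (I x + m))"
    by (rule integral_diff[OF i1(3,1)])
  finally have e1: "integral {a..b} (\<lambda>x. d1 x * H x) =
     integral {a..b} (\<lambda>x. d1 x * (\<psi>\<^sub>2 x * G x)) - integral {a..b} (\<lambda>x. d1 x * (I x + m))" .
  have "stieltjes a b (\<lambda>x. \<psi>\<^sub>1 x * \<psi>\<^sub>2 x) G = \<psi>\<^sub>1 b * \<psi>\<^sub>2 b * G b - \<psi>\<^sub>1 a * \<psi>\<^sub>2 a * G a -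
     integral {a..b} (\<lambda>x. (\<psi>\<^sub>1 x * d2 x + d1 x * \<psi>\<^sub>2 x) * G x)"
    unfolding d1_def d2_def
    by (rule stieltjes_eq) (intro has_vector_derivative_mult C1_D(1)[OF \<psi>1] C1_D(1)[OF \<psi>2])
  also have "integral {a..b} (\<lambda>x. (\<psi>\<^sub>1 x * d2 x + d1 x * \<psi>\<^sub>2 x) * G x) =
     integral {a..b} (\<lambda>x. \<psi>\<^sub>1 x * (d2 x * G x) + d1 x * (\<psi>\<^sub>2 x * G x))"
    by (simp add: distrib_right mult.assoc)
  also have "\<dots> = integral {a..b} (\<lambda>x. \<psi>\<^sub>1 x * (d2 x * G x)) + integral {a..b} (\<lambda>x. d1 x * (\<psi>\<^sub>2 x * G x))"
    by (rule integral_add[OF i1(2,3)])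
  finally have e2: "stieltjes a b (\<lambda>x. \<psi>\<^sub>1 x * \<psi>\<^sub>2 x) G = \<psi>\<^sub>1 b * \<psi>\<^sub>2 b * G b - \<psi>\<^sub>1 a * \<psi>\<^sub>2 a * G a -
     (integral {a..b} (\<lambda>x. \<psi>\<^sub>1 x * (d2 x * G x)) + integral {a..b} (\<lambda>x. d1 x * (\<psi>\<^sub>2 x * G x)))" .
  have "stieltjes a b \<psi>\<^sub>1 H = \<psi>\<^sub>1 b * H b - \<psi>\<^sub>1 a * H a - integral {a..b} (\<lambda>x. d1 x * H x)"
    by (simp add: stieltjes_def d1_def)
  also have "\<dots> = \<psi>\<^sub>1 b * (\<psi>\<^sub>2 b * G b - (I b + m)) - \<psi>\<^sub>1 a * (\<psi>\<^sub>2 a * G a - (I a + m))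
     - (integral {a..b} (\<lambda>x. d1 x * (\<psi>\<^sub>2 x * G x)) - integral {a..b} (\<lambda>x. d1 x * (I x + m)))"
    using Heq[of a] Heq[of b] ab by (simp add: e1)
  also have "\<dots> = stieltjes a b (\<lambda>x. \<psi>\<^sub>1 x * \<psi>\<^sub>2 x) G"
    unfolding e2 using parts by (simp add: algebra_simps)
  finally show ?thesis .
qed

lemma continuous_on_stieltjes:
  assumes \<psi>: "\<psi> C1_differentiable_on {a..b}" and G: "continuous_on {a..b} G"
  shows "continuous_on {a..b} (\<lambda>x. stieltjes a x \<psi> G)"
proof -
  have "continuous_on {a..b} (\<lambda>x. integral {a..x} (\<lambda>\<theta>. vector_derivative \<psi> (at \<theta>) * G \<theta>))"
    by (rule continuous_on_vector_derivative, rule integral_has_vector_derivative[OF stieltjes_integrand(1)[OF assms]])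
  then show ?thesis unfolding stieltjes_def
    by (intro continuous_on_diff continuous_on_mult continuous_on_const C1_D(3)[OF \<psi>] G)
qed

lemma stieltjes_substitution:
  assumes ab: "a \<le> b" and g: "\<And>x. x \<in> {a..b} \<Longrightarrow> (g has_real_derivative g' x) (at x)"
    and g'c: "continuous_on {a..b} g'" and g': "\<And>x. x \<in> {a..b} \<Longrightarrow> 0 \<le> g' x"
    and \<psi>: "\<psi> C1_differentiable_on {g a..g b}" and G: "continuous_on {g a..g b} G"
  shows "stieltjes (g a) (g b) \<psi> G = stieltjes a b (\<lambda>x. \<psi> (g x)) (\<lambda>x. G (g x))"
    and "(\<lambda>x. \<psi> (g x)) C1_differentiable_on {a..b}"
    and "continuous_on {a..b} (\<lambda>x. G (g x))"
proof -
  have mono: "g x \<le> g y" if "a \<le> x" "x \<le> y" "y \<le> b" for x y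
  proof (rule DERIV_nonneg_imp_nondecreasing[OF that(2)])
    fix u assume "x \<le> u" "u \<le> y"
    then show "\<exists>y. (g has_real_derivative y) (at u) \<and> 0 \<le> y"
      using g[of u] g'[of u] that by (intro exI[of _ "g' u"]) simp
  qed
  have im: "g ` {a..b} \<subseteq> {g a..g b}" using mono by auto
  have gc: "continuous_on {a..b} g"
    by (rule DERIV_continuous_on) (use g in \<open>auto intro: has_field_derivative_at_within\<close>)
  have d: "((\<lambda>x. \<psi> (g x)) has_vector_derivative g' x *\<^sub>R vector_derivative \<psi> (at (g x))) (at x)"
    if x: "x \<in> {a..b}" for x
  proof -
    have "g x \<in> {g a..g b}" using im x by blast
    then show ?thesis
      using vector_diff_chain_at[OF g[OF x, unfolded has_real_derivative_iff_has_vector_derivative]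
          C1_D(1)[OF \<psi>]] by (simp add: o_def)
  qed
  show "(\<lambda>x. \<psi> (g x)) C1_differentiable_on {a..b}"
    by (rule C1_I[OF d]) (auto intro!: continuous_on_scaleR g'c
        continuous_on_compose2[OF C1_D(2)[OF \<psi>] gc im])
  show "continuous_on {a..b} (\<lambda>x. G (g x))"
    by (rule continuous_on_compose2[OF G gc im])
  have "((\<lambda>x. g' x *\<^sub>R (vector_derivative \<psi> (at (g x)) * G (g x))) has_integral
     integral {g a..g b} (\<lambda>\<theta>. vector_derivative \<psi> (at \<theta>) * G \<theta>)) {a..b}"
    by (rule has_integral_substitution[OF ab _ im stieltjes_integrand(1)[OF \<psi> G]])
      (use mono ab g in \<open>auto intro: has_field_derivative_at_within\<close>)
  then have "integral {a..b} (\<lambda>x. (g' x *\<^sub>R vector_derivative \<psi> (at (g x))) * G (g x)) =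
     integral {g a..g b} (\<lambda>\<theta>. vector_derivative \<psi> (at \<theta>) * G \<theta>)"
    by (simp add: integral_unique)
  then show "stieltjes (g a) (g b) \<psi> G = stieltjes a b (\<lambda>x. \<psi> (g x)) (\<lambda>x. G (g x))"
    by (subst stieltjes_eq[OF d]) (simp_all add: stieltjes_def)
qed

lemma stieltjes_of_primitive:
  assumes \<psi>: "\<psi> C1_differentiable_on {a..b}" and ab: "a \<le> b"
    and W: "\<And>x. x \<in> {a..b} \<Longrightarrow> (W has_vector_derivative w x) (at x within {a..b})"
    and w: "continuous_on {a..b} w"
  shows "stieltjes a b \<psi> W = integral {a..b} (\<lambda>\<theta>. \<psi> \<theta> * w \<theta>)"
proof -
  have Wc: "continuous_on {a..b} W" by (rule continuous_on_vector_derivative[OF W])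
  have i: "(\<lambda>\<theta>. \<psi> \<theta> * w \<theta>) integrable_on {a..b}"
    by (intro integrable_continuous_real continuous_on_mult C1_D(3)[OF \<psi>] w)
  have "((\<lambda>\<theta>. \<psi> \<theta> * w \<theta> + vector_derivative \<psi> (at \<theta>) * W \<theta>) has_integral \<psi> b * W b - \<psi> a * W a) {a..b}"
    by (rule fundamental_theorem_of_calculus[OF ab], rule has_vector_derivative_mult,
        rule has_vector_derivative_at_within[OF C1_D(1)[OF \<psi>]], assumption, erule W)
  then show ?thesis
    using integral_add[OF i stieltjes_integrand(2)[OF \<psi> Wc]] by (simp add: stieltjes_def integral_unique algebra_simps)
qed

text \<open>Only \<psi> is differentiated, so uniform convergence of the primitives is enough, with
  the constant |\<psi>(b)| + |\<psi>(a)| + (b - a) sup |\<psi>'|.\<close>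

lemma stieltjes_tendsto:
  assumes \<psi>: "\<psi> C1_differentiable_on {a..b}" and ab: "a \<le> b"
    and W: "\<And>r. continuous_on {a..b} (W r)" and G: "continuous_on {a..b} G"
    and bound: "\<forall>\<^sub>F r in F. \<forall>\<theta>\<in>{a..b}. norm (W r \<theta> - G \<theta>) \<le> \<epsilon> r" and \<epsilon>: "(\<epsilon> \<longlongrightarrow> 0) F"
  shows "((\<lambda>r. stieltjes a b \<psi> (W r)) \<longlongrightarrow> stieltjes a b \<psi> G) F"
proof -
  obtain B where B: "\<And>\<theta>. \<theta> \<in> {a..b} \<Longrightarrow> norm (vector_derivative \<psi> (at \<theta>)) \<le> B"
    using compact_imp_bounded[OF compact_continuous_image[OF C1_D(2)[OF \<psi>] compact_Icc]]
    unfolding bounded_iff by blast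
  define C where "C = norm (\<psi> b) + norm (\<psi> a) + B * (b - a)"
  have "((\<lambda>r. stieltjes a b \<psi> (W r) - stieltjes a b \<psi> G) \<longlongrightarrow> 0) F"
  proof (rule Lim_null_comparison)
    show "((\<lambda>r. C * \<epsilon> r) \<longlongrightarrow> 0) F" using tendsto_mult_right_zero[OF \<epsilon>] by simp
    show "\<forall>\<^sub>F r in F. norm (stieltjes a b \<psi> (W r) - stieltjes a b \<psi> G) \<le> C * \<epsilon> r"
      using bound
    proof eventually_elim
      case (elim r)
      define D where "D = (\<lambda>\<theta>. W r \<theta> - G \<theta>)"
      have D: "norm (D \<theta>) \<le> \<epsilon> r" if "\<theta> \<in> {a..b}" for \<theta> using elim that by (simp add: D_def)
      have Dc: "continuous_on {a..b} D" unfolding D_def by (intro continuous_on_diff W G)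
      have B0: "0 \<le> B" using B[of a] ab norm_ge_zero by (meson atLeastAtMost_iff order_refl order_trans)
      have e0: "0 \<le> \<epsilon> r" using D[of a] ab norm_ge_zero by (meson atLeastAtMost_iff order_refl order_trans)
      have "norm (integral {a..b} (\<lambda>\<theta>. vector_derivative \<psi> (at \<theta>) * D \<theta>)) \<le> (B * \<epsilon> r) * (b - a)"
      proof (rule integral_bound[OF ab stieltjes_integrand(1)[OF \<psi> Dc]])
        fix \<theta> assume "\<theta> \<in> {a..b}"
        then show "norm (vector_derivative \<psi> (at \<theta>) * D \<theta>) \<le> B * \<epsilon> r"
          unfolding norm_mult using B D B0 e0 by (intro mult_mono) auto
      qed
      moreover have "norm (\<psi> b * D b) \<le> norm (\<psi> b) * \<epsilon> r" "norm (\<psi> a * D a) \<le> norm (\<psi> a) * \<epsilon> r"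
        unfolding norm_mult using D ab by (auto intro!: mult_left_mono)
      moreover have "norm (stieltjes a b \<psi> D) \<le> norm (\<psi> b * D b) + norm (\<psi> a * D a) +
          norm (integral {a..b} (\<lambda>\<theta>. vector_derivative \<psi> (at \<theta>) * D \<theta>))"
        unfolding stieltjes_def by (meson add_mono norm_triangle_ineq4 order_refl order_trans)
      ultimately have "norm (stieltjes a b \<psi> D) \<le> norm (\<psi> b) * \<epsilon> r + norm (\<psi> a) * \<epsilon> r + (B * \<epsilon> r) * (b - a)"
        by linarith
      also have "\<dots> = C * \<epsilon> r" by (simp add: C_def algebra_simps)
      finally show ?case unfolding D_def stieltjes_diff[OF \<psi> W G] .
    qed
  qed
  then show ?thesis by (simp add: LIM_zero_iff)
qed

lemma helgason_integral_stieltjes: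
  assumes "a < b" and \<psi>: "(\<lambda>u. \<Psi> (cis u)) C1_differentiable_on {a..b}"
  shows "helgason_integral f s a b \<Psi> = stieltjes a b (\<lambda>u. \<Psi> (cis u)) (helgason_primitive f s)"
proof -
  have "integral {a..b} (\<lambda>\<theta>. vector_derivative (\<lambda>u. \<Psi> (cis u)) (at \<theta> within {a..b}) * helgason_primitive f s \<theta>) =
    integral {a..b} (\<lambda>\<theta>. vector_derivative (\<lambda>u. \<Psi> (cis u)) (at \<theta>) * helgason_primitive f s \<theta>)"
  proof (rule integral_cong)
    fix \<theta> assume \<theta>: "\<theta> \<in> {a..b}"
    show "vector_derivative (\<lambda>u. \<Psi> (cis u)) (at \<theta> within {a..b}) * helgason_primitive f s \<theta> =
      vector_derivative (\<lambda>u. \<Psi> (cis u)) (at \<theta>) * helgason_primitive f s \<theta>"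
      using vector_derivative_within_cbox[OF \<open>a < b\<close> _
          has_vector_derivative_at_within[OF C1_D(1)[OF \<psi> \<theta>]]] \<theta> by simp
  qed
  then show ?thesis by (simp add: helgason_integral_def stieltjes_def)
qed

section \<open>Fourier uniqueness for continuous periodic functions\<close>

lemma periodic_of_int:
  fixes h :: "real \<Rightarrow> complex"
  assumes "\<And>\<theta>. h (\<theta> + 2 * pi) = h \<theta> + k"
  shows "h (\<theta> + 2 * pi * of_int m) = h \<theta> + of_int m * k"
proof (induction m)
  case (nonneg n)
  then show ?case
  proof (induction n)
    case (Suc n)
    then show ?case using assms[of "\<theta> + 2 * pi * of_int (int n)"] by (simp add: algebra_simps)
  qed simp
next
  case (neg n)
  then show ?case
  proof (induction n)
    case 0
    have "h \<theta> = h (\<theta> - 2 * pi) + k" using assms[of "\<theta> - 2 * pi"] by simp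
    then show ?case by simp
  next
    case (Suc n)
    have "h (\<theta> + 2 * pi * of_int (- int (Suc n))) = h (\<theta> + 2 * pi * of_int (- int (Suc (Suc n)))) + k"
      using assms[of "\<theta> + 2 * pi * of_int (- int (Suc (Suc n)))"] by (simp add: algebra_simps)
    then show ?case using Suc by (simp add: algebra_simps)
  qed
qed

lemma cis_eq_iff: "cis a = cis b \<longleftrightarrow> (\<exists>m::int. a = b + 2 * pi * of_int m)"
  using sin_cos_eq_iff[of a b] by (auto simp: complex_eq_iff mult_ac)

text \<open>\<open>Arg\<close> jumps across the negative real axis. There
  \<open>Arg (- w) + pi\<close> is a continuous argument of w, and a function of period 2 pi does
  not see the difference.\<close>

lemma continuous_on_circle_lift:
  fixes h :: "real \<Rightarrow> complex"
  assumes c: "continuous_on UNIV h" and p: "\<And>\<theta>. h (\<theta> + 2 * pi) = h \<theta>"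
  shows "continuous_on (sphere 0 1) (\<lambda>z. h (Arg z))" "h (Arg (cis \<theta>)) = h \<theta>"
proof -
  have eq: "h a = h b" if "cis a = cis b" for a b
    using that periodic_of_int[of h 0] p by (auto simp: cis_eq_iff)
  have cA: "cis (Arg z) = z" if "z \<in> sphere 0 1" for z
  proof -
    have "z \<noteq> 0" using that by auto
    then show ?thesis using cis_Arg[of z] that by (simp add: sgn_div_norm)
  qed
  show "h (Arg (cis \<theta>)) = h \<theta>" by (rule eq) (rule cA, simp)
  have hc: "isCont h x" for x using c by (simp add: continuous_on_eq_continuous_at)
  show "continuous_on (sphere 0 1) (\<lambda>z. h (Arg z))"
  proof (rule continuous_on_eq_continuous_within[THEN iffD2], rule ballI)
    fix z :: complex assume z: "z \<in> sphere 0 1"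
    show "continuous (at z within sphere 0 1) (\<lambda>z. h (Arg z))"
    proof (cases "z \<in> \<real>\<^sub>\<le>\<^sub>0")
      case False
      have "isCont (\<lambda>z. h (Arg z)) z"
        by (rule isCont_o2[OF continuous_at_Arg[OF False] hc])
      then show ?thesis by (rule continuous_at_imp_continuous_at_within)
    next
      case True
      then have m: "- z \<notin> \<real>\<^sub>\<le>\<^sub>0" using z by (auto simp: complex_nonpos_Reals_iff cmod_def)
      have "isCont (\<lambda>w. - w) z" by (intro continuous_intros)
      then have "isCont (\<lambda>w. Arg (- w)) z" by (rule isCont_o2) (rule continuous_at_Arg[OF m])
      then have "isCont (\<lambda>w. Arg (- w) + pi) z" by (intro continuous_intros)
      then have "isCont (\<lambda>w. h (Arg (- w) + pi)) z" by (rule isCont_o2) (rule hc)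
      then have "continuous (at z within sphere 0 1) (\<lambda>w. h (Arg (- w) + pi))"
        by (rule continuous_at_imp_continuous_at_within)
      moreover have "h (Arg (- w) + pi) = h (Arg w)" if "w \<in> sphere 0 1" for w
        by (rule eq) (use cA[of w] cA[of "-w"] that in \<open>simp add: cis_mult[symmetric]\<close>)
      ultimately show ?thesis
        using z continuous_transform_within[of z "sphere 0 1" "\<lambda>w. h (Arg (- w) + pi)" 1 "\<lambda>w. h (Arg w)"]
        by auto
    qed
  qed
qed

text \<open>Real polynomials in cis \<theta> are trigonometric polynomials, hence orthogonal to h.
  Approximating u = Re h by them makes the integral of u^2 at most e times that of |u|.
  Stone-Weierstrass is applied to a real function, which is why the real part is treated
  alone.\<close>

lemma trig_moments_zero:
  fixes h :: "real \<Rightarrow> complex"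
  assumes c: "continuous_on UNIV h" and p: "\<And>\<theta>. h (\<theta> + 2 * pi) = h \<theta>"
    and m: "\<And>n::int. integral {0..2 * pi} (\<lambda>\<theta>. cis (of_int n * \<theta>) * h \<theta>) = 0"
  shows "Re (h x) = 0"
proof -
  \<comment> \<open>Functions with vanishing moments form a module over trigonometric polynomials;
    the induction over polynomial functions runs inside this set.\<close>
  define N where "N = {g::real \<Rightarrow> complex. continuous_on UNIV g \<and>
    (\<forall>n::int. integral {0..2 * pi} (\<lambda>\<theta>. cis (of_int n * \<theta>) * g \<theta>) = 0)}"
  have ci: "(\<lambda>\<theta>. cis (of_int n * \<theta>) * g \<theta>) integrable_on {0..2 * pi}" if "continuous_on UNIV g" for n :: int and g
    by (intro integrable_continuous_real continuous_intros continuous_on_subset[OF that]) auto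
  have Nadd: "(\<lambda>\<theta>. g \<theta> + k \<theta>) \<in> N" if "g \<in> N" "k \<in> N" for g k
    using that integral_add[OF ci ci] by (auto simp: N_def distrib_left intro!: continuous_on_add)
  have Nmul: "(\<lambda>\<theta>. a * g \<theta>) \<in> N" if "g \<in> N" for g a
  proof -
    have "(\<lambda>\<theta>. cis (of_int n * \<theta>) * (a * g \<theta>)) = (\<lambda>\<theta>. a * (cis (of_int n * \<theta>) * g \<theta>))" for n :: int
      by (simp add: mult_ac)
    then show ?thesis using that by (auto simp: N_def intro!: continuous_on_mult)
  qed
  have Ncis: "(\<lambda>\<theta>. cis (of_int k * \<theta>) * g \<theta>) \<in> N" if "g \<in> N" for g and k :: int
  proof -
    have "(\<lambda>\<theta>. cis (of_int n * \<theta>) * (cis (of_int k * \<theta>) * g \<theta>)) = (\<lambda>\<theta>. cis (of_int (n + k) * \<theta>) * g \<theta>)" for n :: int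
      by (simp add: cis_mult distrib_right flip: mult.assoc)
    moreover have "continuous_on UNIV (\<lambda>\<theta>. cis (of_int k * \<theta>) * g \<theta>)"
      using that by (auto simp: N_def intro!: continuous_intros)
    ultimately show ?thesis using that by (simp add: N_def del: of_int_add)
  qed
  have poly: "\<forall>g\<in>N. (\<lambda>\<theta>. of_real (q (cis \<theta>)) * g \<theta>) \<in> N" if "real_polynomial_function q" for q
    using that
  proof induction
    case (linear q)
    \<comment> \<open>A real linear q takes the value q(1) cos \<theta> + q(i) sin \<theta> on the
      circle, a combination of cis \<theta> and cis(-\<theta>).\<close>
    have "of_real (q (cis \<theta>)) * g \<theta> = (of_real (q 1) / 2 + of_real (q \<i>) / (2 * \<i>)) * (cis (of_int 1 * \<theta>) * g \<theta>) +
        (of_real (q 1) / 2 - of_real (q \<i>) / (2 * \<i>)) * (cis (of_int (-1) * \<theta>) * g \<theta>)" for g \<theta>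
    proof -
      interpret q: bounded_linear q by fact
      have "cis \<theta> = cos \<theta> *\<^sub>R 1 + sin \<theta> *\<^sub>R \<i>" by (simp add: complex_eq_iff)
      then have "q (cis \<theta>) = cos \<theta> * q 1 + sin \<theta> * q \<i>" by (simp add: q.add q.scaleR)
      then show ?thesis by (simp add: complex_eq_iff field_simps)
    qed
    then show ?case using Nadd Nmul Ncis by presburger
  next
    case (const c) then show ?case using Nmul by blast
  next
    case (add f g)
    then show ?case using Nadd by (simp add: distrib_right)
  next
    case (mult f g)
    then show ?case by (simp add: mult.assoc)
  qed
  have hN: "h \<in> N" using c m by (simp add: N_def)
  define u where "u = (\<lambda>\<theta>. Re (h \<theta>))"
  have uc: "continuous_on S u" for S unfolding u_def
    by (intro continuous_on_Re continuous_on_subset[OF c subset_UNIV])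
  have q0: "integral {0..2 * pi} (\<lambda>\<theta>. q (cis \<theta>) * u \<theta>) = 0"
    and qi: "(\<lambda>\<theta>. q (cis \<theta>) * u \<theta>) integrable_on {0..2 * pi}"
    if "real_polynomial_function q" for q
  proof -
    have "(\<lambda>\<theta>. of_real (q (cis \<theta>)) * h \<theta>) \<in> N" using poly[OF that] hN by blast
    then have "continuous_on UNIV (\<lambda>\<theta>. of_real (q (cis \<theta>)) * h \<theta>)"
      and z: "integral {0..2 * pi} (\<lambda>\<theta>. cis (of_int 0 * \<theta>) * (of_real (q (cis \<theta>)) * h \<theta>)) = 0"
      unfolding N_def by blast+
    then have "((\<lambda>\<theta>. of_real (q (cis \<theta>)) * h \<theta>) has_integral 0) {0..2 * pi}"
      using integrable_integral[OF integrable_continuous_real[OF continuous_on_subset[OF _ subset_UNIV]],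
          of "\<lambda>\<theta>. of_real (q (cis \<theta>)) * h \<theta>" 0 "2 * pi"] by simp
    from has_integral_linear[OF this bounded_linear_Re]
    have "((\<lambda>\<theta>. q (cis \<theta>) * u \<theta>) has_integral 0) {0..2 * pi}" by (simp add: o_def u_def)
    then show "integral {0..2 * pi} (\<lambda>\<theta>. q (cis \<theta>) * u \<theta>) = 0"
      "(\<lambda>\<theta>. q (cis \<theta>) * u \<theta>) integrable_on {0..2 * pi}" by (auto simp: has_integral_iff)
  qed
  define A where "A = integral {0..2 * pi} (\<lambda>\<theta>. \<bar>u \<theta>\<bar>)"
  have A: "(\<lambda>\<theta>. \<bar>u \<theta>\<bar>) integrable_on {0..2 * pi}" by (intro integrable_continuous_real continuous_intros uc)
  have u2: "(\<lambda>\<theta>. u \<theta> * u \<theta>) integrable_on {0..2 * pi}" by (intro integrable_continuous_real continuous_intros uc)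
  have le: "integral {0..2 * pi} (\<lambda>\<theta>. u \<theta> * u \<theta>) \<le> e * A" if e: "0 < e" for e
  proof -
    have cu: "continuous_on (sphere 0 1) (\<lambda>z. u (Arg z))"
      unfolding u_def by (intro continuous_on_Re continuous_on_circle_lift(1)[OF c p])
    obtain q where q: "real_polynomial_function q" "\<And>z. z \<in> sphere 0 1 \<Longrightarrow> \<bar>u (Arg z) - q z\<bar> < e"
      using Stone_Weierstrass_real_polynomial_function[OF compact_sphere cu e] by blast
    have q': "\<bar>u \<theta> - q (cis \<theta>)\<bar> \<le> e" for \<theta>
      using q(2)[of "cis \<theta>"] continuous_on_circle_lift(2)[OF c p, of \<theta>] by (simp add: u_def)
    have "integral {0..2 * pi} (\<lambda>\<theta>. u \<theta> * u \<theta>) = integral {0..2 * pi} (\<lambda>\<theta>. u \<theta> * u \<theta> - q (cis \<theta>) * u \<theta>)"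
      using integral_diff[OF u2 qi[OF q(1)]] q0[OF q(1)] by simp
    also have "\<dots> \<le> integral {0..2 * pi} (\<lambda>\<theta>. e * \<bar>u \<theta>\<bar>)"
    proof (rule integral_le)
      show "(\<lambda>\<theta>. u \<theta> * u \<theta> - q (cis \<theta>) * u \<theta>) integrable_on {0..2 * pi}"
        by (rule integrable_diff[OF u2 qi[OF q(1)]])
      show "(\<lambda>\<theta>. e * \<bar>u \<theta>\<bar>) integrable_on {0..2 * pi}" by (intro integrable_continuous_real continuous_intros uc)
      show "u \<theta> * u \<theta> - q (cis \<theta>) * u \<theta> \<le> e * \<bar>u \<theta>\<bar>" for \<theta>
      proof -
        have "u \<theta> * u \<theta> - q (cis \<theta>) * u \<theta> \<le> \<bar>u \<theta> - q (cis \<theta>)\<bar> * \<bar>u \<theta>\<bar>"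
          by (metis abs_ge_self abs_mult left_diff_distrib)
        also have "\<dots> \<le> e * \<bar>u \<theta>\<bar>" using q' by (intro mult_right_mono) auto
        finally show ?thesis .
      qed
    qed
    finally show ?thesis by (simp add: A_def)
  qed
  have "integral {0..2 * pi} (\<lambda>\<theta>. u \<theta> * u \<theta>) \<le> 0"
  proof (rule ccontr)
    assume *: "\<not> ?thesis"
    have "0 \<le> A" unfolding A_def by (rule integral_nonneg[OF A]) simp
    define I where "I = integral {0..2 * pi} (\<lambda>\<theta>. u \<theta> * u \<theta>)"
    have I0: "0 < I" using * by (simp add: I_def)
    \<comment> \<open>The error is chosen so that e A < I; A + 1 keeps the denominator positive when
      A = 0.\<close>
    have "I \<le> (I / (2 * (A + 1))) * A"
      using le[of "I / (2 * (A + 1))"] * \<open>0 \<le> A\<close> by (simp add: I_def)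
    also have "\<dots> < I" using I0 \<open>0 \<le> A\<close> by (simp add: I_def[symmetric] field_simps add_nonneg_pos)
    finally show False by simp
  qed
  moreover have "0 \<le> integral {0..2 * pi} (\<lambda>\<theta>. u \<theta> * u \<theta>)" by (rule integral_nonneg[OF u2]) simp
  ultimately have z: "((\<lambda>\<theta>. u \<theta> * u \<theta>) has_integral 0) (cbox 0 (2 * pi))"
    using u2 by (simp add: has_integral_iff)
  have u0: "u \<theta> = 0" if "\<theta> \<in> {0..2 * pi}" for \<theta>
  proof -
    have "continuous_on (cbox 0 (2 * pi)) (\<lambda>\<theta>. u \<theta> * u \<theta>)" by (intro continuous_on_mult uc)
    from has_integral_0_cbox_imp_0[OF this _ z, of \<theta>] that pi_gt_zero show ?thesis
      by (simp add: not_le)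
  qed
  have "h x = h (Arg (cis x))" using continuous_on_circle_lift(2)[OF c p] by simp
  also have "\<dots> = h (Arg2pi (cis x))"
  proof -
    have "cis (Arg2pi (cis x)) = cis x"
      using Arg2pi_eq[of "cis x"] by (simp add: cis_conv_exp)
    then show ?thesis
      using continuous_on_circle_lift(2)[OF c p, of "Arg2pi (cis x)"] continuous_on_circle_lift(2)[OF c p, of x]
      by simp
  qed
  finally have "Re (h x) = u (Arg2pi (cis x))" by (simp add: u_def)
  also have "\<dots> = 0" by (rule u0) (use Arg2pi_ge_0[of "cis x"] Arg2pi_lt_2pi[of "cis x"] in simp)
  finally show ?thesis .
qed

lemma fourier_coefficients_zero:
  fixes h :: "real \<Rightarrow> complex"
  assumes c: "continuous_on UNIV h" and p: "\<And>\<theta>. h (\<theta> + 2 * pi) = h \<theta>"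
    and m: "\<And>n::int. integral {0..2 * pi} (\<lambda>\<theta>. cis (of_int n * \<theta>) * h \<theta>) = 0"
  shows "h x = 0"
proof -
  have "Re (- \<i> * h x) = 0"
  proof (rule trig_moments_zero)
    have "(\<lambda>\<theta>. cis (of_int n * \<theta>) * (- \<i> * h \<theta>)) = (\<lambda>\<theta>. (- \<i>) * (cis (of_int n * \<theta>) * h \<theta>))" for n :: int
      by (simp add: mult_ac)
    then show "integral {0..2 * pi} (\<lambda>\<theta>. cis (of_int n * \<theta>) * (- \<i> * h \<theta>)) = 0" for n :: int
      by (simp only: integral_mult_right m mult_zero_right)
  qed (use c p in \<open>auto intro!: continuous_on_minus continuous_on_mult continuous_on_const\<close>)
  moreover have "Re (h x) = 0" by (rule trig_moments_zero[OF c p m])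
  ultimately show ?thesis by (simp add: complex_eq_iff)
qed

lemma integral_cis:
  fixes n :: int
  shows "integral {0..2 * pi} (\<lambda>\<theta>. cis (of_int n * \<theta>)) = (if n = 0 then of_real (2 * pi) else 0)"
proof (cases "n = 0")
  case False
  define c where "c = 1 / (\<i> * of_int n)"
  have "((\<lambda>\<theta>. cis (of_int n * \<theta>)) has_integral cis (of_int n * (2 * pi)) * c - cis (of_int n * 0) * c) {0..2 * pi}"
  proof (rule fundamental_theorem_of_calculus)
    fix x :: real
    have "((\<lambda>x. cis (of_int n * x) * c) has_vector_derivative
       (\<i> * of_real (of_int n) * cis (of_int n * x)) * c) (at x within {0..2 * pi})"
      by (rule has_vector_derivative_mult_left[OF has_vector_derivative_cis])
    then show "((\<lambda>x. cis (of_int n * x) * c) has_vector_derivative cis (of_int n * x)) (at x within {0..2 * pi})"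
      using False by (simp add: c_def)
  qed simp
  moreover have "cis (of_int n * (2 * pi)) = 1"
    using cis_multiple_2pi[of "of_int n"] by (simp add: mult_ac)
  ultimately show ?thesis using False by (simp add: integral_unique)
qed (simp add: scaleR_conv_of_real)

lemma nonconstant_fourier_coefficient:
  fixes h :: "real \<Rightarrow> complex"
  assumes c: "continuous_on UNIV h" and p: "\<And>\<theta>. h (\<theta> + 2 * pi) = h \<theta>"
    and m: "\<And>n::int. n \<noteq> 0 \<Longrightarrow> integral {0..2 * pi} (\<lambda>\<theta>. cis (of_int n * \<theta>) * h \<theta>) = 0"
  shows "h x = h y"
proof -
  define k where "k = integral {0..2 * pi} h / of_real (2 * pi)"
  have "h x - k = 0" for x
  proof (rule fourier_coefficients_zero[of "\<lambda>x. h x - k"])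
    show "integral {0..2 * pi} (\<lambda>\<theta>. cis (of_int n * \<theta>) * (h \<theta> - k)) = 0" for n :: int
    proof -
      have "integral {0..2 * pi} (\<lambda>\<theta>. cis (of_int n * \<theta>) * (h \<theta> - k)) =
        integral {0..2 * pi} (\<lambda>\<theta>. cis (of_int n * \<theta>) * h \<theta> - cis (of_int n * \<theta>) * k)"
        by (simp add: right_diff_distrib)
      also have "\<dots> = integral {0..2 * pi} (\<lambda>\<theta>. cis (of_int n * \<theta>) * h \<theta>) -
          integral {0..2 * pi} (\<lambda>\<theta>. cis (of_int n * \<theta>) * k)"
        by (intro integral_diff integrable_continuous_real continuous_intros continuous_on_subset[OF c]) auto
      also have "integral {0..2 * pi} (\<lambda>\<theta>. cis (of_int n * \<theta>) * k) = (if n = 0 then of_real (2 * pi) else 0) * k"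
        unfolding integral_mult_left integral_cis ..
      finally show ?thesis using m[of n] by (auto simp: k_def)
    qed
  qed (use c p in \<open>auto intro: continuous_on_diff continuous_on_const\<close>)
  from this[of x] this[of y] show ?thesis by simp
qed

subsection \<open>Automorphisms of the disk\<close>

text \<open>The denominator of the SU(1,1) normal form (a z + b) / (cnj b z + cnj a) of a disk
  automorphism, whose derivative is \<open>1 / (jac a b z)^2\<close>.\<close>

definition jac :: "complex \<Rightarrow> complex \<Rightarrow> complex \<Rightarrow> complex" where
  "jac a b z = cnj b * z + cnj a"

definition disk_auto :: "complex \<Rightarrow> complex \<Rightarrow> (complex \<Rightarrow> complex) \<Rightarrow> bool" where
  "disk_auto a b g \<longleftrightarrow> (norm a)\<^sup>2 - (norm b)\<^sup>2 = 1 \<and> (\<forall>z\<in>cball 0 1. g z = (a * z + b) / jac a b z)"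

lemma disk_auto_identity: "(norm a)\<^sup>2 - (norm b)\<^sup>2 = 1 \<Longrightarrow>
    (norm (jac a b z))\<^sup>2 - (norm (a * z + b))\<^sup>2 = 1 - (norm z)\<^sup>2"
proof -
  assume ab: "(norm a)\<^sup>2 - (norm b)\<^sup>2 = 1"
  have "(norm (jac a b z))\<^sup>2 - (norm (a * z + b))\<^sup>2 = ((norm a)\<^sup>2 - (norm b)\<^sup>2) * (1 - (norm z)\<^sup>2)"
    unfolding jac_def cmod_power2 by (simp add: power2_eq_square algebra_simps)
  then show ?thesis using ab by simp
qed

lemma jac_nonzero:
  assumes ab: "(norm a)\<^sup>2 - (norm b)\<^sup>2 = 1" and z: "z \<in> cball 0 1"
  shows "jac a b z \<noteq> 0"
proof
  assume "jac a b z = 0"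
  then have "cnj b * z = - cnj a" by (simp add: jac_def add_eq_0_iff2)
  then have "norm b * norm z = norm a" by (metis complex_mod_cnj norm_minus_cancel norm_mult)
  moreover have "norm b * norm z \<le> norm b" using z by (simp add: mult_left_le)
  ultimately have "norm a \<le> norm b" by linarith
  then have "(norm a)\<^sup>2 \<le> (norm b)\<^sup>2" by (intro power_mono) auto
  then show False using ab by linarith
qed

text \<open>The difference formula for g z - g w carries most of the weight: it gives injectivity,
  and on the circle its modulus is the conformal invariance of the boundary kernel. The last fact, g
  \<xi> = \<xi> cnj(jac) / jac, is what allows a lift to the line.\<close>

lemma disk_auto_facts:
  assumes g: "disk_auto a b g"
  shows "z \<in> cball 0 1 \<Longrightarrow> 1 - (norm (g z))\<^sup>2 = (1 - (norm z)\<^sup>2) / (norm (jac a b z))\<^sup>2"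
    and "z \<in> cball 0 1 \<Longrightarrow> w \<in> cball 0 1 \<Longrightarrow> g z - g w = (z - w) / (jac a b z * jac a b w)"
    and "z \<in> ball 0 1 \<Longrightarrow> g z \<in> ball 0 1"
    and "z \<in> sphere 0 1 \<Longrightarrow> g z \<in> sphere 0 1"
    and "z \<in> ball 0 1 \<Longrightarrow> (g has_field_derivative 1 / (jac a b z)\<^sup>2) (at z)"
    and "inj_on g (cball 0 1)"
    and "\<xi> \<in> sphere 0 1 \<Longrightarrow> g \<xi> = \<xi> * cnj (jac a b \<xi>) / jac a b \<xi>"
proof -
  have ab: "(norm a)\<^sup>2 - (norm b)\<^sup>2 = 1" and gz: "\<And>z. z \<in> cball 0 1 \<Longrightarrow> g z = (a * z + b) / jac a b z"
    using g by (auto simp: disk_auto_def)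
  have nz: "jac a b z \<noteq> 0" if "z \<in> cball 0 1" for z by (rule jac_nonzero[OF ab that])
  have det: "a * cnj a - b * cnj b = 1"
    using ab by (simp only: complex_norm_square[symmetric] of_real_diff[symmetric]) simp
  have id: "(norm (jac a b z))\<^sup>2 - (norm (a * z + b))\<^sup>2 = 1 - (norm z)\<^sup>2" for z
    using disk_auto_identity[OF ab] .
  show 1: "1 - (norm (g z))\<^sup>2 = (1 - (norm z)\<^sup>2) / (norm (jac a b z))\<^sup>2" if "z \<in> cball 0 1" for z
    unfolding id[of z, symmetric] gz[OF that] norm_divide power_divide using nz[OF that]
    by (simp add: diff_divide_distrib)
  show 2: "g z - g w = (z - w) / (jac a b z * jac a b w)" if "z \<in> cball 0 1" "w \<in> cball 0 1" for z w
  proof -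
    have "(a * z + b) * jac a b w - (a * w + b) * jac a b z = (a * cnj a - b * cnj b) * (z - w)"
      unfolding jac_def by (simp add: algebra_simps)
    then have "(a * z + b) * jac a b w - (a * w + b) * jac a b z = z - w" unfolding det by simp
    then show ?thesis unfolding gz[OF that(1)] gz[OF that(2)]
      by (subst diff_frac_eq) (simp_all add: nz[OF that(1)] nz[OF that(2)])
  qed
  show "g z \<in> ball 0 1" if "z \<in> ball 0 1" for z
  proof -
    have z: "z \<in> cball 0 1" "norm z < 1" using that by auto
    have "0 < (norm (jac a b z))\<^sup>2" using nz[OF z(1)] by simp
    moreover have "0 < 1 - (norm z)\<^sup>2" using z(2) by (simp add: abs_square_less_1)
    ultimately have "0 < 1 - (norm (g z))\<^sup>2" unfolding 1[OF z(1)] by (rule divide_pos_pos[rotated])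
    then show ?thesis by (simp add: abs_square_less_1)
  qed
  show "g z \<in> sphere 0 1" if "z \<in> sphere 0 1" for z
  proof -
    have "1 - (norm (g z))\<^sup>2 = 0" using 1[of z] that by simp
    then show ?thesis by (simp add: power2_eq_1_iff) (metis norm_ge_zero not_one_le_zero neg_0_le_iff_le zero_le_one)
  qed
  show "(g has_field_derivative 1 / (jac a b z)\<^sup>2) (at z)" if "z \<in> ball 0 1" for z
  proof -
    have z: "z \<in> cball 0 1" using that by auto
    have "((\<lambda>z. (a * z + b) / jac a b z) has_field_derivative
      (a * jac a b z - (a * z + b) * cnj b) / (jac a b z * jac a b z)) (at z)"
      unfolding jac_def using nz[OF z, unfolded jac_def]
      by (auto intro!: derivative_eq_intros)
    also have "a * jac a b z - (a * z + b) * cnj b = 1"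
      unfolding det[symmetric] jac_def by (simp add: algebra_simps)
    finally have "((\<lambda>z. (a * z + b) / jac a b z) has_field_derivative 1 / (jac a b z)\<^sup>2) (at z)"
      by (simp add: power2_eq_square)
    then show ?thesis
      by (rule has_field_derivative_transform_within_open[OF _ open_ball that]) (simp add: gz)
  qed
  show "inj_on g (cball 0 1)"
  proof (rule inj_onI)
    fix z w assume zw: "z \<in> cball 0 1" "w \<in> cball 0 1" "g z = g w"
    then have "(z - w) / (jac a b z * jac a b w) = 0" using 2 by (metis diff_self)
    then show "z = w" using nz zw by simp
  qed
  show "g \<xi> = \<xi> * cnj (jac a b \<xi>) / jac a b \<xi>" if "\<xi> \<in> sphere 0 1" for \<xi>
  proof -
    have "\<xi> * cnj \<xi> = 1" using that by (simp add: complex_norm_square[symmetric])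
    then have "\<xi> * cnj (jac a b \<xi>) = a * \<xi> + b"
      by (simp add: jac_def algebra_simps)
    then show ?thesis using gz[of \<xi>] that by simp
  qed
qed

text \<open>A Moebius map of determinant 1 that preserves the circle multiplies the Hermitian form
  |z|^2 - |w|^2 by some real \<kappa>; the determinant forces \<kappa>^2 = 1, and \<kappa> = -1
  would exchange the inside and the outside of the disk. For \<kappa> = 1 the coefficients have the
  normal form.\<close>

lemma fuchsian_disk_auto:
  assumes \<Gamma>: "cocompact_fuchsian \<Gamma>" and \<gamma>: "\<gamma> \<in> \<Gamma>"
  obtains a b where "disk_auto a b \<gamma>"
proof -
  have "subgroup \<Gamma> (BijGroup (cball 0 1))" using \<Gamma> unfolding cocompact_fuchsian_def by (elim conjE)
  then have "\<gamma> \<in> carrier (BijGroup (cball 0 1))" using \<gamma> by (rule subgroup.mem_carrier)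
  then have bij: "bij_betw \<gamma> (cball 0 1) (cball 0 1)" by (simp add: BijGroup_def Bij_def)
  have m': "\<forall>\<gamma>\<in>\<Gamma>. \<gamma> ` ball 0 1 = ball 0 1 \<and>
        (\<exists>a b c d. a * d - b * c = 1 \<and> \<gamma> = restrict (moebius a b c d) (cball 0 1))"
    using \<Gamma> unfolding cocompact_fuchsian_def by (elim conjE)
  then have ball: "\<gamma> ` ball 0 1 = ball 0 1" using \<gamma> by blast
  obtain a b c d where det: "a * d - b * c = 1" and m: "\<gamma> = restrict (moebius a b c d) (cball 0 1)"
    using m' \<gamma> by blast
  have g: "\<gamma> z = (a * z + b) / (c * z + d)" if "z \<in> cball 0 1" for z
    using that by (simp add: m moebius_def)
  \<comment> \<open>A bijection of the closed disk that maps the open disk onto itself cannot send a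
    boundary point inside.\<close>
  have sph: "norm (\<gamma> \<xi>) = 1" if "norm \<xi> = 1" for \<xi>
  proof (rule ccontr)
    have \<xi>: "\<xi> \<in> cball 0 1" using that by simp
    assume "norm (\<gamma> \<xi>) \<noteq> 1"
    then have "\<gamma> \<xi> \<in> ball 0 1" using bij_betwE[OF bij] \<xi> by fastforce
    then obtain z where "z \<in> ball 0 1" "\<gamma> z = \<gamma> \<xi>" using ball by (metis imageE)
    then show False using bij_betw_imp_inj_on[OF bij] \<xi> that unfolding inj_on_def by fastforce
  qed
  have circle: "norm (a * \<xi> + b) = norm (c * \<xi> + d)" if "norm \<xi> = 1" for \<xi>
  proof -
    have "norm (a * \<xi> + b) / norm (c * \<xi> + d) = 1"
      using sph[OF that] g[of \<xi>] that by (simp only: norm_divide[symmetric] mem_cball_0 order_refl)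
    \<comment> \<open>A quotient with value 1 has a nonzero denominator, because division by 0
      yields 0.\<close>
    then show ?thesis by (metis div_by_0 eq_divide_eq_1 zero_neq_one)
  qed
  define X where "X = a * cnj b - c * cnj d"
  define k where "k = (norm a)\<^sup>2 + (norm b)\<^sup>2 - (norm c)\<^sup>2 - (norm d)\<^sup>2"
  have kX: "k + 2 * Re (X * \<xi>) = 0" if "norm \<xi> = 1" for \<xi>
  proof -
    have exp: "(norm (u * \<xi> + v))\<^sup>2 = (norm u)\<^sup>2 + (norm v)\<^sup>2 + 2 * Re (u * cnj v * \<xi>)" for u v
    proof -
      have "(norm (u * \<xi> + v))\<^sup>2 = (norm (u * \<xi>))\<^sup>2 + (norm v)\<^sup>2 + 2 * Re (u * cnj v * \<xi>)"
        unfolding cmod_power2 by (simp add: power2_eq_square algebra_simps)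
      then show ?thesis using that by (simp add: norm_mult)
    qed
    have "(norm (a * \<xi> + b))\<^sup>2 - (norm (c * \<xi> + d))\<^sup>2 = 0" using circle[OF that] by simp
    then show ?thesis unfolding exp k_def X_def by (simp add: algebra_simps)
  qed
  \<comment> \<open>The trigonometric polynomial k + 2 Re(X \<xi>) vanishes on the circle; the four
    points 1, -1, i, -i already determine k and X.\<close>
  have "k = 0" "X = 0"
    using kX[of 1] kX[of "-1"] kX[of "\<i>"] kX[of "-\<i>"] by (auto simp: complex_eq_iff)
  then have X: "a * cnj b = c * cnj d" and k: "(norm a)\<^sup>2 - (norm c)\<^sup>2 = (norm d)\<^sup>2 - (norm b)\<^sup>2"
    by (auto simp: X_def k_def)
  have X': "cnj a * b = cnj c * d" using arg_cong[OF X, of cnj] by simp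
  define \<kappa> where "\<kappa> = (norm d)\<^sup>2 - (norm b)\<^sup>2"
  have \<kappa>1: "of_real \<kappa> = d * cnj d - b * cnj b"
    unfolding \<kappa>_def of_real_diff complex_norm_square ..
  have \<kappa>2: "of_real \<kappa> = a * cnj a - c * cnj c"
    unfolding \<kappa>_def k[symmetric] of_real_diff complex_norm_square ..
  \<comment> \<open>Both factors equal \<kappa>, and the relations between the rows turn their
    product into |ad - bc|^2 = 1.\<close>
  have "(a * cnj a - c * cnj c) * (d * cnj d - b * cnj b) =
     a * cnj a * d * cnj d - (a * cnj b) * (cnj a * b) - (c * cnj d) * (cnj c * d) + c * cnj c * b * cnj b"
    by (simp add: algebra_simps)
  also have "\<dots> = a * cnj a * d * cnj d - (a * cnj b) * (cnj c * d) - (c * cnj d) * (cnj a * b) + c * cnj c * b * cnj b"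
    by (simp only: X X')
  also have "\<dots> = (a * d - b * c) * cnj (a * d - b * c)"
    by (simp add: algebra_simps)
  finally have "complex_of_real (\<kappa> * \<kappa>) = 1" by (simp add: det flip: \<kappa>1 \<kappa>2)
  then have "\<kappa> * \<kappa> = 1" using of_real_eq_1_iff by blast
  then have \<kappa>: "\<kappa> = 1 \<or> \<kappa> = -1" by (metis power2_eq_1_iff power2_eq_square)
  have "\<kappa> \<noteq> -1"
  proof
    assume \<kappa>: "\<kappa> = -1"
    \<comment> \<open>For \<kappa> = -1 the numerator exceeds the denominator throughout the disk,
      so the image can lie in the disk only where the division by 0 returns 0. A denominator
      vanishing on the whole disk contradicts the determinant.\<close>
    have z0: "c * z + d = 0" if z: "norm z < 1" for z
    proof (rule ccontr)
      assume nz: "c * z + d \<noteq> 0"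
      have "\<gamma> z \<in> ball 0 1" using ball z by (metis imageI mem_ball_0)
      then have "norm (a * z + b) / norm (c * z + d) < 1"
        using g[of z] z by (simp add: norm_divide)
      then have "norm (a * z + b) < norm (c * z + d)" using nz by (simp add: divide_simps)
      then have "(norm (a * z + b))\<^sup>2 < (norm (c * z + d))\<^sup>2" by (intro power_strict_mono) auto
      moreover have "(norm (c * z + d))\<^sup>2 - (norm (a * z + b))\<^sup>2 = \<kappa> * (1 - (norm z)\<^sup>2)"
      proof -
        have exp: "(norm (u * z + v))\<^sup>2 = (norm u)\<^sup>2 * (norm z)\<^sup>2 + (norm v)\<^sup>2 + 2 * Re (u * cnj v * z)" for u v
        proof -
          have "(norm (u * z + v))\<^sup>2 = (norm (u * z))\<^sup>2 + (norm v)\<^sup>2 + 2 * Re (u * cnj v * z)"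
            unfolding cmod_power2 by (simp add: power2_eq_square algebra_simps)
          then show ?thesis by (simp add: norm_mult power_mult_distrib)
        qed
        have "(norm (c * z + d))\<^sup>2 - (norm (a * z + b))\<^sup>2 =
          ((norm d)\<^sup>2 - (norm b)\<^sup>2) - ((norm a)\<^sup>2 - (norm c)\<^sup>2) * (norm z)\<^sup>2"
          unfolding exp X by (simp add: algebra_simps)
        then show ?thesis unfolding k \<kappa>_def by (simp add: algebra_simps)
      qed
      moreover have "(norm z)\<^sup>2 < 1" using z by (simp add: abs_square_less_1)
      ultimately show False using \<kappa> by simp
    qed
    have "d = 0" using z0[of 0] by simp
    moreover have "c = 0" using z0[of "1/2"] \<open>d = 0\<close> by (simp add: norm_divide)
    ultimately show False using det by simp
  qed
  then have \<kappa>: "\<kappa> = 1" using \<kappa> by blast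
  have "a = a * (d * cnj d - b * cnj b)" by (simp add: \<kappa> flip: \<kappa>1)
  also have "\<dots> = cnj d * (a * d) - b * (a * cnj b)" by (simp add: algebra_simps)
  also have "\<dots> = cnj d * (a * d - b * c)" unfolding X by (simp add: algebra_simps)
  finally have ad: "a = cnj d" by (simp add: det)
  have "cnj b = cnj b * (a * cnj a - c * cnj c)" by (simp add: \<kappa> flip: \<kappa>2)
  also have "\<dots> = cnj a * (a * cnj b) - c * (cnj b * cnj c)" by (simp add: algebra_simps)
  also have "\<dots> = c * cnj (a * d - b * c)" unfolding X by (simp add: algebra_simps)
  finally have bc: "cnj b = c" by (simp add: det)
  have "disk_auto a b \<gamma>"
    unfolding disk_auto_def jac_def bc using g \<kappa> by (auto simp: ad \<kappa>_def)
  then show ?thesis by (rule that)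
qed

section \<open>Partial derivatives and invariance of the hyperbolic Laplacian\<close>

definition has_partials :: "(complex \<Rightarrow> complex) \<Rightarrow> complex \<Rightarrow> complex \<Rightarrow> complex \<Rightarrow> bool" where
  "has_partials u z ux uy \<longleftrightarrow> (u has_derivative (\<lambda>h. of_real (Re h) * ux + of_real (Im h) * uy)) (at z)"

lemma has_partialsD:
  assumes "has_partials u z ux uy"
  shows "u differentiable (at z)" "partial_x u z = ux" "partial_y u z = uy"
proof -
  show "u differentiable (at z)" using assms unfolding has_partials_def differentiable_def by blast
  have "frechet_derivative u (at z) = (\<lambda>h. of_real (Re h) * ux + of_real (Im h) * uy)"
    using frechet_derivative_at[OF assms[unfolded has_partials_def]] by simp
  then show "partial_x u z = ux" "partial_y u z = uy" by (simp_all add: partial_x_def partial_y_def)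
qed

lemma differentiable_has_partials:
  assumes "u differentiable (at z)"
  shows "has_partials u z (partial_x u z) (partial_y u z)"
proof -
  let ?D = "frechet_derivative u (at z)"
  have D: "(u has_derivative ?D) (at z)" using assms by (simp add: frechet_derivative_works)
  interpret D: bounded_linear ?D using D by (rule has_derivative_bounded_linear)
  have "?D h = of_real (Re h) * partial_x u z + of_real (Im h) * partial_y u z" for h
  proof -
    have "h = Re h *\<^sub>R 1 + Im h *\<^sub>R \<i>" by (simp add: complex_eq_iff)
    then have "?D h = ?D (Re h *\<^sub>R 1 + Im h *\<^sub>R \<i>)" by simp
    then show ?thesis
      by (simp only: D.add D.scaleR partial_x_def partial_y_def) (simp only: scaleR_conv_of_real)
  qed
  then have "?D = (\<lambda>h. of_real (Re h) * partial_x u z + of_real (Im h) * partial_y u z)" by blast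
  then show ?thesis using D unfolding has_partials_def by simp
qed

lemma has_partials_add:
  assumes "has_partials u z ux uy" "has_partials v z vx vy"
  shows "has_partials (\<lambda>z. u z + v z) z (ux + vx) (uy + vy)"
  using has_derivative_add[OF assms[unfolded has_partials_def]]
  by (simp add: has_partials_def algebra_simps)

lemma has_partials_mult:
  assumes "has_partials u z ux uy" "has_partials v z vx vy"
  shows "has_partials (\<lambda>z. u z * v z) z (u z * vx + ux * v z) (u z * vy + uy * v z)"
  using has_derivative_mult[OF assms[unfolded has_partials_def]]
  by (simp add: has_partials_def algebra_simps)

lemma has_partials_compose:
  assumes "has_partials u (g z) ux uy" "(g has_field_derivative g') (at z)"
  shows "has_partials (\<lambda>z. u (g z)) z (of_real (Re g') * ux + of_real (Im g') * uy)
    (- of_real (Im g') * ux + of_real (Re g') * uy)"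
  using has_derivative_compose[OF assms(2)[unfolded has_field_derivative_def] assms(1)[unfolded has_partials_def]]
  by (simp add: has_partials_def algebra_simps)

lemma has_partials_Re_Im:
  assumes "(g has_field_derivative g') (at z)"
  shows "has_partials (\<lambda>z. of_real (Re (g z))) z (of_real (Re g')) (- of_real (Im g'))"
    "has_partials (\<lambda>z. of_real (Im (g z))) z (of_real (Im g')) (of_real (Re g'))"
    "has_partials (\<lambda>z. - of_real (Im (g z))) z (- of_real (Im g')) (- of_real (Re g'))"
proof -
  have D: "(g has_derivative (*) g') (at z)" using assms by (simp add: has_field_derivative_def)
  have r: "((\<lambda>z. complex_of_real (Re (g z))) has_derivative (\<lambda>h. of_real (Re (g' * h)))) (at z)"
    by (rule has_derivative_of_real[OF has_derivative_Re[OF D]])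
  have i: "((\<lambda>z. complex_of_real (Im (g z))) has_derivative (\<lambda>h. of_real (Im (g' * h)))) (at z)"
    by (rule has_derivative_of_real[OF has_derivative_Im[OF D]])
  show "has_partials (\<lambda>z. of_real (Re (g z))) z (of_real (Re g')) (- of_real (Im g'))"
    using r by (simp add: has_partials_def algebra_simps)
  show "has_partials (\<lambda>z. of_real (Im (g z))) z (of_real (Im g')) (of_real (Re g'))"
    using i by (simp add: has_partials_def algebra_simps)
  show "has_partials (\<lambda>z. - of_real (Im (g z))) z (- of_real (Im g')) (- of_real (Re g'))"
    using has_derivative_minus[OF i] by (simp add: has_partials_def algebra_simps)
qed

text \<open>The function u is compared with v only on S: iterated partial derivatives are known by
  formulas inside the disk, while outside it \<open>frechet_derivative\<close> is
  unspecified.\<close>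

lemma C1_on_I:
  assumes S: "open S" and eq: "\<And>z. z \<in> S \<Longrightarrow> u z = v z"
    and v: "\<And>z. z \<in> S \<Longrightarrow> has_partials v z (vx z) (vy z)"
    and c: "continuous_on S vx" "continuous_on S vy"
  shows "C1_on S u" "\<And>z. z \<in> S \<Longrightarrow> partial_x u z = vx z" "\<And>z. z \<in> S \<Longrightarrow> partial_y u z = vy z"
proof -
  have u: "has_partials u z (vx z) (vy z)" if "z \<in> S" for z
    unfolding has_partials_def
    by (rule has_derivative_transform_within_open[OF v[OF that, unfolded has_partials_def] S that])
      (simp add: eq)
  show px: "\<And>z. z \<in> S \<Longrightarrow> partial_x u z = vx z" and py: "\<And>z. z \<in> S \<Longrightarrow> partial_y u z = vy z"
    using has_partialsD[OF u] by blast+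
  show "C1_on S u" unfolding C1_on_def
    using has_partialsD(1)[OF u] c px py continuous_on_cong[of S S "partial_x u" vx]
      continuous_on_cong[of S S "partial_y u" vy] by auto
qed

lemma disk_auto_open: "disk_auto a b g \<Longrightarrow> z \<in> ball 0 1 \<Longrightarrow> jac a b z \<noteq> 0"
  using jac_nonzero[of a b z] by (auto simp: disk_auto_def)

text \<open>Since g is holomorphic, the Euclidean Laplacian of f o g is |g'|^2 times that of f at g
  z, and |g'| = (1 - |g z|^2) / (1 - |z|^2) is exactly the change of the conformal factor.\<close>

lemma hyp_eigenfunction_compose:
  assumes f: "hyp_eigenfunction \<mu> f" and g: "disk_auto a b g"
  shows "hyp_eigenfunction \<mu> (\<lambda>z. f (g z))"
proof -
  define B where "B = ball (0::complex) 1"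
  define k where "k = (\<lambda>z. 1 / (jac a b z)\<^sup>2)"
  define k' where "k' = (\<lambda>z. - 2 * cnj b / (jac a b z) ^ 3)"
  define p where "p = (\<lambda>z. complex_of_real (Re (k z)))"
  define q where "q = (\<lambda>z. complex_of_real (Im (k z)))"
  define p' where "p' = (\<lambda>z. complex_of_real (Re (k' z)))"
  define q' where "q' = (\<lambda>z. complex_of_real (Im (k' z)))"
  define fx where "fx = partial_x f"
  define fy where "fy = partial_y f"
  have B: "open B" by (simp add: B_def)
  have gB: "g z \<in> B" if "z \<in> B" for z using disk_auto_facts(3)[OF g] that by (simp add: B_def)
  have nz: "jac a b z \<noteq> 0" if "z \<in> B" for z using disk_auto_open[OF g] that by (simp add: B_def)
  have gd: "(g has_field_derivative k z) (at z)" if "z \<in> B" for z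
    using disk_auto_facts(5)[OF g, of z] that by (simp add: B_def k_def)
  have angle_kernel_d: "(k has_field_derivative k' z) (at z)" if "z \<in> B" for z
  proof -
    have j: "(jac a b has_field_derivative cnj b) (at z)"
      unfolding jac_def[abs_def] by (auto intro!: derivative_eq_intros)
    have "(k has_field_derivative - (2 * jac a b z * cnj b) / ((jac a b z)\<^sup>2 * (jac a b z)\<^sup>2)) (at z)"
      unfolding k_def using nz[OF that] by (auto intro!: derivative_eq_intros j simp: mult_ac)
    also have "- (2 * jac a b z * cnj b) / ((jac a b z)\<^sup>2 * (jac a b z)\<^sup>2) = k' z"
      using nz[OF that] by (simp add: k'_def power2_eq_square power3_eq_cube)
    finally show ?thesis .
  qed
  have jc: "continuous_on B (jac a b)" unfolding jac_def[abs_def] by (intro continuous_intros)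
  have kc: "continuous_on B k" "continuous_on B k'"
    unfolding k_def k'_def by (intro continuous_intros jc; use nz in simp)+
  have gc: "continuous_on B g" by (rule DERIV_continuous_on) (use gd has_field_derivative_at_within in blast)
  have gim: "g ` B \<subseteq> B" using gB by blast
  have cp: "continuous_on B p" "continuous_on B q" "continuous_on B p'" "continuous_on B q'"
    unfolding p_def q_def p'_def q'_def by (intro continuous_intros kc)+
  have f2: "C1_on B f" "C1_on B fx" "C1_on B fy"
    using f unfolding hyp_eigenfunction_def C2_on_def B_def fx_def fy_def by auto
  have hp: "has_partials u (g z) (partial_x u (g z)) (partial_y u (g z))" if "C1_on B u" "z \<in> B" for u z
    by (rule differentiable_has_partials) (use that gB in \<open>auto simp: C1_on_def\<close>)
  have pc: "continuous_on B (\<lambda>z. partial_x u (g z))" "continuous_on B (\<lambda>z. partial_y u (g z))" if "C1_on B u" for u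
    using that continuous_on_compose2[OF _ gc gim] by (auto simp: C1_on_def)
  have c0: "continuous_on B u" if "C1_on B u" for u
    by (rule continuous_at_imp_continuous_on) (use that differentiable_imp_continuous_within in \<open>auto simp: C1_on_def\<close>)
  have uc: "continuous_on B (\<lambda>z. u (g z))" if "C1_on B u" for u
    by (rule continuous_on_compose2[OF c0[OF that] gc gim])
  define hx where "hx = (\<lambda>z. p z * fx (g z) + q z * fy (g z))"
  define hy where "hy = (\<lambda>z. (- q z) * fx (g z) + p z * fy (g z))"
  have comp: "has_partials (\<lambda>z. u (g z)) z (p z * partial_x u (g z) + q z * partial_y u (g z))
      ((- q z) * partial_x u (g z) + p z * partial_y u (g z))" if "C1_on B u" "z \<in> B" for u z
    using has_partials_compose[OF hp[OF that] gd[OF that(2)]] by (simp add: p_def q_def)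
  have h1: "C1_on B (\<lambda>z. f (g z))" "\<And>z. z \<in> B \<Longrightarrow> partial_x (\<lambda>z. f (g z)) z = hx z"
    "\<And>z. z \<in> B \<Longrightarrow> partial_y (\<lambda>z. f (g z)) z = hy z"
  proof -
    have c: "continuous_on B hx" "continuous_on B hy"
      unfolding hx_def hy_def by (intro continuous_intros cp uc f2)+
    have "has_partials (\<lambda>z. f (g z)) z (hx z) (hy z)" if "z \<in> B" for z
      using comp[OF f2(1) that] by (simp add: hx_def hy_def fx_def fy_def)
    note C1_on_I[OF B refl this c]
    then show "C1_on B (\<lambda>z. f (g z))" "\<And>z. z \<in> B \<Longrightarrow> partial_x (\<lambda>z. f (g z)) z = hx z"
      "\<And>z. z \<in> B \<Longrightarrow> partial_y (\<lambda>z. f (g z)) z = hy z" by blast+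
  qed
  have P: "has_partials p z (p' z) (- q' z)" "has_partials q z (q' z) (p' z)"
    "has_partials (\<lambda>z. - q z) z (- q' z) (- p' z)" if "z \<in> B" for z
    using has_partials_Re_Im[OF angle_kernel_d[OF that]] by (simp_all add: p_def q_def p'_def q'_def)
  define fxx where "fxx = (\<lambda>z. partial_x fx (g z))"
  define fxy where "fxy = (\<lambda>z. partial_y fx (g z))"
  define fyx where "fyx = (\<lambda>z. partial_x fy (g z))"
  define fyy where "fyy = (\<lambda>z. partial_y fy (g z))"
  have comp2: "has_partials (\<lambda>z. fx (g z)) z (p z * fxx z + q z * fxy z) ((- q z) * fxx z + p z * fxy z)"
    "has_partials (\<lambda>z. fy (g z)) z (p z * fyx z + q z * fyy z) ((- q z) * fyx z + p z * fyy z)" if "z \<in> B" for z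
    using comp[OF f2(2) that] comp[OF f2(3) that] unfolding fxx_def fxy_def fyx_def fyy_def by blast+
  have cc: "continuous_on B fxx" "continuous_on B fxy" "continuous_on B fyx" "continuous_on B fyy"
    unfolding fxx_def fxy_def fyx_def fyy_def by (intro pc f2)+
  define hxx where "hxx = (\<lambda>z. (p z * (p z * fxx z + q z * fxy z) + p' z * fx (g z)) +
      (q z * (p z * fyx z + q z * fyy z) + q' z * fy (g z)))"
  define hxy where "hxy = (\<lambda>z. (p z * ((- q z) * fxx z + p z * fxy z) + (- q' z) * fx (g z)) +
      (q z * ((- q z) * fyx z + p z * fyy z) + p' z * fy (g z)))"
  define hyx where "hyx = (\<lambda>z. ((- q z) * (p z * fxx z + q z * fxy z) + (- q' z) * fx (g z)) +
      (p z * (p z * fyx z + q z * fyy z) + p' z * fy (g z)))"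
  define hyy where "hyy = (\<lambda>z. ((- q z) * ((- q z) * fxx z + p z * fxy z) + (- p' z) * fx (g z)) +
      (p z * ((- q z) * fyx z + p z * fyy z) + (- q' z) * fy (g z)))"
  have h2: "C1_on B (partial_x (\<lambda>z. f (g z)))" "\<And>z. z \<in> B \<Longrightarrow> partial_x (partial_x (\<lambda>z. f (g z))) z = hxx z"
  proof -
    have c: "continuous_on B hxx" "continuous_on B hxy"
      unfolding hxx_def hxy_def by (intro continuous_intros cp uc f2 cc)+
    have "has_partials hx z (hxx z) (hxy z)" if "z \<in> B" for z
      unfolding hx_def hxx_def hxy_def
      by (intro has_partials_add has_partials_mult P comp2 that)
    note C1_on_I[OF B h1(2) this c]
    then show "C1_on B (partial_x (\<lambda>z. f (g z)))" "\<And>z. z \<in> B \<Longrightarrow> partial_x (partial_x (\<lambda>z. f (g z))) z = hxx z"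
      by blast+
  qed
  have h3: "C1_on B (partial_y (\<lambda>z. f (g z)))" "\<And>z. z \<in> B \<Longrightarrow> partial_y (partial_y (\<lambda>z. f (g z))) z = hyy z"
  proof -
    have c: "continuous_on B hyx" "continuous_on B hyy"
      unfolding hyx_def hyy_def by (intro continuous_intros cp uc f2 cc)+
    have "has_partials hy z (hyx z) (hyy z)" if "z \<in> B" for z
      unfolding hy_def hyx_def hyy_def
      by (intro has_partials_add has_partials_mult P comp2 that)
    note C1_on_I[OF B h1(3) this c]
    then show "C1_on B (partial_y (\<lambda>z. f (g z)))" "\<And>z. z \<in> B \<Longrightarrow> partial_y (partial_y (\<lambda>z. f (g z))) z = hyy z"
      by blast+
  qed
  have "hyp_laplacian (\<lambda>z. f (g z)) z = - \<mu> * f (g z)" if z: "z \<in> B" for z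
  proof -
    have zc: "z \<in> cball 0 1" using z by (simp add: B_def)
    have pq: "p z * p z + q z * q z = of_real ((norm (k z))\<^sup>2)"
      unfolding p_def q_def cmod_power2 by (simp add: power2_eq_square)
    have nk: "norm (k z) = 1 / (norm (jac a b z))\<^sup>2" by (simp add: k_def norm_divide norm_power)
    \<comment> \<open>In the sum the first-order terms cancel by the Cauchy-Riemann equations for
      g', and each mixed partial derivative cancels against itself.\<close>
    have "hxx z + hyy z = (p z * p z + q z * q z) * (fxx z + fyy z)"
      unfolding hxx_def hyy_def by (simp add: algebra_simps)
    then have "hyp_laplacian (\<lambda>z. f (g z)) z =
        of_real ((1 - (norm z)\<^sup>2)\<^sup>2 / 4) * (of_real ((norm (k z))\<^sup>2) * (fxx z + fyy z))"
      unfolding hyp_laplacian_def h2(2)[OF z] h3(2)[OF z] pq by simp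
    also have "\<dots> = of_real (((1 - (norm z)\<^sup>2) / (norm (jac a b z))\<^sup>2)\<^sup>2 / 4) * (fxx z + fyy z)"
      unfolding nk by (simp add: power_divide power2_eq_square)
    also have "\<dots> = hyp_laplacian f (g z)"
      unfolding disk_auto_facts(1)[OF g zc, symmetric] hyp_laplacian_def fxx_def fyy_def fx_def fy_def ..
    also have "\<dots> = - \<mu> * f (g z)"
      using f gB[OF z] unfolding hyp_eigenfunction_def B_def by blast
    finally show ?thesis .
  qed
  then show ?thesis
    unfolding hyp_eigenfunction_def C2_on_def using h1(1) h2(1) h3(1) unfolding B_def by blast
qed

subsection \<open>Eigenfunctions in polar coordinates\<close>

lemma tanh_half:
  "sinh r * (1 - (tanh (r / 2))\<^sup>2) = 2 * tanh (r / 2)"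
  "cosh r * (1 - (tanh (r / 2))\<^sup>2) = 1 + (tanh (r / 2))\<^sup>2"
  "0 < 1 - (tanh (r / 2))\<^sup>2" for r :: real
proof -
  define S C where "S = sinh (r / 2)" and "C = cosh (r / 2)"
  have C: "C > 0" by (simp add: C_def)
  have CS: "C\<^sup>2 = S\<^sup>2 + 1" unfolding C_def S_def by (rule cosh_square_eq)
  have sh: "sinh r = 2 * S * C" and ch: "cosh r = C\<^sup>2 + S\<^sup>2"
    using sinh_double[of "r/2"] cosh_double[of "r/2"] by (simp_all add: S_def C_def)
  have t: "tanh (r / 2) = S / C" by (simp add: tanh_def S_def C_def)
  have w: "1 - (tanh (r / 2))\<^sup>2 = 1 / C\<^sup>2"
  proof -
    have "1 - (S / C)\<^sup>2 = (C\<^sup>2 - S\<^sup>2) / C\<^sup>2" using C by (simp add: power_divide diff_divide_distrib)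
    then show ?thesis unfolding t CS by simp
  qed
  show "sinh r * (1 - (tanh (r / 2))\<^sup>2) = 2 * tanh (r / 2)"
    unfolding w unfolding sh t using C by (simp add: power2_eq_square)
  show "cosh r * (1 - (tanh (r / 2))\<^sup>2) = 1 + (tanh (r / 2))\<^sup>2"
    unfolding w unfolding ch t using C by (simp add: power_divide add_divide_distrib)
  show "0 < 1 - (tanh (r / 2))\<^sup>2" unfolding w using C by simp
qed

lemma norm_polar_point: "norm (polar_point r \<theta>) = \<bar>tanh (r / 2)\<bar>"
  by (simp add: polar_point_def norm_mult)

lemma polar_point_ball: "polar_point r \<theta> \<in> ball 0 1"
  using tanh_half(3)[of r] by (simp add: norm_polar_point abs_square_less_1[symmetric])

lemma ball_polar_point:
  assumes "z \<in> ball 0 1"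
  obtains r \<theta> where "0 \<le> r" "z = polar_point r \<theta>"
proof -
  have n: "norm z < 1" using assms by simp
  define x where "x = norm z"
  have x: "0 \<le> x" "x < 1" using n by (auto simp: x_def)
  define r where "r = - ln ((1 - x) / (1 + x))"
  have e: "exp (- 2 * (r / 2)) = (1 - x) / (1 + x)" using x by (simp add: r_def)
  have "tanh (r / 2) = norm z"
    unfolding tanh_real_altdef e x_def[symmetric] using x by (simp add: field_simps)
  moreover have "0 \<le> r" using x by (simp add: r_def ln_le_zero_iff)
  moreover have "of_real (norm z) * cis (Arg z) = z"
    using rcis_cmod_Arg[of z] by (simp add: rcis_def)
  ultimately have "z = polar_point r (Arg z)" "0 \<le> r" by (auto simp: polar_point_def)
  then show ?thesis using that by blast
qed

definition polar_pull :: "(complex \<Rightarrow> complex) \<Rightarrow> real \<Rightarrow> real \<Rightarrow> complex" where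
  "polar_pull u r \<theta> = u (polar_point r \<theta>)"

text \<open>The factor (1 - tanh^2) / 2 is the derivative of the Euclidean radius tanh(r/2) with
  respect to the hyperbolic radius.\<close>

definition polar_pull_r :: "(complex \<Rightarrow> complex) \<Rightarrow> real \<Rightarrow> real \<Rightarrow> complex" where
  "polar_pull_r u r \<theta> = of_real ((1 - (tanh (r / 2))\<^sup>2) / 2) *
     (of_real (cos \<theta>) * polar_pull (partial_x u) r \<theta> + of_real (sin \<theta>) * polar_pull (partial_y u) r \<theta>)"

definition polar_pull_t :: "(complex \<Rightarrow> complex) \<Rightarrow> real \<Rightarrow> real \<Rightarrow> complex" where
  "polar_pull_t u r \<theta> = of_real (tanh (r / 2)) *
     (of_real (- sin \<theta>) * polar_pull (partial_x u) r \<theta> + of_real (cos \<theta>) * polar_pull (partial_y u) r \<theta>)"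

definition polar_pull_rr :: "(complex \<Rightarrow> complex) \<Rightarrow> real \<Rightarrow> real \<Rightarrow> complex" where
  "polar_pull_rr u r \<theta> = of_real ((1 - (tanh (r / 2))\<^sup>2) / 2) *
     (of_real (cos \<theta>) * polar_pull_r (partial_x u) r \<theta> + of_real (sin \<theta>) * polar_pull_r (partial_y u) r \<theta>) +
     of_real (- tanh (r / 2) * ((1 - (tanh (r / 2))\<^sup>2) / 2)) *
     (of_real (cos \<theta>) * polar_pull (partial_x u) r \<theta> + of_real (sin \<theta>) * polar_pull (partial_y u) r \<theta>)"

definition polar_pull_tt :: "(complex \<Rightarrow> complex) \<Rightarrow> real \<Rightarrow> real \<Rightarrow> complex" where
  "polar_pull_tt u r \<theta> = of_real (tanh (r / 2)) *
     ((of_real (- sin \<theta>) * polar_pull_t (partial_x u) r \<theta> + of_real (- cos \<theta>) * polar_pull (partial_x u) r \<theta>) +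
      (of_real (cos \<theta>) * polar_pull_t (partial_y u) r \<theta> + of_real (- sin \<theta>) * polar_pull (partial_y u) r \<theta>))"

lemma has_partials_curve:
  assumes "has_partials u (c x) ux uy" "(c has_vector_derivative v) (at x)"
  shows "((\<lambda>x. u (c x)) has_vector_derivative of_real (Re v) * ux + of_real (Im v) * uy) (at x)"
  using has_derivative_compose[OF assms(2)[unfolded has_vector_derivative_def] assms(1)[unfolded has_partials_def]]
  by (simp add: has_vector_derivative_def scaleR_conv_of_real algebra_simps)

lemma tanh_half_derivative:
  "((\<lambda>r. tanh (r / 2)) has_real_derivative (1 - (tanh (r / 2))\<^sup>2) / 2) (at r)" for r :: real
proof -
  have "((\<lambda>r. r / 2) has_real_derivative 1 / 2) (at r)" by (auto intro!: derivative_eq_intros)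
  moreover have "cosh (r / 2) \<noteq> 0" using cosh_real_pos[of "r / 2"] by linarith
  ultimately show ?thesis
    using has_field_derivative_tanh[of "\<lambda>r. r / 2" r "1/2" UNIV] by simp
qed

lemma polar_pull_derivatives:
  assumes u: "C1_on (ball 0 1) u"
  shows "((\<lambda>r. polar_pull u r \<theta>) has_vector_derivative polar_pull_r u r \<theta>) (at r)"
    and "((\<lambda>\<theta>. polar_pull u r \<theta>) has_vector_derivative polar_pull_t u r \<theta>) (at \<theta>)"
proof -
  have hp: "has_partials u (polar_point r \<theta>) (polar_pull (partial_x u) r \<theta>) (polar_pull (partial_y u) r \<theta>)"
    unfolding polar_pull_def
    by (rule differentiable_has_partials) (use u polar_point_ball in \<open>auto simp: C1_on_def\<close>)
  have "((\<lambda>r. polar_point r \<theta>) has_vector_derivative of_real ((1 - (tanh (r / 2))\<^sup>2) / 2) * cis \<theta>) (at r)"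
    unfolding polar_point_def
    by (intro has_vector_derivative_mult_left has_vector_derivative_of_real tanh_half_derivative)
  from has_partials_curve[OF hp this]
  show "((\<lambda>r. polar_pull u r \<theta>) has_vector_derivative polar_pull_r u r \<theta>) (at r)"
    by (simp add: polar_pull_def[of u] polar_pull_r_def algebra_simps)
  have "((\<lambda>\<theta>. polar_point r \<theta>) has_vector_derivative of_real (tanh (r / 2)) * (\<i> * of_real 1 * cis (1 * \<theta>))) (at \<theta>)"
    unfolding polar_point_def
    using has_vector_derivative_mult_right[OF has_vector_derivative_cis[of 1 \<theta>]] by simp
  from has_partials_curve[OF hp this]
  show "((\<lambda>\<theta>. polar_pull u r \<theta>) has_vector_derivative polar_pull_t u r \<theta>) (at \<theta>)"
    by (simp add: polar_pull_def[of u] polar_pull_t_def algebra_simps)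
qed

lemma continuous_on_polar_pull:
  assumes "continuous_on (ball 0 1) u"
  shows "continuous_on UNIV (\<lambda>(r, \<theta>). polar_pull u r \<theta>)"
proof -
  have "continuous_on UNIV (\<lambda>x. polar_point (fst x) (snd x))"
    unfolding polar_point_def
    by (intro continuous_intros) (use cosh_real_pos in \<open>auto simp: less_le\<close>)
  then have "continuous_on UNIV (\<lambda>x. u (polar_point (fst x) (snd x)))"
    by (rule continuous_on_compose2[OF assms]) (use polar_point_ball in blast)
  then show ?thesis by (simp add: polar_pull_def case_prod_unfold)
qed

lemma C1_on_continuous: "C1_on S u \<Longrightarrow> continuous_on S u"
  by (rule continuous_at_imp_continuous_on) (auto simp: C1_on_def intro: differentiable_imp_continuous_within)

lemma continuous_on_polar_pull_derivatives:
  assumes "C1_on (ball 0 1) u"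
  shows "continuous_on UNIV (\<lambda>(r, \<theta>). polar_pull_r u r \<theta>)" "continuous_on UNIV (\<lambda>(r, \<theta>). polar_pull_t u r \<theta>)"
proof -
  have c: "continuous_on UNIV (\<lambda>x. polar_pull (partial_x u) (fst x) (snd x))"
    "continuous_on UNIV (\<lambda>x. polar_pull (partial_y u) (fst x) (snd x))"
    using assms continuous_on_polar_pull by (auto simp: C1_on_def case_prod_unfold)
  have t: "continuous_on UNIV (\<lambda>x::real \<times> real. tanh (fst x / 2))"
    by (intro continuous_intros) (use cosh_real_pos in \<open>auto simp: less_le\<close>)
  show "continuous_on UNIV (\<lambda>(r, \<theta>). polar_pull_r u r \<theta>)"
    unfolding polar_pull_r_def case_prod_unfold
    by (intro continuous_on_mult continuous_on_add continuous_on_of_real continuous_on_cos continuous_on_sin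
        continuous_on_diff continuous_on_power continuous_on_divide continuous_on_const continuous_on_snd
        continuous_on_id c t) simp_all
  show "continuous_on UNIV (\<lambda>(r, \<theta>). polar_pull_t u r \<theta>)"
    unfolding polar_pull_t_def case_prod_unfold
    by (intro continuous_on_mult continuous_on_add continuous_on_of_real continuous_on_cos continuous_on_sin
        continuous_on_minus continuous_on_snd continuous_on_id c t)
qed

lemma polar_pull_polar_eigenfunction:
  assumes f: "hyp_eigenfunction (of_real \<mu>) f"
  shows "polar_eigenfunction \<mu> (polar_pull f) (polar_pull_r f) (polar_pull_rr f) (polar_pull_t f) (polar_pull_tt f)"
proof
  have C: "C1_on (ball 0 1) f" "C1_on (ball 0 1) (partial_x f)" "C1_on (ball 0 1) (partial_y f)"
    using f by (auto simp: hyp_eigenfunction_def C2_on_def)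
  note c = C1_on_continuous[OF C(1)] C1_on_continuous[OF C(2)] C1_on_continuous[OF C(3)]
  have cp: "continuous_on UNIV (\<lambda>x. polar_pull (partial_x f) (fst x) (snd x))"
    "continuous_on UNIV (\<lambda>x. polar_pull (partial_y f) (fst x) (snd x))"
    "continuous_on UNIV (\<lambda>x. polar_pull_r (partial_x f) (fst x) (snd x))"
    "continuous_on UNIV (\<lambda>x. polar_pull_r (partial_y f) (fst x) (snd x))"
    "continuous_on UNIV (\<lambda>x. polar_pull_t (partial_x f) (fst x) (snd x))"
    "continuous_on UNIV (\<lambda>x. polar_pull_t (partial_y f) (fst x) (snd x))"
    using continuous_on_polar_pull[OF c(2)] continuous_on_polar_pull[OF c(3)] continuous_on_polar_pull_derivatives[OF C(2)]
      continuous_on_polar_pull_derivatives[OF C(3)] by (simp_all add: case_prod_unfold)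
  have t: "continuous_on UNIV (\<lambda>x::real \<times> real. tanh (fst x / 2))"
    by (intro continuous_intros) (use cosh_real_pos in \<open>auto simp: less_le\<close>)
  show "((\<lambda>r. polar_pull f r \<theta>) has_vector_derivative polar_pull_r f r \<theta>) (at r)"
    "((\<lambda>\<theta>. polar_pull f r \<theta>) has_vector_derivative polar_pull_t f r \<theta>) (at \<theta>)" for r \<theta>
    by (rule polar_pull_derivatives[OF C(1)])+
  show "((\<lambda>r. polar_pull_r f r \<theta>) has_vector_derivative polar_pull_rr f r \<theta>) (at r)" for r \<theta>
    unfolding polar_pull_r_def[of f] polar_pull_rr_def
  proof (rule has_vector_derivative_mult)
    have "((\<lambda>r. (1 - (tanh (r / 2))\<^sup>2) / 2) has_real_derivative
        - tanh (r / 2) * ((1 - (tanh (r / 2))\<^sup>2) / 2)) (at r)"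
      using DERIV_power[OF tanh_half_derivative[of r], of 2]
      by (auto intro!: derivative_eq_intros simp: power2_eq_square)
    then show "((\<lambda>r. complex_of_real ((1 - (tanh (r / 2))\<^sup>2) / 2)) has_vector_derivative
        of_real (- tanh (r / 2) * ((1 - (tanh (r / 2))\<^sup>2) / 2))) (at r)"
      by (rule has_vector_derivative_of_real)
  qed (intro has_vector_derivative_add has_vector_derivative_mult_right polar_pull_derivatives C)
  show "((\<lambda>\<theta>. polar_pull_t f r \<theta>) has_vector_derivative polar_pull_tt f r \<theta>) (at \<theta>)" for r \<theta>
    unfolding polar_pull_t_def[of f] polar_pull_tt_def
    by (intro has_vector_derivative_mult_right has_vector_derivative_add has_vector_derivative_mult
        has_vector_derivative_of_real polar_pull_derivatives C) (auto intro!: derivative_eq_intros)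
  show "continuous_on UNIV (\<lambda>(r, \<theta>). polar_pull f r \<theta>)" by (rule continuous_on_polar_pull[OF c(1)])
  show "continuous_on UNIV (\<lambda>(r, \<theta>). polar_pull_r f r \<theta>)" "continuous_on UNIV (\<lambda>(r, \<theta>). polar_pull_t f r \<theta>)"
    by (rule continuous_on_polar_pull_derivatives[OF C(1)])+
  show "continuous_on UNIV (\<lambda>(r, \<theta>). polar_pull_rr f r \<theta>)"
    unfolding polar_pull_rr_def case_prod_unfold
    by (intro continuous_on_mult continuous_on_add continuous_on_of_real continuous_on_cos continuous_on_sin
        continuous_on_minus continuous_on_diff continuous_on_power continuous_on_divide continuous_on_const
        continuous_on_snd continuous_on_id cp t) simp_all
  show "continuous_on UNIV (\<lambda>(r, \<theta>). polar_pull_tt f r \<theta>)"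
    unfolding polar_pull_tt_def case_prod_unfold
    by (intro continuous_on_mult continuous_on_add continuous_on_of_real continuous_on_cos continuous_on_sin
        continuous_on_minus continuous_on_snd continuous_on_id cp t)
  show "polar_pull f r (\<theta> + 2 * pi) = polar_pull f r \<theta>" for r \<theta>
    by (simp add: polar_pull_def polar_point_def cis_mult[symmetric])
  fix r \<theta>
  define \<rho> where "\<rho> = complex_of_real (tanh (r / 2))"
  define w where "w = 1 - \<rho> * \<rho>"
  define S H where "S = complex_of_real (sinh r)" and "H = complex_of_real (cosh r)"
  define c q where "c = complex_of_real (cos \<theta>)" and "q = complex_of_real (sin \<theta>)"
  define X Y where "X = polar_pull (partial_x f) r \<theta>" and "Y = polar_pull (partial_y f) r \<theta>"
  define XX XY where "XX = polar_pull (partial_x (partial_x f)) r \<theta>" and "XY = polar_pull (partial_y (partial_x f)) r \<theta>"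
  define YX YY where "YX = polar_pull (partial_x (partial_y f)) r \<theta>" and "YY = polar_pull (partial_y (partial_y f)) r \<theta>"
  have wr: "complex_of_real (1 - (tanh (r / 2))\<^sup>2) = w"
    by (simp add: w_def \<rho>_def power2_eq_square)
  have w0: "w \<noteq> 0" unfolding wr[symmetric] using tanh_half(3)[of r] by (metis of_real_eq_0_iff less_irrefl)
  have Sw: "S * w = 2 * \<rho>" and Hw: "H * w = 1 + \<rho> * \<rho>"
  proof -
    show "S * w = 2 * \<rho>"
      unfolding S_def wr[symmetric] of_real_mult[symmetric] tanh_half(1) by (simp add: \<rho>_def)
    show "H * w = 1 + \<rho> * \<rho>"
      unfolding H_def wr[symmetric] of_real_mult[symmetric] tanh_half(2) by (simp add: \<rho>_def power2_eq_square)
  qed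
  have cq: "c * c + q * q = 1"
  proof -
    have "cos \<theta> * cos \<theta> + sin \<theta> * sin \<theta> = 1"
      using sin_cos_squared_add[of \<theta>] by (simp add: power2_eq_square)
    then have "complex_of_real (cos \<theta> * cos \<theta> + sin \<theta> * sin \<theta>) = of_real 1" by (rule arg_cong)
    then show ?thesis unfolding c_def q_def by (simp only: of_real_mult of_real_add of_real_1)
  qed
  have np: "(norm (polar_point r \<theta>))\<^sup>2 = (tanh (r / 2))\<^sup>2" by (simp add: norm_polar_point)
  have "hyp_laplacian f (polar_point r \<theta>) = - of_real \<mu> * f (polar_point r \<theta>)"
    using f polar_point_ball unfolding hyp_eigenfunction_def by blast
  then have lap: "w * w * (XX + YY) = - 4 * of_real \<mu> * polar_pull f r \<theta>"
    unfolding hyp_laplacian_def np of_real_divide of_real_power wr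
    by (simp add: XX_def YY_def polar_pull_def power2_eq_square)
  have Fr: "polar_pull_r f r \<theta> = w / 2 * (c * X + q * Y)"
    unfolding polar_pull_r_def of_real_divide wr by (simp add: c_def q_def X_def Y_def)
  have Frr: "polar_pull_rr f r \<theta> = w / 2 * (c * (w / 2 * (c * XX + q * XY)) + q * (w / 2 * (c * YX + q * YY)))
     + (- \<rho>) * (w / 2) * (c * X + q * Y)"
    unfolding polar_pull_rr_def polar_pull_r_def of_real_divide of_real_mult of_real_minus wr
    by (simp add: c_def q_def X_def Y_def XX_def XY_def YX_def YY_def \<rho>_def)
  have Ftt: "polar_pull_tt f r \<theta> = \<rho> * ((- q * (\<rho> * (- q * XX + c * XY)) - c * X) + (c * (\<rho> * (- q * YX + c * YY)) - q * Y))"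
    unfolding polar_pull_tt_def polar_pull_t_def
    by (simp add: c_def q_def X_def Y_def XX_def XY_def YX_def YY_def \<rho>_def)
  \<comment> \<open>Multiplication by w = 1 - \<rho>^2 lets sinh and cosh be eliminated through S w
    = 2 \<rho> and H w = 1 + \<rho>^2. The coefficient of the first-order terms then vanishes
    identically, and the second-order terms form the Laplacian.\<close>
  have "w * (S * S * polar_pull_rr f r \<theta> + S * H * polar_pull_r f r \<theta> + of_real \<mu> * (S * S) * polar_pull f r \<theta> + polar_pull_tt f r \<theta>) = 0"
  proof -
    have "w * (S * S * polar_pull_rr f r \<theta> + S * H * polar_pull_r f r \<theta> + of_real \<mu> * (S * S) * polar_pull f r \<theta> + polar_pull_tt f r \<theta>) =
      w * ((S * w) * (S * w) / 4) * (c * c * XX + c * q * (XY + YX) + q * q * YY)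
      + (- \<rho> * ((S * w) * (S * w)) / 2 + (S * w) * (H * w) / 2 - w * \<rho>) * (c * X + q * Y)
      + w * of_real \<mu> * (S * S) * polar_pull f r \<theta>
      + w * (\<rho> * \<rho>) * (q * q * XX - c * q * (XY + YX) + c * c * YY)"
      unfolding Fr Frr Ftt by (simp add: field_simps)
    also have "\<dots> = w * (\<rho> * \<rho>) * ((c * c + q * q) * (XX + YY))
      + (- \<rho> * (2 * \<rho> * (2 * \<rho>)) / 2 + (2 * \<rho>) * (1 + \<rho> * \<rho>) / 2 - w * \<rho>) * (c * X + q * Y)
      + w * of_real \<mu> * (S * S) * polar_pull f r \<theta>"
      unfolding Sw Hw by (simp add: field_simps)
    also have "- \<rho> * (2 * \<rho> * (2 * \<rho>)) / 2 + (2 * \<rho>) * (1 + \<rho> * \<rho>) / 2 - w * \<rho> = 0"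
      by (simp add: w_def field_simps)
    also have "w * (\<rho> * \<rho>) * ((c * c + q * q) * (XX + YY)) + 0 * (c * X + q * Y)
      + w * of_real \<mu> * (S * S) * polar_pull f r \<theta> = 0"
    proof -
      have "w * (w * (\<rho> * \<rho>) * (XX + YY) + w * of_real \<mu> * (S * S) * polar_pull f r \<theta>) =
        (\<rho> * \<rho>) * (w * w * (XX + YY)) + of_real \<mu> * ((S * w) * (S * w)) * polar_pull f r \<theta>"
        by (simp add: algebra_simps)
      also have "\<dots> = 0" unfolding lap Sw by (simp add: algebra_simps)
      finally show ?thesis using w0 by (simp add: cq)
    qed
    finally show ?thesis .
  qed
  then have "S * S * polar_pull_rr f r \<theta> + S * H * polar_pull_r f r \<theta> + of_real \<mu> * (S * S) * polar_pull f r \<theta> + polar_pull_tt f r \<theta> = 0"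
    using w0 by simp
  then show "of_real ((sinh r)\<^sup>2) * polar_pull_rr f r \<theta> + of_real (sinh r * cosh r) * polar_pull_r f r \<theta> +
      of_real (\<mu> * (sinh r)\<^sup>2) * polar_pull f r \<theta> + polar_pull_tt f r \<theta> = 0"
    by (simp add: S_def H_def power2_eq_square)
qed

lemma helgason_density_polar_density:
  assumes "hyp_eigenfunction (of_real \<mu>) f"
  shows "helgason_density f s r = polar_density s (polar_pull f) (polar_pull_r f) r"
proof
  fix \<theta>
  interpret polar_eigenfunction \<mu> "polar_pull f" "polar_pull_r f" "polar_pull_rr f" "polar_pull_t f" "polar_pull_tt f"
    by (rule polar_pull_polar_eigenfunction[OF assms])
  have "normal_deriv f r \<theta> = polar_pull_r f r \<theta>"
    unfolding normal_deriv_def using vector_derivative_at[OF F_r] by (simp add: polar_pull_def)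
  then show "helgason_density f s r \<theta> = polar_density s (polar_pull f) (polar_pull_r f) r \<theta>"
    by (simp add: helgason_density_def polar_density_def polar_pull_def)
qed

text \<open>Cocompactness enters here: f and its gradient are bounded on a compact fundamental
  domain, and the hyperbolic length (1 - |z|^2) |grad f| is invariant. The sum of the moduli of the
  two partial derivatives is invariant only up to the factor 2 that a rotation costs.\<close>

lemma automorphic_gradient_bound:
  assumes \<Gamma>: "cocompact_fuchsian \<Gamma>" and f: "C1_on (ball 0 1) f" and aut: "automorphic \<Gamma> f"
  obtains B where "\<And>z. z \<in> ball 0 1 \<Longrightarrow> norm (f z) \<le> B"
    "\<And>z. z \<in> ball 0 1 \<Longrightarrow> (1 - (norm z)\<^sup>2) * (norm (partial_x f z) + norm (partial_y f z)) \<le> B"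
proof -
  have "\<exists>F. compact F \<and> F \<subseteq> ball 0 1 \<and> F = closure (interior F) \<and>
        (\<Union>\<gamma>\<in>\<Gamma>. \<gamma> ` F) = ball 0 1 \<and>
        (\<forall>\<gamma>\<in>\<Gamma>. \<gamma> \<noteq> \<one>\<^bsub>BijGroup (cball 0 1)\<^esub> \<longrightarrow> \<gamma> ` interior F \<inter> interior F = {})"
    using \<Gamma> unfolding cocompact_fuchsian_def by (elim conjE)
  then obtain F where F: "compact F" "F \<subseteq> ball 0 1" and cover: "(\<Union>\<gamma>\<in>\<Gamma>. \<gamma> ` F) = ball 0 1"
    by (elim exE conjE)
  define N where "N = (\<lambda>z. norm (partial_x f z) + norm (partial_y f z))"
  have cF: "continuous_on F f" "continuous_on F N"
    unfolding N_def
    by (intro continuous_on_add continuous_on_norm continuous_on_subset[OF _ F(2)]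
        C1_on_continuous[OF f] f[unfolded C1_on_def, THEN conjunct2, THEN conjunct1]
        f[unfolded C1_on_def, THEN conjunct2, THEN conjunct2])+
  obtain B1 where B1: "\<And>z. z \<in> F \<Longrightarrow> norm (f z) \<le> B1"
    using compact_imp_bounded[OF compact_continuous_image[OF cF(1) F(1)]] unfolding bounded_iff by blast
  obtain B2 where B2: "\<And>z. z \<in> F \<Longrightarrow> norm (N z) \<le> B2"
    using compact_imp_bounded[OF compact_continuous_image[OF cF(2) F(1)]] unfolding bounded_iff by blast
  have z: "norm (f z) \<le> B1 \<and> (1 - (norm z)\<^sup>2) * N z \<le> 2 * B2" if "z \<in> ball 0 1" for z
  proof -
    have "z \<in> (\<Union>\<gamma>\<in>\<Gamma>. \<gamma> ` F)" unfolding cover by (rule that)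
    then obtain \<gamma> where \<gamma>: "\<gamma> \<in> \<Gamma>" and zF: "z \<in> \<gamma> ` F" by (rule UN_E)
    from zF obtain x where zx: "z = \<gamma> x" and x: "x \<in> F" by (rule imageE)
    obtain a b where g: "disk_auto a b \<gamma>" using fuchsian_disk_auto[OF \<Gamma> \<gamma>] .
    have xb: "x \<in> ball 0 1" "x \<in> cball 0 1" using x F(2) by auto
    have fx: "f z = f x" using aut \<gamma> xb(1) by (simp add: automorphic_def zx)
    define g' where "g' = 1 / (jac a b x)\<^sup>2"
    have d: "(\<gamma> has_field_derivative g') (at x)" using disk_auto_facts(5)[OF g xb(1)] by (simp add: g'_def)
    have hz: "has_partials f (\<gamma> x) (partial_x f z) (partial_y f z)"
      unfolding zx[symmetric] by (rule differentiable_has_partials) (use f that in \<open>auto simp: C1_on_def\<close>)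
    have "has_partials f x (of_real (Re g') * partial_x f z + of_real (Im g') * partial_y f z)
      (- of_real (Im g') * partial_x f z + of_real (Re g') * partial_y f z)"
      unfolding has_partials_def
      by (rule has_derivative_transform_within_open[OF has_partials_compose[OF hz d, unfolded has_partials_def]
            open_ball xb(1)]) (use aut \<gamma> in \<open>auto simp: automorphic_def\<close>)
    then have px: "partial_x f x = of_real (Re g') * partial_x f z + of_real (Im g') * partial_y f z"
      and py: "partial_y f x = - of_real (Im g') * partial_x f z + of_real (Re g') * partial_y f z"
      using has_partialsD by blast+
    have g2: "of_real (Re g') * of_real (Re g') + of_real (Im g') * of_real (Im g') = (of_real ((norm g')\<^sup>2) :: complex)"
      unfolding cmod_power2 by (simp add: power2_eq_square)
    \<comment> \<open>The chain rule expresses the gradient at x by the one at z. The Cauchy-Riemann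
      matrix is inverted by its transpose, up to its determinant |g'|^2.\<close>
    have "of_real ((norm g')\<^sup>2) * partial_x f z = of_real (Re g') * partial_x f x - of_real (Im g') * partial_y f x"
      unfolding px py g2[symmetric] by (simp add: algebra_simps)
    then have "(norm g')\<^sup>2 * norm (partial_x f z) = norm (of_real (Re g') * partial_x f x - of_real (Im g') * partial_y f x)"
      by (metis norm_mult norm_of_real abs_of_nonneg zero_le_power2)
    also have "\<dots> \<le> norm g' * norm (partial_x f x) + norm g' * norm (partial_y f x)"
      by (intro norm_triangle_le_diff add_mono) (auto simp: norm_mult intro!: mult_right_mono abs_Re_le_cmod abs_Im_le_cmod)
    finally have 1: "(norm g')\<^sup>2 * norm (partial_x f z) \<le> norm g' * N x" by (simp add: N_def distrib_left)
    have "of_real ((norm g')\<^sup>2) * partial_y f z = of_real (Im g') * partial_x f x + of_real (Re g') * partial_y f x"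
      unfolding px py g2[symmetric] by (simp add: algebra_simps)
    then have "(norm g')\<^sup>2 * norm (partial_y f z) = norm (of_real (Im g') * partial_x f x + of_real (Re g') * partial_y f x)"
      by (metis norm_mult norm_of_real abs_of_nonneg zero_le_power2)
    also have "\<dots> \<le> norm g' * norm (partial_x f x) + norm g' * norm (partial_y f x)"
      by (intro norm_triangle_le add_mono) (auto simp: norm_mult intro!: mult_right_mono abs_Re_le_cmod abs_Im_le_cmod)
    finally have 2: "(norm g')\<^sup>2 * norm (partial_y f z) \<le> norm g' * N x" by (simp add: N_def distrib_left)
    have g'0: "0 < norm g'" using disk_auto_open[OF g xb(1)] by (simp add: g'_def)
    have "norm g' * (norm g' * N z) \<le> norm g' * (2 * N x)"
    proof -
      have "norm g' * (norm g' * N z) = (norm g')\<^sup>2 * norm (partial_x f z) + (norm g')\<^sup>2 * norm (partial_y f z)"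
        by (simp add: N_def power2_eq_square distrib_left mult.assoc)
      also have "\<dots> \<le> norm g' * N x + norm g' * N x" using 1 2 by (rule add_mono)
      finally show ?thesis by (simp only: mult_2 distrib_left)
    qed
    then have 3: "norm g' * N z \<le> 2 * N x" using g'0 by simp
    have "1 - (norm z)\<^sup>2 = (1 - (norm x)\<^sup>2) * norm g'"
      unfolding zx disk_auto_facts(1)[OF g xb(2)] g'_def by (simp add: norm_divide norm_power)
    then have "(1 - (norm z)\<^sup>2) * N z = (1 - (norm x)\<^sup>2) * (norm g' * N z)" by simp
    also have "\<dots> \<le> 1 * (2 * B2)"
    proof (rule mult_mono)
      show "norm g' * N z \<le> 2 * B2" using 3 B2[OF x] by simp
      show "0 \<le> norm g' * N z" by (simp add: N_def)
    qed simp_all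
    finally show ?thesis using B1[OF x] fx by simp
  qed
  show ?thesis
  proof (rule that)
    show "norm (f z) \<le> max B1 (2 * B2)" if "z \<in> ball 0 1" for z
      using z[OF that] by (auto intro: max.coboundedI1)
    show "(1 - (norm z)\<^sup>2) * (norm (partial_x f z) + norm (partial_y f z)) \<le> max B1 (2 * B2)"
      if "z \<in> ball 0 1" for z using z[OF that] by (auto simp: N_def intro: max.coboundedI2)
  qed
qed

lemma polar_pull_bounds:
  assumes B: "\<And>z. z \<in> ball 0 1 \<Longrightarrow> norm (f z) \<le> B"
    "\<And>z. z \<in> ball 0 1 \<Longrightarrow> (1 - (norm z)\<^sup>2) * (norm (partial_x f z) + norm (partial_y f z)) \<le> B"
    and r: "0 < r"
  shows "norm (polar_pull f r \<theta>) \<le> B" "norm (polar_pull_t f r \<theta>) \<le> B * sinh r"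
proof -
  let ?z = "polar_point r \<theta>"
  let ?N = "norm (partial_x f ?z) + norm (partial_y f ?z)"
  define \<rho> where "\<rho> = tanh (r / 2)"
  show "norm (polar_pull f r \<theta>) \<le> B" unfolding polar_pull_def by (rule B(1)[OF polar_point_ball])
  have \<rho>: "0 \<le> \<rho>" using r by (simp add: \<rho>_def)
  have w: "(1 - \<rho>\<^sup>2) * ?N \<le> B" using B(2)[OF polar_point_ball[of r \<theta>]] by (simp add: norm_polar_point \<rho>_def)
  have "norm (polar_pull_t f r \<theta>) \<le> \<rho> * ?N"
    unfolding polar_pull_t_def norm_mult polar_pull_def \<rho>_def[symmetric] norm_of_real abs_of_nonneg[OF \<rho>]
    by (intro mult_left_mono[OF _ \<rho>] norm_triangle_le add_mono)
      (auto simp: norm_mult intro!: mult_left_le_one_le)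
  also have "\<rho> * ?N = sinh r / 2 * ((1 - \<rho>\<^sup>2) * ?N)"
    using tanh_half(1)[of r] unfolding \<rho>_def[symmetric] by simp
  also have "\<dots> \<le> sinh r / 2 * B" using r by (intro mult_left_mono w) auto
  also have "\<dots> \<le> B * sinh r"
  proof -
    have "0 \<le> B" using order_trans[OF norm_ge_zero B(1)[OF polar_point_ball[of r \<theta>]]] .
    then show ?thesis using r by (simp add: mult_ac)
  qed
  finally show "norm (polar_pull_t f r \<theta>) \<le> B * sinh r" .
qed

subsection \<open>The Poisson representation\<close>

lemma radial_solution_lincomb:
  assumes K: "radial_solution \<mu> n K K' K''" and L: "radial_solution \<mu> n L L' L''"
  shows "radial_solution \<mu> n (\<lambda>r. K r - c * L r) (\<lambda>r. K' r - c * L' r) (\<lambda>r. K'' r - c * L'' r)"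
  unfolding radial_solution_def
proof (intro conjI allI)
  fix r
  show "((\<lambda>r. K r - c * L r) has_vector_derivative K' r - c * L' r) (at r)"
    by (rule has_vector_derivative_diff[OF radial_solutionD(1)[OF K]
        has_vector_derivative_mult_right[OF radial_solutionD(1)[OF L]]])
  show "((\<lambda>r. K' r - c * L' r) has_vector_derivative K'' r - c * L'' r) (at r)"
    by (rule has_vector_derivative_diff[OF radial_solutionD(2)[OF K]
        has_vector_derivative_mult_right[OF radial_solutionD(2)[OF L]]])
  have eq: "of_real ((sinh r)\<^sup>2) * K'' r + of_real (sinh r * cosh r) * K' r + of_real (\<mu> * (sinh r)\<^sup>2 - n\<^sup>2) * K r = 0"
    "of_real ((sinh r)\<^sup>2) * L'' r + of_real (sinh r * cosh r) * L' r + of_real (\<mu> * (sinh r)\<^sup>2 - n\<^sup>2) * L r = 0"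
    using K L unfolding radial_solution_def by blast+
  have "of_real ((sinh r)\<^sup>2) * (K'' r - c * L'' r) + of_real (sinh r * cosh r) * (K' r - c * L' r) +
      of_real (\<mu> * (sinh r)\<^sup>2 - n\<^sup>2) * (K r - c * L r) =
    (of_real ((sinh r)\<^sup>2) * K'' r + of_real (sinh r * cosh r) * K' r + of_real (\<mu> * (sinh r)\<^sup>2 - n\<^sup>2) * K r)
    - c * (of_real ((sinh r)\<^sup>2) * L'' r + of_real (sinh r * cosh r) * L' r + of_real (\<mu> * (sinh r)\<^sup>2 - n\<^sup>2) * L r)"
    by (simp only: right_diff_distrib distrib_left mult.left_commute) simp
  then show "of_real ((sinh r)\<^sup>2) * (K'' r - c * L'' r) + of_real (sinh r * cosh r) * (K' r - c * L' r) +
      of_real (\<mu> * (sinh r)\<^sup>2 - n\<^sup>2) * (K r - c * L r) = 0" unfolding eq by simp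
next
  show "continuous_on UNIV (\<lambda>r. K'' r - c * L'' r)"
    using K L by (auto simp: radial_solution_def intro!: continuous_on_diff continuous_on_mult continuous_on_const)
qed

lemma integral_periodic_shift:
  fixes k :: "real \<Rightarrow> complex"
  assumes c: "continuous_on UNIV k" and p: "\<And>x. k (x + 2 * pi) = k x"
  shows "integral {0..2 * pi} (\<lambda>\<theta>. k (\<theta> - \<eta>)) = integral {0..2 * pi} k"
proof -
  \<comment> \<open>The antiderivative lives on a compact interval, which has to contain 0, -\<eta>
    and their translates by 2 pi.\<close>
  define N where "N = \<bar>\<eta>\<bar> + 2 * pi"
  obtain A where A: "\<And>x. x \<in> {-N..N + 2 * pi} \<Longrightarrow> (A has_vector_derivative k x) (at x within {-N..N + 2 * pi})"
    using antiderivative_continuous[OF continuous_on_subset[OF c subset_UNIV]] by blast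
  have int: "integral {x..x + 2 * pi} k = A (x + 2 * pi) - A x" if "x \<in> {-N..N}" for x
  proof (rule integral_unique, rule fundamental_theorem_of_calculus)
    fix y assume "y \<in> {x..x + 2 * pi}"
    then show "(A has_vector_derivative k y) (at y within {x..x + 2 * pi})"
      by (intro has_vector_derivative_within_subset[OF A]) (use that pi_gt_zero in auto)
  qed simp
  have const: "\<exists>c. \<forall>x\<in>{-N..N}. A (x + 2 * pi) - A x = c"
  proof (rule has_derivative_zero_constant)
    fix x assume "x \<in> {-N..N}"
    moreover have "0 < 2 * pi" by simp
    ultimately have x: "x \<in> {-N..N + 2 * pi}" "x + 2 * pi \<in> {-N..N + 2 * pi}" "{-N..N} \<subseteq> {-N..N + 2 * pi}"
      unfolding atLeastAtMost_iff subset_iff by (linarith | (safe, linarith))+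
    have img: "(\<lambda>x. x + 2 * pi) ` {-N..N} \<subseteq> {-N..N + 2 * pi}"
    proof (rule image_subsetI)
      fix y assume "y \<in> {-N..N}"
      then show "y + 2 * pi \<in> {-N..N + 2 * pi}" using pi_gt_zero unfolding atLeastAtMost_iff by linarith
    qed
    have 1: "(A has_vector_derivative k x) (at x within {-N..N})"
      by (rule has_vector_derivative_within_subset[OF A]) (rule x)+
    have t: "((\<lambda>x. x + 2 * pi) has_vector_derivative 1) (at x within {-N..N})"
      by (auto intro!: derivative_eq_intros simp: has_real_derivative_iff_has_vector_derivative[symmetric])
    have "(A has_vector_derivative k (x + 2 * pi)) (at (x + 2 * pi) within (\<lambda>x. x + 2 * pi) ` {-N..N})"
      by (rule has_vector_derivative_within_subset[OF A]) (rule x img)+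
    from vector_diff_chain_within[OF t this]
    have "((\<lambda>x. A (x + 2 * pi)) has_vector_derivative k x) (at x within {-N..N})"
      by (simp add: o_def p)
    from has_vector_derivative_diff[OF this 1]
    show "((\<lambda>x. A (x + 2 * pi) - A x) has_derivative (\<lambda>h. 0)) (at x within {-N..N})"
      by (simp add: has_vector_derivative_def)
  qed simp
  have mem: "- \<eta> \<in> {-N..N}" "0 \<in> {-N..N}" using pi_gt_zero unfolding N_def atLeastAtMost_iff by linarith+
  then have "A (- \<eta> + 2 * pi) - A (- \<eta>) = A (0 + 2 * pi) - A 0" using const by metis
  then have eq: "integral {- \<eta>..- \<eta> + 2 * pi} k = integral {0..0 + 2 * pi} k"
    unfolding int[OF mem(1)] int[OF mem(2)] .
  have "integral {0..2 * pi} (\<lambda>\<theta>. k (\<theta> - \<eta>)) = integral {0..2 * pi} (k \<circ> (\<lambda>x. x + (- \<eta>)))"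
    by (simp add: o_def)
  also have "\<dots> = integral {0 + (- \<eta>)..2 * pi + (- \<eta>)} k"
    by (rule integral_shift[OF continuous_on_subset[OF c subset_UNIV]])
  also have "0 + (- \<eta>) = - \<eta>" by simp
  also have "2 * pi + (- \<eta>) = - \<eta> + 2 * pi" by simp
  finally show ?thesis unfolding eq by simp
qed

definition poisson :: "complex \<Rightarrow> (real \<Rightarrow> complex) \<Rightarrow> real \<Rightarrow> real \<Rightarrow> complex" where
  "poisson s G r \<theta> = stieltjes 0 (2 * pi) (\<lambda>\<eta>. poisson_kernel s r (\<theta> - \<eta>)) G"

lemma poisson_kernel_periodic: "poisson_kernel s r (\<theta> + 2 * pi) = poisson_kernel s r \<theta>" "poisson_kernel_t s r (\<theta> + 2 * pi) = poisson_kernel_t s r \<theta>"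
  by (simp_all add: poisson_kernel_t_def poisson_kernel_def poisson_denom_def)

lemma poisson_kernel_shifted_derivative:
  "((\<lambda>\<eta>. poisson_kernel s r (\<theta> - \<eta>)) has_vector_derivative - poisson_kernel_t s r (\<theta> - \<eta>)) (at \<eta>)"
proof -
  have "((\<lambda>\<eta>. \<theta> - \<eta>) has_vector_derivative - 1) (at \<eta>)"
    unfolding has_real_derivative_iff_has_vector_derivative[symmetric]
    by (auto intro!: derivative_eq_intros)
  from vector_diff_chain_at[OF this poisson_kernel_derivatives(2)] show ?thesis by (simp add: o_def)
qed

lemma continuous_on_poisson_kernel_shifted:
  "continuous_on S (\<lambda>x. poisson_kernel s r (fst x - snd x))" "continuous_on S (\<lambda>x. poisson_kernel_t s r (fst x - snd x))"
proof -
  have c: "continuous_on S (\<lambda>x. fst x - snd x :: real)" by (intro continuous_intros)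
  show "continuous_on S (\<lambda>x. poisson_kernel s r (fst x - snd x))"
    by (rule continuous_on_compose2[OF continuous_on_slice(1)[OF continuous_on_poisson_kernel] c, of UNIV]) simp
  show "continuous_on S (\<lambda>x. poisson_kernel_t s r (fst x - snd x))"
    by (rule continuous_on_compose2[OF continuous_on_slice(1)[OF continuous_on_poisson_kernel_derivatives(2)] c, of UNIV]) simp
qed

lemma poisson_kernel_shifted_C1: "(\<lambda>\<eta>. poisson_kernel s r (\<theta> - \<eta>)) C1_differentiable_on S"
proof (rule C1_I[OF poisson_kernel_shifted_derivative])
  have "continuous_on S (\<lambda>\<eta>. (\<theta>, \<eta>))" by (intro continuous_on_Pair continuous_on_const continuous_on_id)
  from continuous_on_compose2[OF continuous_on_poisson_kernel_shifted(2) this subset_refl]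
  show "continuous_on S (\<lambda>\<eta>. - poisson_kernel_t s r (\<theta> - \<eta>))" by (intro continuous_on_minus) simp
qed

lemma cis_C1: "(\<lambda>\<eta>. cis (a * \<eta>)) C1_differentiable_on S"
  by (rule C1_I[OF has_vector_derivative_cis]) (intro continuous_intros)

lemma fourier_poisson_kernel_t:
  "fourier (poisson_kernel_t s) n r = \<i> * of_int n * fourier (poisson_kernel s) n r"
proof -
  let ?c = "\<lambda>\<theta>. cis (- of_int n * \<theta>)"
  define a where "a = \<i> * of_real (- of_int n)"
  have i: "(\<lambda>\<theta>. ?c \<theta> * poisson_kernel_t s r \<theta>) integrable_on {0..2 * pi}" "(\<lambda>\<theta>. ?c \<theta> * poisson_kernel s r \<theta>) integrable_on {0..2 * pi}"
    by (intro integrable_continuous_real continuous_on_mult continuous_intros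
        continuous_on_slice(1)[OF continuous_on_poisson_kernel] continuous_on_slice(1)[OF continuous_on_poisson_kernel_derivatives(2)])+
  have "((\<lambda>\<theta>. ?c \<theta> * poisson_kernel_t s r \<theta> + (a * ?c \<theta>) * poisson_kernel s r \<theta>) has_integral
      ?c (2 * pi) * poisson_kernel s r (2 * pi) - ?c 0 * poisson_kernel s r 0) {0..2 * pi}"
    unfolding a_def
    by (rule fundamental_theorem_of_calculus, simp, rule has_vector_derivative_at_within,
        rule has_vector_derivative_mult[OF has_vector_derivative_cis poisson_kernel_derivatives(2)])
  moreover have "?c (2 * pi) = 1" using cis_multiple_2pi[of "- of_int n"] by (simp add: mult_ac)
  moreover have "poisson_kernel s r (2 * pi) = poisson_kernel s r 0" using poisson_kernel_periodic(1)[of s r 0] by simp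
  ultimately have z: "((\<lambda>\<theta>. ?c \<theta> * poisson_kernel_t s r \<theta> + (a * ?c \<theta>) * poisson_kernel s r \<theta>) has_integral 0) {0..2 * pi}"
    by simp
  have "((\<lambda>\<theta>. ?c \<theta> * poisson_kernel_t s r \<theta> + a * (?c \<theta> * poisson_kernel s r \<theta>)) has_integral
      fourier (poisson_kernel_t s) n r + a * fourier (poisson_kernel s) n r) {0..2 * pi}"
    unfolding fourier_def
    by (intro has_integral_add has_integral_mult_right integrable_integral i)
  from has_integral_unique[OF this z[unfolded mult.assoc]]
  show ?thesis by (simp add: a_def)
qed

text \<open>The Poisson transform is the convolution of dG with the kernel, so Fourier coefficients
  multiply. G itself is periodic only up to the increment \<kappa>; the product therefore contains
  the Stieltjes coefficient of dG, not a coefficient of G.\<close>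

lemma fourier_poisson:
  assumes G: "continuous_on UNIV G" and per: "\<And>\<theta>. G (\<theta> + 2 * pi) = G \<theta> + \<kappa>"
  shows "fourier (poisson s G) n r = stieltjes 0 (2 * pi) (\<lambda>\<eta>. cis (- of_int n * \<eta>)) G * fourier (poisson_kernel s) n r"
    and "continuous_on UNIV (poisson s G r)" and "poisson s G r (\<theta> + 2 * pi) = poisson s G r \<theta>"
proof -
  let ?c = "\<lambda>\<theta>. cis (- of_int n * \<theta>)"
  have G2: "G (2 * pi) = G 0 + \<kappa>" using per[of 0] by simp
  have p2: "poisson_kernel s r (\<theta> - 2 * pi) = poisson_kernel s r \<theta>" for \<theta> using poisson_kernel_periodic(1)[of s r "\<theta> - 2 * pi"] by simp
  \<comment> \<open>The kernel is periodic, so the boundary terms of the Stieltjes integral collapse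
    to \<kappa> times the kernel.\<close>
  have eq: "poisson s G r \<theta> = \<kappa> * poisson_kernel s r \<theta> + integral {0..2 * pi} (\<lambda>\<eta>. poisson_kernel_t s r (\<theta> - \<eta>) * G \<eta>)" for \<theta>
  proof -
    have "poisson s G r \<theta> = poisson_kernel s r (\<theta> - 2 * pi) * G (2 * pi) - poisson_kernel s r (\<theta> - 0) * G 0 -
        integral {0..2 * pi} (\<lambda>\<eta>. - poisson_kernel_t s r (\<theta> - \<eta>) * G \<eta>)"
      unfolding poisson_def by (rule stieltjes_eq[OF poisson_kernel_shifted_derivative])
    then show ?thesis unfolding p2 G2 by (simp add: algebra_simps)
  qed
  have cont2: "continuous_on S (\<lambda>x. poisson_kernel_t s r (fst x - snd x) * G (snd x))" for S
    by (intro continuous_on_mult continuous_on_poisson_kernel_shifted continuous_on_compose2[OF G] continuous_on_snd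
        continuous_on_id) simp
  have ci: "continuous_on UNIV (\<lambda>\<theta>. integral {0..2 * pi} (\<lambda>\<eta>. poisson_kernel_t s r (\<theta> - \<eta>) * G \<eta>))"
    using integral_continuous_on_param[of UNIV 0 "2 * pi" "\<lambda>\<theta> \<eta>. poisson_kernel_t s r (\<theta> - \<eta>) * G \<eta>"] cont2
    by (simp add: case_prod_unfold)
  show "continuous_on UNIV (poisson s G r)"
    unfolding eq[abs_def]
    by (intro continuous_on_add continuous_on_mult continuous_on_const ci continuous_on_slice(1)[OF continuous_on_poisson_kernel])
  show "poisson s G r (\<theta> + 2 * pi) = poisson s G r \<theta>"
  proof -
    have "poisson_kernel s r (\<theta> + 2 * pi - \<eta>) = poisson_kernel s r (\<theta> - \<eta>)" for \<eta>
      using poisson_kernel_periodic(1)[of s r "\<theta> - \<eta>"] by (simp add: algebra_simps)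
    then show ?thesis by (simp add: poisson_def)
  qed
  have i1: "(\<lambda>\<theta>. ?c \<theta> * poisson_kernel s r \<theta>) integrable_on {0..2 * pi}"
    by (intro integrable_continuous_real continuous_on_mult continuous_intros
        continuous_on_slice(1)[OF continuous_on_poisson_kernel])
  have i2: "(\<lambda>\<theta>. ?c \<theta> * integral {0..2 * pi} (\<lambda>\<eta>. poisson_kernel_t s r (\<theta> - \<eta>) * G \<eta>)) integrable_on {0..2 * pi}"
    by (rule integrable_continuous_real, rule continuous_on_mult, intro continuous_intros,
        rule continuous_on_subset[OF ci subset_UNIV])
  have inner: "integral {0..2 * pi} (\<lambda>\<theta>. ?c \<theta> * (poisson_kernel_t s r (\<theta> - \<eta>) * G \<eta>)) =
      (?c \<eta> * G \<eta>) * fourier (poisson_kernel_t s) n r" for \<eta>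
  proof -
    define k where "k = (\<lambda>x. ?c x * poisson_kernel_t s r x)"
    have kc: "continuous_on UNIV k" unfolding k_def
      by (intro continuous_on_mult continuous_intros continuous_on_slice(1)[OF continuous_on_poisson_kernel_derivatives(2)])
    have kp: "k (x + 2 * pi) = k x" for x
    proof -
      have "?c (x + 2 * pi) = ?c x * cis (2 * pi * (- of_int n))"
        unfolding cis_mult by (simp add: algebra_simps)
      then show ?thesis using cis_multiple_2pi[of "- of_int n"] by (simp add: k_def poisson_kernel_periodic)
    qed
    have fac: "?c \<theta> * (poisson_kernel_t s r (\<theta> - \<eta>) * G \<eta>) = (?c \<eta> * G \<eta>) * k (\<theta> - \<eta>)" for \<theta>
    proof -
      have "?c \<theta> = ?c \<eta> * ?c (\<theta> - \<eta>)" unfolding cis_mult by (simp add: algebra_simps)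
      then show ?thesis by (simp add: k_def mult_ac)
    qed
    have "integral {0..2 * pi} (\<lambda>\<theta>. ?c \<theta> * (poisson_kernel_t s r (\<theta> - \<eta>) * G \<eta>)) =
       (?c \<eta> * G \<eta>) * integral {0..2 * pi} (\<lambda>\<theta>. k (\<theta> - \<eta>))"
      unfolding fac by (rule integral_mult_right)
    also have "integral {0..2 * pi} (\<lambda>\<theta>. k (\<theta> - \<eta>)) = fourier (poisson_kernel_t s) n r"
      unfolding integral_periodic_shift[OF kc kp] by (simp add: k_def fourier_def)
    finally show ?thesis .
  qed
  have swap: "integral {0..2 * pi} (\<lambda>\<theta>. ?c \<theta> * integral {0..2 * pi} (\<lambda>\<eta>. poisson_kernel_t s r (\<theta> - \<eta>) * G \<eta>)) =
     integral {0..2 * pi} (\<lambda>\<eta>. ?c \<eta> * G \<eta>) * fourier (poisson_kernel_t s) n r"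
  proof -
    have "integral (cbox 0 (2 * pi)) (\<lambda>\<theta>. integral (cbox 0 (2 * pi)) (\<lambda>\<eta>. ?c \<theta> * (poisson_kernel_t s r (\<theta> - \<eta>) * G \<eta>))) =
      integral (cbox 0 (2 * pi)) (\<lambda>\<eta>. integral (cbox 0 (2 * pi)) (\<lambda>\<theta>. ?c \<theta> * (poisson_kernel_t s r (\<theta> - \<eta>) * G \<eta>)))"
    proof (rule integral_swap_continuous)
      have "continuous_on S (\<lambda>x. ?c (fst x) * (poisson_kernel_t s r (fst x - snd x) * G (snd x)))" for S
        by (intro continuous_on_mult cont2 continuous_intros)
      then show "continuous_on (cbox (0, 0) (2 * pi, 2 * pi)) (\<lambda>(\<theta>, \<eta>). ?c \<theta> * (poisson_kernel_t s r (\<theta> - \<eta>) * G \<eta>))"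
        by (simp add: case_prod_unfold)
    qed
    then show ?thesis by (simp only: inner integral_mult_right integral_mult_left interval_cbox[symmetric])
  qed
  have "fourier (poisson s G) n r = integral {0..2 * pi} (\<lambda>\<theta>. \<kappa> * (?c \<theta> * poisson_kernel s r \<theta>) +
      ?c \<theta> * integral {0..2 * pi} (\<lambda>\<eta>. poisson_kernel_t s r (\<theta> - \<eta>) * G \<eta>))"
    unfolding fourier_def eq by (simp only: distrib_left mult.left_commute)
  also have "\<dots> = integral {0..2 * pi} (\<lambda>\<theta>. \<kappa> * (?c \<theta> * poisson_kernel s r \<theta>)) +
      integral {0..2 * pi} (\<lambda>\<theta>. ?c \<theta> * integral {0..2 * pi} (\<lambda>\<eta>. poisson_kernel_t s r (\<theta> - \<eta>) * G \<eta>))"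
    by (rule integral_add[OF integrable_on_mult_right[OF i1] i2])
  also have "integral {0..2 * pi} (\<lambda>\<theta>. \<kappa> * (?c \<theta> * poisson_kernel s r \<theta>)) = \<kappa> * fourier (poisson_kernel s) n r"
    unfolding fourier_def by (rule integral_mult_right)
  also note swap
  finally have F: "fourier (poisson s G) n r = \<kappa> * fourier (poisson_kernel s) n r +
      integral {0..2 * pi} (\<lambda>\<eta>. ?c \<eta> * G \<eta>) * (\<i> * of_int n * fourier (poisson_kernel s) n r)" unfolding fourier_poisson_kernel_t .
  have "stieltjes 0 (2 * pi) ?c G = ?c (2 * pi) * G (2 * pi) - ?c 0 * G 0 -
      integral {0..2 * pi} (\<lambda>\<eta>. (\<i> * of_real (- of_int n) * ?c \<eta>) * G \<eta>)"
    by (rule stieltjes_eq[OF has_vector_derivative_cis])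
  also have "?c (2 * pi) = 1" using cis_multiple_2pi[of "- of_int n"] by (simp add: mult_ac)
  also have "integral {0..2 * pi} (\<lambda>\<eta>. (\<i> * of_real (- of_int n) * ?c \<eta>) * G \<eta>) =
      (\<i> * of_real (- of_int n)) * integral {0..2 * pi} (\<lambda>\<eta>. ?c \<eta> * G \<eta>)"
    by (simp only: mult.assoc integral_mult_right)
  finally have "stieltjes 0 (2 * pi) ?c G = \<kappa> + \<i> * of_int n * integral {0..2 * pi} (\<lambda>\<eta>. ?c \<eta> * G \<eta>)"
    by (simp add: G2)
  then show "fourier (poisson s G) n r = stieltjes 0 (2 * pi) ?c G * fourier (poisson_kernel s) n r"
    unfolding F by (simp add: distrib_left distrib_right mult_ac)
qed

lemma continuous_on_quasiperiodic:
  fixes G :: "real \<Rightarrow> complex"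
  assumes c: "continuous_on {0..2 * pi} G" and per: "\<And>\<theta>. G (\<theta> + 2 * pi) = G \<theta> + \<kappa>"
  shows "continuous_on UNIV G"
proof -
  have cm: "continuous_on {2 * pi * of_int m..2 * pi * of_int (m + 1)} G" for m :: int
  proof -
    have "G x = G (x - 2 * pi * of_int m) + of_int m * \<kappa>" for x
      using periodic_of_int[of G \<kappa> "x - 2 * pi * of_int m" m] per by simp
    moreover have "continuous_on {2 * pi * of_int m..2 * pi * of_int (m + 1)} (\<lambda>x. G (x - 2 * pi * of_int m))"
      by (rule continuous_on_compose2[OF c]) (auto intro!: continuous_intros simp: algebra_simps)
    ultimately show ?thesis by (metis (no_types, lifting) continuous_on_add continuous_on_const continuous_on_cong)
  qed
  show ?thesis
  proof (rule continuous_at_imp_continuous_on, rule ballI)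
    fix x :: real
    define m where "m = \<lfloor>x / (2 * pi)\<rfloor>"
    have "of_int m \<le> x / (2 * pi)" "x / (2 * pi) < of_int m + 1" unfolding m_def by linarith+
    then have x: "2 * pi * of_int m \<le> x" "x < 2 * pi * of_int (m + 1)" by (simp_all add: field_simps)
    have mm: "m - 1 + 1 = m" by simp
    have "continuous_on ({2 * pi * of_int (m - 1)..2 * pi * of_int m} \<union> {2 * pi * of_int m..2 * pi * of_int (m + 1)}) G"
      using cm[of "m - 1", unfolded mm] cm[of m] by (intro continuous_on_closed_Un) auto
    then have "continuous_on {2 * pi * of_int (m - 1)<..<2 * pi * of_int (m + 1)} G"
      by (rule continuous_on_subset) auto
    moreover have "2 * pi * of_int (m - 1) < x"
    proof -
      have "2 * pi * of_int (m - 1) < 2 * pi * of_int m" by (intro mult_strict_left_mono) auto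
      then show ?thesis using x by linarith
    qed
    ultimately show "isCont G x" using x continuous_on_interior[of "{2 * pi * of_int (m - 1)<..<2 * pi * of_int (m + 1)}" G x]
      by (simp add: interior_open)
  qed
qed

section \<open>The constant c(s), the primitive of the distribution and its Poisson
  transform\<close>

context
  fixes s :: complex and t \<mu> :: real
  assumes s: "s = 1/2 + \<i> * of_real t" and \<mu>: "\<mu> = 1/4 + t\<^sup>2"
begin

interpretation poisson_kernel: polar_eigenfunction \<mu> "poisson_kernel s" "poisson_kernel_r s" "poisson_kernel_rr s" "poisson_kernel_t s" "poisson_kernel_tt s"
  by (rule poisson_kernel_polar_eigenfunction[OF spectral_parameter(1)[OF s \<mu>]])

text \<open>Mean value property: both sides are regular solutions of the radial equation for n = 0
  with the same value at r = 0.\<close>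

lemma fourier_mean_value:
  assumes f: "hyp_eigenfunction (of_real \<mu>) f" and r: "0 \<le> r"
  shows "fourier (polar_pull f) 0 r = f 0 * fourier (poisson_kernel s) 0 r"
proof -
  interpret F: polar_eigenfunction \<mu> "polar_pull f" "polar_pull_r f" "polar_pull_rr f" "polar_pull_t f" "polar_pull_tt f"
    by (rule polar_pull_polar_eigenfunction[OF f])
  have K: "radial_solution \<mu> 0 (\<lambda>r. fourier (polar_pull f) 0 r - f 0 * fourier (poisson_kernel s) 0 r)
     (\<lambda>r. fourier (polar_pull_r f) 0 r - f 0 * fourier (poisson_kernel_r s) 0 r) (\<lambda>r. fourier (polar_pull_rr f) 0 r - f 0 * fourier (poisson_kernel_rr s) 0 r)"
    using radial_solution_lincomb[OF F.fourier_radial_solution[of 0] poisson_kernel.fourier_radial_solution[of 0]] by simp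
  have "fourier (polar_pull f) 0 0 - f 0 * fourier (poisson_kernel s) 0 0 = 0"
    by (simp add: fourier_def poisson_kernel_at_0 polar_pull_def polar_point_def scaleR_conv_of_real)
  from radial_solution_unique[OF K spectral_parameter(3)[OF s \<mu>] this r] show ?thesis by simp
qed

text \<open>By the mean value property the mass on every circle is f(0) times that of the Poisson
  kernel, which tends to c(s). Derivatives in r are compared too, as the density contains
  one.\<close>

lemma mass_limit:
  assumes f: "hyp_eigenfunction (of_real \<mu>) f"
  shows "((\<lambda>r. integral {0..2 * pi} (helgason_density f s r)) \<longlongrightarrow> f 0 * otal_const s) at_top"
proof -
  interpret F: polar_eigenfunction \<mu> "polar_pull f" "polar_pull_r f" "polar_pull_rr f" "polar_pull_t f" "polar_pull_tt f"
    by (rule polar_pull_polar_eigenfunction[OF f])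
  have eq: "integral {0..2 * pi} (helgason_density f s r) = f 0 * fourier (polar_density s (poisson_kernel s) (poisson_kernel_r s)) 0 r"
    if r: "0 < r" for r
  proof -
    have "fourier (polar_pull_r f) 0 r = f 0 * fourier (poisson_kernel_r s) 0 r"
    proof (rule vector_derivative_unique_at)
      show "(fourier (polar_pull f) 0 has_vector_derivative fourier (polar_pull_r f) 0 r) (at r)"
        using radial_solutionD(1)[OF F.fourier_radial_solution] .
      have "((\<lambda>r. f 0 * fourier (poisson_kernel s) 0 r) has_vector_derivative f 0 * fourier (poisson_kernel_r s) 0 r) (at r)"
        by (rule has_vector_derivative_mult_right[OF radial_solutionD(1)[OF poisson_kernel.fourier_radial_solution]])
      then show "(fourier (polar_pull f) 0 has_vector_derivative f 0 * fourier (poisson_kernel_r s) 0 r) (at r)"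
        by (rule has_vector_derivative_transform_within_open[of _ _ _ "{0<..}"])
          (use r fourier_mean_value[OF f] in auto)
    qed
    then have "fourier (polar_density s (polar_pull f) (polar_pull_r f)) 0 r = f 0 * fourier (polar_density s (poisson_kernel s) (poisson_kernel_r s)) 0 r"
      unfolding F.fourier_polar_density poisson_kernel.fourier_polar_density radial_density_def
      using fourier_mean_value[OF f, of r] r by (simp add: algebra_simps)
    then show ?thesis
      unfolding helgason_density_polar_density[OF f] fourier_0[OF s \<mu>] .
  qed
  have "((\<lambda>r. f 0 * fourier (polar_density s (poisson_kernel s) (poisson_kernel_r s)) 0 r) \<longlongrightarrow> f 0 * otal_const s) at_top"
    by (intro tendsto_intros otal_const_limit_0[OF s \<mu>])
  then show ?thesis
    by (rule Lim_transform_eventually)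
      (use eventually_gt_at_top[of 0] in eventually_elim, simp add: eq)
qed

text \<open>\<open>mass_limit\<close> shows that \<open>otal_const s\<close> satisfies the
  description behind \<open>helgason_const\<close>. Uniqueness comes from the given h: an
  eigenfunction with h(0) = 0 would put no condition on c.\<close>

lemma helgason_const_eq:
  assumes h: "hyp_eigenfunction (s * (1 - s)) h" "bounded (h ` ball 0 1)" "h 0 \<noteq> 0"
  shows "helgason_const s = otal_const s"
  unfolding helgason_const_def
proof (rule the_equality)
  note c0 = otal_const_nonzero[OF s \<mu>] and par = spectral_parameter(1)[OF s \<mu>]
  have lim: "((\<lambda>r. (1 / c) * integral {0..2 * pi} (helgason_density h s r)) \<longlongrightarrow> (1 / c) * (h 0 * otal_const s)) at_top"
    if "hyp_eigenfunction (s * (1 - s)) h" for h c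
    by (intro tendsto_mult tendsto_const mass_limit) (use that par in simp)
  show "otal_const s \<noteq> 0 \<and> (\<forall>h. hyp_eigenfunction (s * (1 - s)) h \<and> bounded (h ` ball 0 1) \<longrightarrow>
        ((\<lambda>r. (1 / otal_const s) * integral {0..2 * pi} (helgason_density h s r)) \<longlongrightarrow> h 0) at_top)"
  proof (intro conjI allI impI c0, elim conjE)
    fix h assume "hyp_eigenfunction (s * (1 - s)) h"
    from lim[OF this, of "otal_const s"]
    show "((\<lambda>r. (1 / otal_const s) * integral {0..2 * pi} (helgason_density h s r)) \<longlongrightarrow> h 0) at_top"
      using c0 by simp
  qed
  fix c assume c: "c \<noteq> 0 \<and> (\<forall>h. hyp_eigenfunction (s * (1 - s)) h \<and> bounded (h ` ball 0 1) \<longrightarrow>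
        ((\<lambda>r. (1 / c) * integral {0..2 * pi} (helgason_density h s r)) \<longlongrightarrow> h 0) at_top)"
  then have "((\<lambda>r. (1 / c) * integral {0..2 * pi} (helgason_density h s r)) \<longlongrightarrow> h 0) at_top"
    using h by blast
  from tendsto_unique[OF _ this lim[OF h(1)]] have "h 0 = (1 / c) * (h 0 * otal_const s)" by simp
  then show "c = otal_const s" using c h(3) by (simp add: field_simps)
qed

text \<open>Each coefficient of the transform is that of dG times that of the kernel, and the latter
  cannot vanish for all r > 0, since its density tends to the nonzero constant c(s). So all
  coefficients of dG vanish: n = 0 makes G periodic, the others leave only the mean of G.\<close>

lemma poisson_injective:
  assumes G: "continuous_on UNIV G" and per: "\<And>\<theta>. G (\<theta> + 2 * pi) = G \<theta> + \<kappa>"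
    and z: "\<And>r \<theta>. 0 < r \<Longrightarrow> poisson s G r \<theta> = 0"
  shows "G x = G y"
proof -
  have d: "stieltjes 0 (2 * pi) (\<lambda>\<eta>. cis (- of_int n * \<eta>)) G = 0" for n :: int
  proof (rule ccontr)
    assume "stieltjes 0 (2 * pi) (\<lambda>\<eta>. cis (- of_int n * \<eta>)) G \<noteq> 0"
    moreover have "fourier (poisson s G) n r = 0" if "0 < r" for r
      unfolding fourier_def using z[OF that] by simp
    ultimately have \<Phi>: "fourier (poisson_kernel s) n r = 0" if "0 < r" for r
      using that fourier_poisson(1)[OF G per, where s = s and n = n and r = r] by simp
    have \<Phi>': "fourier (poisson_kernel_r s) n r = 0" if r: "0 < r" for r
    proof (rule vector_derivative_unique_at)
      show "(fourier (poisson_kernel s) n has_vector_derivative fourier (poisson_kernel_r s) n r) (at r)"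
        using radial_solutionD(1)[OF poisson_kernel.fourier_radial_solution] .
      show "(fourier (poisson_kernel s) n has_vector_derivative 0) (at r)"
        by (rule has_vector_derivative_transform_within_open[OF has_vector_derivative_const, of "{0<..}"])
          (use r \<Phi> in auto)
    qed
    have "((\<lambda>_. 0) \<longlongrightarrow> otal_const s) (at_top :: real filter)"
    proof (rule Lim_transform_eventually[OF otal_const_limit[OF s \<mu>, of n]])
      show "\<forall>\<^sub>F r in at_top. fourier (polar_density s (poisson_kernel s) (poisson_kernel_r s)) n r = 0"
        using eventually_gt_at_top[of 0]
        by eventually_elim (simp add: poisson_kernel.fourier_polar_density radial_density_def \<Phi> \<Phi>')
    qed
    then have "otal_const s = 0" using tendsto_unique[OF _ _ tendsto_const] by force
    then show False using otal_const_nonzero[OF s \<mu>] by simp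
  qed
  have "G (2 * pi) - G 0 = stieltjes 0 (2 * pi) (\<lambda>\<eta>. cis (- of_int 0 * \<eta>)) G"
    by (subst stieltjes_eq[OF has_vector_derivative_cis]) simp
  then have "\<kappa> = 0" using d[of 0] per[of 0] by simp
  then have per0: "G (\<theta> + 2 * pi) = G \<theta>" for \<theta> using per by simp
  have "integral {0..2 * pi} (\<lambda>\<eta>. cis (of_int n * \<eta>) * G \<eta>) = 0" if "n \<noteq> 0" for n :: int
  proof -
    have "stieltjes 0 (2 * pi) (\<lambda>\<eta>. cis (of_int n * \<eta>)) G = 0" using d[of "- n"] by simp
    also have "stieltjes 0 (2 * pi) (\<lambda>\<eta>. cis (of_int n * \<eta>)) G = cis (of_int n * (2 * pi)) * G (2 * pi) - cis (of_int n * 0) * G 0 -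
      integral {0..2 * pi} (\<lambda>\<eta>. (\<i> * of_real (of_int n) * cis (of_int n * \<eta>)) * G \<eta>)"
      by (rule stieltjes_eq[OF has_vector_derivative_cis])
    also have "cis (of_int n * (2 * pi)) = 1" using cis_multiple_2pi[of "of_int n"] by (simp add: mult_ac)
    also have "integral {0..2 * pi} (\<lambda>\<eta>. (\<i> * of_real (of_int n) * cis (of_int n * \<eta>)) * G \<eta>) =
      (\<i> * of_real (of_int n)) * integral {0..2 * pi} (\<lambda>\<eta>. cis (of_int n * \<eta>) * G \<eta>)"
      by (simp only: mult.assoc integral_mult_right)
    finally show ?thesis using that per0[of 0] by simp
  qed
  from nonconstant_fourier_coefficient[OF G per0 this] show ?thesis .
qed

context
  fixes f :: "complex \<Rightarrow> complex" and B :: real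
  assumes f: "hyp_eigenfunction (of_real \<mu>) f"
    and B: "\<And>z. z \<in> ball 0 1 \<Longrightarrow> norm (f z) \<le> B"
      "\<And>z. z \<in> ball 0 1 \<Longrightarrow> (1 - (norm z)\<^sup>2) * (norm (partial_x f z) + norm (partial_y f z)) \<le> B"
    and nz: "\<exists>z\<in>ball 0 1. f z \<noteq> 0"
begin

interpretation F: polar_eigenfunction \<mu> "polar_pull f" "polar_pull_r f" "polar_pull_rr f" "polar_pull_t f" "polar_pull_tt f"
  by (rule polar_pull_polar_eigenfunction[OF f])

text \<open>If f vanishes at the origin it says nothing about c(s). The automorphism z -> (z + w) /
  (1 + cnj w z) takes the origin to a point w with f(w) nonzero, and the composite is again a
  bounded eigenfunction.\<close>

lemma helgason_const_otal: "helgason_const s = otal_const s"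
proof -
  obtain w where w: "w \<in> ball 0 1" "f w \<noteq> 0" using nz by blast
  have nw: "norm w < 1" using w(1) by simp
  then have D: "0 < 1 - (norm w)\<^sup>2" by (simp add: abs_square_less_1)
  \<comment> \<open>Scales the coefficients to determinant 1.\<close>
  define k where "k = 1 / sqrt (1 - (norm w)\<^sup>2)"
  have k: "0 < k" "k\<^sup>2 * (1 - (norm w)\<^sup>2) = 1" using D by (simp_all add: k_def power_divide)
  define a b where "a = complex_of_real k" and "b = of_real k * w"
  define g where "g = (\<lambda>z. (a * z + b) / jac a b z)"
  have "(norm a)\<^sup>2 - (norm b)\<^sup>2 = 1"
    using k by (simp add: a_def b_def norm_mult power_mult_distrib right_diff_distrib)
  then have g: "disk_auto a b g" by (simp add: disk_auto_def g_def)
  have g0: "g 0 = w" using k by (simp add: g_def jac_def a_def b_def)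
  show ?thesis
  proof (rule helgason_const_eq)
    show "hyp_eigenfunction (s * (1 - s)) (\<lambda>z. f (g z))"
      using hyp_eigenfunction_compose[OF f g] spectral_parameter(1)[OF s \<mu>] by simp
    show "bounded ((\<lambda>z. f (g z)) ` ball 0 1)"
      unfolding bounded_iff using B(1) disk_auto_facts(3)[OF g] by blast
    show "f (g 0) \<noteq> 0" using w g0 by simp
  qed
qed

text \<open>The error bound for the arc from 0 to \<alpha> grows with \<alpha>; replacing it by the
  bound at 2 pi gives a single rate for all endpoints, hence uniform convergence.\<close>

lemma primitive_limit:
  obtains \<epsilon> where "(\<epsilon> \<longlongrightarrow> 0) at_top"
    "\<And>r \<alpha>. 0 < r \<Longrightarrow> 0 \<le> \<alpha> \<Longrightarrow> \<alpha> \<le> 2 * pi \<Longrightarrow>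
      norm ((1 / otal_const s) * integral {0..\<alpha>} (polar_density s (polar_pull f) (polar_pull_r f) r) - helgason_primitive0 f s \<alpha>) \<le> \<epsilon> r"
proof -
  let ?w = "polar_density s (polar_pull f) (polar_pull_r f)"
  define C where "C = norm (1 / otal_const s) * (2 * (norm s * B * (2 * pi) + 2 * B))"
  define \<epsilon> where "\<epsilon> = (\<lambda>r::real. C * exp (- r / 2))"
  have B0: "0 \<le> B" using order_trans[OF norm_ge_zero B(1)[of 0]] by simp
  have bound: "norm ((1 / otal_const s) * integral {0..\<alpha>} (?w r) - helgason_primitive0 f s \<alpha>) \<le> \<epsilon> r"
    if r: "0 < r" and \<alpha>: "0 \<le> \<alpha>" "\<alpha> \<le> 2 * pi" for r \<alpha>
  proof -
    obtain L where L: "((\<lambda>r. integral {0..\<alpha>} (?w r)) \<longlongrightarrow> L) at_top"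
      and Lb: "\<And>r. 0 < r \<Longrightarrow> norm (integral {0..\<alpha>} (?w r) - L) \<le> 2 * (norm s * B * (\<alpha> - 0) + 2 * B) * exp (- r / 2)"
      using F.Otal_limit[OF spectral_parameter(1,2)[OF s \<mu>] \<alpha>(1) polar_pull_bounds[OF B]] by blast
    have "helgason_primitive0 f s \<alpha> = (1 / otal_const s) * L"
      unfolding helgason_primitive0_def helgason_const_otal helgason_density_polar_density[OF f]
      by (rule tendsto_Lim[OF _ tendsto_mult[OF tendsto_const L]]) simp
    then have "norm ((1 / otal_const s) * integral {0..\<alpha>} (?w r) - helgason_primitive0 f s \<alpha>) =
        norm (1 / otal_const s) * norm (integral {0..\<alpha>} (?w r) - L)"
      by (simp only: norm_mult[symmetric] right_diff_distrib)
    also have "\<dots> \<le> norm (1 / otal_const s) * (2 * (norm s * B * (\<alpha> - 0) + 2 * B) * exp (- r / 2))"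
      by (intro mult_left_mono Lb r) simp
    also have "\<dots> \<le> norm (1 / otal_const s) * (2 * (norm s * B * (2 * pi) + 2 * B) * exp (- r / 2))"
      using \<alpha> B0 by (intro mult_left_mono mult_right_mono add_mono) auto
    finally show ?thesis by (simp add: \<epsilon>_def C_def mult.assoc)
  qed
  have "(\<epsilon> \<longlongrightarrow> 0) at_top" unfolding \<epsilon>_def by real_asymp
  then show ?thesis using that bound by blast
qed

lemma helgason_primitive_facts:
  "continuous_on UNIV (helgason_primitive f s)"
  "helgason_primitive f s (\<theta> + 2 * pi) = helgason_primitive f s \<theta> + f 0"
  "\<alpha> \<in> {0..2 * pi} \<Longrightarrow> helgason_primitive f s \<alpha> = helgason_primitive0 f s \<alpha>"
proof -
  let ?w = "polar_density s (polar_pull f) (polar_pull_r f)"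
  let ?P = "helgason_primitive f s"
  let ?Q = "helgason_primitive0 f s"
  obtain \<epsilon> where \<epsilon>: "(\<epsilon> \<longlongrightarrow> 0) at_top"
    "\<And>r \<alpha>. 0 < r \<Longrightarrow> 0 \<le> \<alpha> \<Longrightarrow> \<alpha> \<le> 2 * pi \<Longrightarrow> norm ((1 / otal_const s) * integral {0..\<alpha>} (?w r) - ?Q \<alpha>) \<le> \<epsilon> r"
    using primitive_limit by blast
  have wc: "continuous_on S (?w r)" for S r
    unfolding polar_density_def
    by (intro continuous_on_mult continuous_on_add continuous_on_const continuous_on_slice(1)[OF F.contF]
        continuous_on_slice(1)[OF F.contFr])
  have per: "?P (\<theta> + 2 * pi) = ?P \<theta> + f 0" for \<theta>
  proof -
    have fl: "\<lfloor>(\<theta> + 2 * pi) / (2 * pi)\<rfloor> = \<lfloor>\<theta> / (2 * pi)\<rfloor> + 1" by (simp add: add_divide_distrib)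
    have arg: "\<theta> + 2 * pi - 2 * pi * of_int (m + 1) = \<theta> - 2 * pi * of_int m" for m :: int
      by (simp add: algebra_simps)
    define m where "m = \<lfloor>\<theta> / (2 * pi)\<rfloor>"
    have "?P (\<theta> + 2 * pi) = ?Q (\<theta> + 2 * pi - 2 * pi * of_int (m + 1)) + of_int (m + 1) * f 0"
      unfolding helgason_primitive_def fl m_def Let_def ..
    moreover have "?P \<theta> = ?Q (\<theta> - 2 * pi * of_int m) + of_int m * f 0"
      unfolding helgason_primitive_def m_def Let_def ..
    ultimately show ?thesis unfolding arg by (simp add: distrib_right)
  qed
  show "?P (\<theta> + 2 * pi) = ?P \<theta> + f 0" by (rule per)
  have P00: "?Q 0 = 0"
    unfolding helgason_primitive0_def by (rule tendsto_Lim) simp_all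
  have P02: "?Q (2 * pi) = f 0"
    unfolding helgason_primitive0_def helgason_const_otal
  proof (rule tendsto_Lim)
    show "((\<lambda>r. 1 / otal_const s * integral {0..2 * pi} (helgason_density f s r)) \<longlongrightarrow> f 0) at_top"
      using tendsto_mult[OF tendsto_const mass_limit[OF f], of "1 / otal_const s"] otal_const_nonzero[OF s \<mu>] by simp
  qed simp
  \<comment> \<open>At 2 pi the floor has already passed to the next period, so
    \<open>helgason_primitive\<close> there is the value at 0 plus f(0). It agrees with the limit at
    2 pi because the total mass is f(0).\<close>
  have eq: "?P \<alpha> = ?Q \<alpha>" if "\<alpha> \<in> {0..2 * pi}" for \<alpha>
  proof (cases "\<alpha> = 2 * pi")
    case True
    have "?P (0 + 2 * pi) = ?P 0 + f 0" by (rule per)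
    then show ?thesis using True P00 P02 by (simp add: helgason_primitive_def)
  next
    case False
    then have "\<lfloor>\<alpha> / (2 * pi)\<rfloor> = 0" using that by (simp add: floor_eq_iff)
    then show ?thesis by (simp add: helgason_primitive_def)
  qed
  show "\<alpha> \<in> {0..2 * pi} \<Longrightarrow> ?P \<alpha> = ?Q \<alpha>" by (rule eq)
  have ul: "uniform_limit {0..2 * pi} (\<lambda>r \<alpha>. (1 / otal_const s) * integral {0..\<alpha>} (?w r)) ?Q at_top"
  proof (rule uniform_limitI)
    fix e :: real assume "0 < e"
    then have "\<forall>\<^sub>F r in at_top. \<epsilon> r < e" using order_tendstoD(2)[OF \<epsilon>(1)] by simp
    then show "\<forall>\<^sub>F r in at_top. \<forall>\<alpha>\<in>{0..2 * pi}. dist ((1 / otal_const s) * integral {0..\<alpha>} (?w r)) (?Q \<alpha>) < e"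
      using eventually_gt_at_top[of 0]
    proof eventually_elim
      case (elim r)
      show ?case
      proof
        fix \<alpha> assume "\<alpha> \<in> {0..2 * pi}"
        then show "dist ((1 / otal_const s) * integral {0..\<alpha>} (?w r)) (?Q \<alpha>) < e"
          unfolding dist_norm using elim by (intro le_less_trans[OF \<epsilon>(2)]) auto
      qed
    qed
  qed
  have ev: "\<forall>\<^sub>F r in at_top. continuous_on {0..2 * pi} (\<lambda>\<alpha>. (1 / otal_const s) * integral {0..\<alpha>} (?w r))"
    by (intro always_eventually allI continuous_on_mult continuous_on_const
        indefinite_integral_continuous_1 integrable_continuous_real wc)
  have "continuous_on {0..2 * pi} ?Q"
    by (rule uniform_limit_theorem[OF ev ul]) simp
  then have "continuous_on {0..2 * pi} ?P" by (rule continuous_on_eq) (rule eq[symmetric])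
  then show "continuous_on UNIV ?P" by (rule continuous_on_quasiperiodic[where \<kappa> = "f 0"]) (rule per)
qed

text \<open>The indefinite integrals of the normalised densities converge uniformly to the
  primitive, and pairing \<psi> with such an integral by parts gives back the integral of \<psi>
  times the density.\<close>

lemma helgason_pairing_limit:
  assumes \<psi>: "\<psi> C1_differentiable_on {0..2 * pi}"
  shows "((\<lambda>r. (1 / otal_const s) * integral {0..2 * pi} (\<lambda>\<theta>. \<psi> \<theta> * polar_density s (polar_pull f) (polar_pull_r f) r \<theta>)) \<longlongrightarrow>
    stieltjes 0 (2 * pi) \<psi> (helgason_primitive f s)) at_top"
proof -
  let ?w = "polar_density s (polar_pull f) (polar_pull_r f)"
  obtain \<epsilon> where \<epsilon>: "(\<epsilon> \<longlongrightarrow> 0) at_top"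
    "\<And>r \<alpha>. 0 < r \<Longrightarrow> 0 \<le> \<alpha> \<Longrightarrow> \<alpha> \<le> 2 * pi \<Longrightarrow>
       norm ((1 / otal_const s) * integral {0..\<alpha>} (?w r) - helgason_primitive0 f s \<alpha>) \<le> \<epsilon> r"
    using primitive_limit by blast
  define W where "W = (\<lambda>r \<alpha>. (1 / otal_const s) * integral {0..\<alpha>} (?w r))"
  have wc: "continuous_on S (?w r)" for S r
    unfolding polar_density_def
    by (intro continuous_on_mult continuous_on_add continuous_on_const continuous_on_slice(1)[OF F.contF]
        continuous_on_slice(1)[OF F.contFr])
  have Wd: "(W r has_vector_derivative (1 / otal_const s) * ?w r x) (at x within {0..2 * pi})" if "x \<in> {0..2 * pi}" for r x
    unfolding W_def by (rule has_vector_derivative_mult_right[OF integral_has_vector_derivative[OF wc that]])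
  have Wc: "continuous_on {0..2 * pi} (W r)" for r by (rule continuous_on_vector_derivative[OF Wd])
  have "((\<lambda>r. stieltjes 0 (2 * pi) \<psi> (W r)) \<longlongrightarrow> stieltjes 0 (2 * pi) \<psi> (helgason_primitive f s)) at_top"
  proof (rule stieltjes_tendsto[OF \<psi> _ Wc continuous_on_subset[OF helgason_primitive_facts(1) subset_UNIV] _ \<epsilon>(1)])
    show "\<forall>\<^sub>F r in at_top. \<forall>\<theta>\<in>{0..2 * pi}. norm (W r \<theta> - helgason_primitive f s \<theta>) \<le> \<epsilon> r"
      using eventually_gt_at_top[of 0]
    proof eventually_elim
      case (elim r)
      show ?case
      proof
        fix \<theta> assume \<theta>: "\<theta> \<in> {0..2 * pi}"
        show "norm (W r \<theta> - helgason_primitive f s \<theta>) \<le> \<epsilon> r"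
          unfolding W_def helgason_primitive_facts(3)[OF \<theta>] by (rule \<epsilon>(2)) (use elim \<theta> in auto)
      qed
    qed
  qed simp
  moreover have "stieltjes 0 (2 * pi) \<psi> (W r) = (1 / otal_const s) * integral {0..2 * pi} (\<lambda>\<theta>. \<psi> \<theta> * ?w r \<theta>)" for r
  proof -
    have "stieltjes 0 (2 * pi) \<psi> (W r) = integral {0..2 * pi} (\<lambda>\<theta>. \<psi> \<theta> * ((1 / otal_const s) * ?w r \<theta>))"
      by (rule stieltjes_of_primitive[OF \<psi> _ Wd], simp, assumption, intro continuous_on_mult continuous_on_const wc)
    also have "(\<lambda>\<theta>. \<psi> \<theta> * ((1 / otal_const s) * ?w r \<theta>)) = (\<lambda>\<theta>. (1 / otal_const s) * (\<psi> \<theta> * ?w r \<theta>))"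
      by (rule ext) (rule mult.left_commute)
    finally show ?thesis by (simp only: integral_mult_right)
  qed
  ultimately show ?thesis by simp
qed

text \<open>Let d be the n-th coefficient of the distribution. The coefficient of f minus d times
  that of the Poisson kernel is a regular radial solution whose density tends to d c(s) - d c(s) =
  0, so it vanishes by \<open>radial_solution_zero\<close>. Fourier uniqueness on each circle
  finishes; the centre is treated apart.\<close>

lemma poisson_representation:
  assumes r: "0 \<le> r"
  shows "polar_pull f r \<theta> = poisson s (helgason_primitive f s) r \<theta>"
proof (cases "r = 0")
  case True
  have "poisson s (helgason_primitive f s) 0 \<theta> = stieltjes 0 (2 * pi) (\<lambda>\<eta>. 1) (helgason_primitive f s)"
    by (simp add: poisson_def poisson_kernel_at_0)
  also have "\<dots> = helgason_primitive f s (2 * pi) - helgason_primitive f s 0" by (simp add: stieltjes_def)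
  also have "\<dots> = f 0" using helgason_primitive_facts(2)[of 0] by simp
  finally show ?thesis using True by (simp add: polar_pull_def polar_point_def)
next
  case False
  then have r: "0 < r" using r by simp
  let ?G = "helgason_primitive f s"
  have coeff: "fourier (polar_pull f) n r = stieltjes 0 (2 * pi) (\<lambda>\<eta>. cis (- of_int n * \<eta>)) ?G * fourier (poisson_kernel s) n r" for n
  proof -
    define d where "d = stieltjes 0 (2 * pi) (\<lambda>\<eta>. cis (- of_int n * \<eta>)) ?G"
    have K: "radial_solution \<mu> (of_int n) (\<lambda>r. fourier (polar_pull f) n r - d * fourier (poisson_kernel s) n r)
       (\<lambda>r. fourier (polar_pull_r f) n r - d * fourier (poisson_kernel_r s) n r) (\<lambda>r. fourier (polar_pull_rr f) n r - d * fourier (poisson_kernel_rr s) n r)"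
      by (rule radial_solution_lincomb[OF F.fourier_radial_solution poisson_kernel.fourier_radial_solution])
    have "((\<lambda>r. (1 / otal_const s) * fourier (polar_density s (polar_pull f) (polar_pull_r f)) n r) \<longlongrightarrow> d) at_top"
      unfolding d_def fourier_def by (rule helgason_pairing_limit[OF cis_C1])
    then have "((\<lambda>r. otal_const s * ((1 / otal_const s) * fourier (polar_density s (polar_pull f) (polar_pull_r f)) n r)) \<longlongrightarrow> otal_const s * d) at_top"
      by (intro tendsto_intros)
    then have "((\<lambda>r. fourier (polar_density s (polar_pull f) (polar_pull_r f)) n r) \<longlongrightarrow> d * otal_const s) at_top"
      using otal_const_nonzero[OF s \<mu>] by (simp add: mult.commute)
    then have "((\<lambda>r. fourier (polar_density s (polar_pull f) (polar_pull_r f)) n r - d * fourier (polar_density s (poisson_kernel s) (poisson_kernel_r s)) n r)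
        \<longlongrightarrow> d * otal_const s - d * otal_const s) at_top"
      by (intro tendsto_intros otal_const_limit[OF s \<mu>])
    moreover have "radial_density s (\<lambda>r. fourier (polar_pull f) n r - d * fourier (poisson_kernel s) n r)
       (\<lambda>r. fourier (polar_pull_r f) n r - d * fourier (poisson_kernel_r s) n r) =
      (\<lambda>r. fourier (polar_density s (polar_pull f) (polar_pull_r f)) n r - d * fourier (polar_density s (poisson_kernel s) (poisson_kernel_r s)) n r)"
      unfolding F.fourier_polar_density poisson_kernel.fourier_polar_density radial_density_def
      by (simp add: algebra_simps)
    ultimately have "(radial_density s (\<lambda>r. fourier (polar_pull f) n r - d * fourier (poisson_kernel s) n r)
       (\<lambda>r. fourier (polar_pull_r f) n r - d * fourier (poisson_kernel_r s) n r) \<longlongrightarrow> 0) at_top" by simp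
    from radial_solution_zero[OF K s spectral_parameter(1)[OF s \<mu>] this r] show ?thesis by (simp add: d_def)
  qed
  note PP = fourier_poisson[OF helgason_primitive_facts(1,2), where s = s and r = r]
  have "polar_pull f r \<theta> - poisson s ?G r \<theta> = 0"
  proof (rule fourier_coefficients_zero[of "\<lambda>\<theta>. polar_pull f r \<theta> - poisson s ?G r \<theta>"])
    show "continuous_on UNIV (\<lambda>\<theta>. polar_pull f r \<theta> - poisson s ?G r \<theta>)"
      by (intro continuous_on_diff continuous_on_slice(1)[OF F.contF] PP)
    show "polar_pull f r (\<theta> + 2 * pi) - poisson s ?G r (\<theta> + 2 * pi) = polar_pull f r \<theta> - poisson s ?G r \<theta>" for \<theta>
      using F.periodic PP(3) by simp
    show "integral {0..2 * pi} (\<lambda>\<theta>. cis (of_int n * \<theta>) * (polar_pull f r \<theta> - poisson s ?G r \<theta>)) = 0" for n :: int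
    proof -
      have "integral {0..2 * pi} (\<lambda>\<theta>. cis (of_int n * \<theta>) * (polar_pull f r \<theta> - poisson s ?G r \<theta>)) =
        integral {0..2 * pi} (\<lambda>\<theta>. cis (of_int n * \<theta>) * polar_pull f r \<theta> - cis (of_int n * \<theta>) * poisson s ?G r \<theta>)"
        by (simp only: right_diff_distrib)
      also have "\<dots> = integral {0..2 * pi} (\<lambda>\<theta>. cis (of_int n * \<theta>) * polar_pull f r \<theta>) -
         integral {0..2 * pi} (\<lambda>\<theta>. cis (of_int n * \<theta>) * poisson s ?G r \<theta>)"
        by (intro integral_diff integrable_continuous_real continuous_on_mult continuous_on_subset[OF PP(2)]
            continuous_on_slice(1)[OF F.contF] continuous_intros) auto
      also have "\<dots> = fourier (polar_pull f) (- n) r - fourier (poisson s ?G) (- n) r" by (simp add: fourier_def)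
      also have "\<dots> = 0" unfolding coeff PP(1) by simp
      finally show ?thesis .
    qed
  qed
  then show ?thesis by simp
qed

end

end

subsection \<open>Covariance of the distribution\<close>

lemma poisson_kernel_polar:
  "(1 - (norm (polar_point r \<theta>))\<^sup>2) / (norm (polar_point r \<theta> - cis \<eta>))\<^sup>2 = inverse (poisson_denom r (\<theta> - \<eta>))"
proof -
  define \<rho> where "\<rho> = tanh (r / 2)"
  have w: "0 < 1 - \<rho>\<^sup>2" unfolding \<rho>_def by (rule tanh_half(3))
  have "(norm (polar_point r \<theta> - cis \<eta>))\<^sup>2 = (\<rho> * cos \<theta> - cos \<eta>)\<^sup>2 + (\<rho> * sin \<theta> - sin \<eta>)\<^sup>2"
    unfolding cmod_power2 by (simp add: polar_point_def \<rho>_def)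
  also have "\<dots> = \<rho>\<^sup>2 * ((sin \<theta>)\<^sup>2 + (cos \<theta>)\<^sup>2) + ((sin \<eta>)\<^sup>2 + (cos \<eta>)\<^sup>2) - 2 * \<rho> * (cos \<theta> * cos \<eta> + sin \<theta> * sin \<eta>)"
  proof -
    have "(\<rho> * c - c')\<^sup>2 + (\<rho> * d - d')\<^sup>2 = \<rho>\<^sup>2 * (d\<^sup>2 + c\<^sup>2) + (d'\<^sup>2 + c'\<^sup>2) - 2 * \<rho> * (c * c' + d * d')"
      for c c' d d' :: real by (simp add: power2_eq_square algebra_simps)
    then show ?thesis .
  qed
  also have "\<dots> = (1 + \<rho>\<^sup>2) - 2 * \<rho> * cos (\<theta> - \<eta>)"
    unfolding sin_cos_squared_add cos_diff by simp
  also have "\<dots> = poisson_denom r (\<theta> - \<eta>) * (1 - \<rho>\<^sup>2)"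
  proof -
    have "poisson_denom r (\<theta> - \<eta>) * (1 - \<rho>\<^sup>2) = cosh r * (1 - \<rho>\<^sup>2) - sinh r * (1 - \<rho>\<^sup>2) * cos (\<theta> - \<eta>)"
      by (simp add: poisson_denom_def algebra_simps)
    then show ?thesis unfolding tanh_half(1,2)[of r, folded \<rho>_def] by simp
  qed
  finally have n: "(norm (polar_point r \<theta> - cis \<eta>))\<^sup>2 = poisson_denom r (\<theta> - \<eta>) * (1 - \<rho>\<^sup>2)" .
  have "(norm (polar_point r \<theta>))\<^sup>2 = \<rho>\<^sup>2" by (simp add: norm_polar_point \<rho>_def)
  moreover have "c / (p * c) = inverse p" if "c \<noteq> 0" for c p :: real
    using that by (simp add: inverse_eq_divide)
  ultimately show ?thesis unfolding n using w by (metis less_irrefl)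
qed

text \<open>The logarithm is a principal one, which is harmless as \<open>|b| < |a|\<close>.\<close>

definition circle_lift :: "complex \<Rightarrow> complex \<Rightarrow> real \<Rightarrow> real" where
  "circle_lift a b \<theta> = \<theta> + 2 * Arg a - 2 * Im (Ln (1 + (cnj b / cnj a) * cis \<theta>))"

text \<open>The reciprocal of |g'| at the boundary point cis \<theta>, so that
  \<open>jac_power s\<close> below is |g'|^(-s).\<close>

definition jac_sq :: "complex \<Rightarrow> complex \<Rightarrow> real \<Rightarrow> real" where
  "jac_sq a b \<theta> = (norm (jac a b (cis \<theta>)))\<^sup>2"

definition jac_power :: "complex \<Rightarrow> complex \<Rightarrow> complex \<Rightarrow> real \<Rightarrow> complex" where
  "jac_power s a b \<theta> = exp (s * of_real (ln (jac_sq a b \<theta>)))"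

text \<open>From g \<xi> = \<xi> cnj(jac) / jac the argument of the image is \<theta> - 2 arg(jac).
  Writing jac = cnj a (1 + c \<xi>) with |c| < 1 splits this into the constant 2 Arg a and the
  argument of a point in the right half-plane, which is the formula for the lift.\<close>

lemma circle_lift_facts:
  assumes ab: "(norm a)\<^sup>2 - (norm b)\<^sup>2 = 1"
  shows "0 < jac_sq a b \<theta>"
    and "(circle_lift a b has_real_derivative 1 / jac_sq a b \<theta>) (at \<theta>)"
    and "disk_auto a b g \<Longrightarrow> cis (circle_lift a b \<theta>) = g (cis \<theta>)"
    and "circle_lift a b (\<theta> + 2 * pi) = circle_lift a b \<theta> + 2 * pi"
    and "(jac_sq a b has_real_derivative 2 * Re (\<i> * (cnj b * a * cis \<theta>))) (at \<theta>)"
    and "continuous_on S (jac_sq a b)"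
    and "strict_mono (circle_lift a b)"
    and "jac_power s a b C1_differentiable_on S"
proof -
  define c where "c = cnj b / cnj a"
  have a0: "a \<noteq> 0" using ab by (auto simp: power2_eq_square) (smt (verit) zero_le_square)
  have nab: "norm b < norm a"
  proof -
    have "(norm b)\<^sup>2 < (norm a)\<^sup>2" using ab by linarith
    then show ?thesis by (rule power2_less_imp_less) simp
  qed
  then have nc: "norm c < 1" using a0 by (simp add: c_def norm_divide)
  have re: "0 < Re (1 + c * cis \<theta>)" for \<theta>
  proof -
    have "\<bar>Re (c * cis \<theta>)\<bar> \<le> norm c" using abs_Re_le_cmod[of "c * cis \<theta>"] by (simp add: norm_mult)
    then show ?thesis using nc by simp
  qed
  then have w0: "1 + c * cis \<theta> \<noteq> 0" for \<theta> by (metis less_irrefl zero_complex.simps(1))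
  have J: "jac a b (cis \<theta>) = cnj a * (1 + c * cis \<theta>)" for \<theta>
    using a0 by (simp add: jac_def c_def algebra_simps)
  have jac_sq: "jac_sq a b \<theta> = (norm a)\<^sup>2 * (norm (1 + c * cis \<theta>))\<^sup>2" for \<theta>
    unfolding jac_sq_def J by (simp add: norm_mult power_mult_distrib)
  show pos: "0 < jac_sq a b \<theta>" for \<theta> unfolding jac_sq using a0 w0 by simp
  show D: "(circle_lift a b has_real_derivative 1 / jac_sq a b \<theta>) (at \<theta>)" for \<theta>
  proof -
    have 1: "((\<lambda>\<theta>. 1 + c * cis \<theta>) has_vector_derivative c * (\<i> * cis \<theta>)) (at \<theta>)"
    proof -
      have "((\<lambda>\<theta>. 1 + c * cis (1 * \<theta>)) has_vector_derivative 0 + c * (\<i> * of_real 1 * cis (1 * \<theta>))) (at \<theta>)"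
        by (intro has_vector_derivative_add has_vector_derivative_const has_vector_derivative_mult_right
            has_vector_derivative_cis)
      then show ?thesis by simp
    qed
    have "1 + c * cis \<theta> \<notin> \<real>\<^sub>\<le>\<^sub>0" using re[of \<theta>] by (auto simp: complex_nonpos_Reals_iff)
    then have "(Ln has_field_derivative 1 / (1 + c * cis \<theta>)) (at (1 + c * cis \<theta>))"
      using has_field_derivative_Ln by (simp add: field_class.field_divide_inverse)
    from field_vector_diff_chain_at[OF 1 this]
    have "((\<lambda>\<theta>. Ln (1 + c * cis \<theta>)) has_vector_derivative c * (\<i> * cis \<theta>) * (1 / (1 + c * cis \<theta>))) (at \<theta>)"
      by (simp add: o_def)
    from bounded_linear.has_vector_derivative[OF bounded_linear_Im this]
    have "((\<lambda>\<theta>. Im (Ln (1 + c * cis \<theta>))) has_real_derivative Im (c * (\<i> * cis \<theta>) * (1 / (1 + c * cis \<theta>)))) (at \<theta>)"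
      by (simp add: has_real_derivative_iff_has_vector_derivative)
    then have "(circle_lift a b has_real_derivative 1 - 2 * Im (c * (\<i> * cis \<theta>) * (1 / (1 + c * cis \<theta>)))) (at \<theta>)"
      unfolding circle_lift_def[abs_def] c_def[symmetric]
      by (intro DERIV_diff DERIV_cmult) (auto intro!: derivative_eq_intros)
    \<comment> \<open>With u = c cis \<theta> the left side is 1 - 2 Re(u / (1 + u)) = (1 - |u|^2) /
      |1 + u|^2, and 1 - |c|^2 = 1 / |a|^2.\<close>
    also have "1 - 2 * Im (c * (\<i> * cis \<theta>) * (1 / (1 + c * cis \<theta>))) = 1 / jac_sq a b \<theta>"
    proof -
      define u where "u = c * cis \<theta>"
      have u: "1 + u \<noteq> 0" using w0 by (simp add: u_def)
      have nu: "norm u = norm c" by (simp add: u_def norm_mult)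
      have "c * (\<i> * cis \<theta>) * (1 / (1 + c * cis \<theta>)) = \<i> * (u / (1 + u))" by (simp add: u_def mult_ac)
      then have "Im (c * (\<i> * cis \<theta>) * (1 / (1 + c * cis \<theta>))) = Re (u / (1 + u))"
        by (simp only: Im_i_times)
      also have "u / (1 + u) = u * cnj (1 + u) / of_real ((norm (1 + u))\<^sup>2)"
        by (rule complex_div_cnj)
      also have "Re \<dots> = Re (u * cnj (1 + u)) / (norm (1 + u))\<^sup>2" by (rule Re_divide_of_real)
      finally have "1 - 2 * Im (c * (\<i> * cis \<theta>) * (1 / (1 + c * cis \<theta>))) =
         ((norm (1 + u))\<^sup>2 - 2 * Re (u * cnj (1 + u))) / (norm (1 + u))\<^sup>2" using u by (simp add: diff_divide_distrib)
      also have "(norm (1 + u))\<^sup>2 - 2 * Re (u * cnj (1 + u)) = 1 - (norm u)\<^sup>2"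
        unfolding cmod_power2 by (simp add: power2_eq_square algebra_simps)
      also have "1 - (norm u)\<^sup>2 = 1 / (norm a)\<^sup>2"
        
      proof -
        have "1 - (norm c)\<^sup>2 = ((norm a)\<^sup>2 - (norm b)\<^sup>2) / (norm a)\<^sup>2"
          using a0 by (simp add: c_def norm_divide power_divide diff_divide_distrib)
        then show ?thesis unfolding nu ab .
      qed
      finally show ?thesis unfolding jac_sq u_def by simp
    qed
    finally show ?thesis .
  qed
  show "cis (circle_lift a b \<theta>) = g (cis \<theta>)" if g: "disk_auto a b g"
  proof -
    define w where "w = 1 + c * cis \<theta>"
    have w: "w \<noteq> 0" using w0 by (simp add: w_def)
    have "cis (Im (Ln w)) = w / of_real (norm w)"
    proof -
      have "w = exp (Ln w)" using w by simp
      also have "exp (Ln w) = of_real (exp (Re (Ln w))) * cis (Im (Ln w))" by (simp add: exp_eq_polar)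
      also have "exp (Re (Ln w)) = norm w" using w by simp
      finally have "w = of_real (norm w) * cis (Im (Ln w))" .
      then show ?thesis using w by (metis nonzero_mult_div_cancel_left norm_eq_zero of_real_eq_0_iff)
    qed
    then have cw: "cis (- Im (Ln w)) = cnj w / of_real (norm w)" by (metis cis_cnj complex_cnj_divide complex_cnj_complex_of_real)
    have ca: "cis (Arg a) = a / of_real (norm a)" using a0 cis_Arg[OF a0] by (simp add: sgn_eq)
    have "cis (circle_lift a b \<theta>) = cis \<theta> * (cis (Arg a) * cis (Arg a)) * (cis (- Im (Ln w)) * cis (- Im (Ln w)))"
      unfolding circle_lift_def c_def[symmetric] w_def[symmetric] cis_mult by (simp add: algebra_simps)
    also have "\<dots> = cis \<theta> * (a * cnj w) * (a * cnj w) / of_real ((norm a * norm w) * (norm a * norm w))"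
      unfolding cw ca by (simp add: mult_ac)
    also have "of_real ((norm a * norm w) * (norm a * norm w)) = (a * cnj w) * (cnj a * w)"
    proof -
      have "complex_of_real ((norm a * norm w) * (norm a * norm w)) = of_real ((norm (a * cnj w))\<^sup>2)"
        by (simp add: norm_mult power2_eq_square)
      also have "\<dots> = (a * cnj w) * cnj (a * cnj w)" by (rule complex_norm_square)
      finally show ?thesis by simp
    qed
    also have "cis \<theta> * (a * cnj w) * (a * cnj w) / ((a * cnj w) * (cnj a * w)) = cis \<theta> * (a * cnj w) / (cnj a * w)"
      using a0 w by simp
    also have "\<dots> = g (cis \<theta>)"
      using disk_auto_facts(7)[OF g, of "cis \<theta>"] by (simp add: J w_def)
    finally show ?thesis .
  qed
  show "circle_lift a b (\<theta> + 2 * pi) = circle_lift a b \<theta> + 2 * pi"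
    by (simp add: circle_lift_def cis_mult[symmetric])
  show Dj: "(jac_sq a b has_real_derivative 2 * Re (\<i> * (cnj b * a * cis \<theta>))) (at \<theta>)" for \<theta>
  proof -
    have eq: "jac_sq a b = (\<lambda>\<theta>. (norm a)\<^sup>2 + (norm b)\<^sup>2 + 2 * Re (cnj b * a * cis \<theta>))"
    proof
      fix \<theta>
      have "jac_sq a b \<theta> = (norm (cnj b * cis \<theta>))\<^sup>2 + (norm (cnj a))\<^sup>2 + 2 * Re (cnj b * cis \<theta> * cnj (cnj a))"
        unfolding jac_sq_def jac_def cmod_power2 by (simp add: power2_eq_square algebra_simps)
      then show "jac_sq a b \<theta> = (norm a)\<^sup>2 + (norm b)\<^sup>2 + 2 * Re (cnj b * a * cis \<theta>)"
        by (simp add: norm_mult algebra_simps)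
    qed
    have "((\<lambda>\<theta>. cnj b * a * cis (1 * \<theta>)) has_vector_derivative cnj b * a * (\<i> * of_real 1 * cis (1 * \<theta>))) (at \<theta>)"
      by (rule has_vector_derivative_mult_right[OF has_vector_derivative_cis])
    from bounded_linear.has_vector_derivative[OF bounded_linear_Re this]
    have "((\<lambda>\<theta>. Re (cnj b * a * cis \<theta>)) has_real_derivative Re (\<i> * (cnj b * a * cis \<theta>))) (at \<theta>)"
      by (simp add: has_real_derivative_iff_has_vector_derivative mult_ac)
    then show ?thesis unfolding eq by (auto intro!: derivative_eq_intros)
  qed
  show cj: "continuous_on S (jac_sq a b)" for S
    by (rule DERIV_continuous_on) (use Dj in \<open>auto intro: has_field_derivative_at_within\<close>)
  show "strict_mono (circle_lift a b)"
  proof (rule strict_monoI)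
    fix x y :: real assume "x < y"
    then show "circle_lift a b x < circle_lift a b y"
      by (rule DERIV_pos_imp_increasing) (use D pos in \<open>metis zero_less_divide_1_iff\<close>)
  qed
  show "jac_power s a b C1_differentiable_on S"
  proof (rule C1_I)
    fix x
    have "((\<lambda>x. ln (jac_sq a b x)) has_real_derivative (2 * Re (\<i> * (cnj b * a * cis x))) / jac_sq a b x) (at x)"
      using Dj[of x] pos[of x] by (auto intro!: derivative_eq_intros)
    from vector_diff_chain_at[OF this[unfolded has_real_derivative_iff_has_vector_derivative] has_vector_derivative_exp_real[of s]]
    show "(jac_power s a b has_vector_derivative
       ((2 * Re (\<i> * (cnj b * a * cis x))) / jac_sq a b x) *\<^sub>R (s * exp (s * of_real (ln (jac_sq a b x))))) (at x)"
      by (simp add: o_def jac_power_def[abs_def])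
  next
    have n: "jac_sq a b x \<noteq> 0" for x using pos[of x] by simp
    show "continuous_on S (\<lambda>x. ((2 * Re (\<i> * (cnj b * a * cis x))) / jac_sq a b x) *\<^sub>R (s * exp (s * of_real (ln (jac_sq a b x)))))"
      by (intro continuous_on_scaleR continuous_on_divide continuous_on_mult continuous_on_const continuous_on_Re
          continuous_on_cis continuous_on_id continuous_on_exp continuous_on_of_real continuous_on_ln cj)
        (auto simp: n)
  qed
qed

lemma poisson_denom_transform:
  assumes g: "disk_auto a b g" and z: "g (polar_point r \<theta>) = polar_point r' \<theta>'"
  shows "poisson_denom r' (\<theta>' - circle_lift a b \<eta>) = poisson_denom r (\<theta> - \<eta>) / jac_sq a b \<eta>"
proof -
  have ab: "(norm a)\<^sup>2 - (norm b)\<^sup>2 = 1" using g by (simp add: disk_auto_def)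
  define z where "z = polar_point r \<theta>"
  have zb: "z \<in> ball 0 1" "z \<in> cball 0 1" using polar_point_ball[of r \<theta>] by (auto simp: z_def)
  have e: "cis \<eta> \<in> cball 0 1" by simp
  have Jz: "(norm (jac a b z))\<^sup>2 \<noteq> 0" using disk_auto_open[OF g zb(1)] by simp
  have "inverse (poisson_denom r' (\<theta>' - circle_lift a b \<eta>)) = (1 - (norm (g z))\<^sup>2) / (norm (g z - g (cis \<eta>)))\<^sup>2"
    unfolding poisson_kernel_polar[symmetric] z[symmetric] z_def circle_lift_facts(3)[OF ab g] ..
  also have "\<dots> = ((1 - (norm z)\<^sup>2) / (norm (jac a b z))\<^sup>2) / ((norm (z - cis \<eta>))\<^sup>2 / ((norm (jac a b z))\<^sup>2 * jac_sq a b \<eta>))"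
    unfolding disk_auto_facts(1)[OF g zb(2)] disk_auto_facts(2)[OF g zb(2) e] jac_sq_def
    by (simp add: norm_divide norm_mult power_divide power_mult_distrib)
  also have "\<dots> = (1 - (norm z)\<^sup>2) / (norm (z - cis \<eta>))\<^sup>2 * jac_sq a b \<eta>"
    using Jz by (simp add: divide_divide_eq_left divide_divide_eq_right)
  also have "\<dots> = inverse (poisson_denom r (\<theta> - \<eta>)) * jac_sq a b \<eta>" unfolding z_def poisson_kernel_polar ..
  finally show ?thesis by (metis divide_inverse inverse_inverse_eq inverse_mult_distrib)
qed

lemma poisson_kernel_transform:
  assumes g: "disk_auto a b g" and z: "g (polar_point r \<theta>) = polar_point r' \<theta>'"
  shows "poisson_kernel s r' (\<theta>' - circle_lift a b \<eta>) = poisson_kernel s r (\<theta> - \<eta>) * jac_power s a b \<eta>"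
proof -
  have ab: "(norm a)\<^sup>2 - (norm b)\<^sup>2 = 1" using g by (simp add: disk_auto_def)
  have eq: "ln (poisson_denom r' (\<theta>' - circle_lift a b \<eta>)) = ln (poisson_denom r (\<theta> - \<eta>)) - ln (jac_sq a b \<eta>)"
    unfolding poisson_denom_transform[OF assms] using poisson_denom_pos[of r "\<theta> - \<eta>"] circle_lift_facts(1)[OF ab, of \<eta>]
    by (simp add: ln_div)
  show ?thesis unfolding poisson_kernel_def jac_power_def eq exp_add[symmetric] by (simp add: algebra_simps)
qed

text \<open>\<open>stieltjes\<close> is meaningful only for ordered endpoints, whence the two
  branches of this primitive of \<psi> dG on the whole line.\<close>

lemma stieltjes_primitive:
  assumes \<psi>: "\<And>S. \<psi> C1_differentiable_on S" and G: "\<And>S. continuous_on S G"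
  defines "H \<equiv> \<lambda>x. if 0 \<le> x then stieltjes 0 x \<psi> G else - stieltjes x 0 \<psi> G"
  shows "x \<le> y \<Longrightarrow> H y - H x = stieltjes x y \<psi> G" and "continuous_on UNIV H"
proof -
  have diff: "H y - H x = stieltjes x y \<psi> G" if "x \<le> y" for x y
  proof -
    consider "0 \<le> x" | "x < 0" "0 \<le> y" | "y < 0" by linarith
    then show ?thesis
    proof cases
      case 1 then show ?thesis using stieltjes_combine[OF \<psi> G, of 0 x y] that by (simp add: H_def)
    next
      case 2 then show ?thesis using stieltjes_combine[OF \<psi> G, of x 0 y] by (simp add: H_def)
    next
      case 3 then show ?thesis using stieltjes_combine[OF \<psi> G, of x y 0] that by (simp add: H_def)
    qed
  qed
  then show "x \<le> y \<Longrightarrow> H y - H x = stieltjes x y \<psi> G" .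
  show "continuous_on UNIV H"
  proof (rule continuous_at_imp_continuous_on, rule ballI)
    fix x :: real
    have "continuous_on {x - 1..x + 1} (\<lambda>y. H (x - 1) + stieltjes (x - 1) y \<psi> G)"
      by (intro continuous_on_add continuous_on_const continuous_on_stieltjes \<psi> G)
    then have "continuous_on {x - 1..x + 1} H"
    proof (rule continuous_on_eq)
      fix y assume "y \<in> {x - 1..x + 1}"
      then show "H (x - 1) + stieltjes (x - 1) y \<psi> G = H y" using diff[of "x - 1" y] by (simp add: algebra_simps)
    qed
    then show "isCont H x" by (rule continuous_on_interior) (simp add: interior_atLeastAtMost_real)
  qed
qed

lemma stieltjes_shift:
  assumes \<psi>: "\<And>S. \<psi> C1_differentiable_on S" and \<psi>p: "\<And>x. \<psi> (x + 2 * pi) = \<psi> x"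
    and G: "\<And>S. continuous_on S G" and Gp: "\<And>x. G (x + 2 * pi) = G x + \<kappa>" and xy: "x \<le> y"
  shows "stieltjes (x + 2 * pi) (y + 2 * pi) \<psi> G = stieltjes x y \<psi> G"
proof -
  have "stieltjes (x + 2 * pi) (y + 2 * pi) \<psi> G = stieltjes x y (\<lambda>x. \<psi> (x + 2 * pi)) (\<lambda>x. G (x + 2 * pi))"
    by (rule stieltjes_substitution(1)[OF xy, where g' = "\<lambda>_. 1"]) (auto intro!: derivative_eq_intros \<psi> G)
  also have "\<dots> = stieltjes x y \<psi> G"
    unfolding \<psi>p Gp by (rule stieltjes_add_const[OF \<psi> G xy])
  finally show ?thesis .
qed

lemma stieltjes_period:
  assumes \<psi>: "\<And>S. \<psi> C1_differentiable_on S" and \<psi>p: "\<And>x. \<psi> (x + 2 * pi) = \<psi> x"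
    and G: "\<And>S. continuous_on S G" and Gp: "\<And>x. G (x + 2 * pi) = G x + \<kappa>"
  shows "stieltjes x (x + 2 * pi) \<psi> G = stieltjes 0 (2 * pi) \<psi> G"
proof -
  note S = stieltjes_shift[OF \<psi> \<psi>p G Gp]
  have c: "stieltjes u w \<psi> G = stieltjes u v \<psi> G + stieltjes v w \<psi> G" if "u \<le> v" "v \<le> w" for u v w
    by (rule stieltjes_combine[OF \<psi> G that])
  \<comment> \<open>A common starting point to the left of both 0 and x, so that every splitting
    respects the order of the endpoints.\<close>
  define M where "M = - \<bar>x\<bar>"
  have M: "M \<le> 0" "M \<le> x" by (auto simp: M_def)
  have "stieltjes M (x + 2 * pi) \<psi> G = stieltjes M x \<psi> G + stieltjes x (x + 2 * pi) \<psi> G" using M by (intro c) auto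
  moreover have "stieltjes M (x + 2 * pi) \<psi> G = stieltjes M (M + 2 * pi) \<psi> G + stieltjes M x \<psi> G"
    using c[of M "M + 2 * pi" "x + 2 * pi"] S[of M x] M by simp
  moreover have "stieltjes M (0 + 2 * pi) \<psi> G = stieltjes M 0 \<psi> G + stieltjes 0 (0 + 2 * pi) \<psi> G" using M by (intro c) auto
  moreover have "stieltjes M (0 + 2 * pi) \<psi> G = stieltjes M (M + 2 * pi) \<psi> G + stieltjes M 0 \<psi> G"
    using c[of M "M + 2 * pi" "0 + 2 * pi"] S[of M 0] M by simp
  ultimately show ?thesis by simp
qed

lemma jac_sq_periodic: "jac_sq a b (\<theta> + 2 * pi) = jac_sq a b \<theta>"
  by (simp add: jac_sq_def cis_mult[symmetric])

context
  fixes s :: complex and t \<mu> :: real and f :: "complex \<Rightarrow> complex" and B :: real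
  assumes s: "s = 1/2 + \<i> * of_real t" and \<mu>: "\<mu> = 1/4 + t\<^sup>2"
    and f: "hyp_eigenfunction (of_real \<mu>) f"
    and B: "\<And>z. z \<in> ball 0 1 \<Longrightarrow> norm (f z) \<le> B"
      "\<And>z. z \<in> ball 0 1 \<Longrightarrow> (1 - (norm z)\<^sup>2) * (norm (partial_x f z) + norm (partial_y f z)) \<le> B"
    and nz: "\<exists>z\<in>ball 0 1. f z \<noteq> 0"
begin

text \<open>Invariance of the eigenfunction becomes the transformation law \<open>dG = |\<gamma>'|\<^sup>-\<^sup>s d(G \<circ> \<gamma>)\<close> because
  both sides have the same Poisson transform.\<close>

lemma helgason_covariance:
  assumes g: "disk_auto a b g" and inv: "\<And>z. z \<in> ball 0 1 \<Longrightarrow> f (g z) = f z"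
    and \<psi>: "\<psi> C1_differentiable_on {\<alpha>..\<beta>}" and \<alpha>\<beta>: "\<alpha> \<le> \<beta>"
  shows "stieltjes \<alpha> \<beta> \<psi> (helgason_primitive f s) =
    stieltjes \<alpha> \<beta> (\<lambda>x. \<psi> x * jac_power s a b x) (\<lambda>x. helgason_primitive f s (circle_lift a b x))"
proof -
  have ab: "(norm a)\<^sup>2 - (norm b)\<^sup>2 = 1" using g by (simp add: disk_auto_def)
  note L = circle_lift_facts[OF ab]
  define G where "G = helgason_primitive f s"
  note GF = helgason_primitive_facts[OF s \<mu> f B nz, folded G_def]
  have Gc: "continuous_on S G" for S by (rule continuous_on_subset[OF GF(1) subset_UNIV])
  have lc: "continuous_on S (circle_lift a b)" for S
    by (rule DERIV_continuous_on) (use L(2) in \<open>auto intro: has_field_derivative_at_within\<close>)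
  define GL where "GL = (\<lambda>x. G (circle_lift a b x))"
  have GLc: "continuous_on S GL" for S
    unfolding GL_def by (rule continuous_on_compose2[OF Gc[of UNIV] lc]) simp
  have GLp: "GL (x + 2 * pi) = GL x + f 0" for x unfolding GL_def L(4) by (rule GF(2))
  have jC: "jac_power s a b C1_differentiable_on S" for S by (rule L(8))
  have jp: "jac_power s a b (x + 2 * pi) = jac_power s a b x" for x by (simp add: jac_power_def jac_sq_periodic)
  \<comment> \<open>The primitive of |g'|^(-s) d(G o g), to be shown equal to G up to a
    constant.\<close>
  define H where "H = (\<lambda>x. if 0 \<le> x then stieltjes 0 x (jac_power s a b) GL else - stieltjes x 0 (jac_power s a b) GL)"
  have H: "\<And>x y. x \<le> y \<Longrightarrow> H y - H x = stieltjes x y (jac_power s a b) GL" "continuous_on UNIV H"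
    using stieltjes_primitive[OF jC GLc] by (auto simp: H_def)
  have Hc: "continuous_on S H" for S by (rule continuous_on_subset[OF H(2) subset_UNIV])
  have Hdiff: "H (y + 2 * pi) - H (x + 2 * pi) = H y - H x" if "x \<le> y" for x y
    using H(1)[of x y] H(1)[of "x + 2 * pi" "y + 2 * pi"] that stieltjes_shift[OF jC jp GLc GLp that] by simp
  have Hp: "H (x + 2 * pi) = H x + H (2 * pi)" for x
  proof -
    have "H 0 = 0" by (simp add: H_def stieltjes_refl)
    then show ?thesis using Hdiff[of 0 x] Hdiff[of x 0] by (cases "0 \<le> x") (auto simp: algebra_simps)
  qed
  \<comment> \<open>Express f(z) by invariance as the Poisson integral at g z, substitute the lift
    of g in it, and let the transformation law of the kernel produce |g'|^(-s); this is the Poisson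
    integral of H at z.\<close>
  have PH: "poisson s H r \<theta> = poisson s G r \<theta>" if r: "0 < r" for r \<theta>
  proof -
    define z where "z = polar_point r \<theta>"
    have zb: "z \<in> ball 0 1" unfolding z_def by (rule polar_point_ball)
    obtain r' \<theta>' where r': "0 \<le> r'" and gz: "g z = polar_point r' \<theta>'"
      using ball_polar_point[OF disk_auto_facts(3)[OF g zb]] by blast
    let ?p = "\<lambda>\<eta>. poisson_kernel s r' (\<theta>' - \<eta>)"
    have pp: "?p (x + 2 * pi) = ?p x" for x
      using poisson_kernel_periodic(1)[of s r' "\<theta>' - (x + 2 * pi)"] by simp
    have pC: "(\<lambda>\<eta>. poisson_kernel s r (\<theta> - \<eta>)) C1_differentiable_on S" for S by (rule poisson_kernel_shifted_C1)
    have "poisson s G r \<theta> = polar_pull f r \<theta>"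
      unfolding G_def using poisson_representation[OF s \<mu> f B nz] r by simp
    also have "\<dots> = f (g z)" using inv[OF zb] by (simp add: polar_pull_def z_def)
    also have "\<dots> = polar_pull f r' \<theta>'" by (simp add: gz polar_pull_def)
    also have "\<dots> = stieltjes 0 (2 * pi) ?p G"
      using poisson_representation[OF s \<mu> f B nz r'] by (simp add: G_def poisson_def)
    \<comment> \<open>The integral over one period does not depend on where it starts; starting at
      the image of 0 makes it the image of the interval from 0 to 2 pi.\<close>
    also have "\<dots> = stieltjes (circle_lift a b 0) (circle_lift a b 0 + 2 * pi) ?p G"
      by (rule stieltjes_period[OF poisson_kernel_shifted_C1 pp Gc GF(2), symmetric])
    also have "circle_lift a b 0 + 2 * pi = circle_lift a b (2 * pi)" using L(4)[of 0] by simp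
    also have "stieltjes (circle_lift a b 0) (circle_lift a b (2 * pi)) ?p G = stieltjes 0 (2 * pi) (\<lambda>\<eta>. ?p (circle_lift a b \<eta>)) GL"
      unfolding GL_def
    proof (rule stieltjes_substitution(1)[OF _ L(2)])
      show "continuous_on {0..2 * pi} (\<lambda>\<theta>. 1 / jac_sq a b \<theta>)"
        by (intro continuous_on_divide continuous_on_const L(6)) (use L(1) in \<open>auto simp: less_le\<close>)
      show "0 \<le> 1 / jac_sq a b x" for x using L(1)[of x] by simp
    qed (simp_all add: poisson_kernel_shifted_C1 Gc)
    also have "(\<lambda>\<eta>. ?p (circle_lift a b \<eta>)) = (\<lambda>\<eta>. poisson_kernel s r (\<theta> - \<eta>) * jac_power s a b \<eta>)"
      using poisson_kernel_transform[OF g gz[unfolded z_def]] by blast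
    also have "stieltjes 0 (2 * pi) (\<lambda>\<eta>. poisson_kernel s r (\<theta> - \<eta>) * jac_power s a b \<eta>) GL = stieltjes 0 (2 * pi) (\<lambda>\<eta>. poisson_kernel s r (\<theta> - \<eta>)) H"
    proof (rule stieltjes_density[OF pC jC GLc, symmetric])
      show "H x = stieltjes 0 x (jac_power s a b) GL + 0" if "x \<in> {0..2 * pi}" for x using that by (simp add: H_def)
    qed simp
    finally show ?thesis by (simp add: poisson_def)
  qed
  have "H x - G x = H \<alpha> - G \<alpha>" for x
  proof (rule poisson_injective[OF s \<mu>, of "\<lambda>x. H x - G x"])
    show "continuous_on UNIV (\<lambda>x. H x - G x)" by (intro continuous_on_diff Hc Gc)
    show "H (\<theta> + 2 * pi) - G (\<theta> + 2 * pi) = H \<theta> - G \<theta> + (H (2 * pi) - f 0)" for \<theta>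
      using GF(2)[of \<theta>] by (simp add: Hp)
    show "poisson s (\<lambda>x. H x - G x) r \<theta> = 0" if "0 < r" for r \<theta>
      using PH[OF that] stieltjes_diff[OF poisson_kernel_shifted_C1 Hc Gc] by (simp add: poisson_def)
  qed
  then have "G x = stieltjes \<alpha> x (jac_power s a b) GL + G \<alpha>" if "x \<in> {\<alpha>..\<beta>}" for x
    using H(1)[of \<alpha> x] that by (simp add: algebra_simps) (metis add.commute add_diff_eq diff_add_cancel)
  from stieltjes_density[OF \<psi> jC GLc \<alpha>\<beta> this] show ?thesis unfolding GL_def G_def .
qed

text \<open>A constant primitive has Poisson transform zero.\<close>

lemma helgason_primitive_nonconstant: "\<exists>x y. helgason_primitive f s x \<noteq> helgason_primitive f s y"
proof (rule ccontr)
  assume "\<not> ?thesis"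
  then have c: "helgason_primitive f s = (\<lambda>_. helgason_primitive f s 0)" by auto
  obtain z where z: "z \<in> ball 0 1" "f z \<noteq> 0" using nz by blast
  obtain r \<theta> where r: "0 \<le> r" "z = polar_point r \<theta>" using ball_polar_point[OF z(1)] .
  have "f z = poisson s (helgason_primitive f s) r \<theta>"
    using poisson_representation[OF s \<mu> f B nz r(1)] r(2) by (simp add: polar_pull_def)
  also have "\<dots> = 0" unfolding poisson_def by (subst c) (rule stieltjes_const[OF poisson_kernel_shifted_C1], simp)
  finally show False using z by simp
qed

end

subsection \<open>Analyticity and injectivity of the kernel integrals\<close>

text \<open>For real angles between 0 and 2 pi the chord length is 2 sin(x/2). Here its logarithm
  continues holomorphically to complex angles.\<close>

definition angle_domain :: "complex set" where
  "angle_domain = {z. 2 * sin (z / 2) \<notin> \<real>\<^sub>\<le>\<^sub>0}"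

text \<open>
  For \<open>n = 0\<close> this is the kernel \<open>|\<xi> - \<eta>|\<^sup>-\<^sup>2\<^sup>s\<close> in terms of the angle between \<open>\<xi>\<close> and \<open>\<eta>\<close>; the powers of the
  cotangent make the family closed under differentiation.
\<close>

definition angle_kernel :: "complex \<Rightarrow> nat \<Rightarrow> complex \<Rightarrow> complex" where
  "angle_kernel s n z = exp (- 2 * s * Ln (2 * sin (z / 2))) * (cos (z / 2) / sin (z / 2)) ^ n"

text \<open>The derivative of the kernel, from (cot(z/2))' = -(1 + cot^2(z/2)) / 2. For n = 0 the
  truncated \<open>n - 1\<close> is harmless because its coefficient is 0.\<close>

definition angle_kernel_d :: "complex \<Rightarrow> nat \<Rightarrow> complex \<Rightarrow> complex" where
  "angle_kernel_d s n z = - ((s + of_nat n / 2) * angle_kernel s (Suc n) z + of_nat n / 2 * angle_kernel s (n - 1) z)"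

definition angle_kernel_dd :: "complex \<Rightarrow> nat \<Rightarrow> complex \<Rightarrow> complex" where
  "angle_kernel_dd s n z = - ((s + of_nat n / 2) * angle_kernel_d s (Suc n) z + of_nat n / 2 * angle_kernel_d s (n - 1) z)"

lemma open_kdom: "open angle_domain"
proof -
  have eq: "angle_domain = (\<lambda>z. 2 * sin (z / 2)) -` (- \<real>\<^sub>\<le>\<^sub>0)" by (auto simp: angle_domain_def)
  show ?thesis unfolding eq
    by (rule open_vimage, rule open_Compl[OF closed_nonpos_Reals_complex], intro continuous_intros) simp
qed

lemma angle_domain_sin: "z \<in> angle_domain \<Longrightarrow> sin (z / 2) \<noteq> 0"
  by (auto simp: angle_domain_def)

lemma real_kdom:
  assumes "0 < x" "x < 2 * pi"
  shows "of_real x \<in> angle_domain" "0 < sin (x / 2)"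
proof -
  show p: "0 < sin (x / 2)" by (rule sin_gt_zero) (use assms in auto)
  have "2 * sin (complex_of_real x / 2) = of_real (2 * sin (x / 2))" by (simp flip: sin_of_real)
  then show "of_real x \<in> angle_domain" using p by (simp add: angle_domain_def del: of_real_mult)
qed

lemma angle_kernel_derivative:
  assumes z: "z \<in> angle_domain"
  shows "(angle_kernel s n has_field_derivative angle_kernel_d s n z) (at z)"
proof -
  define S C where "S = sin (z / 2)" and "C = cos (z / 2) / sin (z / 2)"
  have S: "S \<noteq> 0" using angle_domain_sin[OF z] by (simp add: S_def)
  have L: "2 * S \<notin> \<real>\<^sub>\<le>\<^sub>0" using z by (simp add: angle_domain_def S_def)
  have dS: "((\<lambda>z. 2 * sin (z / 2)) has_field_derivative cos (z / 2)) (at z)"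
    by (auto intro!: derivative_eq_intros)
  have dL: "((\<lambda>z. Ln (2 * sin (z / 2))) has_field_derivative C / 2) (at z)"
    using DERIV_chain2[OF has_field_derivative_Ln[of "2 * sin (z / 2)"] dS] L S
    by (simp add: S_def C_def field_simps)
  have dE: "((\<lambda>z. exp (- 2 * s * Ln (2 * sin (z / 2)))) has_field_derivative
      exp (- 2 * s * Ln (2 * S)) * (- s * C)) (at z)"
    using DERIV_chain2[OF DERIV_exp DERIV_cmult[OF dL, of "- 2 * s"]] by (simp add: S_def)
  have dC: "((\<lambda>z. cos (z / 2) / sin (z / 2)) has_field_derivative - (1 + C\<^sup>2) / 2) (at z)"
  proof -
    have "((\<lambda>z. cos (z / 2) / sin (z / 2)) has_field_derivative
        ((- sin (z / 2) / 2) * sin (z / 2) - cos (z / 2) * (cos (z / 2) / 2)) / (sin (z / 2) * sin (z / 2))) (at z)"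
      using S by (auto intro!: derivative_eq_intros simp: S_def)
    also have "((- sin (z / 2) / 2) * sin (z / 2) - cos (z / 2) * (cos (z / 2) / 2)) / (sin (z / 2) * sin (z / 2)) = - (1 + C\<^sup>2) / 2"
    proof -
      define Q where "Q = cos (z / 2)"
      have QS: "S * S + Q * Q = 1" using sin_cos_squared_add[of "z / 2"] by (simp add: S_def Q_def power2_eq_square)
      have C2: "1 + C\<^sup>2 = 1 / (S * S)"
      proof -
        have "1 + C\<^sup>2 = (S * S + Q * Q) / (S * S)"
          using S by (simp add: C_def S_def[symmetric] Q_def[symmetric] add_divide_distrib power2_eq_square)
        then show ?thesis unfolding QS .
      qed
      have "(- S / 2) * S - Q * (Q / 2) = - (S * S + Q * Q) / 2" by (simp add: field_simps)
      then show ?thesis unfolding C2 S_def[symmetric] Q_def[symmetric] QS by simp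
    qed
    finally show ?thesis .
  qed
  have dP: "((\<lambda>z. (cos (z / 2) / sin (z / 2)) ^ n) has_field_derivative of_nat n * C ^ (n - 1) * (- (1 + C\<^sup>2) / 2)) (at z)"
    using DERIV_power[OF dC, of n] by (simp add: C_def mult_ac)
  have D: "(angle_kernel s n has_field_derivative
      exp (- 2 * s * Ln (2 * S)) * (of_nat n * C ^ (n - 1) * (- (1 + C\<^sup>2) / 2)) + exp (- 2 * s * Ln (2 * S)) * (- s * C) * C ^ n) (at z)"
    unfolding angle_kernel_def[abs_def] using DERIV_mult[OF dE dP] by (simp add: S_def C_def algebra_simps)
  have kkC: "angle_kernel s m z = exp (- 2 * s * Ln (2 * S)) * C ^ m" for m by (simp add: angle_kernel_def S_def C_def)
  have "exp (- 2 * s * Ln (2 * S)) * (of_nat n * C ^ (n - 1) * (- (1 + C\<^sup>2) / 2)) + exp (- 2 * s * Ln (2 * S)) * (- s * C) * C ^ n = angle_kernel_d s n z"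
    unfolding angle_kernel_d_def kkC by (cases n) (simp_all add: field_simps power2_eq_square)
  then show ?thesis using D by simp
qed

lemma angle_kernel_d_derivative:
  assumes "z \<in> angle_domain"
  shows "(angle_kernel_d s n has_field_derivative angle_kernel_dd s n z) (at z)"
proof -
  have eq: "angle_kernel_d s n = (\<lambda>z. - ((s + of_nat n / 2) * angle_kernel s (Suc n) z + of_nat n / 2 * angle_kernel s (n - 1) z))"
    by (rule ext) (rule angle_kernel_d_def)
  show ?thesis
    unfolding angle_kernel_dd_def by (subst eq) (intro DERIV_minus DERIV_add DERIV_cmult angle_kernel_derivative assms)
qed

lemma continuous_on_angle_kernel: "continuous_on angle_domain (angle_kernel s n)" "continuous_on angle_domain (angle_kernel_d s n)" "continuous_on angle_domain (angle_kernel_dd s n)"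
proof -
  show 1: "continuous_on angle_domain (angle_kernel s n)" for n
    by (rule DERIV_continuous_on, rule has_field_derivative_at_within, rule angle_kernel_derivative)
  show 2: "continuous_on angle_domain (angle_kernel_d s n)" for n
    by (rule DERIV_continuous_on, rule has_field_derivative_at_within, rule angle_kernel_d_derivative)
  show "continuous_on angle_domain (angle_kernel_dd s n)"
    unfolding angle_kernel_dd_def[abs_def] by (intro continuous_on_minus continuous_on_add continuous_on_mult continuous_on_const 2)
qed

lemma angle_kernel_curve:
  assumes "of_real (\<eta> - \<theta>) \<in> angle_domain"
  shows "((\<lambda>\<eta>. angle_kernel s n (of_real (\<eta> - \<theta>))) has_vector_derivative angle_kernel_d s n (of_real (\<eta> - \<theta>))) (at \<eta>)"
proof -
  have "((\<lambda>\<eta>. complex_of_real (\<eta> - \<theta>)) has_vector_derivative of_real 1) (at \<eta>)"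
    by (rule has_vector_derivative_of_real) (auto intro!: derivative_eq_intros)
  from field_vector_diff_chain_at[OF this angle_kernel_derivative[OF assms]]
  show ?thesis by (simp add: o_def)
qed

lemma angle_kernel_C1:
  assumes "\<theta> < \<alpha>" "\<beta> < \<theta> + 2 * pi"
  shows "(\<lambda>\<eta>. angle_kernel s n (of_real (\<eta> - \<theta>))) C1_differentiable_on {\<alpha>..\<beta>}"
proof (rule C1_I)
  have d: "of_real (\<eta> - \<theta>) \<in> angle_domain" if "\<eta> \<in> {\<alpha>..\<beta>}" for \<eta>
    by (rule real_kdom(1)) (use that assms in auto)
  show "((\<lambda>\<eta>. angle_kernel s n (of_real (\<eta> - \<theta>))) has_vector_derivative angle_kernel_d s n (of_real (\<eta> - \<theta>))) (at \<eta>)" if "\<eta> \<in> {\<alpha>..\<beta>}" for \<eta>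
    by (rule angle_kernel_curve[OF d[OF that]])
  show "continuous_on {\<alpha>..\<beta>} (\<lambda>\<eta>. angle_kernel_d s n (of_real (\<eta> - \<theta>)))"
    by (rule continuous_on_compose2[OF continuous_on_angle_kernel(2)]) (use d in \<open>auto intro!: continuous_intros\<close>)
qed

lemma norm_cis_diff:
  assumes "0 < \<eta> - \<theta>" "\<eta> - \<theta> < 2 * pi"
  shows "norm (cis \<theta> - cis \<eta>) = 2 * sin ((\<eta> - \<theta>) / 2)"
proof -
  have "(norm (cis \<theta> - cis \<eta>))\<^sup>2 = (sin \<theta>)\<^sup>2 + (cos \<theta>)\<^sup>2 + ((sin \<eta>)\<^sup>2 + (cos \<eta>)\<^sup>2) - 2 * (cos \<eta> * cos \<theta> + sin \<eta> * sin \<theta>)"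
  proof -
    have "(x - u)\<^sup>2 + (y - v)\<^sup>2 = y\<^sup>2 + x\<^sup>2 + (v\<^sup>2 + u\<^sup>2) - 2 * (u * x + v * y)" for x y u v :: real
      by (simp add: power2_eq_square algebra_simps)
    then show ?thesis unfolding cmod_power2 by simp
  qed
  also have "\<dots> = 2 - 2 * cos (2 * ((\<eta> - \<theta>) / 2))" 
  proof -
    have "2 * ((\<eta> - \<theta>) / 2) = \<eta> - \<theta>" by simp
    then show ?thesis unfolding cos_diff[symmetric] by (simp only:) simp
  qed
  also have "\<dots> = (2 * sin ((\<eta> - \<theta>) / 2))\<^sup>2"
    unfolding cos_double_sin by (simp add: power_mult_distrib)
  finally have "(norm (cis \<theta> - cis \<eta>))\<^sup>2 = (2 * sin ((\<eta> - \<theta>) / 2))\<^sup>2" .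
  then show ?thesis by (rule power2_eq_imp_eq) (use real_kdom(2)[OF assms] in auto)
qed

lemma kernel_eq_angle_kernel:
  assumes "0 < \<eta> - \<theta>" "\<eta> - \<theta> < 2 * pi"
  shows "1 / complex_of_real (norm (cis \<theta> - cis \<eta>)) powr (2 * s) = angle_kernel s 0 (of_real (\<eta> - \<theta>))"
proof -
  have p: "0 < sin ((\<eta> - \<theta>) / 2)" by (rule real_kdom(2)[OF assms])
  have eq: "complex_of_real (2 * sin ((\<eta> - \<theta>) / 2)) = 2 * sin (of_real (\<eta> - \<theta>) / 2)"
    by (simp flip: sin_of_real)
  have "2 * sin (complex_of_real (\<eta> - \<theta>) / 2) \<noteq> 0" unfolding eq[symmetric] using p by simp
  with eq show ?thesis
    unfolding norm_cis_diff[OF assms] angle_kernel_def powr_def using p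
    by (simp add: exp_minus inverse_eq_divide del: of_real_mult of_real_diff)
qed

lemma boundary_kernel_powr:
  "complex_of_real (boundary_kernel \<xi> \<eta>) powr s = 1 / of_real (norm (\<xi> - \<eta>)) powr (2 * s)"
proof (cases "\<xi> = \<eta>")
  case False
  define n where "n = norm (\<xi> - \<eta>)"
  have n: "0 < n" using False by (simp add: n_def)
  have "ln (inverse (n\<^sup>2)) = - (2 * ln n)" using n by (simp add: ln_inverse ln_realpow)
  then have "complex_of_real (inverse (n\<^sup>2)) powr s = exp (s * of_real (- (2 * ln n)))"
    using n by (simp add: powr_def Ln_of_real del: of_real_inverse of_real_power)
  moreover have "of_real n powr (2 * s) = exp (2 * s * of_real (ln n))"
    using n by (simp add: powr_def Ln_of_real)
  ultimately show ?thesis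
    by (simp add: boundary_kernel_def n_def[symmetric] exp_minus inverse_eq_divide mult_ac)
qed (simp add: boundary_kernel_def)

lemma kernel_C1:
  assumes "\<theta> < \<alpha>" "\<beta> < \<theta> + 2 * pi"
  shows "(\<lambda>u. 1 / complex_of_real (norm (cis \<theta> - cis u)) powr (2 * s)) C1_differentiable_on {\<alpha>..\<beta>}"
proof (rule C1_I)
  have d: "of_real (\<eta> - \<theta>) \<in> angle_domain" if "\<eta> \<in> {\<alpha>..\<beta>}" for \<eta>
    by (rule real_kdom(1)) (use that assms in auto)
  show "((\<lambda>u. 1 / complex_of_real (norm (cis \<theta> - cis u)) powr (2 * s)) has_vector_derivative angle_kernel_d s 0 (of_real (\<eta> - \<theta>))) (at \<eta>)"
    if "\<eta> \<in> {\<alpha>..\<beta>}" for \<eta>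
  proof (rule has_vector_derivative_transform_within_open[OF angle_kernel_curve[OF d[OF that]]])
    show "open {\<theta><..<\<theta> + 2 * pi}" by simp
    show "\<eta> \<in> {\<theta><..<\<theta> + 2 * pi}" using that assms by auto
    show "angle_kernel s 0 (of_real (u - \<theta>)) = 1 / complex_of_real (norm (cis \<theta> - cis u)) powr (2 * s)"
      if "u \<in> {\<theta><..<\<theta> + 2 * pi}" for u
      by (rule kernel_eq_angle_kernel[symmetric]) (use that in auto)
  qed
  show "continuous_on {\<alpha>..\<beta>} (\<lambda>\<eta>. angle_kernel_d s 0 (of_real (\<eta> - \<theta>)))"
    by (rule continuous_on_compose2[OF continuous_on_angle_kernel(2)]) (use d in \<open>auto intro!: continuous_intros\<close>)
qed

lemma helgason_integral_kernel:
  assumes "\<alpha> < \<beta>" "\<theta> < \<alpha>" "\<beta> < \<theta> + 2 * pi"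
  shows "helgason_integral f s \<alpha> \<beta> (\<lambda>\<eta>. 1 / of_real (norm (cis \<theta> - \<eta>)) powr (2 * s)) =
    stieltjes \<alpha> \<beta> (\<lambda>\<eta>. angle_kernel s 0 (of_real (\<eta> - \<theta>))) (helgason_primitive f s)"
proof -
  have "helgason_integral f s \<alpha> \<beta> (\<lambda>\<eta>. 1 / of_real (norm (cis \<theta> - \<eta>)) powr (2 * s)) =
    stieltjes \<alpha> \<beta> (\<lambda>u. 1 / of_real (norm (cis \<theta> - cis u)) powr (2 * s)) (helgason_primitive f s)"
    by (rule helgason_integral_stieltjes[OF assms(1) kernel_C1[OF assms(2,3)]])
  also have "\<dots> = stieltjes \<alpha> \<beta> (\<lambda>\<eta>. angle_kernel s 0 (of_real (\<eta> - \<theta>))) (helgason_primitive f s)"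
    by (rule stieltjes_cong[OF assms(1) kernel_C1[OF assms(2,3)] angle_kernel_C1[OF assms(2,3)] kernel_eq_angle_kernel refl]) (use assms in auto)
  finally show ?thesis .
qed

text \<open>The kernel integrals \<open>angle_kernel_integral s G \<alpha> \<beta> n\<close>, as functions of a complex angle, satisfy
  \<open>N\<^sub>n' = (s + n/2) N\<^sub>n\<^sub>+\<^sub>1 + (n/2) N\<^sub>n\<^sub>-\<^sub>1\<close>.\<close>

definition angle_kernel_integral :: "complex \<Rightarrow> (real \<Rightarrow> complex) \<Rightarrow> real \<Rightarrow> real \<Rightarrow> nat \<Rightarrow> complex \<Rightarrow> complex" where
  "angle_kernel_integral s G \<alpha> \<beta> n \<zeta> = angle_kernel s n (of_real \<beta> - \<zeta>) * G \<beta> - angle_kernel s n (of_real \<alpha> - \<zeta>) * G \<alpha> -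
     integral {\<alpha>..\<beta>} (\<lambda>\<eta>. angle_kernel_d s n (of_real \<eta> - \<zeta>) * G \<eta>)"

lemma angle_kernel_integral_real:
  assumes "\<theta> < \<alpha>" "\<beta> < \<theta> + 2 * pi"
  shows "angle_kernel_integral s G \<alpha> \<beta> n (of_real \<theta>) = stieltjes \<alpha> \<beta> (\<lambda>\<eta>. angle_kernel s n (of_real (\<eta> - \<theta>))) G"
proof -
  have "stieltjes \<alpha> \<beta> (\<lambda>\<eta>. angle_kernel s n (of_real (\<eta> - \<theta>))) G = angle_kernel s n (of_real (\<beta> - \<theta>)) * G \<beta> - angle_kernel s n (of_real (\<alpha> - \<theta>)) * G \<alpha> -
     integral {\<alpha>..\<beta>} (\<lambda>\<eta>. angle_kernel_d s n (of_real (\<eta> - \<theta>)) * G \<eta>)"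
    by (rule stieltjes_eq, rule angle_kernel_curve, rule real_kdom(1)) (use assms in auto)
  then show ?thesis by (simp add: angle_kernel_integral_def)
qed

text \<open>The differences \<eta> - \<theta>0 form a compact subset of the open set
  \<open>angle_domain\<close>; its distance to the complement is a radius good for all \<eta> at
  once.\<close>

lemma angle_kernel_integral_nbhd:
  assumes "\<alpha> < \<beta>" "\<theta>\<^sub>0 < \<alpha>" "\<beta> < \<theta>\<^sub>0 + 2 * pi"
  obtains \<epsilon> where "0 < \<epsilon>" "\<And>\<zeta> \<eta>. \<zeta> \<in> ball (of_real \<theta>\<^sub>0) \<epsilon> \<Longrightarrow> \<eta> \<in> {\<alpha>..\<beta>} \<Longrightarrow> of_real \<eta> - \<zeta> \<in> angle_domain"
proof -
  define K where "K = (\<lambda>\<eta>. complex_of_real (\<eta> - \<theta>\<^sub>0)) ` {\<alpha>..\<beta>}"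
  have "compact K" unfolding K_def by (intro compact_continuous_image continuous_intros) auto
  moreover have "closed (- angle_domain)" using open_kdom by (simp add: closed_def)
  moreover have "K \<inter> - angle_domain = {}"
    unfolding K_def using assms by (auto simp del: of_real_diff intro!: real_kdom(1))
  ultimately obtain d where d: "0 < d" "\<And>x y. x \<in> K \<Longrightarrow> y \<in> - angle_domain \<Longrightarrow> d \<le> dist x y"
    using separate_compact_closed[of K "- angle_domain"] by blast
  show ?thesis
  proof (rule that[OF d(1)])
    fix \<zeta> \<eta> assume z: "\<zeta> \<in> ball (complex_of_real \<theta>\<^sub>0) d" and e: "\<eta> \<in> {\<alpha>..\<beta>}"
    show "of_real \<eta> - \<zeta> \<in> angle_domain"
    proof (rule ccontr)
      assume "of_real \<eta> - \<zeta> \<notin> angle_domain"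
      then have "d \<le> dist (complex_of_real (\<eta> - \<theta>\<^sub>0)) (of_real \<eta> - \<zeta>)" using e by (intro d(2)) (auto simp: K_def)
      also have "\<dots> = dist (complex_of_real \<theta>\<^sub>0) \<zeta>" by (simp add: dist_norm norm_minus_commute)
      finally show False using z by simp
    qed
  qed
qed

text \<open>Differentiating under the integral sign produces \<open>angle_kernel_dd\<close>, which
  satisfies the same recursion in n as \<open>angle_kernel_d\<close>. The boundary terms and the
  integral therefore recombine into kernel integrals of the neighbouring indices.\<close>

lemma angle_kernel_integral_derivative:
  assumes \<epsilon>: "\<And>\<zeta> \<eta>. \<zeta> \<in> ball z\<^sub>0 \<epsilon> \<Longrightarrow> \<eta> \<in> {\<alpha>..\<beta>} \<Longrightarrow> of_real \<eta> - \<zeta> \<in> angle_domain"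
    and G: "continuous_on {\<alpha>..\<beta>} G" and ab: "\<alpha> \<le> \<beta>" and \<zeta>: "\<zeta> \<in> ball z\<^sub>0 \<epsilon>"
  shows "(angle_kernel_integral s G \<alpha> \<beta> n has_field_derivative
     (s + of_nat n / 2) * angle_kernel_integral s G \<alpha> \<beta> (Suc n) \<zeta> + of_nat n / 2 * angle_kernel_integral s G \<alpha> \<beta> (n - 1) \<zeta>) (at \<zeta>)"
proof -
  let ?U = "ball z\<^sub>0 \<epsilon>"
  have m: "((\<lambda>\<zeta>. of_real \<eta> - \<zeta>) has_field_derivative - 1) (at \<zeta>)" for \<eta> and \<zeta> :: complex
    by (auto intro!: derivative_eq_intros)
  have dk: "((\<lambda>\<zeta>. angle_kernel s n (of_real \<eta> - \<zeta>)) has_field_derivative - angle_kernel_d s n (of_real \<eta> - \<zeta>)) (at \<zeta>)"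
    if "\<zeta> \<in> ?U" "\<eta> \<in> {\<alpha>..\<beta>}" for \<zeta> \<eta>
    using DERIV_chain2[OF angle_kernel_derivative[OF \<epsilon>[OF that]] m] by simp
  have dd: "((\<lambda>\<zeta>. angle_kernel_d s n (of_real \<eta> - \<zeta>) * G \<eta>) has_field_derivative - angle_kernel_dd s n (of_real \<eta> - \<zeta>) * G \<eta>) (at \<zeta>)"
    if "\<zeta> \<in> ?U" "\<eta> \<in> {\<alpha>..\<beta>}" for \<zeta> \<eta>
    using DERIV_cmult_right[OF DERIV_chain2[OF angle_kernel_d_derivative[OF \<epsilon>[OF that]] m], where c = "G \<eta>"] by simp
  have ck: "continuous_on {\<alpha>..\<beta>} (\<lambda>\<eta>. h (of_real \<eta> - \<zeta>) * G \<eta>)" if "continuous_on angle_domain h" "\<zeta> \<in> ?U" for h \<zeta>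
    by (intro continuous_on_mult G continuous_on_compose2[OF that(1)] continuous_intros) (use \<epsilon>[OF that(2)] in auto)
  have "((\<lambda>\<zeta>. integral (cbox \<alpha> \<beta>) (\<lambda>\<eta>. angle_kernel_d s n (of_real \<eta> - \<zeta>) * G \<eta>)) has_field_derivative
      integral (cbox \<alpha> \<beta>) (\<lambda>\<eta>. - angle_kernel_dd s n (of_real \<eta> - \<zeta>) * G \<eta>)) (at \<zeta> within ?U)"
  proof (rule leibniz_rule_field_derivative[OF _ _ _ \<zeta> convex_ball])
    show "((\<lambda>\<zeta>. angle_kernel_d s n (of_real \<eta> - \<zeta>) * G \<eta>) has_field_derivative - angle_kernel_dd s n (of_real \<eta> - \<zeta>) * G \<eta>) (at \<zeta> within ?U)"
      if "\<zeta> \<in> ?U" "\<eta> \<in> cbox \<alpha> \<beta>" for \<zeta> \<eta>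
      using dd[of \<zeta> \<eta>] that by (auto intro: has_field_derivative_at_within)
    show "(\<lambda>\<eta>. angle_kernel_d s n (of_real \<eta> - \<zeta>) * G \<eta>) integrable_on cbox \<alpha> \<beta>" if "\<zeta> \<in> ?U" for \<zeta>
      using integrable_continuous_real[OF ck[OF continuous_on_angle_kernel(2) that]] by simp
    have "continuous_on (?U \<times> cbox \<alpha> \<beta>) (\<lambda>x. complex_of_real (snd x) - fst x)" by (intro continuous_intros)
    then have 1: "continuous_on (?U \<times> cbox \<alpha> \<beta>) (\<lambda>x. angle_kernel_dd s n (complex_of_real (snd x) - fst x))"
      by (rule continuous_on_compose2[OF continuous_on_angle_kernel(3)]) (use \<epsilon> in auto)
    have "continuous_on (?U \<times> cbox \<alpha> \<beta>) (\<lambda>x. G (snd x))"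
      by (rule continuous_on_compose2[OF G]) (auto intro!: continuous_intros)
    with 1 show "continuous_on (?U \<times> cbox \<alpha> \<beta>) (\<lambda>(\<zeta>, \<eta>). - angle_kernel_dd s n (of_real \<eta> - \<zeta>) * G \<eta>)"
      unfolding case_prod_unfold by (intro continuous_on_mult continuous_on_minus)
  qed
  then have dI: "((\<lambda>\<zeta>. integral {\<alpha>..\<beta>} (\<lambda>\<eta>. angle_kernel_d s n (of_real \<eta> - \<zeta>) * G \<eta>)) has_field_derivative
      integral {\<alpha>..\<beta>} (\<lambda>\<eta>. - angle_kernel_dd s n (of_real \<eta> - \<zeta>) * G \<eta>)) (at \<zeta>)"
    using at_within_open[OF \<zeta> open_ball] by simp
  have mem: "\<beta> \<in> {\<alpha>..\<beta>}" "\<alpha> \<in> {\<alpha>..\<beta>}" using ab by auto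
  have D: "(angle_kernel_integral s G \<alpha> \<beta> n has_field_derivative
      - angle_kernel_d s n (of_real \<beta> - \<zeta>) * G \<beta> - (- angle_kernel_d s n (of_real \<alpha> - \<zeta>) * G \<alpha>) -
      integral {\<alpha>..\<beta>} (\<lambda>\<eta>. - angle_kernel_dd s n (of_real \<eta> - \<zeta>) * G \<eta>)) (at \<zeta>)"
    unfolding angle_kernel_integral_def[abs_def]
    by (intro DERIV_diff DERIV_cmult_right dI dk \<zeta> mem)
  define A B where "A = s + of_nat n / 2" and "B = (of_nat n / 2 :: complex)"
  have i: "(\<lambda>\<eta>. angle_kernel_d s m (of_real \<eta> - \<zeta>) * G \<eta>) integrable_on {\<alpha>..\<beta>}" for m
    by (rule integrable_continuous_real[OF ck[OF continuous_on_angle_kernel(2) \<zeta>]])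
  have "integral {\<alpha>..\<beta>} (\<lambda>\<eta>. - angle_kernel_dd s n (of_real \<eta> - \<zeta>) * G \<eta>) =
     integral {\<alpha>..\<beta>} (\<lambda>\<eta>. A * (angle_kernel_d s (Suc n) (of_real \<eta> - \<zeta>) * G \<eta>) + B * (angle_kernel_d s (n - 1) (of_real \<eta> - \<zeta>) * G \<eta>))"
    by (simp add: angle_kernel_dd_def A_def B_def algebra_simps)
  also have "\<dots> = A * integral {\<alpha>..\<beta>} (\<lambda>\<eta>. angle_kernel_d s (Suc n) (of_real \<eta> - \<zeta>) * G \<eta>) +
      B * integral {\<alpha>..\<beta>} (\<lambda>\<eta>. angle_kernel_d s (n - 1) (of_real \<eta> - \<zeta>) * G \<eta>)"
    using integral_add[OF integrable_on_mult_right[OF i] integrable_on_mult_right[OF i]]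
    by (simp only: integral_mult_right)
  finally have I: "integral {\<alpha>..\<beta>} (\<lambda>\<eta>. - angle_kernel_dd s n (of_real \<eta> - \<zeta>) * G \<eta>) = \<dots>" .
  have k: "- angle_kernel_d s n z = A * angle_kernel s (Suc n) z + B * angle_kernel s (n - 1) z" for z
    by (simp add: angle_kernel_d_def A_def B_def)
  have "(angle_kernel_integral s G \<alpha> \<beta> n has_field_derivative
     A * angle_kernel_integral s G \<alpha> \<beta> (Suc n) \<zeta> + B * angle_kernel_integral s G \<alpha> \<beta> (n - 1) \<zeta>) (at \<zeta>)"
    using D unfolding I k unfolding angle_kernel_integral_def[of s G \<alpha> \<beta> _ \<zeta>] by (simp add: algebra_simps)
  then show ?thesis unfolding A_def B_def .
qed

text \<open>The kernel integral is holomorphic in a complex disk around \<theta>0, and its Taylor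
  series is restricted to real angles. The last conclusion keeps the angle in the window where the
  integral is that of the boundary kernel.\<close>

lemma angle_kernel_integral_analytic:
  assumes ab: "\<alpha> < \<beta>" "\<theta>\<^sub>0 < \<alpha>" "\<beta> < \<theta>\<^sub>0 + 2 * pi" and G: "continuous_on {\<alpha>..\<beta>} G"
  obtains a \<epsilon> where "0 < \<epsilon>" "\<And>\<theta>. \<bar>\<theta> - \<theta>\<^sub>0\<bar> < \<epsilon> \<Longrightarrow>
    (\<lambda>n. a n * of_real (\<theta> - \<theta>\<^sub>0) ^ n) sums stieltjes \<alpha> \<beta> (\<lambda>\<eta>. angle_kernel s 0 (of_real (\<eta> - \<theta>))) G"
    "\<And>\<theta>. \<bar>\<theta> - \<theta>\<^sub>0\<bar> < \<epsilon> \<Longrightarrow> \<theta> < \<alpha> \<and> \<beta> < \<theta> + 2 * pi"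
proof -
  obtain e where e: "0 < e" "\<And>\<zeta> \<eta>. \<zeta> \<in> ball (of_real \<theta>\<^sub>0) e \<Longrightarrow> \<eta> \<in> {\<alpha>..\<beta>} \<Longrightarrow> of_real \<eta> - \<zeta> \<in> angle_domain"
    using angle_kernel_integral_nbhd[OF ab] by blast
  define N where "N = angle_kernel_integral s G \<alpha> \<beta> 0"
  have "N holomorphic_on ball (of_real \<theta>\<^sub>0) e"
    unfolding holomorphic_on_open[OF open_ball] N_def
    using angle_kernel_integral_derivative[OF e(2) G] ab(1) by (meson less_imp_le)
  note ps = holomorphic_power_series[OF this]
  define \<epsilon> where "\<epsilon> = min e (min (\<alpha> - \<theta>\<^sub>0) (\<theta>\<^sub>0 + 2 * pi - \<beta>))"
  show ?thesis
  proof (rule that)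
    show "0 < \<epsilon>" using e(1) ab by (simp add: \<epsilon>_def)
    show w: "\<theta> < \<alpha> \<and> \<beta> < \<theta> + 2 * pi" if "\<bar>\<theta> - \<theta>\<^sub>0\<bar> < \<epsilon>" for \<theta>
      using that unfolding \<epsilon>_def by linarith
    show "(\<lambda>n. ((deriv ^^ n) N (of_real \<theta>\<^sub>0) / fact n) * of_real (\<theta> - \<theta>\<^sub>0) ^ n) sums stieltjes \<alpha> \<beta> (\<lambda>\<eta>. angle_kernel s 0 (of_real (\<eta> - \<theta>))) G"
      if t: "\<bar>\<theta> - \<theta>\<^sub>0\<bar> < \<epsilon>" for \<theta>
    proof -
      have "complex_of_real \<theta> \<in> ball (of_real \<theta>\<^sub>0) e"
        using t by (simp add: \<epsilon>_def dist_norm abs_minus_commute flip: of_real_diff)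
      from ps[OF this] show ?thesis
        using angle_kernel_integral_real[of \<theta> \<alpha> \<beta> s G 0] w[OF t] by (simp add: N_def)
    qed
  qed
qed

section \<open>Moments and the vanishing of a primitive\<close>

lemma weighted_square_zero:
  fixes u W :: "real \<Rightarrow> real"
  assumes ab: "a < b" and u: "continuous_on {a..b} u" and W: "continuous_on {a..b} W" and W0: "\<And>x. x \<in> {a..b} \<Longrightarrow> 0 < W x"
    and approx: "\<And>e. 0 < e \<Longrightarrow> \<exists>g. continuous_on {a..b} g \<and> (\<forall>x\<in>{a..b}. \<bar>u x - g x\<bar> \<le> e) \<and>
       integral {a..b} (\<lambda>x. g x * (W x * u x)) = 0"
    and x: "x \<in> {a..b}"
  shows "u x = 0"
proof -
  define A where "A = integral {a..b} (\<lambda>x. W x * \<bar>u x\<bar>)"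
  have iA: "(\<lambda>x. W x * \<bar>u x\<bar>) integrable_on {a..b}"
    by (intro integrable_continuous_real continuous_on_mult continuous_on_rabs u W)
  have cu2: "continuous_on {a..b} (\<lambda>x. u x * (W x * u x))" by (intro continuous_on_mult u W)
  have u2: "(\<lambda>x. u x * (W x * u x)) integrable_on {a..b}" by (rule integrable_continuous_real[OF cu2])
  have A0: "0 \<le> A" unfolding A_def by (rule integral_nonneg[OF iA]) (rule mult_nonneg_nonneg[OF less_imp_le[OF W0] abs_ge_zero])
  define I where "I = integral {a..b} (\<lambda>x. u x * (W x * u x))"
  \<comment> \<open>As g is orthogonal to W u, the integral of W u^2 equals that of (u - g) W
    u.\<close>
  have le: "I \<le> e * A" if e: "0 < e" for e
  proof -
    obtain g where g: "continuous_on {a..b} g" "\<And>x. x \<in> {a..b} \<Longrightarrow> \<bar>u x - g x\<bar> \<le> e"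
      "integral {a..b} (\<lambda>x. g x * (W x * u x)) = 0" using approx[OF e] by blast
    have ig: "(\<lambda>x. g x * (W x * u x)) integrable_on {a..b}"
      by (intro integrable_continuous_real continuous_on_mult u W g)
    have "I = integral {a..b} (\<lambda>x. u x * (W x * u x) - g x * (W x * u x))"
      using integral_diff[OF u2 ig] g(3) by (simp add: I_def)
    also have "\<dots> \<le> integral {a..b} (\<lambda>x. e * (W x * \<bar>u x\<bar>))"
    proof (rule integral_le[OF integrable_diff[OF u2 ig] integrable_on_mult_right[OF iA]])
      fix x assume x: "x \<in> {a..b}"
      have "u x * (W x * u x) - g x * (W x * u x) = (u x - g x) * (W x * u x)" by (simp add: left_diff_distrib)
      also have "\<dots> \<le> \<bar>u x - g x\<bar> * (W x * \<bar>u x\<bar>)"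
        using abs_ge_self[of "(u x - g x) * (W x * u x)"] W0[OF x] by (simp add: abs_mult)
      also have "\<dots> \<le> e * (W x * \<bar>u x\<bar>)"
        using g(2)[OF x] W0[OF x] by (intro mult_right_mono) auto
      finally show "u x * (W x * u x) - g x * (W x * u x) \<le> e * (W x * \<bar>u x\<bar>)" .
    qed
    also have "\<dots> = e * A" unfolding A_def by (rule integral_mult_right)
    finally show ?thesis .
  qed
  have "I \<le> 0"
  proof (rule ccontr)
    assume "\<not> ?thesis"
    then have I0: "0 < I" by simp
    have "I \<le> (I / (2 * (A + 1))) * A" using I0 A0 by (intro le) simp
    also have "\<dots> < I" using I0 A0 by (simp add: field_simps add_nonneg_pos)
    finally show False by simp
  qed
  moreover have nn: "0 \<le> u x * (W x * u x)" if "x \<in> {a..b}" for x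
  proof -
    have "u x * (W x * u x) = W x * (u x * u x)" by (rule mult.left_commute)
    moreover have "0 \<le> W x * (u x * u x)" by (rule mult_nonneg_nonneg[OF less_imp_le[OF W0[OF that]] zero_le_square])
    ultimately show ?thesis by (simp only:)
  qed
  then have "0 \<le> I" unfolding I_def by (intro integral_nonneg[OF u2])
  ultimately have "((\<lambda>x. u x * (W x * u x)) has_integral 0) (cbox a b)"
    using u2 by (simp add: has_integral_iff I_def)
  moreover have "continuous_on (cbox a b) (\<lambda>x. u x * (W x * u x))" using cu2 by simp
  ultimately have "u x * (W x * u x) = 0"
    using has_integral_0_cbox_imp_0[of a b "\<lambda>x. u x * (W x * u x)" x] nn ab x by (auto simp: box_real)
  then show ?thesis using W0[OF x] by simp
qed

text \<open>Weierstrass approximation in the variable \<open>v\<close>.\<close>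

lemma moments_zero:
  fixes H :: "real \<Rightarrow> complex" and v v' :: "real \<Rightarrow> real"
  assumes ab: "a < b" and H: "continuous_on {a..b} H"
    and v: "\<And>x. x \<in> {a..b} \<Longrightarrow> (v has_real_derivative v' x) (at x)" and v'c: "continuous_on {a..b} v'"
    and v'0: "\<And>x. x \<in> {a..b} \<Longrightarrow> v' x < 0"
    and m: "\<And>n::nat. integral {a..b} (\<lambda>x. of_real (v x ^ n * v' x) * H x) = 0"
    and x: "x \<in> {a..b}"
  shows "Re (H x) = 0"
proof (rule weighted_square_zero[where W = "\<lambda>x. - v' x", OF ab _ _ _ _ x])
  show uc: "continuous_on {a..b} (\<lambda>x. Re (H x))" by (intro continuous_on_Re H)
  show "continuous_on {a..b} (\<lambda>x. - v' x)" by (intro continuous_on_minus v'c)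
  show "0 < - v' x" if "x \<in> {a..b}" for x using v'0[OF that] by simp
  have vc: "continuous_on {a..b} v"
    by (rule DERIV_continuous_on) (use v in \<open>auto intro: has_field_derivative_at_within\<close>)
  have inj: "v y < v x" if "x < y" "x \<in> {a..b}" "y \<in> {a..b}" for x y
    by (rule DERIV_neg_imp_decreasing[OF that(1)]) (use v v'0 that in \<open>metis atLeastAtMost_iff order_trans\<close>)
  \<comment> \<open>Polynomials in v form an algebra with constants; they separate points because v
    is strictly decreasing.\<close>
  interpret R: function_ring_on "{g. \<exists>p. g = (\<lambda>x. poly p (v x))}" "{a..b}"
  proof
    show "compact {a..b}" by simp
    show "continuous_on {a..b} f" if "f \<in> {g. \<exists>p. g = (\<lambda>x. poly p (v x))}" for f
      using that by (auto intro!: continuous_on_poly vc)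
    show "(\<lambda>x. f x + g x) \<in> {g. \<exists>p. g = (\<lambda>x. poly p (v x))}"
      if "f \<in> {g. \<exists>p. g = (\<lambda>x. poly p (v x))}" "g \<in> {g. \<exists>p. g = (\<lambda>x. poly p (v x))}" for f g
      using that by (auto simp flip: poly_add)
    show "(\<lambda>x. f x * g x) \<in> {g. \<exists>p. g = (\<lambda>x. poly p (v x))}"
      if "f \<in> {g. \<exists>p. g = (\<lambda>x. poly p (v x))}" "g \<in> {g. \<exists>p. g = (\<lambda>x. poly p (v x))}" for f g
      using that by (auto simp flip: poly_mult)
    show "(\<lambda>_. c) \<in> {g. \<exists>p. g = (\<lambda>x. poly p (v x))}" for c :: real
      by (auto intro!: exI[of _ "[:c:]"])
    show "\<exists>f\<in>{g. \<exists>p. g = (\<lambda>x. poly p (v x))}. f x \<noteq> f y" if "x \<in> {a..b}" "y \<in> {a..b}" "x \<noteq> y" for x y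
    proof (rule bexI)
      show "v x \<noteq> v y" using inj[of x y] inj[of y x] that by (metis less_irrefl linorder_neqE_linordered_idom)
      show "v \<in> {g. \<exists>p. g = (\<lambda>x. poly p (v x))}" by (auto intro!: exI[of _ "[:0, 1:]"])
    qed
  qed
  have mono: "((\<lambda>x. v x ^ n * (v' x * Re (H x))) has_integral 0) {a..b}" for n
  proof -
    have "continuous_on {a..b} (\<lambda>x. of_real (v x ^ n * v' x) * H x)"
      by (intro continuous_on_mult continuous_on_of_real continuous_on_power vc v'c H)
    then have "((\<lambda>x. of_real (v x ^ n * v' x) * H x) has_integral 0) {a..b}"
      using integrable_continuous_real m[of n] by (metis integrable_integral)
    from has_integral_linear[OF this bounded_linear_Re] show ?thesis by (simp add: o_def mult.assoc)
  qed
  have poly0: "((\<lambda>x. poly p (v x) * (v' x * Re (H x))) has_integral 0) {a..b}" for p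
  proof -
    have "((\<lambda>x. \<Sum>i\<le>degree p. coeff p i * (v x ^ i * (v' x * Re (H x)))) has_integral (\<Sum>i\<le>degree p. coeff p i * 0)) {a..b}"
      by (intro has_integral_sum has_integral_mult_right mono) simp
    then show ?thesis by (simp add: poly_altdef sum_distrib_right mult.assoc)
  qed
  show "\<exists>g. continuous_on {a..b} g \<and> (\<forall>x\<in>{a..b}. \<bar>Re (H x) - g x\<bar> \<le> e) \<and>
       integral {a..b} (\<lambda>x. g x * (- v' x * Re (H x))) = 0" if e: "0 < e" for e
  proof -
    obtain g where "g \<in> {g. \<exists>p. g = (\<lambda>x. poly p (v x))}" and g: "\<forall>x\<in>{a..b}. \<bar>Re (H x) - g x\<bar> < e"
      using R.Stone_Weierstrass_basic[OF uc e] by blast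
    then obtain p where p: "g = (\<lambda>x. poly p (v x))" by blast
    have "integral {a..b} (\<lambda>x. g x * (- v' x * Re (H x))) = 0"
      using integral_unique[OF poly0[of p]] by (simp add: p)
    moreover have "continuous_on {a..b} g" unfolding p by (rule continuous_on_poly[OF vc])
    ultimately show ?thesis using g by (intro exI[of _ g]) auto
  qed
qed

text \<open>Differentiating at angles near \<theta>0 makes the integrals of S v^n against dG vanish
  for all n, where S is the kernel and v the cotangent of half the angle. With dH = S dG these are
  moments of dH against powers of the monotone v, so H = 0; and since S has no zeros, dG = dH / S
  vanishes as well.\<close>

lemma angle_kernel_integral_zero_imp_const:
  assumes ab: "\<alpha> < \<beta>" "\<theta>\<^sub>0 < \<alpha>" "\<beta> < \<theta>\<^sub>0 + 2 * pi" and G: "continuous_on {\<alpha>..\<beta>} G" and s: "0 < Re s"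
    and \<delta>: "0 < \<delta>"
    and z: "\<And>\<theta>. \<bar>\<theta> - \<theta>\<^sub>0\<bar> < \<delta> \<Longrightarrow> \<theta> < \<alpha> \<Longrightarrow> \<beta> < \<theta> + 2 * pi \<Longrightarrow> stieltjes \<alpha> \<beta> (\<lambda>\<eta>. angle_kernel s 0 (of_real (\<eta> - \<theta>))) G = 0"
    and x: "x \<in> {\<alpha>..\<beta>}"
  shows "G x = G \<alpha>"
proof -
  obtain e where e: "0 < e" "\<And>\<zeta> \<eta>. \<zeta> \<in> ball (of_real \<theta>\<^sub>0) e \<Longrightarrow> \<eta> \<in> {\<alpha>..\<beta>} \<Longrightarrow> of_real \<eta> - \<zeta> \<in> angle_domain"
    using angle_kernel_integral_nbhd[OF ab] by blast
  define \<epsilon> where "\<epsilon> = min (min e \<delta>) (min (\<alpha> - \<theta>\<^sub>0) (\<theta>\<^sub>0 + 2 * pi - \<beta>))"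
  have \<epsilon>: "0 < \<epsilon>" using e(1) ab \<delta> by (simp add: \<epsilon>_def)
  define U where "U = {\<theta>\<^sub>0 - \<epsilon><..<\<theta>\<^sub>0 + \<epsilon>}"
  have U: "\<bar>\<theta> - \<theta>\<^sub>0\<bar> < \<delta>" "\<theta> < \<alpha>" "\<beta> < \<theta> + 2 * pi" "complex_of_real \<theta> \<in> ball (of_real \<theta>\<^sub>0) e" if "\<theta> \<in> U" for \<theta>
  proof -
    have "\<bar>\<theta> - \<theta>\<^sub>0\<bar> < \<epsilon>" using that unfolding U_def by auto
    then show "\<bar>\<theta> - \<theta>\<^sub>0\<bar> < \<delta>" "\<theta> < \<alpha>" "\<beta> < \<theta> + 2 * pi" "complex_of_real \<theta> \<in> ball (of_real \<theta>\<^sub>0) e"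
      unfolding \<epsilon>_def by (auto simp: dist_norm abs_minus_commute simp flip: of_real_diff)
  qed
  let ?N = "angle_kernel_integral s G \<alpha> \<beta>"
  \<comment> \<open>Strong induction, since the derivative of the integral of index m involves the
    indices m + 1 and m - 1. It can be solved for m + 1 because Re s > 0 keeps s + m/2 away from
    0.\<close>
  have N: "\<forall>\<theta>\<in>U. ?N n (of_real \<theta>) = 0" for n
  proof (induction n rule: less_induct)
    case (less n)
    show ?case
    proof (cases n)
      case 0
      then show ?thesis using angle_kernel_integral_real[OF U(2,3)] z[OF U(1,2,3)] by simp
    next
      case (Suc m)
      show ?thesis
      proof
        fix \<theta> assume \<theta>: "\<theta> \<in> U"
        have "((\<lambda>x. ?N m (of_real x)) has_vector_derivative
          (s + of_nat m / 2) * ?N (Suc m) (of_real \<theta>) + of_nat m / 2 * ?N (m - 1) (of_real \<theta>)) (at \<theta>)"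
          using has_vector_derivative_real_field[OF angle_kernel_integral_derivative[OF e(2) G less_imp_le[OF ab(1)] U(4)[OF \<theta>]]] by simp
        moreover have "((\<lambda>x. ?N m (of_real x)) has_vector_derivative 0) (at \<theta>)"
          by (rule has_vector_derivative_transform_within_open[OF has_vector_derivative_const, of U])
            (use \<theta> less.IH[of m] Suc in \<open>auto simp: U_def\<close>)
        ultimately have "(s + of_nat m / 2) * ?N (Suc m) (of_real \<theta>) + of_nat m / 2 * ?N (m - 1) (of_real \<theta>) = 0"
          using vector_derivative_unique_at by blast
        moreover have "of_nat m / 2 * ?N (m - 1) (of_real \<theta>) = 0"
          using less.IH[of "m - 1"] Suc \<theta> by (cases m) auto
        moreover have "s + of_nat m / 2 \<noteq> 0"
        proof -
          have "0 < Re (s + of_nat m / 2)" using s by (simp add: add_pos_nonneg)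
          then show ?thesis by (metis less_irrefl zero_complex.simps(1))
        qed
        ultimately show "?N n (of_real \<theta>) = 0" using Suc by (metis add_0_right mult_eq_0_iff)
      qed
    qed
  qed
  have \<theta>0: "\<theta>\<^sub>0 \<in> U" using \<epsilon> by (simp add: U_def)
  define v where "v = (\<lambda>\<eta>. cos ((\<eta> - \<theta>\<^sub>0) / 2) / sin ((\<eta> - \<theta>\<^sub>0) / 2))"
  define v' where "v' = (\<lambda>\<eta>. - (1 / (2 * (sin ((\<eta> - \<theta>\<^sub>0) / 2))\<^sup>2)))"
  have sp: "0 < sin ((\<eta> - \<theta>\<^sub>0) / 2)" if "\<eta> \<in> {\<alpha>..\<beta>}" for \<eta>
    by (rule real_kdom(2)) (use that ab in auto)
  have vd: "(v has_real_derivative v' \<eta>) (at \<eta>)" if "\<eta> \<in> {\<alpha>..\<beta>}" for \<eta>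
  proof -
    define X Y where "X = sin ((\<eta> - \<theta>\<^sub>0) / 2)" and "Y = cos ((\<eta> - \<theta>\<^sub>0) / 2)"
    have X: "X \<noteq> 0" using sp[OF that] by (simp add: X_def)
    have "(v has_real_derivative ((- X / 2) * X - Y * (Y / 2)) / (X * X)) (at \<eta>)"
      unfolding v_def X_def Y_def using X by (auto intro!: derivative_eq_intros simp: X_def)
    also have "((- X / 2) * X - Y * (Y / 2)) = - ((X\<^sup>2 + Y\<^sup>2) / 2)" by (simp add: power2_eq_square field_simps)
    also have "X\<^sup>2 + Y\<^sup>2 = 1" unfolding X_def Y_def by simp
    finally show ?thesis by (simp add: v'_def X_def[symmetric] power2_eq_square)
  qed
  have v'c: "continuous_on {\<alpha>..\<beta>} v'" unfolding v'_def
    by (intro continuous_intros) (use sp in force)+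
  have v'0: "v' \<eta> < 0" if "\<eta> \<in> {\<alpha>..\<beta>}" for \<eta> using sp[OF that] by (simp add: v'_def)
  define S where "S = (\<lambda>\<eta>. angle_kernel s 0 (of_real (\<eta> - \<theta>\<^sub>0)))"
  have SC: "S C1_differentiable_on {\<alpha>..\<beta>}" unfolding S_def by (rule angle_kernel_C1[OF ab(2,3)])
  define H where "H = (\<lambda>x. stieltjes \<alpha> x S G)"
  have Hc: "continuous_on {\<alpha>..\<beta>} H" unfolding H_def by (rule continuous_on_stieltjes[OF SC G])
  have vn: "((\<lambda>\<eta>. complex_of_real (v \<eta> ^ n)) has_vector_derivative of_real (of_nat n * v \<eta> ^ (n - 1) * v' \<eta>)) (at \<eta>)"
    if "\<eta> \<in> {\<alpha>..\<beta>}" for n \<eta>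
    by (rule has_vector_derivative_of_real) (use DERIV_power[OF vd[OF that], of n] in \<open>simp add: mult_ac\<close>)
  have vc: "continuous_on {\<alpha>..\<beta>} v"
    by (rule DERIV_continuous_on) (use vd in \<open>auto intro: has_field_derivative_at_within\<close>)
  have vnC: "(\<lambda>\<eta>. complex_of_real (v \<eta> ^ n)) C1_differentiable_on {\<alpha>..\<beta>}" for n
    by (rule C1_I[OF vn]) (auto intro!: continuous_intros vc v'c)
  have mom: "stieltjes \<alpha> \<beta> (\<lambda>\<eta>. complex_of_real (v \<eta> ^ n)) H = 0" for n
  proof -
    have "stieltjes \<alpha> \<beta> (\<lambda>\<eta>. complex_of_real (v \<eta> ^ n)) H = stieltjes \<alpha> \<beta> (\<lambda>\<eta>. complex_of_real (v \<eta> ^ n) * S \<eta>) G"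
      by (rule stieltjes_density[OF vnC SC G less_imp_le[OF ab(1)], where k = 0]) (simp add: H_def)
    also have "(\<lambda>\<eta>. complex_of_real (v \<eta> ^ n) * S \<eta>) = (\<lambda>\<eta>. angle_kernel s n (of_real (\<eta> - \<theta>\<^sub>0)))"
    proof
      fix \<eta>
      have "complex_of_real (v \<eta>) = cos (of_real (\<eta> - \<theta>\<^sub>0) / 2) / sin (of_real (\<eta> - \<theta>\<^sub>0) / 2)"
        by (simp add: v_def flip: cos_of_real sin_of_real)
      then show "complex_of_real (v \<eta> ^ n) * S \<eta> = angle_kernel s n (of_real (\<eta> - \<theta>\<^sub>0))"
        by (simp add: S_def angle_kernel_def)
    qed
    finally show ?thesis using N[of n] \<theta>0 angle_kernel_integral_real[OF ab(2,3), of s G n] by metis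
  qed
  have H\<alpha>: "H \<alpha> = 0" by (simp add: H_def stieltjes_refl)
  \<comment> \<open>The moment of order 0 is the total increment of H. With H zero at both ends, the
    moment of order n + 1 becomes an integral of v^n v' H by parts.\<close>
  have H\<beta>: "H \<beta> = 0" using mom[of 0] H\<alpha> by (simp add: stieltjes_def)
  have int: "integral {\<alpha>..\<beta>} (\<lambda>x. of_real (v x ^ n * v' x) * H x) = 0" for n
  proof -
    have "0 = stieltjes \<alpha> \<beta> (\<lambda>\<eta>. complex_of_real (v \<eta> ^ Suc n)) H" by (rule mom[symmetric])
    also have "\<dots> = - integral {\<alpha>..\<beta>} (\<lambda>\<eta>. of_real (of_nat (Suc n) * v \<eta> ^ (Suc n - 1) * v' \<eta>) * H \<eta>)"
      by (subst stieltjes_eq[OF vn]) (simp_all add: H\<alpha> H\<beta>)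
    also have "(\<lambda>\<eta>. of_real (of_nat (Suc n) * v \<eta> ^ (Suc n - 1) * v' \<eta>) * H \<eta>) =
      (\<lambda>\<eta>. complex_of_real (of_nat (Suc n)) * (of_real (v \<eta> ^ n * v' \<eta>) * H \<eta>))"
      by (simp add: mult_ac)
    finally show ?thesis unfolding integral_mult_right by (simp del: of_nat_Suc)
  qed
  have H0: "H y = 0" if y: "y \<in> {\<alpha>..\<beta>}" for y
  proof -
    have "Re (H y) = 0" by (rule moments_zero[OF ab(1) Hc vd v'c v'0 int y])
    moreover have "Re (- \<i> * H y) = 0"
    proof (rule moments_zero[OF ab(1) _ vd v'c v'0 _ y])
      show "continuous_on {\<alpha>..\<beta>} (\<lambda>y. - \<i> * H y)" by (intro continuous_on_mult continuous_on_const Hc)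
      have "(\<lambda>x. of_real (v x ^ n * v' x) * (- \<i> * H x)) = (\<lambda>x. (- \<i>) * (of_real (v x ^ n * v' x) * H x))" for n
        by (simp add: mult_ac)
      then show "integral {\<alpha>..\<beta>} (\<lambda>x. of_real (v x ^ n * v' x) * (- \<i> * H x)) = 0" for n
        by (simp only: integral_mult_right int mult_zero_right)
    qed
    ultimately show ?thesis by (simp add: complex_eq_iff)
  qed
  have x': "\<alpha> \<le> x" "{\<alpha>..x} \<subseteq> {\<alpha>..\<beta>}" using x by auto
  \<comment> \<open>The kernel with exponent -s is the reciprocal of S, so integrating it against dH
    recovers dG.\<close>
  define R where "R = (\<lambda>\<eta>. angle_kernel (- s) 0 (of_real (\<eta> - \<theta>\<^sub>0)))"
  have RC: "R C1_differentiable_on {\<alpha>..x}"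
    unfolding R_def by (rule angle_kernel_C1) (use ab x in auto)
  have "stieltjes \<alpha> x R H = stieltjes \<alpha> x (\<lambda>\<eta>. R \<eta> * S \<eta>) G"
    by (rule stieltjes_density[OF RC C1_subset[OF SC x'(2)] continuous_on_subset[OF G x'(2)] x'(1), where k = 0])
      (simp add: H_def)
  also have "(\<lambda>\<eta>. R \<eta> * S \<eta>) = (\<lambda>_. 1)" by (simp add: R_def S_def angle_kernel_def flip: exp_add)
  also have "stieltjes \<alpha> x (\<lambda>_. 1) G = G x - G \<alpha>" by (simp add: stieltjes_def)
  finally have "G x - G \<alpha> = stieltjes \<alpha> x R H" by simp
  also have "\<dots> = 0"
  proof -
    have "integral {\<alpha>..x} (\<lambda>\<theta>. vector_derivative R (at \<theta>) * H \<theta>) = integral {\<alpha>..x} (\<lambda>\<theta>. 0)"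
      by (rule integral_cong) (use H0 x'(2) in auto)
    then show ?thesis using H0[of x] H\<alpha> x by (simp add: stieltjes_def)
  qed
  finally show ?thesis by simp
qed

subsection \<open>Arcs and their kernel integrals\<close>

lemma arc_closure:
  assumes "arc_between I \<alpha> \<beta>"
  shows "closure I = cis ` {\<alpha>..\<beta>}" "I \<subseteq> sphere 0 1" "cis ` {\<alpha><..<\<beta>} \<subseteq> I"
proof -
  obtain A where ab: "\<alpha> < \<beta>" and A: "{\<alpha><..<\<beta>} \<subseteq> A" "A \<subseteq> {\<alpha>..\<beta>}" and I: "I = cis ` A"
    using assms unfolding arc_between_def by blast
  have cc: "continuous_on S cis" for S by (intro continuous_intros)
  have cl: "closed (cis ` {\<alpha>..\<beta>})"
    by (intro compact_imp_closed compact_continuous_image cc) simp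
  have "closure I \<subseteq> cis ` {\<alpha>..\<beta>}"
    by (rule closure_minimal[OF _ cl]) (use A I in auto)
  moreover have "cis ` closure {\<alpha><..<\<beta>} \<subseteq> closure I"
    by (rule image_closure_subset[OF cc closed_closure]) (use A I closure_subset in blast)
  ultimately show "closure I = cis ` {\<alpha>..\<beta>}" using ab by simp
  show "I \<subseteq> sphere 0 1" using I by auto
  show "cis ` {\<alpha><..<\<beta>} \<subseteq> I" using I A by blast
qed

text \<open>Provides a lift of a point off the closed arc such that the lifted arc lies in the open
  period above it. There the angle differences are between 0 and 2 pi and the chord formula
  applies.\<close>

lemma arc_window:
  assumes "cis \<theta> \<notin> cis ` {\<alpha>..\<beta>}"
  obtains m :: int where "\<theta> + 2 * pi * of_int m < \<alpha>" "\<beta> < \<theta> + 2 * pi * of_int m + 2 * pi"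
proof -
  \<comment> \<open>The first lift at or above \<alpha>. As the point is off the arc, this lift lies
    beyond \<beta>, and the preceding one is the lift sought.\<close>
  define k where "k = \<lceil>(\<alpha> - \<theta>) / (2 * pi)\<rceil>"
  have "of_int k - 1 < (\<alpha> - \<theta>) / (2 * pi)" "(\<alpha> - \<theta>) / (2 * pi) \<le> of_int k" unfolding k_def by linarith+
  then have k: "2 * pi * (of_int k - 1) < \<alpha> - \<theta>" "\<alpha> - \<theta> \<le> 2 * pi * of_int k" by (simp_all add: field_simps)
  have "cis (\<theta> + 2 * pi * of_int k) = cis \<theta>" by (auto simp: cis_eq_iff)
  then have "\<theta> + 2 * pi * of_int k \<notin> {\<alpha>..\<beta>}" using assms by (metis imageI)
  then have "\<beta> < \<theta> + 2 * pi * of_int k" using k by auto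
  then show ?thesis using that[of "k - 1"] k by (simp add: algebra_simps)
qed

lemma cis_inj_window:
  assumes "cis x = cis y" "\<theta> < x" "x < \<theta> + 2 * pi" "\<theta> < y" "y < \<theta> + 2 * pi"
  shows "x = y"
proof -
  obtain m :: int where m: "x = y + 2 * pi * of_int m" using assms(1) by (auto simp: cis_eq_iff)
  have "\<bar>2 * pi * of_int m\<bar> < 2 * pi * 1" using assms m by auto
  then have "\<bar>of_int m :: real\<bar> < 1" by (simp add: abs_mult)
  then have "m = 0" by linarith
  then show ?thesis using m by simp
qed

lemma arc_shift: "cis ` {\<alpha> + 2 * pi * of_int m..\<beta> + 2 * pi * of_int m} = cis ` {\<alpha>..\<beta>}"
proof -
  have "{\<alpha> + 2 * pi * of_int m..\<beta> + 2 * pi * of_int m} = (\<lambda>x. x + 2 * pi * of_int m) ` {\<alpha>..\<beta>}" by simp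
  moreover have "cis (x + 2 * pi * of_int m) = cis x" for x by (auto simp: cis_eq_iff)
  ultimately show ?thesis by (simp add: image_image del: image_add_atLeastAtMost')
qed

text \<open>Inside one window cis is injective, so the closed arc determines its interval. A point
  off the closure is essential: the full circle may be cut open anywhere.\<close>

lemma arc_endpoints_unique:
  assumes I: "arc_between I \<alpha> \<beta>" "arc_between I \<alpha>' \<beta>'" and \<theta>: "cis \<theta> \<notin> closure I"
  obtains m :: int where "\<alpha>' = \<alpha> + 2 * pi * of_int m" "\<beta>' = \<beta> + 2 * pi * of_int m"
proof -
  have eq: "cis ` {\<alpha>..\<beta>} = cis ` {\<alpha>'..\<beta>'}" using arc_closure(1)[OF I(1)] arc_closure(1)[OF I(2)] by simp
  have n: "cis \<theta> \<notin> cis ` {\<alpha>..\<beta>}" "cis \<theta> \<notin> cis ` {\<alpha>'..\<beta>'}" using \<theta> arc_closure(1)[OF I(1)] eq by auto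
  obtain m1 :: int where m1: "\<theta> + 2 * pi * of_int m1 < \<alpha>" "\<beta> < \<theta> + 2 * pi * of_int m1 + 2 * pi"
    using arc_window[OF n(1)] .
  obtain m2 :: int where m2: "\<theta> + 2 * pi * of_int m2 < \<alpha>'" "\<beta>' < \<theta> + 2 * pi * of_int m2 + 2 * pi"
    using arc_window[OF n(2)] .
  define m where "m = m2 - m1"
  have m3: "\<theta> + 2 * pi * of_int m2 < \<alpha> + 2 * pi * of_int m" "\<beta> + 2 * pi * of_int m < \<theta> + 2 * pi * of_int m2 + 2 * pi"
    using m1 by (simp_all add: m_def algebra_simps)
  have eq': "cis ` {\<alpha> + 2 * pi * of_int m..\<beta> + 2 * pi * of_int m} = cis ` {\<alpha>'..\<beta>'}"
    unfolding arc_shift by (rule eq)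
  define W where "W = {\<theta> + 2 * pi * of_int m2<..<\<theta> + 2 * pi * of_int m2 + 2 * pi}"
  have inj: "inj_on cis W" by (rule inj_onI, rule cis_inj_window[of _ _ "\<theta> + 2 * pi * of_int m2"]) (auto simp: W_def)
  have "{\<alpha> + 2 * pi * of_int m..\<beta> + 2 * pi * of_int m} \<subseteq> W" "{\<alpha>'..\<beta>'} \<subseteq> W"
    using m2 m3 by (auto simp: W_def)
  then have "{\<alpha> + 2 * pi * of_int m..\<beta> + 2 * pi * of_int m} = {\<alpha>'..\<beta>'}"
    using inj_on_image_eq_iff[OF inj] eq' by blast
  moreover have "\<alpha> < \<beta>" using I(1) by (simp add: arc_between_def)
  ultimately have "\<alpha>' = \<alpha> + 2 * pi * of_int m" "\<beta>' = \<beta> + 2 * pi * of_int m" by (simp_all add: Icc_eq_Icc)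
  then show ?thesis by (rule that)
qed

definition kernel_transform :: "(complex \<Rightarrow> complex) \<Rightarrow> complex \<Rightarrow> real \<Rightarrow> real \<Rightarrow> complex \<Rightarrow> complex" where
  "kernel_transform f s \<alpha> \<beta> \<xi> = helgason_integral f s \<alpha> \<beta> (\<lambda>\<eta>. 1 / of_real (norm (\<xi> - \<eta>)) powr (2 * s))"

lemma kernel_transform_stieltjes:
  assumes "\<alpha> < \<beta>" "\<theta> < \<alpha>" "\<beta> < \<theta> + 2 * pi"
  shows "kernel_transform f s \<alpha> \<beta> (cis \<theta>) = stieltjes \<alpha> \<beta> (\<lambda>\<eta>. angle_kernel s 0 (of_real (\<eta> - \<theta>))) (helgason_primitive f s)"
  unfolding kernel_transform_def by (rule helgason_integral_kernel[OF assms])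

context
  fixes f :: "complex \<Rightarrow> complex" and s :: complex
  assumes Gc: "continuous_on UNIV (helgason_primitive f s)"
    and Gp: "\<And>\<theta>. helgason_primitive f s (\<theta> + 2 * pi) = helgason_primitive f s \<theta> + f 0"
begin

lemma kernel_transform_shift:
  assumes ab: "\<alpha> < \<beta>" and n: "cis \<theta> \<notin> cis ` {\<alpha>..\<beta>}"
  shows "kernel_transform f s (\<alpha> + 2 * pi * of_int m) (\<beta> + 2 * pi * of_int m) (cis \<theta>) = kernel_transform f s \<alpha> \<beta> (cis \<theta>)"
proof -
  obtain k :: int where k: "\<theta> + 2 * pi * of_int k < \<alpha>" "\<beta> < \<theta> + 2 * pi * of_int k + 2 * pi"
    using arc_window[OF n] .
  define \<theta>1 where "\<theta>1 = \<theta> + 2 * pi * of_int k"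
  define d where "d = 2 * pi * of_int m"
  let ?G = "helgason_primitive f s"
  have c1: "cis \<theta> = cis \<theta>1" "cis \<theta> = cis (\<theta>1 + d)"
    unfolding \<theta>1_def d_def cis_eq_iff by (rule exI[of _ "-k"], simp, rule exI[of _ "-(k + m)"], simp add: algebra_simps)
  have G: "?G (x + d) = ?G x + of_int m * f 0" for x
    unfolding d_def by (rule periodic_of_int[where h = "helgason_primitive f s" and k = "f 0", OF Gp])
  have "kernel_transform f s (\<alpha> + d) (\<beta> + d) (cis \<theta>) = stieltjes (\<alpha> + d) (\<beta> + d) (\<lambda>\<eta>. angle_kernel s 0 (of_real (\<eta> - (\<theta>1 + d)))) ?G"
    unfolding c1(2) by (rule kernel_transform_stieltjes) (use ab k in \<open>auto simp: \<theta>1_def\<close>)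
  also have "\<dots> = stieltjes \<alpha> \<beta> (\<lambda>\<eta>. angle_kernel s 0 (of_real (\<eta> + d - (\<theta>1 + d)))) (\<lambda>\<eta>. ?G (\<eta> + d))"
    by (rule stieltjes_substitution(1)[where g' = "\<lambda>_. 1"])
      (use ab k in \<open>auto intro!: derivative_eq_intros angle_kernel_C1 continuous_on_subset[OF Gc] simp: \<theta>1_def simp del: of_real_diff of_real_add\<close>)
  also have "\<dots> = stieltjes \<alpha> \<beta> (\<lambda>\<eta>. angle_kernel s 0 (of_real (\<eta> - \<theta>1))) (\<lambda>\<eta>. ?G \<eta> + of_int m * f 0)"
    unfolding G by simp
  also have "\<dots> = stieltjes \<alpha> \<beta> (\<lambda>\<eta>. angle_kernel s 0 (of_real (\<eta> - \<theta>1))) ?G"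
    by (rule stieltjes_add_const[OF angle_kernel_C1 continuous_on_subset[OF Gc subset_UNIV]]) (use ab k in \<open>auto simp: \<theta>1_def\<close>)
  also have "\<dots> = kernel_transform f s \<alpha> \<beta> (cis \<theta>)"
    unfolding c1(1) by (rule kernel_transform_stieltjes[symmetric]) (use ab k in \<open>auto simp: \<theta>1_def\<close>)
  finally show ?thesis by (simp add: d_def)
qed

text \<open>Makes the kernel integral a function of the arc alone; the integral representation is
  asserted for every admissible pair of endpoints.\<close>

lemma kernel_transform_unique:
  assumes I: "arc_between I \<alpha> \<beta>" "arc_between I \<alpha>' \<beta>'" and \<xi>: "\<xi> \<in> sphere 0 1" "\<xi> \<notin> closure I"
  shows "kernel_transform f s \<alpha>' \<beta>' \<xi> = kernel_transform f s \<alpha> \<beta> \<xi>"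
proof -
  define \<theta> where "\<theta> = Arg \<xi>"
  have "\<xi> \<noteq> 0" using \<xi>(1) by auto
  then have c: "cis \<theta> = \<xi>" using cis_Arg[of \<xi>] \<xi>(1) by (simp add: \<theta>_def sgn_div_norm)
  have n: "cis \<theta> \<notin> closure I" using \<xi>(2) by (simp add: c)
  obtain m :: int where m: "\<alpha>' = \<alpha> + 2 * pi * of_int m" "\<beta>' = \<beta> + 2 * pi * of_int m"
    using arc_endpoints_unique[OF I n] .
  have "\<alpha> < \<beta>" using I(1) by (simp add: arc_between_def)
  from kernel_transform_shift[OF this] n show ?thesis unfolding m c[symmetric] arc_closure(1)[OF I(1)] by blast
qed

text \<open>The pieces come without an order, so the telescoping of the primitive \<Phi> is taken
  from the theory of tagged divisions. Covering the open interval suffices, as a finite union of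
  closed pieces is closed.\<close>

lemma stieltjes_division:
  assumes \<psi>: "\<psi> C1_differentiable_on {\<alpha>..\<beta>}" and ab: "\<alpha> \<le> \<beta>"
    and F: "finite F" and sub: "\<And>i. i \<in> F \<Longrightarrow> a i < b i \<and> {a i..b i} \<subseteq> {\<alpha>..\<beta>}"
    and disj: "\<And>i j. i \<in> F \<Longrightarrow> j \<in> F \<Longrightarrow> i \<noteq> j \<Longrightarrow> {a i<..<b i} \<inter> {a j<..<b j} = {}"
    and cover: "{\<alpha><..<\<beta>} \<subseteq> (\<Union>i\<in>F. {a i..b i})"
  shows "(\<Sum>i\<in>F. stieltjes (a i) (b i) \<psi> (helgason_primitive f s)) = stieltjes \<alpha> \<beta> \<psi> (helgason_primitive f s)"
proof (cases "\<alpha> = \<beta>")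
  case True
  have "i \<notin> F" for i
  proof
    assume "i \<in> F"
    then have "a i < b i" "{a i..b i} \<subseteq> {\<beta>..\<beta>}" using sub[of i] True by simp_all
    then show False by (simp only: atLeastatMost_subset_iff) linarith
  qed
  then have "F = {}" by blast
  then show ?thesis using True by (simp add: stieltjes_refl)
next
  case False
  let ?G = "helgason_primitive f s"
  define \<Phi> where "\<Phi> = (\<lambda>x. stieltjes \<alpha> x \<psi> ?G)"
  have \<Phi>: "stieltjes x y \<psi> ?G = \<Phi> y - \<Phi> x" if "\<alpha> \<le> x" "x \<le> y" "y \<le> \<beta>" for x y
    using stieltjes_combine[OF C1_subset[OF \<psi>] continuous_on_subset[OF Gc subset_UNIV], of \<alpha> y x] that
    by (simp add: \<Phi>_def)
  \<comment> \<open>The tags are immaterial; the left endpoints serve.\<close>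
  define p where "p = (\<lambda>i. (a i, {a i..b i})) ` F"
  have inj: "inj_on (\<lambda>i. (a i, {a i..b i})) F"
  proof (rule inj_onI, rule ccontr)
    fix i j assume ij: "i \<in> F" "j \<in> F" "(a i, {a i..b i}) = (a j, {a j..b j})" "i \<noteq> j"
    then have "a i = a j" "b i = b j" using sub[of i] sub[of j] by (auto simp: Icc_eq_Icc)
    then have "{a i<..<b i} = {}" using disj[OF ij(1,2,4)] by simp
    then show False using sub[OF ij(1)] by simp
  qed
  have cov: "(\<Union>i\<in>F. {a i..b i}) = {\<alpha>..\<beta>}"
  proof
    show "(\<Union>i\<in>F. {a i..b i}) \<subseteq> {\<alpha>..\<beta>}" using sub by blast
    have "closed (\<Union>i\<in>F. {a i..b i})" using F by (intro closed_UN) auto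
    from closure_minimal[OF cover this] show "{\<alpha>..\<beta>} \<subseteq> (\<Union>i\<in>F. {a i..b i})" using False ab by simp
  qed
  have "p tagged_division_of {\<alpha>..\<beta>}"
  proof (rule tagged_division_ofI)
    show "finite p" using F by (simp add: p_def)
    fix x K assume xK: "(x, K) \<in> p"
    then obtain i where i: "i \<in> F" "x = a i" "K = {a i..b i}" by (auto simp: p_def)
    show "x \<in> K" "K \<subseteq> {\<alpha>..\<beta>}" using sub[OF i(1)] i by auto
    show "\<exists>a b. K = cbox a b" using i(3) by (metis box_real(2))
    fix y L assume yL: "(y, L) \<in> p" and ne: "(x, K) \<noteq> (y, L)"
    obtain j where j: "j \<in> F" "y = a j" "L = {a j..b j}" using yL by (auto simp: p_def)
    have "i \<noteq> j" using ne i j by auto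
    from disj[OF i(1) j(1) this] show "interior K \<inter> interior L = {}"
      unfolding i(3) j(3) interior_atLeastAtMost_real .
  next
    show "\<Union> {K. \<exists>x. (x, K) \<in> p} = {\<alpha>..\<beta>}" unfolding cov[symmetric] by (auto simp: p_def)
  qed
  from additive_tagged_division_1[OF ab this, of \<Phi>]
  have "\<Phi> \<beta> - \<Phi> \<alpha> = (\<Sum>(x, K)\<in>p. \<Phi> (Sup K) - \<Phi> (Inf K))" by simp
  also have "\<dots> = (\<Sum>i\<in>F. \<Phi> (Sup {a i..b i}) - \<Phi> (Inf {a i..b i}))"
    unfolding p_def by (subst sum.reindex[OF inj]) simp
  also have "\<dots> = (\<Sum>i\<in>F. stieltjes (a i) (b i) \<psi> ?G)"
  proof (rule sum.cong[OF refl])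
    fix i assume "i \<in> F"
    from sub[OF this] show "\<Phi> (Sup {a i..b i}) - \<Phi> (Inf {a i..b i}) = stieltjes (a i) (b i) \<psi> ?G"
      using \<Phi>[of "a i" "b i"] by simp
  qed
  finally show ?thesis using \<Phi>[of \<alpha> \<beta>] ab by simp
qed

text \<open>The lifts of the pieces are moved into one window above \<xi>, where cis is injective.
  Disjointness and covering on the circle then become those of a division of an interval.\<close>

lemma kernel_transform_additive:
  assumes Q: "arc_between Q \<alpha> \<beta>" and \<xi>: "\<xi> \<in> sphere 0 1" "\<xi> \<notin> closure Q"
    and F: "finite F" and X: "\<And>i. i \<in> F \<Longrightarrow> arc_between (X i) (a i) (b i)"
    and disj: "\<And>i j. i \<in> F \<Longrightarrow> j \<in> F \<Longrightarrow> i \<noteq> j \<Longrightarrow> X i \<inter> X j = {}" and U: "(\<Union>i\<in>F. X i) = Q"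
  shows "(\<Sum>i\<in>F. kernel_transform f s (a i) (b i) \<xi>) = kernel_transform f s \<alpha> \<beta> \<xi>"
proof -
  define \<theta>0 where "\<theta>0 = Arg \<xi>"
  have "\<xi> \<noteq> 0" using \<xi>(1) by auto
  then have c0: "cis \<theta>0 = \<xi>" using cis_Arg[of \<xi>] \<xi>(1) by (simp add: \<theta>0_def sgn_div_norm)
  have ab: "\<alpha> < \<beta>" using Q by (simp add: arc_between_def)
  have nQ: "cis \<theta>0 \<notin> cis ` {\<alpha>..\<beta>}" using \<xi>(2) arc_closure(1)[OF Q] c0 by simp
  obtain m0 :: int where m0: "\<theta>0 + 2 * pi * of_int m0 < \<alpha>" "\<beta> < \<theta>0 + 2 * pi * of_int m0 + 2 * pi"
    using arc_window[OF nQ] .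
  define \<theta> where "\<theta> = \<theta>0 + 2 * pi * of_int m0"
  have c: "cis \<theta> = \<xi>" unfolding c0[symmetric] \<theta>_def cis_eq_iff by blast
  have w: "\<theta> < \<alpha>" "\<beta> < \<theta> + 2 * pi" using m0 by (simp_all add: \<theta>_def)
  have clX: "cis ` {a i..b i} \<subseteq> cis ` {\<alpha>..\<beta>}" if "i \<in> F" for i
    unfolding arc_closure(1)[OF X[OF that], symmetric] arc_closure(1)[OF Q, symmetric]
    by (rule closure_mono) (use U that in blast)
  have "\<forall>i\<in>F. \<exists>m::int. \<theta> + 2 * pi * of_int m < a i \<and> b i < \<theta> + 2 * pi * of_int m + 2 * pi"
  proof
    fix i assume i: "i \<in> F"
    have "cis \<theta> \<notin> cis ` {a i..b i}" using clX[OF i] nQ c c0 by auto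
    then obtain m :: int where "\<theta> + 2 * pi * of_int m < a i" "b i < \<theta> + 2 * pi * of_int m + 2 * pi"
      by (rule arc_window)
    then show "\<exists>m::int. \<theta> + 2 * pi * of_int m < a i \<and> b i < \<theta> + 2 * pi * of_int m + 2 * pi" by blast
  qed
  then obtain m :: "'a \<Rightarrow> int" where m: "\<And>i. i \<in> F \<Longrightarrow> \<theta> + 2 * pi * of_int (m i) < a i \<and> b i < \<theta> + 2 * pi * of_int (m i) + 2 * pi"
    by metis
  define a' where "a' = (\<lambda>i. a i + 2 * pi * of_int (- m i))"
  define b' where "b' = (\<lambda>i. b i + 2 * pi * of_int (- m i))"
  have w': "\<theta> < a' i" "b' i < \<theta> + 2 * pi" "a' i < b' i" if "i \<in> F" for i
    using m[OF that] X[OF that] by (auto simp: a'_def b'_def arc_between_def)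
  have img: "cis ` {a' i..b' i} = cis ` {a i..b i}" for i unfolding a'_def b'_def by (rule arc_shift)
  have sub: "{a' i..b' i} \<subseteq> {\<alpha>..\<beta>}" if i: "i \<in> F" for i
  proof
    fix x assume x: "x \<in> {a' i..b' i}"
    then have "cis x \<in> cis ` {\<alpha>..\<beta>}" using clX[OF i] img[of i] by blast
    then obtain y where y: "y \<in> {\<alpha>..\<beta>}" "cis x = cis y" by blast
    have "x = y" by (rule cis_inj_window[OF y(2), of \<theta>]) (use x y w w'[OF i] in auto)
    then show "x \<in> {\<alpha>..\<beta>}" using y by simp
  qed
  have op: "cis x \<in> X i" if i: "i \<in> F" and x: "x \<in> {a' i<..<b' i}" for i x
  proof -
    have "cis x = cis (x + 2 * pi * of_int (m i))" by (auto simp: cis_eq_iff intro: exI[of _ "- m i"])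
    moreover have "x + 2 * pi * of_int (m i) \<in> {a i<..<b i}" using x by (auto simp: a'_def b'_def)
    ultimately show ?thesis using arc_closure(3)[OF X[OF i]] by (metis image_subset_iff)
  qed
  have "(\<Sum>i\<in>F. kernel_transform f s (a i) (b i) \<xi>) = (\<Sum>i\<in>F. stieltjes (a' i) (b' i) (\<lambda>\<eta>. angle_kernel s 0 (of_real (\<eta> - \<theta>))) (helgason_primitive f s))"
  proof (rule sum.cong[OF refl])
    fix i assume i: "i \<in> F"
    have "kernel_transform f s (a i) (b i) \<xi> = kernel_transform f s (a' i) (b' i) (cis \<theta>)"
      unfolding c[symmetric] a'_def b'_def
      by (rule kernel_transform_shift[symmetric]) (use X[OF i] clX[OF i] nQ c c0 in \<open>auto simp: arc_between_def\<close>)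
    also have "\<dots> = stieltjes (a' i) (b' i) (\<lambda>\<eta>. angle_kernel s 0 (of_real (\<eta> - \<theta>))) (helgason_primitive f s)"
      by (rule kernel_transform_stieltjes) (use w'[OF i] in auto)
    finally show "kernel_transform f s (a i) (b i) \<xi> = stieltjes (a' i) (b' i) (\<lambda>\<eta>. angle_kernel s 0 (of_real (\<eta> - \<theta>))) (helgason_primitive f s)" .
  qed
  also have "\<dots> = stieltjes \<alpha> \<beta> (\<lambda>\<eta>. angle_kernel s 0 (of_real (\<eta> - \<theta>))) (helgason_primitive f s)"
  proof (rule stieltjes_division[OF angle_kernel_C1[OF w] less_imp_le[OF ab] F])
    show "a' i < b' i \<and> {a' i..b' i} \<subseteq> {\<alpha>..\<beta>}" if "i \<in> F" for i using sub[OF that] w'[OF that] by blast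
    show "{a' i<..<b' i} \<inter> {a' j<..<b' j} = {}" if "i \<in> F" "j \<in> F" "i \<noteq> j" for i j
      using op[OF that(1)] op[OF that(2)] disj[OF that] by blast
    show "{\<alpha><..<\<beta>} \<subseteq> (\<Union>i\<in>F. {a' i..b' i})"
    proof
      fix x assume x: "x \<in> {\<alpha><..<\<beta>}"
      then have "cis x \<in> Q" using arc_closure(3)[OF Q] by blast
      then obtain i where i: "i \<in> F" "cis x \<in> X i" using U by blast
      then have "cis x \<in> cis ` {a' i..b' i}"
        unfolding img arc_closure(1)[OF X[OF i(1)], symmetric] using closure_subset by blast
      then obtain y where y: "y \<in> {a' i..b' i}" "cis x = cis y" by blast
      have "x = y" by (rule cis_inj_window[OF y(2), of \<theta>]) (use x y w w'[OF i(1)] in auto)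
      then show "x \<in> (\<Union>i\<in>F. {a' i..b' i})" using y i by blast
    qed
  qed
  also have "\<dots> = kernel_transform f s \<alpha> \<beta> \<xi>" unfolding c[symmetric] by (rule kernel_transform_stieltjes[symmetric, OF ab w])
  finally show ?thesis .
qed

end

section \<open>Disk automorphisms acting on arcs, kernels and arc length\<close>

lemma arc_image:
  assumes g: "disk_auto a b g" and Q: "arc_between Q \<alpha> \<beta>"
  shows "arc_between (g ` Q) (circle_lift a b \<alpha>) (circle_lift a b \<beta>)"
proof -
  have ab: "(norm a)\<^sup>2 - (norm b)\<^sup>2 = 1" using g by (simp add: disk_auto_def)
  note L = circle_lift_facts[OF ab]
  obtain A where Q': "\<alpha> < \<beta>" "\<beta> \<le> \<alpha> + 2 * pi" "{\<alpha><..<\<beta>} \<subseteq> A" "A \<subseteq> {\<alpha>..\<beta>}" "Q = cis ` A"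
    using Q unfolding arc_between_def by blast
  have m: "circle_lift a b x < circle_lift a b y \<longleftrightarrow> x < y" "circle_lift a b x \<le> circle_lift a b y \<longleftrightarrow> x \<le> y" for x y
    using strict_mono_less[OF L(7)] strict_mono_less_eq[OF L(7)] by auto
  have "{circle_lift a b \<alpha><..<circle_lift a b \<beta>} \<subseteq> circle_lift a b ` A"
  proof
    fix y assume y: "y \<in> {circle_lift a b \<alpha><..<circle_lift a b \<beta>}"
    have "continuous_on {\<alpha>..\<beta>} (circle_lift a b)"
      by (rule DERIV_continuous_on) (use L(2) in \<open>auto intro: has_field_derivative_at_within\<close>)
    then obtain x where x: "\<alpha> \<le> x" "x \<le> \<beta>" "circle_lift a b x = y"
      using IVT'[of "circle_lift a b" \<alpha> y \<beta>] y Q'(1) by auto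
    then have "x \<in> {\<alpha><..<\<beta>}" using y m by auto
    then show "y \<in> circle_lift a b ` A" using Q'(3) x by blast
  qed
  moreover have "circle_lift a b ` A \<subseteq> {circle_lift a b \<alpha>..circle_lift a b \<beta>}" using Q'(4) m by auto
  moreover have "g ` Q = cis ` (circle_lift a b ` A)" unfolding Q'(5) image_image using L(3)[OF g] by simp
  moreover have "circle_lift a b \<beta> \<le> circle_lift a b \<alpha> + 2 * pi" using m(2)[of \<beta> "\<alpha> + 2 * pi"] Q'(2) L(4)[of \<alpha>] by simp
  ultimately show ?thesis unfolding arc_between_def using m(1) Q'(1) by blast
qed

text \<open>The power -s of the transformation law of squared chords. The lift is increasing and
  commutes with the translation by 2 pi, so the image angles stay in a window and all logarithms are
  real.\<close>

lemma angle_kernel_transform: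
  assumes g: "disk_auto a b g" and d: "0 < \<eta> - \<theta>" "\<eta> - \<theta> < 2 * pi"
  shows "angle_kernel s 0 (of_real (circle_lift a b \<eta> - circle_lift a b \<theta>)) = angle_kernel s 0 (of_real (\<eta> - \<theta>)) * jac_power s a b \<eta> * jac_power s a b \<theta>"
proof -
  have ab: "(norm a)\<^sup>2 - (norm b)\<^sup>2 = 1" using g by (simp add: disk_auto_def)
  note L = circle_lift_facts[OF ab]
  have d': "0 < circle_lift a b \<eta> - circle_lift a b \<theta>" "circle_lift a b \<eta> - circle_lift a b \<theta> < 2 * pi"
    using strict_mono_less[OF L(7), of \<theta> \<eta>] strict_mono_less[OF L(7), of \<eta> "\<theta> + 2 * pi"] L(4)[of \<theta>] d by auto
  have kkr: "angle_kernel s 0 (of_real x) = exp (- s * of_real (ln ((2 * sin (x / 2))\<^sup>2)))" if "0 < x" "x < 2 * pi" for x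
  proof -
    have p: "0 < 2 * sin (x / 2)" using real_kdom(2)[OF that] by simp
    have "2 * sin (complex_of_real x / 2) = of_real (2 * sin (x / 2))" by (simp flip: sin_of_real)
    then have "Ln (2 * sin (complex_of_real x / 2)) = of_real (ln (2 * sin (x / 2)))" using p by (simp only: Ln_of_real)
    moreover have "ln ((2 * sin (x / 2))\<^sup>2) = 2 * ln (2 * sin (x / 2))" using p by (simp only: ln_realpow)
    ultimately show ?thesis by (simp add: angle_kernel_def mult_ac)
  qed
  define n where "n = (2 * sin ((\<eta> - \<theta>) / 2))\<^sup>2"
  define n' where "n' = (2 * sin ((circle_lift a b \<eta> - circle_lift a b \<theta>) / 2))\<^sup>2"
  have n0: "0 < n" using real_kdom(2)[OF d] by (simp add: n_def)
  have n: "n = (norm (cis \<theta> - cis \<eta>))\<^sup>2" unfolding n_def norm_cis_diff[OF d] ..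
  have "n' = (norm (g (cis \<theta>) - g (cis \<eta>)))\<^sup>2"
    unfolding n'_def norm_cis_diff[OF d', symmetric] L(3)[OF g] ..
  also have "\<dots> = n / (jac_sq a b \<theta> * jac_sq a b \<eta>)"
    using disk_auto_facts(2)[OF g, of "cis \<theta>" "cis \<eta>"]
    by (simp add: n jac_sq_def norm_divide norm_mult power_divide power_mult_distrib)
  finally have n': "n' = n / (jac_sq a b \<theta> * jac_sq a b \<eta>)" .
  have "ln n' = ln n - ln (jac_sq a b \<theta>) - ln (jac_sq a b \<eta>)"
    unfolding n' using n0 L(1)[of \<theta>] L(1)[of \<eta>] by (simp add: ln_div ln_mult)
  then have "- s * of_real (ln n') = - s * of_real (ln n) + s * of_real (ln (jac_sq a b \<eta>)) + s * of_real (ln (jac_sq a b \<theta>))"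
    by (simp only: of_real_diff) (simp add: algebra_simps)
  then show ?thesis
    unfolding kkr[OF d'] kkr[OF d] n_def[symmetric] n'_def[symmetric] jac_power_def exp_add[symmetric]
    by (rule arg_cong)
qed

text \<open>\<open>arc_deriv\<close> is a derivative within the arc, possibly at an endpoint. It is
  determined only if the point is a limit point of the arc, which holds since arcs are
  nondegenerate.\<close>

lemma at_within_arc:
  assumes I: "arc_between I \<alpha> \<beta>" and x: "cis x \<in> I"
  shows "at x within {\<theta>. cis \<theta> \<in> I} \<noteq> bot"
proof -
  have "cis x \<in> cis ` {\<alpha>..\<beta>}" using x arc_closure(1)[OF I] closure_subset by blast
  then obtain y where y: "y \<in> {\<alpha>..\<beta>}" "cis x = cis y" by blast
  then obtain m :: int where m: "x = y + 2 * pi * of_int m" by (auto simp: cis_eq_iff)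
  define a b where "a = \<alpha> + 2 * pi * of_int m" and "b = \<beta> + 2 * pi * of_int m"
  have ab: "a < b" "a \<le> x" "x \<le> b" using I y m by (auto simp: a_def b_def arc_between_def)
  have S: "{a<..<b} \<subseteq> {\<theta>. cis \<theta> \<in> I}"
  proof
    fix u assume "u \<in> {a<..<b}"
    then have "u - 2 * pi * of_int m \<in> {\<alpha><..<\<beta>}" by (auto simp: a_def b_def)
    then have "cis (u - 2 * pi * of_int m) \<in> I" using arc_closure(3)[OF I] by blast
    moreover have "cis (u - 2 * pi * of_int m) = cis u" by (auto simp: cis_eq_iff intro: exI[of _ "- m"])
    ultimately show "u \<in> {\<theta>. cis \<theta> \<in> I}" by simp
  qed
  have "x \<in> closure ({\<theta>. cis \<theta> \<in> I} - {x})"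
  proof (cases "a < x")
    case True
    have "x \<in> closure {a<..<x}" using True by simp
    moreover have "{a<..<x} \<subseteq> {a<..<b} - {x}" using ab by auto
    ultimately show ?thesis using S closure_mono[of _ "{\<theta>. cis \<theta> \<in> I} - {x}"] by blast
  next
    case False
    then have "x < b" using ab by simp
    then have "x \<in> closure {x<..<b}" by simp
    moreover have "{x<..<b} \<subseteq> {a<..<b} - {x}" using ab by auto
    ultimately show ?thesis using S closure_mono[of _ "{\<theta>. cis \<theta> \<in> I} - {x}"] by blast
  qed
  then show ?thesis by (simp add: trivial_limit_within islimpt_in_closure)
qed

lemma arc_deriv_eq:
  assumes part: "circle_partition p IL" and k: "k < p" and \<xi>: "\<xi> \<in> IL k"
    and g: "disk_auto a b g" and T: "\<And>z. z \<in> IL k \<Longrightarrow> T z = g z"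
    and \<theta>: "cis \<theta> = \<xi>"
  shows "arc_deriv p IL T \<xi> = 1 / jac_sq a b \<theta>"
proof -
  have ab: "(norm a)\<^sup>2 - (norm b)\<^sup>2 = 1" using g by (simp add: disk_auto_def)
  note L = circle_lift_facts[OF ab]
  obtain \<alpha> \<beta> where I: "arc_between (IL k) \<alpha> \<beta>"
    using part k unfolding circle_partition_def circle_interval_def by blast
  have uniq: "k' = k" if "k' < p" "\<xi> \<in> IL k'" for k'
    using part that k \<xi> unfolding circle_partition_def disjoint_family_on_def by blast
  then have S: "{\<theta>. \<exists>k<p. \<xi> \<in> IL k \<and> cis \<theta> \<in> IL k} = {\<theta>. cis \<theta> \<in> IL k}" using k \<xi> by blast
  define x where "x = Arg \<xi>"
  have "norm \<xi> = 1" unfolding \<theta>[symmetric] by simp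
  then have "\<xi> \<noteq> 0" by auto
  then have cx: "cis x = \<xi>" using cis_Arg[of \<xi>] \<open>norm \<xi> = 1\<close> by (simp add: x_def sgn_div_norm)
  have nb: "at x within {\<theta>. cis \<theta> \<in> IL k} \<noteq> bot" by (rule at_within_arc[OF I]) (simp add: cx \<xi>)
  have "((\<lambda>\<theta>. cis (1 * circle_lift a b \<theta>)) has_vector_derivative (1 / jac_sq a b x) *\<^sub>R (\<i> * of_real 1 * cis (1 * circle_lift a b x))) (at x)"
    using vector_diff_chain_at[OF L(2)[unfolded has_real_derivative_iff_has_vector_derivative] has_vector_derivative_cis[of 1]]
    by (simp add: o_def)
  then have "((\<lambda>\<theta>. cis (circle_lift a b \<theta>)) has_vector_derivative (1 / jac_sq a b x) *\<^sub>R (\<i> * cis (circle_lift a b x))) (at x within {\<theta>. cis \<theta> \<in> IL k})"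
    by (simp add: has_vector_derivative_at_within)
  then have "((\<lambda>\<theta>. T (cis \<theta>)) has_vector_derivative (1 / jac_sq a b x) *\<^sub>R (\<i> * cis (circle_lift a b x))) (at x within {\<theta>. cis \<theta> \<in> IL k})"
    by (rule has_vector_derivative_transform[rotated 2]) (use \<xi> cx T L(3)[OF g] in auto)
  then have "vector_derivative (\<lambda>\<theta>. T (cis \<theta>)) (at x within {\<theta>. cis \<theta> \<in> IL k}) = (1 / jac_sq a b x) *\<^sub>R (\<i> * cis (circle_lift a b x))"
    by (rule vector_derivative_within[OF nb])
  then have "arc_deriv p IL T \<xi> = \<bar>1 / jac_sq a b x\<bar>"
    unfolding arc_deriv_def S x_def[symmetric] by (simp add: norm_mult)
  \<comment> \<open>\<open>arc_deriv\<close> is taken at the principal lift, while \<theta> may be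
    any lift; the Jacobian depends only on the point of the circle.\<close>
  also have "jac_sq a b x = jac_sq a b \<theta>" by (simp add: jac_sq_def cx \<theta>)
  finally show ?thesis using L(1)[of \<theta>] by simp
qed

subsection \<open>Baker maps\<close>

lemma inverse_jacobian_powr:
  assumes ab: "(norm a)\<^sup>2 - (norm b)\<^sup>2 = 1"
  shows "z / of_real (1 / jac_sq a b \<theta>) powr s = jac_power s a b \<theta> * z"
proof -
  have p: "0 < jac_sq a b \<theta>" by (rule circle_lift_facts(1)[OF ab])
  then have n: "1 / jac_sq a b \<theta> \<noteq> 0" by simp
  have "Ln (of_real (1 / jac_sq a b \<theta>)) = of_real (ln (1 / jac_sq a b \<theta>))" using p by (intro Ln_of_real) simp
  also have "ln (1 / jac_sq a b \<theta>) = - ln (jac_sq a b \<theta>)" using p by (simp add: ln_div)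
  finally have "complex_of_real (1 / jac_sq a b \<theta>) powr s = exp (- (s * of_real (ln (jac_sq a b \<theta>))))"
    using n by (simp only: powr_def of_real_eq_0_iff if_False of_real_minus mult_minus_right)
  then show ?thesis by (simp add: jac_power_def exp_minus divide_inverse mult.commute)
qed

context
  fixes f :: "complex \<Rightarrow> complex" and s :: complex
  assumes Gc: "continuous_on UNIV (helgason_primitive f s)"
begin

text \<open>Conformal invariance of the kernel turns the covariance of the distribution into that of its kernel integrals.\<close>

lemma kernel_transform_moebius:
  assumes g: "disk_auto a b g" and w: "\<alpha> < \<beta>" "\<theta> < \<alpha>" "\<beta> < \<theta> + 2 * pi"
    and cov: "\<And>\<psi>. \<psi> C1_differentiable_on {\<alpha>..\<beta>} \<Longrightarrow> stieltjes \<alpha> \<beta> \<psi> (helgason_primitive f s) =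
      stieltjes \<alpha> \<beta> (\<lambda>x. \<psi> x * jac_power s a b x) (\<lambda>x. helgason_primitive f s (circle_lift a b x))"
  shows "kernel_transform f s \<alpha> \<beta> (cis \<theta>) / of_real (1 / jac_sq a b \<theta>) powr s =
    kernel_transform f s (circle_lift a b \<alpha>) (circle_lift a b \<beta>) (g (cis \<theta>))"
proof -
  have ab: "(norm a)\<^sup>2 - (norm b)\<^sup>2 = 1" using g by (simp add: disk_auto_def)
  note L = circle_lift_facts[OF ab]
  let ?G = "helgason_primitive f s"
  have m: "circle_lift a b \<alpha> < circle_lift a b \<beta>" "circle_lift a b \<theta> < circle_lift a b \<alpha>" "circle_lift a b \<beta> < circle_lift a b \<theta> + 2 * pi"
    using strict_mono_less[OF L(7)] w strict_mono_less[OF L(7), of \<beta> "\<theta> + 2 * pi"] L(4)[of \<theta>] by auto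
  have kkC: "(\<lambda>\<eta>. angle_kernel s 0 (of_real (\<eta> - circle_lift a b \<theta>))) C1_differentiable_on {circle_lift a b \<alpha>..circle_lift a b \<beta>}"
    by (rule angle_kernel_C1[OF m(2,3)])
  have Gl: "continuous_on {circle_lift a b \<alpha>..circle_lift a b \<beta>} ?G" by (rule continuous_on_subset[OF Gc subset_UNIV])
  have jc: "continuous_on {\<alpha>..\<beta>} (\<lambda>x. 1 / jac_sq a b x)"
    by (intro continuous_on_divide continuous_on_const L(6)) (use L(1) in \<open>auto simp: less_imp_neq[THEN not_sym]\<close>)
  have j0: "0 \<le> 1 / jac_sq a b x" for x using L(1)[of x] by simp
  note sub = stieltjes_substitution[OF less_imp_le[OF w(1)] L(2) jc j0 kkC Gl]
  have kJ: "(\<lambda>\<eta>. angle_kernel s 0 (of_real (\<eta> - \<theta>)) * jac_power s a b \<eta>) C1_differentiable_on {\<alpha>..\<beta>}"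
    by (rule C1_differentiable_on_mult[OF angle_kernel_C1[OF w(2,3)] L(8)])
  then have kJ2: "(\<lambda>\<eta>. jac_power s a b \<theta> * (angle_kernel s 0 (of_real (\<eta> - \<theta>)) * jac_power s a b \<eta>)) C1_differentiable_on {\<alpha>..\<beta>}"
    by (rule C1_differentiable_on_mult[OF C1_differentiable_on_const])
  have "kernel_transform f s \<alpha> \<beta> (cis \<theta>) / of_real (1 / jac_sq a b \<theta>) powr s =
      jac_power s a b \<theta> * stieltjes \<alpha> \<beta> (\<lambda>\<eta>. angle_kernel s 0 (of_real (\<eta> - \<theta>))) ?G"
    unfolding inverse_jacobian_powr[OF ab] kernel_transform_stieltjes[OF w] ..
  \<comment> \<open>Covariance supplies the Jacobian at \<eta>, the division by the derivative has
    supplied the one at \<theta>; the transformation law of the kernel consumes both.\<close>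
  also have "\<dots> = jac_power s a b \<theta> * stieltjes \<alpha> \<beta> (\<lambda>\<eta>. angle_kernel s 0 (of_real (\<eta> - \<theta>)) * jac_power s a b \<eta>) (\<lambda>\<eta>. ?G (circle_lift a b \<eta>))"
    unfolding cov[OF angle_kernel_C1[OF w(2,3)]] ..
  also have "\<dots> = stieltjes \<alpha> \<beta> (\<lambda>\<eta>. jac_power s a b \<theta> * (angle_kernel s 0 (of_real (\<eta> - \<theta>)) * jac_power s a b \<eta>)) (\<lambda>\<eta>. ?G (circle_lift a b \<eta>))"
    by (rule stieltjes_cmult_left[OF kJ, symmetric])
  also have "\<dots> = stieltjes \<alpha> \<beta> (\<lambda>\<eta>. angle_kernel s 0 (of_real (circle_lift a b \<eta> - circle_lift a b \<theta>))) (\<lambda>\<eta>. ?G (circle_lift a b \<eta>))"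
  proof (rule stieltjes_cong[OF w(1) kJ2 sub(2) _ refl])
    fix x assume "x \<in> {\<alpha>..\<beta>}"
    then have d: "0 < x - \<theta>" "x - \<theta> < 2 * pi" using w by auto
    show "jac_power s a b \<theta> * (angle_kernel s 0 (of_real (x - \<theta>)) * jac_power s a b x) = angle_kernel s 0 (of_real (circle_lift a b x - circle_lift a b \<theta>))"
      unfolding angle_kernel_transform[OF g d] by (simp only: mult_ac)
  qed
  also have "\<dots> = stieltjes (circle_lift a b \<alpha>) (circle_lift a b \<beta>) (\<lambda>\<eta>. angle_kernel s 0 (of_real (\<eta> - circle_lift a b \<theta>))) ?G"
    by (rule sub(1)[symmetric])
  also have "\<dots> = kernel_transform f s (circle_lift a b \<alpha>) (circle_lift a b \<beta>) (g (cis \<theta>))"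
    unfolding L(3)[OF g, symmetric] by (rule kernel_transform_stieltjes[OF m, symmetric])
  finally show ?thesis .
qed

lemma kernel_transform_real_analytic:
  assumes Q: "arc_between Q \<alpha> \<beta>" and disj: "closure I \<inter> closure Q = {}"
    and \<psi>: "\<And>\<xi>. \<xi> \<in> I \<Longrightarrow> \<psi> \<xi> = kernel_transform f s \<alpha> \<beta> \<xi>"
  shows "circle_real_analytic_on I \<psi>"
  unfolding circle_real_analytic_on_def
proof (intro allI impI)
  fix \<theta>0 assume \<theta>0: "cis \<theta>0 \<in> I"
  have ab: "\<alpha> < \<beta>" using Q by (simp add: arc_between_def)
  have "cis \<theta>0 \<notin> cis ` {\<alpha>..\<beta>}" using \<theta>0 disj closure_subset arc_closure(1)[OF Q] by blast
  then obtain m :: int where m: "\<theta>0 + 2 * pi * of_int m < \<alpha>" "\<beta> < \<theta>0 + 2 * pi * of_int m + 2 * pi"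
    by (rule arc_window)
  obtain a \<epsilon> where \<epsilon>: "0 < \<epsilon>"
    and su: "\<And>\<theta>. \<bar>\<theta> - (\<theta>0 + 2 * pi * of_int m)\<bar> < \<epsilon> \<Longrightarrow> (\<lambda>n. a n * of_real (\<theta> - (\<theta>0 + 2 * pi * of_int m)) ^ n) sums
      stieltjes \<alpha> \<beta> (\<lambda>\<eta>. angle_kernel s 0 (of_real (\<eta> - \<theta>))) (helgason_primitive f s)"
    and w: "\<And>\<theta>. \<bar>\<theta> - (\<theta>0 + 2 * pi * of_int m)\<bar> < \<epsilon> \<Longrightarrow> \<theta> < \<alpha> \<and> \<beta> < \<theta> + 2 * pi"
    by (rule angle_kernel_integral_analytic[where s = s, OF ab m continuous_on_subset[OF Gc subset_UNIV]], rule that)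
  have "(\<lambda>n. a n * of_real (\<theta> - \<theta>0) ^ n) sums \<psi> (cis \<theta>)" if "\<bar>\<theta> - \<theta>0\<bar> < \<epsilon>" "cis \<theta> \<in> I" for \<theta>
  proof -
    define \<theta>' where "\<theta>' = \<theta> + 2 * pi * of_int m"
    have e: "\<theta>' - (\<theta>0 + 2 * pi * of_int m) = \<theta> - \<theta>0" by (simp add: \<theta>'_def)
    have c: "cis \<theta> = cis \<theta>'" unfolding \<theta>'_def cis_eq_iff by (rule exI[of _ "- m"]) simp
    have d: "\<bar>\<theta>' - (\<theta>0 + 2 * pi * of_int m)\<bar> < \<epsilon>" unfolding e by (rule that(1))
    from w[OF d] have w': "\<theta>' < \<alpha>" "\<beta> < \<theta>' + 2 * pi" by auto
    show ?thesis using su[OF d] unfolding e \<psi>[OF that(2)] unfolding c kernel_transform_stieltjes[OF ab w'] .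
  qed
  with \<epsilon> show "\<exists>a \<epsilon>. 0 < \<epsilon> \<and> (\<forall>\<theta>. \<bar>\<theta> - \<theta>0\<bar> < \<epsilon> \<and> cis \<theta> \<in> I \<longrightarrow> (\<lambda>n. a n * of_real (\<theta> - \<theta>0) ^ n) sums \<psi> (cis \<theta>))"
    by blast
qed

lemma kernel_transform_zero_imp_const:
  assumes I: "arc_between I u v" and Q: "arc_between Q \<alpha> \<beta>" and disj: "closure I \<inter> closure Q = {}"
    and z: "\<And>\<xi>. \<xi> \<in> I \<Longrightarrow> kernel_transform f s \<alpha> \<beta> \<xi> = 0" and s: "0 < Re s" and x: "x \<in> {\<alpha>..\<beta>}"
  shows "helgason_primitive f s x = helgason_primitive f s \<alpha>"
proof -
  have ab: "\<alpha> < \<beta>" "u < v" using Q I by (simp_all add: arc_between_def)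
  \<comment> \<open>The midpoint is interior to the arc whether or not the endpoints belong to it,
    so the integral vanishes on a two-sided neighbourhood.\<close>
  define \<theta>0 where "\<theta>0 = (u + v) / 2"
  have "cis \<theta>0 \<in> I" using arc_closure(3)[OF I] ab by (auto simp: \<theta>0_def)
  then have "cis \<theta>0 \<notin> cis ` {\<alpha>..\<beta>}" using disj closure_subset arc_closure(1)[OF Q] by blast
  then obtain m :: int where m: "\<theta>0 + 2 * pi * of_int m < \<alpha>" "\<beta> < \<theta>0 + 2 * pi * of_int m + 2 * pi"
    by (rule arc_window)
  have z': "stieltjes \<alpha> \<beta> (\<lambda>\<eta>. angle_kernel s 0 (of_real (\<eta> - \<theta>))) (helgason_primitive f s) = 0"
    if \<theta>: "\<bar>\<theta> - (\<theta>0 + 2 * pi * of_int m)\<bar> < (v - u) / 2" "\<theta> < \<alpha>" "\<beta> < \<theta> + 2 * pi" for \<theta>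
  proof -
    define y where "y = \<theta> - 2 * pi * of_int m"
    have "\<bar>y - \<theta>0\<bar> < (v - u) / 2" using \<theta>(1) by (simp add: y_def diff_diff_eq add.commute)
    then have "u < y" "y < v" unfolding \<theta>0_def by (auto simp: abs_less_iff field_simps)
    then have "\<theta> - 2 * pi * of_int m \<in> {u<..<v}" by (simp only: y_def greaterThanLessThan_iff)
    then have "cis (\<theta> - 2 * pi * of_int m) \<in> I" using arc_closure(3)[OF I] by blast
    moreover have "cis (\<theta> - 2 * pi * of_int m) = cis \<theta>" unfolding cis_eq_iff by (rule exI[of _ "- m"]) simp
    ultimately have "kernel_transform f s \<alpha> \<beta> (cis \<theta>) = 0" by (simp only: z)
    then show ?thesis unfolding kernel_transform_stieltjes[OF ab(1) \<theta>(2,3)] .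
  qed
  have "0 < (v - u) / 2" using ab by simp
  from angle_kernel_integral_zero_imp_const[OF ab(1) m continuous_on_subset[OF Gc subset_UNIV] s this z' x]
  show ?thesis .
qed

text \<open>A primitive that is constant on each of finitely many arcs covering the circle has countable, hence trivial, range.\<close>

lemma helgason_primitive_constant:
  assumes Gp: "\<And>\<theta>. helgason_primitive f s (\<theta> + 2 * pi) = helgason_primitive f s \<theta> + f 0"
    and Q: "\<And>k. k < p \<Longrightarrow> arc_between (Q k) (\<alpha> k) (\<beta> k)"
    and cover: "\<And>\<eta>. \<eta> \<in> sphere 0 1 \<Longrightarrow> \<exists>k<p::nat. \<eta> \<in> Q k"
    and const: "\<And>k x. k < p \<Longrightarrow> x \<in> {\<alpha> k..\<beta> k} \<Longrightarrow> helgason_primitive f s x = helgason_primitive f s (\<alpha> k)"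
  shows "helgason_primitive f s x = helgason_primitive f s y"
proof (rule ccontr)
  let ?G = "helgason_primitive f s"
  assume "?G x \<noteq> ?G y"
  then have unc: "uncountable (range ?G)"
    by (rule connected_uncountable[OF connected_continuous_image[OF Gc connected_UNIV] rangeI rangeI])
  have "range ?G \<subseteq> (\<lambda>(k, m). ?G (\<alpha> k) + of_int m * f 0) ` (UNIV :: (nat \<times> int) set)"
  proof (rule image_subsetI)
    fix z :: real
    obtain k where k: "k < p" "cis z \<in> Q k" using cover[of "cis z"] by auto
    have "cis z \<in> cis ` {\<alpha> k..\<beta> k}"
      unfolding arc_closure(1)[OF Q[OF k(1)], symmetric] using k(2) closure_subset by blast
    then obtain w where w: "w \<in> {\<alpha> k..\<beta> k}" "cis z = cis w" by blast
    then obtain m :: int where m: "z = w + 2 * pi * of_int m" by (auto simp: cis_eq_iff)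
    have "?G z = ?G w + of_int m * f 0"
      unfolding m by (rule periodic_of_int[where h = "helgason_primitive f s" and k = "f 0", OF Gp])
    also have "?G w = ?G (\<alpha> k)" by (rule const[OF k(1) w(1)])
    finally have "?G z = (\<lambda>(k, m). ?G (\<alpha> k) + of_int m * f 0) (k, m)" by simp
    then show "?G z \<in> (\<lambda>(k, m). ?G (\<alpha> k) + of_int m * f 0) ` UNIV" by (rule image_eqI) simp
  qed
  then have "countable (range ?G)" by (rule countable_subset) (intro countable_image countableI_type)
  then show False using unc by simp
qed

end

text \<open>
  The baker map identifies the fibre of \<^term>\<open>TL\<close> over a point with a partition of the arc
  \<^term>\<open>QR\<close> above that point.
\<close>

lemma baker_fibres:
  assumes M: "moebius_baker \<Gamma> p IL q IR J T TL TR"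
  obtains \<kappa> \<gamma> where
    "\<And>\<xi>. \<xi> \<in> sphere 0 1 \<Longrightarrow> \<kappa> \<xi> < p \<and> \<xi> \<in> IL (\<kappa> \<xi>)"
    "\<And>k \<xi>. k < p \<Longrightarrow> \<xi> \<in> IL k \<Longrightarrow> \<kappa> \<xi> = k"
    "\<And>k. k < p \<Longrightarrow> \<gamma> k \<in> \<Gamma>"
    "\<And>k \<xi>. k < p \<Longrightarrow> \<xi> \<in> IL k \<Longrightarrow> TL \<xi> = \<gamma> k \<xi>"
    "\<And>\<xi>'. \<xi>' \<in> sphere 0 1 \<Longrightarrow>
      (\<Union>\<xi>\<in>{\<xi> \<in> sphere 0 1. TL \<xi> = \<xi>'}. \<gamma> (\<kappa> \<xi>) ` QR q IR J (\<kappa> \<xi>)) = QR q IR J (\<kappa> \<xi>')"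
    "\<And>\<xi> \<xi>2. \<xi> \<in> sphere 0 1 \<Longrightarrow> \<xi>2 \<in> sphere 0 1 \<Longrightarrow> TL \<xi> = TL \<xi>2 \<Longrightarrow> \<xi> \<noteq> \<xi>2 \<Longrightarrow>
      \<gamma> (\<kappa> \<xi>) ` QR q IR J (\<kappa> \<xi>) \<inter> \<gamma> (\<kappa> \<xi>2) ` QR q IR J (\<kappa> \<xi>2) = {}"
proof -
  define \<Sigma> where "\<Sigma> = baker_domain p IL q IR J"
  note M' = M[unfolded moebius_baker_def Let_def, folded \<Sigma>_def]
  have part: "circle_partition p IL" and bij: "bij_betw T \<Sigma> \<Sigma>"
    and Qi: "\<forall>k<p. circle_interval (QR q IR J k) \<and> closure (QR q IR J k) \<inter> closure (IL k) = {}"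
    and ex1: "\<exists>SL SR. SL \<in> \<Sigma> \<rightarrow> sphere 0 1 \<and> SR \<in> \<Sigma> \<rightarrow> sphere 0 1 \<and>
           (\<forall>(\<xi>, \<eta>)\<in>\<Sigma>. T (\<xi>, \<eta>) = (TL \<xi>, SR (\<xi>, \<eta>)) \<and>
                     inv_into \<Sigma> T (\<xi>, \<eta>) = (SL (\<xi>, \<eta>), TR \<eta>))"
    and ex2: "\<exists>\<gamma>L \<gamma>R. \<gamma>L \<in> sphere 0 1 \<rightarrow> \<Gamma> \<and> \<gamma>R \<in> sphere 0 1 \<rightarrow> \<Gamma> \<and>
           (\<forall>k<p. \<gamma>L constant_on IL k) \<and> (\<forall>l<q. \<gamma>R constant_on IR l) \<and>
           (\<forall>(\<xi>, \<eta>)\<in>\<Sigma>. T (\<xi>, \<eta>) = (\<gamma>L \<xi> \<xi>, \<gamma>L \<xi> \<eta>) \<and>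
                     inv_into \<Sigma> T (\<xi>, \<eta>) = (\<gamma>R \<eta> \<xi>, \<gamma>R \<eta> \<eta>))"
    using M' by - (elim conjE, assumption)+
  obtain SR where SR: "\<And>\<xi> \<eta>. (\<xi>, \<eta>) \<in> \<Sigma> \<Longrightarrow> T (\<xi>, \<eta>) = (TL \<xi>, SR (\<xi>, \<eta>))"
    using ex1 by (elim exE conjE) fast
  obtain \<gamma>L where \<gamma>L: "\<gamma>L \<in> sphere 0 1 \<rightarrow> \<Gamma>" "\<forall>k<p. \<gamma>L constant_on IL k"
    "\<And>\<xi> \<eta>. (\<xi>, \<eta>) \<in> \<Sigma> \<Longrightarrow> T (\<xi>, \<eta>) = (\<gamma>L \<xi> \<xi>, \<gamma>L \<xi> \<eta>)"
    using ex2 by (elim exE conjE) fast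
  have sph: "IL k \<subseteq> sphere 0 1" if "k < p" for k
    using part that unfolding circle_partition_def by blast
  have uniq: "k = k'" if "k < p" "k' < p" "\<xi> \<in> IL k" "\<xi> \<in> IL k'" for k k' \<xi>
    using part that unfolding circle_partition_def disjoint_family_on_def by blast
  have "\<forall>\<xi>\<in>sphere 0 1. \<exists>k<p. \<xi> \<in> IL k" using part unfolding circle_partition_def by blast
  then obtain \<kappa> where \<kappa>: "\<And>\<xi>. \<xi> \<in> sphere 0 1 \<Longrightarrow> \<kappa> \<xi> < p \<and> \<xi> \<in> IL (\<kappa> \<xi>)" by metis
  have \<kappa>u: "\<kappa> \<xi> = k" if "k < p" "\<xi> \<in> IL k" for k \<xi> using \<kappa>[of \<xi>] sph[OF that(1)] that uniq by blast
  have "\<forall>k. \<exists>c. k < p \<longrightarrow> (\<forall>\<xi>\<in>IL k. \<gamma>L \<xi> = c)" using \<gamma>L(2) unfolding constant_on_def by blast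
  then obtain \<gamma> where \<gamma>: "\<And>k \<xi>. k < p \<Longrightarrow> \<xi> \<in> IL k \<Longrightarrow> \<gamma>L \<xi> = \<gamma> k" by metis
  have ne: "I \<noteq> {}" if "circle_interval I" for I
    using that arc_closure(3) unfolding circle_interval_def arc_between_def by fastforce
  \<comment> \<open>The domain is fibred over the circle: above \<xi> lies the arc Q of the
    partition interval that contains \<xi>.\<close>
  have \<Sigma>: "(\<xi>, \<eta>) \<in> \<Sigma> \<longleftrightarrow> \<xi> \<in> sphere 0 1 \<and> \<eta> \<in> QR q IR J (\<kappa> \<xi>)" for \<xi> \<eta>
  proof
    assume "(\<xi>, \<eta>) \<in> \<Sigma>"
    then obtain k l where kl: "k < p" "l < q" "J k l = 1" "\<xi> \<in> IL k" "\<eta> \<in> IR l"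
      unfolding \<Sigma>_def baker_domain_def by blast
    then show "\<xi> \<in> sphere 0 1 \<and> \<eta> \<in> QR q IR J (\<kappa> \<xi>)" using sph \<kappa>u[of k \<xi>] unfolding QR_def by blast
  next
    assume "\<xi> \<in> sphere 0 1 \<and> \<eta> \<in> QR q IR J (\<kappa> \<xi>)"
    then show "(\<xi>, \<eta>) \<in> \<Sigma>" using \<kappa>[of \<xi>] unfolding \<Sigma>_def baker_domain_def QR_def by blast
  qed
  \<comment> \<open>The group elements are tied to \<open>TL\<close> only through points of the
    domain, so some \<eta> above \<xi> is needed; the arc above \<xi> is nonempty.\<close>
  have TLs: "TL \<xi> = \<gamma> k \<xi>" if k: "k < p" "\<xi> \<in> IL k" for k \<xi>
  proof -
    obtain \<eta> where "\<eta> \<in> QR q IR J k" using ne Qi k(1) by blast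
    then have "(\<xi>, \<eta>) \<in> \<Sigma>" unfolding \<Sigma> \<kappa>u[OF k] using sph k by blast
    from SR[OF this] \<gamma>L(3)[OF this] show ?thesis by (simp add: \<gamma>[OF k])
  qed
  have T: "T (\<xi>, \<eta>) = (TL \<xi>, \<gamma> (\<kappa> \<xi>) \<eta>)" if "\<xi> \<in> sphere 0 1" "\<eta> \<in> QR q IR J (\<kappa> \<xi>)" for \<xi> \<eta>
  proof -
    have "(\<xi>, \<eta>) \<in> \<Sigma>" using that \<Sigma> by blast
    from SR[OF this] \<gamma>L(3)[OF this] show ?thesis using \<kappa>[OF that(1)] \<gamma>[of "\<kappa> \<xi>" \<xi>] by simp
  qed
  show ?thesis
  proof (rule that[of \<kappa> \<gamma>])
    show "\<kappa> \<xi> < p \<and> \<xi> \<in> IL (\<kappa> \<xi>)" if "\<xi> \<in> sphere 0 1" for \<xi> using that by (rule \<kappa>)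
    show "\<kappa> \<xi> = k" if "k < p" "\<xi> \<in> IL k" for k \<xi> using that by (rule \<kappa>u)
    show "TL \<xi> = \<gamma> k \<xi>" if "k < p" "\<xi> \<in> IL k" for k \<xi> using that by (rule TLs)
    show "\<gamma> k \<in> \<Gamma>" if k: "k < p" for k
    proof -
      have "circle_interval (IL k)" using part k unfolding circle_partition_def by blast
      from ne[OF this] obtain \<xi> where \<xi>: "\<xi> \<in> IL k" by blast
      then have "\<gamma>L \<xi> \<in> \<Gamma>" using funcset_mem[OF \<gamma>L(1)] sph[OF k] by blast
      then show ?thesis unfolding \<gamma>[OF k \<xi>] .
    qed
    show "(\<Union>\<xi>\<in>{\<xi> \<in> sphere 0 1. TL \<xi> = \<xi>'}. \<gamma> (\<kappa> \<xi>) ` QR q IR J (\<kappa> \<xi>)) = QR q IR J (\<kappa> \<xi>')"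
      if \<xi>': "\<xi>' \<in> sphere 0 1" for \<xi>'
    proof (rule Set.set_eqI)
      fix \<eta>'
      show "\<eta>' \<in> (\<Union>\<xi>\<in>{\<xi> \<in> sphere 0 1. TL \<xi> = \<xi>'}. \<gamma> (\<kappa> \<xi>) ` QR q IR J (\<kappa> \<xi>)) \<longleftrightarrow> \<eta>' \<in> QR q IR J (\<kappa> \<xi>')"
      proof
        assume "\<eta>' \<in> (\<Union>\<xi>\<in>{\<xi> \<in> sphere 0 1. TL \<xi> = \<xi>'}. \<gamma> (\<kappa> \<xi>) ` QR q IR J (\<kappa> \<xi>))"
        then obtain \<xi> \<eta> where e: "\<xi> \<in> sphere 0 1" "TL \<xi> = \<xi>'" "\<eta> \<in> QR q IR J (\<kappa> \<xi>)" "\<eta>' = \<gamma> (\<kappa> \<xi>) \<eta>"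
          by blast
        have "(\<xi>', \<eta>') = T (\<xi>, \<eta>)" unfolding T[OF e(1,3)] e(2,4) ..
        also have "\<dots> \<in> \<Sigma>" using bij_betwE[OF bij] e \<Sigma> by blast
        finally show "\<eta>' \<in> QR q IR J (\<kappa> \<xi>')" using \<Sigma> by blast
      next
        assume "\<eta>' \<in> QR q IR J (\<kappa> \<xi>')"
        \<comment> \<open>Surjectivity of the baker map gives the covering; its injectivity gives
          the disjointness below.\<close>
        then have "(\<xi>', \<eta>') \<in> T ` \<Sigma>" unfolding bij_betw_imp_surj_on[OF bij] \<Sigma> using \<xi>' by blast
        then obtain \<xi> \<eta> where e: "(\<xi>, \<eta>) \<in> \<Sigma>" "(\<xi>', \<eta>') = T (\<xi>, \<eta>)" by auto
        then have h: "\<xi> \<in> sphere 0 1" "\<eta> \<in> QR q IR J (\<kappa> \<xi>)" using \<Sigma> by blast+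
        have "TL \<xi> = \<xi>'" "\<eta>' = \<gamma> (\<kappa> \<xi>) \<eta>" using e(2) unfolding T[OF h] by simp_all
        then show "\<eta>' \<in> (\<Union>\<xi>\<in>{\<xi> \<in> sphere 0 1. TL \<xi> = \<xi>'}. \<gamma> (\<kappa> \<xi>) ` QR q IR J (\<kappa> \<xi>))"
          using h by (intro UN_I[of \<xi>] CollectI conjI image_eqI[of _ _ \<eta>])
      qed
    qed
    show "\<gamma> (\<kappa> \<xi>) ` QR q IR J (\<kappa> \<xi>) \<inter> \<gamma> (\<kappa> \<xi>2) ` QR q IR J (\<kappa> \<xi>2) = {}"
      if "\<xi> \<in> sphere 0 1" "\<xi>2 \<in> sphere 0 1" "TL \<xi> = TL \<xi>2" "\<xi> \<noteq> \<xi>2" for \<xi> \<xi>2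
    proof (rule ccontr)
      assume "\<not> ?thesis"
      then obtain \<eta> \<eta>2 where e: "\<eta> \<in> QR q IR J (\<kappa> \<xi>)" "\<eta>2 \<in> QR q IR J (\<kappa> \<xi>2)" "\<gamma> (\<kappa> \<xi>) \<eta> = \<gamma> (\<kappa> \<xi>2) \<eta>2"
        by blast
      have "T (\<xi>, \<eta>) = T (\<xi>2, \<eta>2)"
        unfolding T[OF that(1) e(1)] T[OF that(2) e(2)] e(3) that(3) ..
      moreover have "(\<xi>, \<eta>) \<in> \<Sigma>" "(\<xi>2, \<eta>2) \<in> \<Sigma>" unfolding \<Sigma> using e that by simp_all
      ultimately have "(\<xi>, \<eta>) = (\<xi>2, \<eta>2)" using bij_betw_imp_inj_on[OF bij] by (simp only: inj_on_eq_iff)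
      then show False using that(4) by simp
    qed
  qed
qed

lemma baker_arcs:
  assumes M: "moebius_baker \<Gamma> p IL q IR J T TL TR"
  shows "circle_partition p IL"
    and "k < p \<Longrightarrow> circle_interval (QR q IR J k)"
    and "k < p \<Longrightarrow> closure (IL k) \<inter> closure (QR q IR J k) = {}"
    and "\<eta> \<in> sphere 0 1 \<Longrightarrow> \<exists>k<p. \<eta> \<in> QR q IR J k"
proof -
  have part: "circle_partition p IL" "circle_partition q IR"
    and Qi: "\<forall>k<p. circle_interval (QR q IR J k) \<and> closure (QR q IR J k) \<inter> closure (IL k) = {}"
    and Ql: "\<forall>l<q. circle_interval (QL p IL J l) \<and> closure (QL p IL J l) \<inter> closure (IR l) = {}"
    using M[unfolded moebius_baker_def Let_def] by - (elim conjE, assumption)+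
  show "circle_partition p IL" by (rule part)
  show "k < p \<Longrightarrow> circle_interval (QR q IR J k)" using Qi by blast
  show "k < p \<Longrightarrow> closure (IL k) \<inter> closure (QR q IR J k) = {}" using Qi by blast
  assume "\<eta> \<in> sphere 0 1"
  then obtain l where l: "l < q" "\<eta> \<in> IR l" using part(2) unfolding circle_partition_def by blast
  \<comment> \<open>Some left interval is joined to the right interval of \<eta>, since QL is an
    interval and hence nonempty.\<close>
  have "circle_interval (QL p IL J l)" using Ql l by blast
  then have "QL p IL J l \<noteq> {}" using arc_closure(3) unfolding circle_interval_def arc_between_def by fastforce
  then obtain k where "k < p" "J k l = 1" unfolding QL_def by blast
  then show "\<exists>k<p. \<eta> \<in> QR q IR J k" using l unfolding QR_def by blast
qed

section \<open>The fixed function of the transfer operator\<close>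

theorem theorem1:
  fixes \<Gamma> :: "(complex \<Rightarrow> complex) set"
    and t :: real and s \<mu> :: complex
    and f :: "complex \<Rightarrow> complex"
    and p q :: nat and IL IR :: "nat \<Rightarrow> complex set" and J :: "nat \<Rightarrow> nat \<Rightarrow> nat"
    and T :: "complex \<times> complex \<Rightarrow> complex \<times> complex"
    and TL TR :: "complex \<Rightarrow> complex"
  assumes "cocompact_fuchsian \<Gamma>"
    and "s = 1 / 2 + \<i> * of_real t"
    and "\<mu> = s * (1 - s)"
    and "hyp_eigenfunction \<mu> f"
    and "\<exists>z\<in>ball 0 1. f z \<noteq> 0"
    and "automorphic \<Gamma> f"
    and "moebius_baker \<Gamma> p IL q IR J T TL TR"
  shows "\<exists>\<psi> :: complex \<Rightarrow> complex.
     (\<exists>\<xi>\<in>sphere 0 1. \<psi> \<xi> \<noteq> 0) \<and>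
     (\<forall>k<p. circle_real_analytic_on (IL k) \<psi>) \<and>
     (\<forall>\<xi>'\<in>sphere 0 1. transfer_operator s p IL TL \<psi> \<xi>' = \<psi> \<xi>') \<and>
     (\<forall>k<p. inj_on TL (IL k) \<and> closure (IL k) \<inter> closure (QR q IR J k) = {} \<and>
        (\<forall>\<alpha> \<beta>. arc_between (QR q IR J k) \<alpha> \<beta> \<longrightarrow>
          (\<forall>\<xi>\<in>IL k.
             \<psi> \<xi> = helgason_integral f s \<alpha> \<beta> (\<lambda>\<eta>. of_real (boundary_kernel \<xi> \<eta>) powr s) \<and>
             \<psi> \<xi> = helgason_integral f s \<alpha> \<beta> (\<lambda>\<eta>. 1 / of_real (norm (\<xi> - \<eta>)) powr (2 * s)))))"
proof -
  define \<nu> where "\<nu> = 1 / 4 + t\<^sup>2"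
  have s: "s = 1/2 + \<i> * of_real t" using assms(2) by simp
  note sp = spectral_parameter[OF s \<nu>_def]
  have f: "hyp_eigenfunction (of_real \<nu>) f" using assms(4) unfolding assms(3) sp(1) .
  then have "C1_on (ball 0 1) f" by (simp add: hyp_eigenfunction_def C2_on_def)
  then obtain B where B: "\<And>z. z \<in> ball 0 1 \<Longrightarrow> norm (f z) \<le> B"
    "\<And>z. z \<in> ball 0 1 \<Longrightarrow> (1 - (norm z)\<^sup>2) * (norm (partial_x f z) + norm (partial_y f z)) \<le> B"
    using automorphic_gradient_bound[OF assms(1) _ assms(6)] by metis
  note H = s \<nu>_def f B assms(5)
  have Gc: "continuous_on UNIV (helgason_primitive f s)" by (rule helgason_primitive_facts(1)[OF H])
  have Gp: "helgason_primitive f s (\<theta> + 2 * pi) = helgason_primitive f s \<theta> + f 0" for \<theta>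
    by (rule helgason_primitive_facts(2)[OF H])
  have cov: "stieltjes \<alpha> \<beta> \<psi> (helgason_primitive f s) = stieltjes \<alpha> \<beta> (\<lambda>x. \<psi> x * jac_power s a b x) (\<lambda>x. helgason_primitive f s (circle_lift a b x))"
    if g: "g \<in> \<Gamma>" "disk_auto a b g" and \<psi>: "\<psi> C1_differentiable_on {\<alpha>..\<beta>}" "\<alpha> < \<beta>" for g a b \<psi> \<alpha> \<beta>
    by (rule helgason_covariance[OF H g(2) _ \<psi>(1) less_imp_le[OF \<psi>(2)]])
      (use assms(6) g(1) in \<open>auto simp: automorphic_def\<close>)

  define Q where "Q = QR q IR J"
  obtain \<kappa> \<gamma> where \<kappa>: "\<And>\<xi>. \<xi> \<in> sphere 0 1 \<Longrightarrow> \<kappa> \<xi> < p \<and> \<xi> \<in> IL (\<kappa> \<xi>)"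
      and \<kappa>u: "\<And>k \<xi>. k < p \<Longrightarrow> \<xi> \<in> IL k \<Longrightarrow> \<kappa> \<xi> = k"
      and \<gamma>: "\<And>k. k < p \<Longrightarrow> \<gamma> k \<in> \<Gamma>"
      and TL: "\<And>k \<xi>. k < p \<Longrightarrow> \<xi> \<in> IL k \<Longrightarrow> TL \<xi> = \<gamma> k \<xi>"
      and U: "\<And>\<xi>'. \<xi>' \<in> sphere 0 1 \<Longrightarrow> (\<Union>\<xi>\<in>{\<xi> \<in> sphere 0 1. TL \<xi> = \<xi>'}. \<gamma> (\<kappa> \<xi>) ` Q (\<kappa> \<xi>)) = Q (\<kappa> \<xi>')"
      and D: "\<And>\<xi> \<xi>2. \<xi> \<in> sphere 0 1 \<Longrightarrow> \<xi>2 \<in> sphere 0 1 \<Longrightarrow> TL \<xi> = TL \<xi>2 \<Longrightarrow> \<xi> \<noteq> \<xi>2 \<Longrightarrow>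
        \<gamma> (\<kappa> \<xi>) ` Q (\<kappa> \<xi>) \<inter> \<gamma> (\<kappa> \<xi>2) ` Q (\<kappa> \<xi>2) = {}"
    using baker_fibres[OF assms(7), folded Q_def] by blast
  note part = baker_arcs(1)[OF assms(7)]
  have Qi: "circle_interval (Q k)" and Qd: "closure (IL k) \<inter> closure (Q k) = {}" if "k < p" for k
    using baker_arcs(2,3)[OF assms(7) that] unfolding Q_def .
  have Qc: "\<exists>k<p. \<eta> \<in> Q k" if "\<eta> \<in> sphere 0 1" for \<eta>
    using baker_arcs(4)[OF assms(7) that] unfolding Q_def .
  have ILs: "IL k \<subseteq> sphere 0 1" if "k < p" for k
    using part that unfolding circle_partition_def by blast
  have nQ: "\<xi> \<notin> closure (Q (\<kappa> \<xi>))" if "\<xi> \<in> sphere 0 1" for \<xi>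
    using \<kappa>[OF that] Qd[of "\<kappa> \<xi>"] closure_subset by blast
  have "\<forall>k. \<exists>u v. k < p \<longrightarrow> arc_between (Q k) u v" using Qi unfolding circle_interval_def by blast
  then obtain al be where arc: "\<And>k. k < p \<Longrightarrow> arc_between (Q k) (al k) (be k)" by metis
  have "\<forall>k. \<exists>a b. k < p \<longrightarrow> disk_auto a b (\<gamma> k)" using fuchsian_disk_auto[OF assms(1)] \<gamma> by metis
  then obtain A B' where auto: "\<And>k. k < p \<Longrightarrow> disk_auto (A k) (B' k) (\<gamma> k)" by metis
  have TLinj: "inj_on TL (IL k)" if k: "k < p" for k
  proof (rule inj_onI)
    fix x y assume xy: "x \<in> IL k" "y \<in> IL k" "TL x = TL y"
    have "IL k \<subseteq> cball 0 1" using ILs[OF k] by auto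
    then have "x \<in> cball 0 1" "y \<in> cball 0 1" using xy by blast+
    moreover have "\<gamma> k x = \<gamma> k y" using xy TL[OF k] by simp
    ultimately show "x = y" using disk_auto_facts(6)[OF auto[OF k]] by (simp only: inj_on_eq_iff)
  qed

  \<comment> \<open>One pair of endpoints is chosen for each arc; the next fact removes the
    dependence on this choice.\<close>
  define \<psi> where "\<psi> \<xi> = kernel_transform f s (al (\<kappa> \<xi>)) (be (\<kappa> \<xi>)) \<xi>" for \<xi>
  have \<psi>: "\<psi> \<xi> = kernel_transform f s \<alpha> \<beta> \<xi>" if k: "k < p" "\<xi> \<in> IL k" "arc_between (Q k) \<alpha> \<beta>" for k \<xi> \<alpha> \<beta>
  proof -
    have \<xi>: "\<xi> \<in> sphere 0 1" using ILs k by blast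
    have "\<xi> \<notin> closure (Q k)" using nQ[OF \<xi>] unfolding \<kappa>u[OF k(1,2)] .
    from kernel_transform_unique[OF Gc Gp k(3) arc[OF k(1)] \<xi> this] show ?thesis
      unfolding \<psi>_def \<kappa>u[OF k(1,2)] .
  qed

  have nonzero: "\<exists>\<xi>\<in>sphere 0 1. \<psi> \<xi> \<noteq> 0"
  proof (rule ccontr)
    assume "\<not> ?thesis"
    then have z: "\<psi> \<xi> = 0" if "\<xi> \<in> sphere 0 1" for \<xi> using that by blast
    have Re_s: "0 < Re s" using sp(2) by simp
    have "helgason_primitive f s x = helgason_primitive f s (al k)" if k: "k < p" and x: "x \<in> {al k..be k}" for k x
    proof -
      obtain u v where I: "arc_between (IL k) u v"
        using part k unfolding circle_partition_def circle_interval_def by blast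
      have z': "kernel_transform f s (al k) (be k) \<xi> = 0" if "\<xi> \<in> IL k" for \<xi>
        using \<psi>[OF k that arc[OF k]] z ILs[OF k] that by auto
      show ?thesis by (rule kernel_transform_zero_imp_const[OF Gc I arc[OF k] Qd[OF k] z' Re_s x])
    qed
    from helgason_primitive_constant[OF Gc Gp arc Qc this] helgason_primitive_nonconstant[OF H]
    show False by blast
  qed

  have fixed: "transfer_operator s p IL TL \<psi> \<xi>' = \<psi> \<xi>'" if \<xi>': "\<xi>' \<in> sphere 0 1" for \<xi>'
  proof -
    define F where "F = {\<xi> \<in> sphere 0 1. TL \<xi> = \<xi>'}"
    \<comment> \<open>The fibre meets each partition interval at most once, so it is finite. Over an
      infinite set \<open>sum\<close> would return 0 by convention.\<close>
    have inj: "inj_on \<kappa> F"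
    proof (rule inj_onI)
      fix x y assume xy: "x \<in> F" "y \<in> F" "\<kappa> x = \<kappa> y"
      then have "x \<in> IL (\<kappa> x)" "y \<in> IL (\<kappa> x)" "TL x = TL y" "\<kappa> x < p"
        using \<kappa>[of x] \<kappa>[of y] by (auto simp: F_def)
      then show "x = y" using TLinj by (auto dest: inj_onD)
    qed
    have "\<kappa> ` F \<subseteq> {..<p}" using \<kappa> by (auto simp: F_def)
    then have fin: "finite F" using inj_on_finite[OF inj] by blast
    define a where "a \<xi> = circle_lift (A (\<kappa> \<xi>)) (B' (\<kappa> \<xi>)) (al (\<kappa> \<xi>))" for \<xi>
    define b where "b \<xi> = circle_lift (A (\<kappa> \<xi>)) (B' (\<kappa> \<xi>)) (be (\<kappa> \<xi>))" for \<xi>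
    have trm: "\<psi> \<xi> / of_real (arc_deriv p IL TL \<xi>) powr s = kernel_transform f s (a \<xi>) (b \<xi>) \<xi>'" if \<xi>: "\<xi> \<in> F" for \<xi>
    proof -
      define k where "k = \<kappa> \<xi>"
      have \<xi>s: "\<xi> \<in> sphere 0 1" "TL \<xi> = \<xi>'" using \<xi> by (simp_all add: F_def)
      have k: "k < p" "\<xi> \<in> IL k" using \<kappa>[OF \<xi>s(1)] by (simp_all add: k_def)
      have "\<xi> \<noteq> 0" "norm \<xi> = 1" using \<xi>s(1) by auto
      then have c: "cis (Arg \<xi>) = \<xi>" using cis_Arg[of \<xi>] by (simp add: sgn_div_norm)
      have "cis (Arg \<xi>) \<notin> cis ` {al k..be k}"
        using nQ[OF \<xi>s(1)] unfolding c k_def[symmetric] arc_closure(1)[OF arc[OF k(1)]] .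
      then obtain m :: int where m: "Arg \<xi> + 2 * pi * of_int m < al k" "be k < Arg \<xi> + 2 * pi * of_int m + 2 * pi"
        by (rule arc_window)
      \<comment> \<open>The lift of \<xi> just below the arc, which puts the chosen endpoints in the
        window that \<open>kernel_transform_moebius\<close> asks for.\<close>
      define \<theta> where "\<theta> = Arg \<xi> + 2 * pi * of_int m"
      have "cis \<theta> = cis (Arg \<xi>)" unfolding \<theta>_def cis_eq_iff by blast
      then have c\<theta>: "cis \<theta> = \<xi>" unfolding c .
      have ab: "al k < be k" using arc[OF k(1)] by (simp add: arc_between_def)
      have dv: "arc_deriv p IL TL \<xi> = 1 / jac_sq (A k) (B' k) \<theta>"
        by (rule arc_deriv_eq[OF part k auto[OF k(1)] _ c\<theta>]) (rule TL[OF k(1)])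
      have "\<psi> \<xi> / of_real (arc_deriv p IL TL \<xi>) powr s
          = kernel_transform f s (al k) (be k) (cis \<theta>) / of_real (1 / jac_sq (A k) (B' k) \<theta>) powr s"
        unfolding dv \<psi>_def k_def[symmetric] c\<theta> ..
      also have "\<dots> = kernel_transform f s (circle_lift (A k) (B' k) (al k)) (circle_lift (A k) (B' k) (be k)) (\<gamma> k (cis \<theta>))"
        by (rule kernel_transform_moebius[OF Gc auto[OF k(1)] ab m[folded \<theta>_def] cov[OF \<gamma>[OF k(1)] auto[OF k(1)] _ ab]])
      also have "\<gamma> k (cis \<theta>) = \<xi>'" unfolding c\<theta> using TL[OF k] \<xi>s(2) by simp
      finally show ?thesis unfolding a_def b_def k_def .
    qed
    have "transfer_operator s p IL TL \<psi> \<xi>' = (\<Sum>\<xi>\<in>F. kernel_transform f s (a \<xi>) (b \<xi>) \<xi>')"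
      unfolding transfer_operator_def F_def[symmetric] by (rule sum.cong[OF refl trm])
    also have "\<dots> = kernel_transform f s (al (\<kappa> \<xi>')) (be (\<kappa> \<xi>')) \<xi>'"
    proof (rule kernel_transform_additive[OF Gc Gp arc \<xi>' nQ[OF \<xi>'] fin, where X = "\<lambda>\<xi>. \<gamma> (\<kappa> \<xi>) ` Q (\<kappa> \<xi>)"])
      show "\<kappa> \<xi>' < p" using \<kappa>[OF \<xi>'] by blast
      show "arc_between (\<gamma> (\<kappa> \<xi>) ` Q (\<kappa> \<xi>)) (a \<xi>) (b \<xi>)" if "\<xi> \<in> F" for \<xi>
      proof -
        have "\<kappa> \<xi> < p" using that \<kappa>[of \<xi>] by (simp add: F_def)
        from arc_image[OF auto[OF this] arc[OF this]] show ?thesis unfolding a_def b_def .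
      qed
      show "\<gamma> (\<kappa> i) ` Q (\<kappa> i) \<inter> \<gamma> (\<kappa> j) ` Q (\<kappa> j) = {}" if "i \<in> F" "j \<in> F" "i \<noteq> j" for i j
        by (rule D) (use that in \<open>auto simp: F_def\<close>)
      show "(\<Union>\<xi>\<in>F. \<gamma> (\<kappa> \<xi>) ` Q (\<kappa> \<xi>)) = Q (\<kappa> \<xi>')" unfolding F_def by (rule U[OF \<xi>'])
    qed
    finally show ?thesis unfolding \<psi>_def .
  qed

  have analytic: "circle_real_analytic_on (IL k) \<psi>" if k: "k < p" for k
    by (rule kernel_transform_real_analytic[OF Gc arc[OF k] Qd[OF k] \<psi>[OF k _ arc[OF k]]])

  show ?thesis
  proof (rule exI[of _ \<psi>], intro conjI allI impI ballI)
    show "\<exists>\<xi>\<in>sphere 0 1. \<psi> \<xi> \<noteq> 0" by (rule nonzero)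
    show "circle_real_analytic_on (IL k) \<psi>" if "k < p" for k by (rule analytic[OF that])
    show "transfer_operator s p IL TL \<psi> \<xi>' = \<psi> \<xi>'" if "\<xi>' \<in> sphere 0 1" for \<xi>' by (rule fixed[OF that])
    show "inj_on TL (IL k)" if "k < p" for k by (rule TLinj[OF that])
    show "closure (IL k) \<inter> closure (QR q IR J k) = {}" if "k < p" for k
      using Qd[OF that] unfolding Q_def .
    fix k \<alpha> \<beta> \<xi> assume k: "k < p" "arc_between (QR q IR J k) \<alpha> \<beta>" "\<xi> \<in> IL k"
    show "\<psi> \<xi> = helgason_integral f s \<alpha> \<beta> (\<lambda>\<eta>. 1 / of_real (norm (\<xi> - \<eta>)) powr (2 * s))"
      using \<psi>[OF k(1,3) k(2)[folded Q_def]] unfolding kernel_transform_def .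
    then show "\<psi> \<xi> = helgason_integral f s \<alpha> \<beta> (\<lambda>\<eta>. of_real (boundary_kernel \<xi> \<eta>) powr s)"
      unfolding boundary_kernel_powr .
  qed
qed

end
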